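(* Let $0<k_1\le k_2$. Let $L$ be the unique integer such that $\varepsilon:=k_1-k_2+L\in[0,1)$, and let $\lambda=-k_1-k_2$. Then the tensor product of the positive discrete series representation $\pi^+_{k_1}$ and the negative discrete series representation $\pi^-_{k_2}$ of $\mathfrak{su}(1,1)$ decomposes as $$\pi_{k_1}^+\otimes\pi_{k_2}^-\cong\int_0^{\infty\,\oplus}\pi^{\rho,\varepsilon}\,d\rho\qquad\text{if } k_1-k_2\ge-\tfrac12,\ k_1+k_2\ge\tfrac12,$$ $$\pi_{k_1}^+\otimes\pi_{k_2}^-\cong\int_0^{\infty\,\oplus}\pi^{\rho,\varepsilon}\,d\rho\ \oplus\ \pi^{\lambda,\varepsilon}\qquad\text{if } k_1+k_2<\tfrac12,$$ $$\pi_{k_1}^+\otimes\pi_{k_2}^-\cong\int_0^{\infty\,\oplus}\pi^{\rho,\varepsilon}\,d\rho\ \oplus\bigoplus_{\substack{j\in\mathbb Z_{\ge0}\\ k_2-k_1-\frac12-j>0}}\pi^-_{k_2-k_1-j}\qquad\text{if } k_1-k_2<-\tfrac12 .$$ Further, under this identification, for all $n_1,n_2\in\mathbb Z_{\ge0}$, $$e_{n_1}\otimes e_{n_2}=(-1)^{n_2}\int_{\mathbb R}\hat S_n(y;n_1-n_2)\,e_{n_1-n_2-L}\,d\mu(y;n_1-n_2),\qquad n=\min\{n_1,n_2\}.$$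
   Context: **The Lie algebra.** $\mathfrak{su}(1,1)$ is spanned by $H,B,C$ with $[H,B]=2B$, $[H,C]=-2C$, $[B,C]=H$ and $*$-structure $H^*=H$, $B^*=-C$. All operators below are unbounded, defined on finite linear combinations of the indicated orthonormal basis vectors. For $Y\in\mathfrak{su}(1,1)$, $\Delta(Y)=1\otimes Y+Y\otimes1$, and $\pi\otimes\pi'$ is the representation $Y\mapsto(\pi\otimes\pi')(\Delta(Y))$. **Representations.** - $\pi^+_k$ ($k>0$) on $\ell^2(\mathbb Z_{\ge0})$: $He_n=2(k+n)e_n$, $Be_n=\sqrt{(n+1)(2k+n)}\,e_{n+1}$, $Ce_n=-\sqrt{n(2k+n-1)}\,e_{n-1}$. - $\pi^-_k$ ($k>0$) on $\ell^2(\mathbb Z_{\ge0})$: $He_n=-2(k+n)e_n$, $Be_n=-\sqrt{n(2k+n-1)}\,e_{n-1}$, $Ce_n=\sqrt{(n+1)(2k+n)}\,e_{n+1}$. - Principal series $\pi^{\rho,\varepsilon}$ ($\varepsilon\in[0,1)$, $\rho\ge0$, $(\rho,\varepsilon)\ne(0,\frac12)$) on $\ell^2(\mathbb Z)$: $He_n=2(\varepsilon+n)e_n$, $Be_n=\sqrt{(n+\varepsilon+\frac12)^2+\rho^2}\,e_{n+1}$, $Ce_n=-\sqrt{(n+\varepsilon-\frac12)^2+\rho^2}\,e_{n-1}$. - Complementary series $\pi^{\lambda,\varepsilon}$ ($\varepsilon\in[0,\frac12)$ and $\lambda\in(-\frac12,-\varepsilon)$, or $\varepsilon\in(\frac12,1)$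 and $\lambda\in(-\frac12,\varepsilon-1)$) on $\ell^2(\mathbb Z)$: $He_n=2(\varepsilon+n)e_n$, $Be_n=\sqrt{(n+\varepsilon+1+\lambda)(n+\varepsilon-\lambda)}\,e_{n+1}$, $Ce_n=-\sqrt{(n+\varepsilon+\lambda)(n+\varepsilon-\lambda-1)}\,e_{n-1}$. **Continuous dual Hahn polynomials.** $S_n(y;a,b,c)=(a+b)_n(a+c)_n\,{}_3F_2\!\left({-n,\,a+ix,\,a-ix\atop a+b,\,a+c};1\right)$ with $x^2=y$, which is symmetric in $a,b,c$, and $$\hat S_n(y;a,b,c)=\frac{(-1)^nS_n(y;a,b,c)}{\sqrt{n!\,(a+b)_n(a+c)_n(b+c)_n}}.$$ For $p\in\mathbb Z$ let $$(a_p,b_p,c_p)=\begin{cases}(k_1-k_2+\frac12,\ k_1+k_2-\frac12,\ k_2-k_1-p+\frac12),&p\le0,\\(k_2-k_1+\frac12,\ k_1+k_2-\frac12,\ k_1-k_2+p+\frac12),&p\ge0,\end{cases}$$ (for $p=0$ the two are permutations of each other), and $\hat S_n(y;p)=\hat S_n(y;a_p,b_p,c_p)$, $d\mu(y;p)=d\mu(y;a_p,b_p,c_p)$. **The measure $d\mu$.** Let $a,b,c$ be real with pairwise sums positive, labelled (by symmetry) so that $a$ is the smallest. Then $$\int_{\mathbb R}f(y)\,d\mu(y;a,b,c)=\int_0^\infty f(x^2)W(x^2)\,dx+\sum_{k=0}^K\sqrt{m_k}\,f(-(a+k)^2),$$ $$W(x^2)=\left|\frac{\Gamma(a+ix)\Gamma(b+ix)\Gamma(c+ix)}{\Gamma(2ix)}\right|\frac1{\sqrt{2\pi\,\Gamma(a+b)\Gamma(a+c)\Gamma(b+c)}},$$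 $$m_k=\frac{\Gamma(b-a)\Gamma(c-a)}{\Gamma(-2a)\Gamma(b+c)}(-1)^k\frac{(2a)_k(a+1)_k(a+b)_k(a+c)_k}{(a)_k(a-b+1)_k(a-c+1)_k\,k!},$$ where $K$ is the largest non-negative integer with $a+K<0$ (the sum is absent if $a\ge0$). **Meaning of the identification.** The vector-valued integral $\int_{\mathbb R}g(y)\,e_{p-L}\,d\mu(y;p)$ denotes the element of the representation space of the right-hand side whose component in the direct integral is the field $\rho\mapsto g(\rho^2)W(\rho^2)e_{p-L}$ (with respect to Lebesgue measure $d\rho$, $e_{p-L}$ being the basis vector of the space $\ell^2(\mathbb Z)$ of $\pi^{\rho,\varepsilon}$), and whose component in the discrete summand attached to a mass point $y_0$ of $d\mu(\cdot;p)$ is $g(y_0)$ times the mass $\sqrt{m_k}$ at $y_0$ times $e_{p-L}$. The mass point $y_0=-(k_1+k_2-\frac12)^2$ (occurring if $k_1+k_2<\frac12$) is attached to $\pi^{\lambda,\varepsilon}$, with $e_{p-L}$ its basis vector. A mass point $y_0=-(k_1-k_2+\frac12+j)^2$ (occurring if $k_1-k_2<-\frac12$, $j\ge\max(0,p)$) is attached to $\pi^-_{k_2-k_1-j}$; there $e_{p-L}$ denotes the orthonormal basis vector of the representation space with $H$-eigenvalue $2(\varepsilon+p-L)=2(k_1-k_2+p)$, that is, up to a sign convention which the statement does not specify, the standard basis vector with index $j-p$ of the space $\ell^2(\mathbb Z_{\ge0})$ of $\pi^-_{k_2-k_1-j}$. The assertion $\cong$ means: the linear map $\Lambda$ determined by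 the displayed formula for $e_{n_1}\otimes e_{n_2}$ extends to a unitary operator from $\ell^2(\mathbb Z_{\ge0})\otimes\ell^2(\mathbb Z_{\ge0})$ onto the Hilbert space of the right-hand side, and for $Y\in\{H,B,C\}$ it intertwines the action of $Y$ on finite linear combinations of the $e_{n_1}\otimes e_{n_2}$ with the componentwise action of $Y$ on the right-hand side (defined on finite linear combinations of the images of the $e_{n_1}\otimes e_{n_2}$). *)

theory Defs
  imports "HOL-Analysis.Analysis"
begin

type_synonym 'i vec = "'i \<Rightarrow> complex"

definition ell2 :: "'i vec set" where
  "ell2 = {v. (\<lambda>i. (cmod (v i))\<^sup>2) summable_on UNIV}"

definition ell2_inner :: "'i vec \<Rightarrow> 'i vec \<Rightarrow> complex" where
  "ell2_inner v w = (\<Sum>\<^sub>\<infinity>i. cnj (v i) * w i)"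

definition svec :: "complex \<Rightarrow> 'i vec \<Rightarrow> 'i vec" where
  "svec c v = (\<lambda>i. c * v i)"

definition avec :: "'i vec \<Rightarrow> 'i vec \<Rightarrow> 'i vec" where
  "avec v w = (\<lambda>i. v i + w i)"

definition ket :: "'i \<Rightarrow> 'i vec" where
  "ket i = (\<lambda>j. if j = i then 1 else 0)"

text \<open>The Hilbert space tensor product of \<open>\<ell>\<^sup>2(I)\<close> and \<open>\<ell>\<^sup>2(J)\<close> is realised as \<open>\<ell>\<^sup>2(I \<times> J)\<close>.\<close>

definition tensor_vec :: "'i vec \<Rightarrow> 'j vec \<Rightarrow> ('i \<times> 'j) vec" where
  "tensor_vec v w = (\<lambda>(i, j). v i * w j)"

definition fin_comb :: "'i vec set" where
  "fin_comb = {v. finite {i. v i \<noteq> 0}}"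

text \<open>Linear extension, to finite linear combinations, of a map given on basis vectors.
  Outside \<open>fin_comb\<close> the value is irrelevant.\<close>

definition lin_ext :: "('i \<Rightarrow> 'i vec) \<Rightarrow> 'i vec \<Rightarrow> 'i vec" where
  "lin_ext T v = (\<lambda>j. \<Sum>i | v i \<noteq> 0. v i * T i j)"

text \<open>The constructors are the spanning elements \<open>H\<close>, \<open>B\<close>, \<open>C\<close>. A representation by unbounded
  operators on \<open>\<ell>\<^sup>2\<close> is given by the images of the basis vectors under these three elements.\<close>

datatype su11 = SU_H | SU_B | SU_C

type_synonym 'i basis_rep = "su11 \<Rightarrow> 'i \<Rightarrow> 'i vec"

text \<open>In the discrete series, \<open>n - 1\<close> is truncated at \<open>n = 0\<close>, where the coefficient vanishes.\<close>

fun pi_plus :: "real \<Rightarrow> nat basis_rep" where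
  "pi_plus k SU_H n = svec (of_real (2 * (k + real n))) (ket n)"
| "pi_plus k SU_B n = svec (of_real (sqrt ((real n + 1) * (2 * k + real n)))) (ket (n + 1))"
| "pi_plus k SU_C n = svec (of_real (- sqrt (real n * (2 * k + real n - 1)))) (ket (n - 1))"

fun pi_minus :: "real \<Rightarrow> nat basis_rep" where
  "pi_minus k SU_H n = svec (of_real (- 2 * (k + real n))) (ket n)"
| "pi_minus k SU_B n = svec (of_real (- sqrt (real n * (2 * k + real n - 1)))) (ket (n - 1))"
| "pi_minus k SU_C n = svec (of_real (sqrt ((real n + 1) * (2 * k + real n)))) (ket (n + 1))"

fun pi_principal :: "real \<Rightarrow> real \<Rightarrow> int basis_rep" where
  "pi_principal \<rho> \<epsilon> SU_H n = svec (of_real (2 * (\<epsilon> + of_int n))) (ket n)"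
| "pi_principal \<rho> \<epsilon> SU_B n = svec (of_real (sqrt ((of_int n + \<epsilon> + 1/2)\<^sup>2 + \<rho>\<^sup>2))) (ket (n + 1))"
| "pi_principal \<rho> \<epsilon> SU_C n = svec (of_real (- sqrt ((of_int n + \<epsilon> - 1/2)\<^sup>2 + \<rho>\<^sup>2))) (ket (n - 1))"

fun pi_compl :: "real \<Rightarrow> real \<Rightarrow> int basis_rep" where
  "pi_compl l \<epsilon> SU_H n = svec (of_real (2 * (\<epsilon> + of_int n))) (ket n)"
| "pi_compl l \<epsilon> SU_B n =
     svec (of_real (sqrt ((of_int n + \<epsilon> + 1 + l) * (of_int n + \<epsilon> - l)))) (ket (n + 1))"
| "pi_compl l \<epsilon> SU_C n =
     svec (of_real (- sqrt ((of_int n + \<epsilon> + l) * (of_int n + \<epsilon> - l - 1)))) (ket (n - 1))"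

definition compl_params :: "real \<Rightarrow> real \<Rightarrow> bool" where
  "compl_params l \<epsilon> \<longleftrightarrow>
     (0 \<le> \<epsilon> \<and> \<epsilon> < 1/2 \<and> -1/2 < l \<and> l < - \<epsilon>) \<or> (1/2 < \<epsilon> \<and> \<epsilon> < 1 \<and> -1/2 < l \<and> l < \<epsilon> - 1)"

text \<open>The action of \<open>\<Delta>(Y) = 1 \<otimes> Y + Y \<otimes> 1\<close>.\<close>

definition tensor_rep :: "'i basis_rep \<Rightarrow> 'j basis_rep \<Rightarrow> ('i \<times> 'j) basis_rep" where
  "tensor_rep \<pi> \<pi>' Y =
     (\<lambda>(i, j). avec (tensor_vec (ket i) (\<pi>' Y j)) (tensor_vec (\<pi> Y i) (ket j)))"

text \<open>Hilbert spaces are presented by a set of representatives with a positive semidefinite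
  inner product (conjugate linear in the first argument); representatives are identified
  when their difference has norm zero. For direct integrals this is equality almost
  everywhere.\<close>

record 'v hilb_rep =
  vecs :: "'v set"
  vplus :: "'v \<Rightarrow> 'v \<Rightarrow> 'v"
  vscale :: "complex \<Rightarrow> 'v \<Rightarrow> 'v"
  vinner :: "'v \<Rightarrow> 'v \<Rightarrow> complex"
  vact :: "su11 \<Rightarrow> 'v \<Rightarrow> 'v"

text \<open>Membership in \<open>vecs\<close> is part of \<open>hilb_eq\<close>, since \<open>vinner\<close> has no meaning elsewhere
  (a divergent sum or integral has the value 0).\<close>

definition hilb_eq :: "'v hilb_rep \<Rightarrow> 'v \<Rightarrow> 'v \<Rightarrow> bool" where
  "hilb_eq V v w \<longleftrightarrow> v \<in> vecs V \<and> w \<in> vecs V \<and>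
     (let d = vplus V v (vscale V (-1) w) in vinner V d d = 0)"

definition ell2_rep :: "'i basis_rep \<Rightarrow> 'i vec hilb_rep" where
  "ell2_rep \<pi> = \<lparr>vecs = ell2, vplus = avec, vscale = svec, vinner = ell2_inner,
     vact = (\<lambda>Y. lin_ext (\<pi> Y))\<rparr>"

definition direct_integral ::
    "'r measure \<Rightarrow> ('r \<Rightarrow> 'i basis_rep) \<Rightarrow> ('r \<Rightarrow> 'i vec) hilb_rep" where
  "direct_integral M \<pi> = \<lparr>
     vecs = {f. (\<forall>i. (\<lambda>r. f r i) \<in> borel_measurable M) \<and> (\<forall>r\<in>space M. f r \<in> ell2) \<and>
                integrable M (\<lambda>r. \<Sum>\<^sub>\<infinity>i. (cmod (f r i))\<^sup>2)},
     vplus = (\<lambda>f g r. avec (f r) (g r)),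
     vscale = (\<lambda>c f r. svec c (f r)),
     vinner = (\<lambda>f g. \<integral>r. ell2_inner (f r) (g r) \<partial>M),
     vact = (\<lambda>Y f r. lin_ext (\<pi> r Y) (f r))\<rparr>"

definition direct_sum :: "'v hilb_rep \<Rightarrow> 'w hilb_rep \<Rightarrow> ('v \<times> 'w) hilb_rep" where
  "direct_sum V W = \<lparr>
     vecs = vecs V \<times> vecs W,
     vplus = (\<lambda>(v, w) (v', w'). (vplus V v v', vplus W w w')),
     vscale = (\<lambda>c (v, w). (vscale V c v, vscale W c w)),
     vinner = (\<lambda>(v, w) (v', w'). vinner V v v' + vinner W w w'),
     vact = (\<lambda>Y (v, w). (vact V Y v, vact W Y w))\<rparr>"

text \<open>Components outside \<open>J\<close> are unconstrained and do not enter the inner product, so they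
  are invisible up to \<open>hilb_eq\<close>.\<close>

definition direct_Sum :: "'j set \<Rightarrow> ('j \<Rightarrow> 'v hilb_rep) \<Rightarrow> ('j \<Rightarrow> 'v) hilb_rep" where
  "direct_Sum J V = \<lparr>
     vecs = {v. (\<forall>j\<in>J. v j \<in> vecs (V j)) \<and> (\<lambda>j. Re (vinner (V j) (v j) (v j))) summable_on J},
     vplus = (\<lambda>v w j. vplus (V j) (v j) (w j)),
     vscale = (\<lambda>c v j. vscale (V j) c (v j)),
     vinner = (\<lambda>v w. \<Sum>\<^sub>\<infinity>j\<in>J. vinner (V j) (v j) (w j)),
     vact = (\<lambda>Y v j. vact (V j) Y (v j))\<rparr>"

definition unitary_onto :: "'v hilb_rep \<Rightarrow> 'w hilb_rep \<Rightarrow> ('v \<Rightarrow> 'w) \<Rightarrow> bool" where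
  "unitary_onto V W U \<longleftrightarrow>
     (\<forall>v\<in>vecs V. U v \<in> vecs W) \<and>
     (\<forall>v\<in>vecs V. \<forall>w\<in>vecs V. hilb_eq W (U (vplus V v w)) (vplus W (U v) (U w))) \<and>
     (\<forall>c. \<forall>v\<in>vecs V. hilb_eq W (U (vscale V c v)) (vscale W c (U v))) \<and>
     (\<forall>v\<in>vecs V. \<forall>w\<in>vecs V. vinner W (U v) (U w) = vinner V v w) \<and>
     (\<forall>w\<in>vecs W. \<exists>v\<in>vecs V. hilb_eq W (U v) w)"

text \<open>The linear map with \<open>e\<^sub>i \<otimes> e\<^sub>j \<mapsto> \<Lambda> i j\<close> extends to a unitary operator onto \<open>W\<close>
  that intertwines the actions on finite linear combinations of the \<open>e\<^sub>i \<otimes> e\<^sub>j\<close>.\<close>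

definition decomposes_via ::
    "('i \<times> 'j) basis_rep \<Rightarrow> 'w hilb_rep \<Rightarrow> ('i \<Rightarrow> 'j \<Rightarrow> 'w) \<Rightarrow> bool" where
  "decomposes_via \<pi> W \<Lambda> \<longleftrightarrow>
     (\<exists>U. unitary_onto (ell2_rep \<pi>) W U \<and>
          (\<forall>i j. hilb_eq W (U (tensor_vec (ket i) (ket j))) (\<Lambda> i j)) \<and>
          (\<forall>Y. \<forall>v\<in>fin_comb. hilb_eq W (U (vact (ell2_rep \<pi>) Y v)) (vact W Y (U v))))"

text \<open>\<open>S\<^sub>n(y;a,b,c)\<close>, with \<open>x = csqrt y\<close>; the series is even in \<open>x\<close> and terminates.\<close>

definition cdh_S :: "nat \<Rightarrow> real \<Rightarrow> real \<Rightarrow> real \<Rightarrow> real \<Rightarrow> complex" where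
  "cdh_S n y a b c =
     (let x = csqrt (of_real y) in
      of_real (pochhammer (a + b) n * pochhammer (a + c) n) *
      eval_fps (fps_hypergeo [- of_nat n, of_real a + \<i> * x, of_real a - \<i> * x]
                             [of_real (a + b), of_real (a + c)] 1) 1)"

definition cdh_S_hat :: "nat \<Rightarrow> real \<Rightarrow> real \<Rightarrow> real \<Rightarrow> real \<Rightarrow> complex" where
  "cdh_S_hat n y a b c = (-1) ^ n * cdh_S n y a b c /
     of_real (sqrt (fact n * pochhammer (a + b) n * pochhammer (a + c) n * pochhammer (b + c) n))"

text \<open>The measure \<open>d\<mu>(y;a,b,c)\<close> is the image of \<open>cdh_W a b c (x\<^sup>2) dx\<close> on \<open>(0,\<infinity>)\<close> under
  \<open>x \<mapsto> x\<^sup>2\<close>, plus mass \<open>cdh_mass a b c y\<close> at each point \<open>y\<close> (zero off the mass points).\<close>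

definition cdh_W :: "real \<Rightarrow> real \<Rightarrow> real \<Rightarrow> real \<Rightarrow> real" where
  "cdh_W a b c y =
     (let x = sqrt y in
      cmod (Gamma (Complex a x) * Gamma (Complex b x) * Gamma (Complex c x) / Gamma (Complex 0 (2 * x)))
        * (1 / sqrt (2 * pi * Gamma (a + b) * Gamma (a + c) * Gamma (b + c))))"

definition cdh_m :: "real \<Rightarrow> real \<Rightarrow> real \<Rightarrow> nat \<Rightarrow> real" where
  "cdh_m a b c k =
     Gamma (b - a) * Gamma (c - a) / (Gamma (- 2 * a) * Gamma (b + c)) * (-1) ^ k *
     ((pochhammer (2 * a) k * pochhammer (a + 1) k * pochhammer (a + b) k * pochhammer (a + c) k) /
      (pochhammer a k * pochhammer (a - b + 1) k * pochhammer (a - c + 1) k * fact k))"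

text \<open>Mass at \<open>y\<close> when \<open>a\<close> is the smallest parameter. The points \<open>- (a + k)\<^sup>2\<close> with
  \<open>a + k < 0\<close> are distinct, so the sum has at most one term.\<close>

definition cdh_mass_min :: "real \<Rightarrow> real \<Rightarrow> real \<Rightarrow> real \<Rightarrow> real" where
  "cdh_mass_min a b c y =
     (\<Sum>k | a + real k < 0 \<and> y = - ((a + real k)\<^sup>2). sqrt (cdh_m a b c k))"

definition cdh_mass :: "real \<Rightarrow> real \<Rightarrow> real \<Rightarrow> real \<Rightarrow> real" where
  "cdh_mass a b c y =
     (if a \<le> b \<and> a \<le> c then cdh_mass_min a b c y
      else if b \<le> c then cdh_mass_min b a c y
      else cdh_mass_min c a b y)"

definition par_a :: "real \<Rightarrow> real \<Rightarrow> int \<Rightarrow> real" where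
  "par_a k1 k2 p = (if p \<le> 0 then k1 - k2 + 1/2 else k2 - k1 + 1/2)"

definition par_b :: "real \<Rightarrow> real \<Rightarrow> int \<Rightarrow> real" where
  "par_b k1 k2 p = k1 + k2 - 1/2"

definition par_c :: "real \<Rightarrow> real \<Rightarrow> int \<Rightarrow> real" where
  "par_c k1 k2 p = (if p \<le> 0 then k2 - k1 - of_int p + 1/2 else k1 - k2 + of_int p + 1/2)"

definition S_hat :: "real \<Rightarrow> real \<Rightarrow> nat \<Rightarrow> int \<Rightarrow> real \<Rightarrow> complex" where
  "S_hat k1 k2 n p y = cdh_S_hat n y (par_a k1 k2 p) (par_b k1 k2 p) (par_c k1 k2 p)"

definition mu_W :: "real \<Rightarrow> real \<Rightarrow> int \<Rightarrow> real \<Rightarrow> real" where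
  "mu_W k1 k2 p y = cdh_W (par_a k1 k2 p) (par_b k1 k2 p) (par_c k1 k2 p) y"

definition mu_mass :: "real \<Rightarrow> real \<Rightarrow> int \<Rightarrow> real \<Rightarrow> real" where
  "mu_mass k1 k2 p y = cdh_mass (par_a k1 k2 p) (par_b k1 k2 p) (par_c k1 k2 p) y"

text \<open>Components of \<open>\<integral> g(y) v d\<mu>(y;p)\<close> for a basis vector \<open>v\<close>: in the direct integral, and in
  the summand attached to the point \<open>y0\<close>.\<close>

definition integral_cont ::
    "real \<Rightarrow> real \<Rightarrow> int \<Rightarrow> (real \<Rightarrow> complex) \<Rightarrow> 'i vec \<Rightarrow> real \<Rightarrow> 'i vec" where
  "integral_cont k1 k2 p g v = (\<lambda>\<rho>. svec (g (\<rho>\<^sup>2) * of_real (mu_W k1 k2 p (\<rho>\<^sup>2))) v)"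

definition integral_atom ::
    "real \<Rightarrow> real \<Rightarrow> int \<Rightarrow> real \<Rightarrow> (real \<Rightarrow> complex) \<Rightarrow> 'i vec \<Rightarrow> 'i vec" where
  "integral_atom k1 k2 p y0 g v = svec (g y0 * of_real (mu_mass k1 k2 p y0)) v"

text \<open>The three components of
  \<open>(-1)\<^bsup>n2\<^esup> \<integral> S_hat\<^sub>n(y; n1 - n2) e\<^bsub>n1 - n2 - L\<^esub> d\<mu>(y; n1 - n2)\<close> with \<open>n = min n1 n2\<close>:
  in the direct integral, in \<open>\<pi>\<^bsup>\<lambda>,\<epsilon>\<^esup>\<close>, and in \<open>\<pi>\<^sup>-\<close> with parameter \<open>k2 - k1 - j\<close>.\<close>

definition image_cont :: "real \<Rightarrow> real \<Rightarrow> int \<Rightarrow> nat \<Rightarrow> nat \<Rightarrow> real \<Rightarrow> int vec" where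
  "image_cont k1 k2 L n1 n2 =
     (let p = int n1 - int n2 in
      (\<lambda>\<rho>. svec ((-1) ^ n2)
         (integral_cont k1 k2 p (S_hat k1 k2 (min n1 n2) p) (ket (p - L)) \<rho>)))"

definition image_compl :: "real \<Rightarrow> real \<Rightarrow> int \<Rightarrow> nat \<Rightarrow> nat \<Rightarrow> int vec" where
  "image_compl k1 k2 L n1 n2 =
     (let p = int n1 - int n2 in
      svec ((-1) ^ n2)
        (integral_atom k1 k2 p (- ((k1 + k2 - 1/2)\<^sup>2)) (S_hat k1 k2 (min n1 n2) p) (ket (p - L))))"

text \<open>In \<open>\<pi>\<^sup>-\<close> with parameter \<open>k2 - k1 - j\<close>, the vector \<open>e\<^bsub>p - L\<^esub>\<close> is the standard basis vector
  of index \<open>j - p\<close> up to the sign \<open>s j (j - p)\<close>. For \<open>j < p\<close> the mass is zero and the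
  truncated index \<open>nat (int j - p)\<close> is irrelevant.\<close>

definition image_minus ::
    "real \<Rightarrow> real \<Rightarrow> (nat \<Rightarrow> nat \<Rightarrow> complex) \<Rightarrow> nat \<Rightarrow> nat \<Rightarrow> nat \<Rightarrow> nat vec" where
  "image_minus k1 k2 s n1 n2 j =
     (let p = int n1 - int n2; m = nat (int j - p) in
      svec ((-1) ^ n2)
        (integral_atom k1 k2 p (- ((k1 - k2 + 1/2 + real j)\<^sup>2)) (S_hat k1 k2 (min n1 n2) p)
          (svec (s j m) (ket m))))"

definition half_line :: "real measure" where
  "half_line = restrict_space lborel {0<..}"

end

theory Submission
  imports Defs "HOL-Complex_Analysis.Complex_Analysis" "HOL-Probability.Probability"
begin

text \<open>
  The matrix coefficients \<open>Tc k1 k2 n1 n2 y w\<close> of the asserted map are real: up to sign and normalisation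
  they are continuous dual Hahn polynomials times the square root of \<open>PiP \<alpha> p\<close> times a weight that does not
  depend on \<open>p = n1 - n2\<close> (\<open>\<alpha> = k1 - k2 + 1/2\<close>, \<open>B = k1 + k2 - 1/2\<close>). Two contiguous relations for the
  polynomials say exactly that the map intertwines \<open>B\<close> and \<open>C\<close>. Unitarity is, for each \<open>p\<close>, orthonormality
  and completeness of the polynomials. Orthogonality reduces, through \<open>PiP \<alpha> p * phi k B\<close>, to the single
  integral of \<open>2 x sinh (2 pi x) / (cosh (2 pi x) - cos (2 pi \<alpha>)) \<bar>\<Gamma> (B + i x)\<bar>\<^sup>2\<close>, which is evaluated by
  shifting a contour by a unit step: the integrand is a difference of two translates, and the only pole
  crossed, present for \<open>B < 0\<close>, gives the mass point of the complementary series. For \<open>\<alpha> < 0\<close> the weight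
  depends on \<open>\<alpha>\<close> modulo 1 only, and the mass points of the discrete series telescope. Completeness follows
  from the exponential decay of the weight, by uniqueness of characteristic functions.
\<close>

section \<open>Continuous dual Hahn polynomials\<close>

text \<open>For every \<open>p\<close> two of the three parameters have an integral sum,
  \<open>a_p + c_p = 1 + |p|\<close>. The reflection formula therefore turns the squared modulus of
  \<open>Gamma (a + i x) * Gamma (c + i x)\<close> into a polynomial in \<open>x^2\<close> times a
  trigonometric quotient; this is why one weight serves all \<open>p\<close>. The third parameter
  \<open>B\<close> is the same for all \<open>p\<close>. So the polynomials are expanded in
  \<open>phi k B\<close>: multiplication by \<open>phi k B\<close> merely raises \<open>B\<close> by
  \<open>k\<close> in the weight, and the total mass as a function of \<open>B\<close> contains
  every moment. The contour integrand is \<open>Gamma (B + s) * Gamma (B + 1 - s)\<close> times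
  \<open>sin (2 pi s) / (cos (2 pi \<alpha>) - cos (2 pi s))\<close>. The second factor has period
  1, and between the lines \<open>Re s = 0\<close> and \<open>Re s = 1\<close> the first changes by
  \<open>2 i y\<close> times a squared modulus. For \<open>\<alpha> = 0\<close>,
  \<open>\<alpha> = 1/2\<close> and \<open>B = 0\<close> poles coincide or reach the contour; these
  values are obtained as limits. The three cases of the theorem are one argument about a density
  with finitely many atoms. They differ only in the atoms and in the representation attached to each
  atom.\<close>

fun dh :: "nat \<Rightarrow> real \<Rightarrow> real \<Rightarrow> real \<Rightarrow> real poly" where
  "dh 0 a b c = 1"
| "dh (Suc 0) a b c = [:a * b + a * c + b * c, - 1:]"
| "dh (Suc (Suc n)) a b c =
     [:2 * (real n + 1)\<^sup>2 + (real n + 1) * (2 * a + 2 * b + 2 * c - 1) + a * b + a * c + b * c, - 1:]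
       * dh (Suc n) a b c
     - smult ((real n + 1) * (real n + a + b) * (real n + a + c) * (real n + b + c)) (dh n a b c)"

text \<open>One form of the recurrence for all \<open>n\<close>: at \<open>n = 0\<close> the
  truncated index \<open>n - 1\<close> is harmless because its coefficient vanishes. All
  coefficients are symmetric in \<open>a\<close>, \<open>b\<close>, \<open>c\<close>, so the
  symmetry of the polynomials, hidden in the hypergeometric series, comes for free.\<close>

lemma dh_Suc:
  "dh (Suc n) a b c =
     [:2 * (real n)\<^sup>2 + real n * (2 * a + 2 * b + 2 * c - 1) + a * b + a * c + b * c, - 1:] * dh n a b c
     - smult (real n * (real n - 1 + a + b) * (real n - 1 + a + c) * (real n - 1 + b + c)) (dh (n - 1) a b c)"
  by (cases n) (simp_all add: algebra_simps)

declare dh.simps(3) [simp del]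

lemma dh_swap: "dh n a b c = dh n b a c" "dh n a b c = dh n a c b"
proof -
  show "dh n a b c = dh n b a c"
    by (induction n a b c rule: dh.induct) (simp_all add: dh.simps(3) algebra_simps)
  show "dh n a b c = dh n a c b"
    by (induction n a b c rule: dh.induct) (simp_all add: dh.simps(3) algebra_simps)
qed

lemma poly_dh_Suc:
  "poly (dh (Suc n) a b c) y =
     (2 * (real n)\<^sup>2 + real n * (2 * a + 2 * b + 2 * c - 1) + a * b + a * c + b * c - y) * poly (dh n a b c) y
     - real n * (real n - 1 + a + b) * (real n - 1 + a + c) * (real n - 1 + b + c) * poly (dh (n - 1) a b c) y"
  by (simp add: dh_Suc algebra_simps)

text \<open>The relations connect the families with parameters \<open>c\<close> and
  \<open>c + 1\<close>, whose weights differ by the factor \<open>c^2 + y\<close>. Neither is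
  inductive alone: at \<open>Suc n\<close> the first follows from both at \<open>n\<close>, and the
  second follows from the first at \<open>Suc n\<close> and the second at \<open>n\<close>.\<close>

lemma poly_dh_contiguous:
  "poly (dh n a b c) y
     = poly (dh n a b (c + 1)) y - real n * (a + b + real n - 1) * poly (dh (n - 1) a b (c + 1)) y"
  "(c\<^sup>2 + y) * poly (dh n a b (c + 1)) y
     = (real n + a + c) * (real n + b + c) * poly (dh n a b c) y - poly (dh (Suc n) a b c) y"
proof (induction n)
  case 0
  { case 1 show ?case by simp }
  { case 2 show ?case by (simp add: algebra_simps power2_eq_square) }
next
  case (Suc n)
  define s t where "s n = poly (dh n a b c) y" and "t n = poly (dh n a b (c + 1)) y" for n
  define m where "m = real n"
  have IH1: "s n = t n - m * (a + b + m - 1) * t (n - 1)"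
    and IH2: "(c\<^sup>2 + y) * t n = (m + a + c) * (m + b + c) * s n - s (Suc n)"
    using Suc unfolding s_def t_def m_def by blast+
  have t1: "t (Suc n) = (2 * m\<^sup>2 + m * (2 * a + 2 * b + 2 * (c + 1) - 1) + a * b + a * (c + 1) + b * (c + 1) - y) * t n
      - m * (m - 1 + a + b) * (m - 1 + a + (c + 1)) * (m - 1 + b + (c + 1)) * t (n - 1)"
    unfolding t_def m_def by (rule poly_dh_Suc)
  have s2: "s (Suc (Suc n)) = (2 * (m + 1)\<^sup>2 + (m + 1) * (2 * a + 2 * b + 2 * c - 1) + a * b + a * c + b * c - y) * s (Suc n)
      - (m + 1) * (m + a + b) * (m + a + c) * (m + b + c) * s n"
    unfolding s_def m_def by (subst poly_dh_Suc) (simp add: algebra_simps)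
  have A: "s (Suc n) = t (Suc n) - (m + 1) * (a + b + m) * t n"
  proof -
    have "s (Suc n) = (m + a + c) * (m + b + c) * (t n - m * (a + b + m - 1) * t (n - 1)) - (c\<^sup>2 + y) * t n"
      using IH1 IH2 by simp
    thus ?thesis
      unfolding t1 by (simp add: algebra_simps power2_eq_square)
  qed
  have B: "(c\<^sup>2 + y) * t (Suc n) = (m + 1 + a + c) * (m + 1 + b + c) * s (Suc n) - s (Suc (Suc n))"
  proof -
    have "(c\<^sup>2 + y) * t (Suc n) = (c\<^sup>2 + y) * s (Suc n) + (m + 1) * (a + b + m) * ((c\<^sup>2 + y) * t n)"
    proof -
      have "t (Suc n) = s (Suc n) + (m + 1) * (a + b + m) * t n" using A by simp
      thus ?thesis by (simp only:) (simp add: algebra_simps)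
    qed
    also have "\<dots> = (m + 1 + a + c) * (m + 1 + b + c) * s (Suc n) - s (Suc (Suc n))"
      unfolding IH2 s2 by (simp add: algebra_simps power2_eq_square)
    finally show ?thesis .
  qed
  { case 1 show ?case using A by (simp add: s_def t_def m_def algebra_simps) }
  { case 2 show ?case using B by (simp add: s_def t_def m_def algebra_simps) }
qed

text \<open>With \<open>y = x^2\<close> this is \<open>(a + i x)_k (a - i x)_k\<close>, the part of
  the hypergeometric term that depends on \<open>x\<close>. Multiplying the squared modulus of
  \<open>Gamma (a + i x)\<close> by it raises \<open>a\<close> by \<open>k\<close>.\<close>

definition phi :: "nat \<Rightarrow> real \<Rightarrow> real poly" where
  "phi k a = (\<Prod>j<k. [:(a + real j)\<^sup>2, 1:])"

lemma phi_0 [simp]: "phi 0 a = 1"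
  and phi_Suc: "phi (Suc k) a = [:(a + real k)\<^sup>2, 1:] * phi k a"
  by (simp_all add: phi_def algebra_simps)

lemma phi_Suc_shift: "phi (Suc k) a = [:a\<^sup>2, 1:] * phi k (a + 1)"
  unfolding phi_def by (subst prod.lessThan_Suc_shift) (simp add: algebra_simps)

lemma poly_phi: "poly (phi k a) y = (\<Prod>j<k. (a + real j)\<^sup>2 + y)"
  by (simp add: phi_def poly_prod algebra_simps)

text \<open>The contiguous relation raising \<open>a\<close> turns this into Pascal's rule.\<close>

lemma poly_dh_expansion:
  "poly (dh n a b c) y = (\<Sum>k\<le>n. (-1) ^ k * real (n choose k) * poly (phi k a) y
      * pochhammer (a + b + real k) (n - k) * pochhammer (a + c + real k) (n - k))"
proof (induction n arbitrary: a)
  case 0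
  show ?case by simp
next
  case (Suc n)
  define T where "T k = poly (phi k a) y * pochhammer (a + b + real k) (Suc n - k)
      * pochhammer (a + c + real k) (Suc n - k)" for k
  have "(a\<^sup>2 + y) * poly (dh n b c (a + 1)) y
      = (real n + b + a) * (real n + c + a) * poly (dh n b c a) y - poly (dh (Suc n) b c a) y"
    by (rule poly_dh_contiguous)
  moreover have "dh m b c u = dh m u b c" for m u
    using dh_swap by metis
  ultimately have "poly (dh (Suc n) a b c) y
      = (real n + a + b) * (real n + a + c) * poly (dh n a b c) y - (a\<^sup>2 + y) * poly (dh n (a + 1) b c) y"
    by (simp add: algebra_simps)
  also have "(real n + a + b) * (real n + a + c) * poly (dh n a b c) y
      = (\<Sum>k\<le>n. (-1) ^ k * real (n choose k) * T k)"
    unfolding Suc.IH sum_distrib_left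
  proof (intro sum.cong refl)
    fix k assume "k \<in> {..n}"
    hence k: "k \<le> n" by simp
    have p: "pochhammer (u + real k) (Suc n - k) = pochhammer (u + real k) (n - k) * (u + real n)" for u :: real
      using k by (simp add: Suc_diff_le pochhammer_Suc)
    show "(real n + a + b) * (real n + a + c) * ((-1) ^ k * real (n choose k) * poly (phi k a) y
        * pochhammer (a + b + real k) (n - k) * pochhammer (a + c + real k) (n - k))
        = (-1) ^ k * real (n choose k) * T k"
      unfolding T_def p by (simp add: algebra_simps)
  qed
  also have "(a\<^sup>2 + y) * poly (dh n (a + 1) b c) y = (\<Sum>k\<le>n. (-1) ^ k * real (n choose k) * T (Suc k))"
    unfolding Suc.IH sum_distrib_left
  proof (intro sum.cong refl)
    fix k assume "k \<in> {..n}"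
    have "poly (phi (Suc k) a) y = (a\<^sup>2 + y) * poly (phi k (a + 1)) y"
      by (simp add: phi_Suc_shift algebra_simps)
    thus "(a\<^sup>2 + y) * ((-1) ^ k * real (n choose k) * poly (phi k (a + 1)) y
        * pochhammer (a + 1 + b + real k) (n - k) * pochhammer (a + 1 + c + real k) (n - k))
        = (-1) ^ k * real (n choose k) * T (Suc k)"
      by (simp add: T_def mult_ac add_ac)
  qed
  also have "(\<Sum>k\<le>n. (-1) ^ k * real (n choose k) * T k) - (\<Sum>k\<le>n. (-1) ^ k * real (n choose k) * T (Suc k))
      = (\<Sum>k\<le>Suc n. (-1) ^ k * real (Suc n choose k) * T k)"
  proof -
    have "(\<Sum>k\<le>n. (-1) ^ k * real (n choose k) * T k) = (\<Sum>k\<le>Suc n. (-1) ^ k * real (n choose k) * T k)"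
      by simp
    also have "\<dots> = T 0 - (\<Sum>k\<le>n. (-1) ^ k * real (n choose Suc k) * T (Suc k))"
      by (subst sum.atMost_Suc_shift) (simp add: sum_negf [symmetric])
    finally have "(\<Sum>k\<le>n. (-1) ^ k * real (n choose k) * T k) - (\<Sum>k\<le>n. (-1) ^ k * real (n choose k) * T (Suc k))
       = T 0 - (\<Sum>k\<le>n. (-1) ^ k * real (Suc n choose Suc k) * T (Suc k))"
      by (simp add: algebra_simps sum.distrib)
    also have "\<dots> = (\<Sum>k\<le>Suc n. (-1) ^ k * real (Suc n choose k) * T k)"
      by (subst sum.atMost_Suc_shift) (simp add: sum_negf [symmetric])
    finally show ?thesis .
  qed
  finally show ?case
    by (simp add: T_def mult_ac)
qed

lemma eval_fps_finite:
  fixes f :: "'a :: {banach, real_normed_div_algebra, comm_ring_1} fps"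
  assumes "\<And>k. k > n \<Longrightarrow> fps_nth f k = 0"
  shows "eval_fps f z = (\<Sum>k\<le>n. fps_nth f k * z ^ k)"
  unfolding eval_fps_def using assms by (intro suminf_finite) auto

lemma pochhammer_conjugates:
  assumes "x\<^sup>2 = of_real y"
  shows "pochhammer (of_real a + \<i> * x) k * pochhammer (of_real a - \<i> * x) k = of_real (poly (phi k a) y)"
proof -
  have "pochhammer (of_real a + \<i> * x) k * pochhammer (of_real a - \<i> * x) k
      = (\<Prod>j<k. (of_real a + \<i> * x + of_nat j) * (of_real a - \<i> * x + of_nat j))"
    by (simp add: pochhammer_prod prod.distrib atLeast0LessThan)
  also have "\<dots> = (\<Prod>j<k. of_real ((a + real j)\<^sup>2 + y))"
  proof (intro prod.cong refl)
    fix j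
    have "(of_real a + \<i> * x + of_nat j) * (of_real a - \<i> * x + of_nat j) = (of_real a + of_nat j)\<^sup>2 + x\<^sup>2"
      by (simp add: algebra_simps power2_eq_square)
    thus "(of_real a + \<i> * x + of_nat j) * (of_real a - \<i> * x + of_nat j) = of_real ((a + real j)\<^sup>2 + y)"
      by (simp add: assms)
  qed
  finally show ?thesis by (simp add: poly_phi)
qed

lemma cdh_S_eq_dh:
  assumes "a + b > 0" "a + c > 0"
  shows "cdh_S n y a b c = of_real (poly (dh n a b c) y)"
proof -
  define x where "x = csqrt (of_real y)"
  have x: "x\<^sup>2 = of_real y" by (simp add: x_def)
  define F where "F = fps_hypergeo [- of_nat n, of_real a + \<i> * x, of_real a - \<i> * x]
                             [of_real (a + b), of_real (a + c)] 1"
  define t where "t k = fps_nth F k" for k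
  have t: "t k = pochhammer (- of_nat n) k * of_real (poly (phi k a) y)
      / (of_real (pochhammer (a + b) k) * of_real (pochhammer (a + c) k) * fact k)" for k
    unfolding t_def F_def by (simp add: pochhammer_conjugates [OF x, symmetric] pochhammer_of_real mult_ac del: of_real_add)
  have t0: "t k = 0" if "k > n" for k
    unfolding t using that by (simp add: pochhammer_of_nat_eq_0_iff)
  have "cdh_S n y a b c = of_real (pochhammer (a + b) n * pochhammer (a + c) n) * (\<Sum>k\<le>n. t k)"
    unfolding cdh_S_def Let_def x_def [symmetric] F_def [symmetric]
    by (subst eval_fps_finite [of n]) (simp_all add: t_def [symmetric] t0)
  also have "\<dots> = (\<Sum>k\<le>n. of_real ((-1) ^ k * real (n choose k) * poly (phi k a) y
      * pochhammer (a + b + real k) (n - k) * pochhammer (a + c + real k) (n - k)))"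
    unfolding sum_distrib_left
  proof (intro sum.cong refl)
    fix k assume "k \<in> {..n}"
    hence k: "k \<le> n" by simp
    have "pochhammer (- real n) k = (-1) ^ k * fact k * real (n choose k)"
      by (simp add: binomial_gbinomial gbinomial_pochhammer)
    hence bin: "pochhammer (- of_nat n :: complex) k = of_real ((-1) ^ k * fact k * real (n choose k))"
      by (metis of_real_minus of_real_of_nat_eq pochhammer_of_real)
    \<comment> \<open>The series divides by these symbols; cancelling them against the prefactor
      requires that none of them is zero.\<close>
    have nz: "pochhammer (a + b) k \<noteq> 0" "pochhammer (a + c) k \<noteq> 0"
      using assms by (auto simp: pochhammer_eq_0_iff)
    have "t k = of_real ((-1) ^ k * real (n choose k) * poly (phi k a) y / (pochhammer (a + b) k * pochhammer (a + c) k))"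
      unfolding t bin by simp
    moreover have "pochhammer (a + u) n = pochhammer (a + u) k * pochhammer (a + u + real k) (n - k)" for u
      by (rule pochhammer_product [OF k])
    ultimately show "of_real (pochhammer (a + b) n * pochhammer (a + c) n) * t k
       = of_real ((-1) ^ k * real (n choose k) * poly (phi k a) y
         * pochhammer (a + b + real k) (n - k) * pochhammer (a + c + real k) (n - k))"
      using nz by simp
  qed
  also have "\<dots> = of_real (poly (dh n a b c) y)"
    by (simp add: poly_dh_expansion)
  finally show ?thesis .
qed

section \<open>Orthogonality with respect to a linear functional\<close>

lemma poly_functional_sum:
  fixes L :: "real poly \<Rightarrow> real"
  assumes "\<And>P Q. L (P + Q) = L P + L Q" and "\<And>c P. L (smult c P) = c * L P"
  shows "L (\<Sum>k\<in>S. f k) = (\<Sum>k\<in>S. L (f k))"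
proof -
  have "L 0 = 0" using assms(2)[of 0 0] by simp
  thus ?thesis
    by (induction S rule: infinite_finite_induct) (simp_all add: assms)
qed

text \<open>The recurrence moves a factor \<open>y\<close> from one polynomial to the other, which
  reduces every pairing to pairings with \<open>dh 0\<close>, and these are covered by
  \<open>zero\<close>. The squared norms satisfy \<open>h n = e n * h (n - 1)\<close>.\<close>

lemma dh_orthogonal:
  fixes L :: "real poly \<Rightarrow> real"
  assumes add: "\<And>P Q. L (P + Q) = L P + L Q" and scale: "\<And>c P. L (smult c P) = c * L P"
    and zero: "\<And>n. n > 0 \<Longrightarrow> L (dh n a b c) = 0"
  shows "L (dh m a b c * dh n a b c) =
    (if m = n then L 1 * (fact n * pochhammer (a + b) n * pochhammer (a + c) n * pochhammer (b + c) n) else 0)"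
proof -
  define e where "e n = real n * (real n - 1 + a + b) * (real n - 1 + a + c) * (real n - 1 + b + c)" for n
  define d where "d n = 2 * (real n)\<^sup>2 + real n * (2 * a + 2 * b + 2 * c - 1) + a * b + a * c + b * c" for n
  define h where "h n = L 1 * (fact n * pochhammer (a + b) n * pochhammer (a + c) n * pochhammer (b + c) n)" for n
  have diff: "L (P - Q) = L P - L Q" for P Q
    using add[of P "- Q"] scale[of "-1" Q] by simp
  have rec: "dh (Suc n) a b c = [:d n, -1:] * dh n a b c - smult (e n) (dh (n - 1) a b c)" for n
    unfolding d_def e_def by (rule dh_Suc)
  have *: "L (dh m a b c * dh n a b c) = (if m = n then h n else 0)" if "m \<le> n" for m n
    using that
  proof (induction m arbitrary: n rule: less_induct)
    case (less m)
    show ?case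
    proof (cases m)
      case 0
      thus ?thesis using zero[of n] by (auto simp: h_def)
    next
      case (Suc k)
      then obtain n' where n: "n = Suc n'" using less.prems by (cases n) auto
      have "dh m a b c * dh n a b c = [:d k, -1:] * dh k a b c * dh n a b c - smult (e k) (dh (k - 1) a b c * dh n a b c)"
        unfolding Suc rec by (simp add: algebra_simps)
      \<comment> \<open>Recentred at \<open>d n\<close>, the linear factor can be handed over to
        \<open>dh n\<close>, whose own recurrence then applies.\<close>
      also have "[:d k, -1:] = smult (d k - d n) 1 + [:d n, -1:]"
        by simp
      also have "(smult (d k - d n) 1 + [:d n, -1:]) * dh k a b c * dh n a b c
          = smult (d k - d n) (dh k a b c * dh n a b c) + dh k a b c * ([:d n, -1:] * dh n a b c)"
        by (simp only: distrib_right mult_smult_left mult_1_left) (simp only: mult_ac)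
      also have "[:d n, -1:] * dh n a b c = dh (Suc n) a b c + smult (e n) (dh (n - 1) a b c)"
        unfolding rec by simp
      finally have "L (dh m a b c * dh n a b c) =
          (d k - d n) * L (dh k a b c * dh n a b c) + L (dh k a b c * dh (Suc n) a b c)
          + e n * L (dh k a b c * dh (n - 1) a b c) - e k * L (dh (k - 1) a b c * dh n a b c)"
        by (simp only: diff add scale distrib_left mult_smult_right)
      also have "L (dh k a b c * dh n a b c) = 0"
        using less.IH[of k n] less.prems Suc by simp
      also have "L (dh k a b c * dh (Suc n) a b c) = 0"
        using less.IH[of k "Suc n"] less.prems Suc by simp
      also have "e k * L (dh (k - 1) a b c * dh n a b c) = 0"
        using less.IH[of "k - 1" n] less.prems Suc by (cases k) (auto simp: e_def)
      also have "L (dh k a b c * dh (n - 1) a b c) = (if k = n - 1 then h k else 0)"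
        using less.IH[of k "n - 1"] less.prems Suc by auto
      finally show ?thesis
        unfolding Suc n by (auto simp: e_def h_def pochhammer_Suc algebra_simps)
    qed
  qed
  show ?thesis
    using *[of m n] *[of n m] by (auto simp: h_def mult.commute not_le split: if_splits)
      (metis (no_types, opaque_lifting) mult.commute nat_le_linear)
qed

section \<open>The weight function\<close>

lemma cmod_Gamma_series:
  assumes "b > 0" "n > 0"
  shows "cmod (Gamma_series (Complex b x) n) = Gamma_series b n * (\<Prod>k\<le>n. (b + real k) / cmod (Complex (b + real k) x))"
proof -
  have p1: "cmod (pochhammer (Complex b x) (n + 1)) = (\<Prod>k\<le>n. cmod (Complex (b + real k) x))"
  proof -
    have "Complex b x + of_nat k = Complex (b + real k) x" for k by (simp add: complex_eq_iff)
    thus ?thesis by (simp add: pochhammer_prod prod_norm [symmetric] atLeast0LessThan lessThan_Suc_atMost del: of_nat_Suc)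
  qed
  have p2: "pochhammer b (n + 1) = (\<Prod>k\<le>n. b + real k)"
    by (simp add: pochhammer_prod atLeast0LessThan lessThan_Suc_atMost)
  have "(\<Prod>k\<le>n. b + real k) \<noteq> 0" using assms by (simp add: add_pos_nonneg less_imp_neq [symmetric])
  thus ?thesis
    unfolding Gamma_series_def norm_divide norm_mult p1 p2 prod_dividef
    by (simp add: norm_exp_eq_Re del: of_nat_Suc)
qed

text \<open>In the limit formula every factor \<open>u / |u + i x|\<close> increases with
  \<open>u\<close>, hence so does the quotient of \<open>|Gamma (b + i x)|\<close> by
  \<open>Gamma b\<close> with \<open>b\<close>. This takes the place of Stirling's formula: decay
  known for large integers passes down to all smaller positive \<open>b\<close>.\<close>

lemma cmod_Gamma_mono:
  assumes "0 < b" "b \<le> b'"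
  shows "cmod (Gamma (Complex b x)) * Gamma b' \<le> cmod (Gamma (Complex b' x)) * Gamma b"
proof (rule LIMSEQ_le)
  show "(\<lambda>n. cmod (Gamma_series (Complex b x) n) * Gamma_series b' n) \<longlonglongrightarrow> cmod (Gamma (Complex b x)) * Gamma b'"
    "(\<lambda>n. cmod (Gamma_series (Complex b' x) n) * Gamma_series b n) \<longlonglongrightarrow> cmod (Gamma (Complex b' x)) * Gamma b"
    by (intro tendsto_intros)+
  show "\<exists>N. \<forall>n\<ge>N. cmod (Gamma_series (Complex b x) n) * Gamma_series b' n
      \<le> cmod (Gamma_series (Complex b' x) n) * Gamma_series b n"
  proof (intro exI allI impI)
    fix n :: nat assume n: "n \<ge> 1"
    have "u / cmod (Complex u x) \<le> v / cmod (Complex v x)" if "0 < u" "u \<le> v" for u v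
    proof -
      have "u\<^sup>2 * (v\<^sup>2 + x\<^sup>2) \<le> v\<^sup>2 * (u\<^sup>2 + x\<^sup>2)"
        using that by (simp add: distrib_left mult_right_mono power_mono)
      hence "u\<^sup>2 / (u\<^sup>2 + x\<^sup>2) \<le> v\<^sup>2 / (v\<^sup>2 + x\<^sup>2)"
        using that by (simp add: divide_simps sum_power2_gt_zero_iff mult.commute)
      hence "sqrt (u\<^sup>2 / (u\<^sup>2 + x\<^sup>2)) \<le> sqrt (v\<^sup>2 / (v\<^sup>2 + x\<^sup>2))" by simp
      thus ?thesis using that by (simp add: cmod_def real_sqrt_divide)
    qed
    hence "(\<Prod>k\<le>n. (b + real k) / cmod (Complex (b + real k) x)) \<le> (\<Prod>k\<le>n. (b' + real k) / cmod (Complex (b' + real k) x))"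
      using assms by (intro prod_mono) auto
    moreover have "Gamma_series b n \<ge> 0" "Gamma_series b' n \<ge> 0"
      using assms unfolding Gamma_series_def by (auto intro!: divide_nonneg_nonneg mult_nonneg_nonneg pochhammer_nonneg)
    ultimately show "cmod (Gamma_series (Complex b x) n) * Gamma_series b' n
      \<le> cmod (Gamma_series (Complex b' x) n) * Gamma_series b n"
      using assms n by (simp add: cmod_Gamma_series mult_ac mult_left_mono)
  qed
qed

lemma cmod_Gamma_le:
  assumes "0 < b"
  shows "cmod (Gamma (Complex b x)) \<le> Gamma b"
proof (rule LIMSEQ_le)
  show "(\<lambda>n. cmod (Gamma_series (Complex b x) n)) \<longlonglongrightarrow> cmod (Gamma (Complex b x))"
    "(\<lambda>n. Gamma_series b n) \<longlonglongrightarrow> Gamma b"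
    by (intro tendsto_intros)+
  show "\<exists>N. \<forall>n\<ge>N. cmod (Gamma_series (Complex b x) n) \<le> Gamma_series b n"
  proof (intro exI allI impI)
    fix n :: nat assume n: "n \<ge> 1"
    have "u / cmod (Complex u x) \<le> 1" if "0 < u" for u
      using that complex_Re_le_cmod [of "Complex u x"] by (simp add: divide_le_eq_1)
    hence "(\<Prod>k\<le>n. (b + real k) / cmod (Complex (b + real k) x)) \<le> (\<Prod>k\<le>n. 1)"
      using assms by (intro prod_mono) (auto simp: add_pos_nonneg)
    moreover have "Gamma_series b n \<ge> 0"
      using assms unfolding Gamma_series_def by (auto intro!: divide_nonneg_nonneg mult_nonneg_nonneg pochhammer_nonneg)
    ultimately show "cmod (Gamma_series (Complex b x) n) \<le> Gamma_series b n"
      using assms n mult_left_mono [of "\<Prod>k\<le>n. (b + real k) / cmod (Complex (b + real k) x)" 1 "Gamma_series b n"]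
      by (simp add: cmod_Gamma_series)
  qed
qed

lemma Gamma_plus1_pos: "x > 0 \<Longrightarrow> Gamma (x + 1) = x * Gamma (x :: real)"
  by (rule Gamma_plus1) (auto elim!: nonpos_Ints_cases)

lemma Gamma_Complex_plus1:
  assumes "x \<noteq> 0 \<or> b > 0"
  shows "Gamma (Complex (b + 1) x) = Complex b x * Gamma (Complex b x)"
proof -
  have "Complex b x \<notin> \<int>\<^sub>\<le>\<^sub>0"
    using assms by (auto elim!: nonpos_Ints_cases simp: complex_eq_iff)
  moreover have "Complex (b + 1) x = Complex b x + 1" by (simp add: complex_eq_iff)
  ultimately show ?thesis by (simp add: Gamma_plus1)
qed

lemma cmod_Gamma_Complex_plus1:
  assumes "x \<noteq> 0 \<or> b > 0"
  shows "(cmod (Gamma (Complex (b + 1) x)))\<^sup>2 = (b\<^sup>2 + x\<^sup>2) * (cmod (Gamma (Complex b x)))\<^sup>2"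
  by (simp add: Gamma_Complex_plus1 [OF assms] norm_mult power_mult_distrib cmod_power2 [of "Complex b x"])

lemma sinh_cosh_of_real:
  "sinh (of_real x) = (of_real (sinh x) :: complex)" "cosh (of_real x) = (of_real (cosh x) :: complex)"
  by (simp_all add: sinh_field_def cosh_field_def exp_of_real [symmetric])

lemma cmod_Gamma_1:
  assumes "x > 0"
  shows "(cmod (Gamma (Complex 1 x)))\<^sup>2 = pi * x / sinh (pi * x)"
proof -
  have eq: "Complex 0 x = \<i> * of_real x" and cnj: "1 - Complex 0 x = cnj (Complex 1 x)"
    by (simp_all add: complex_eq_iff)
  have "of_real ((cmod (Gamma (Complex 1 x)))\<^sup>2) = Gamma (Complex 1 x) * Gamma (1 - Complex 0 x)"
    by (simp only: complex_norm_square cnj_Gamma cnj)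
  also have "\<dots> = Complex 0 x * (Gamma (Complex 0 x) * Gamma (1 - Complex 0 x))"
    using Gamma_Complex_plus1 [of x 0] assms by simp
  also have "\<dots> = Complex 0 x * of_real pi / sin (of_real pi * Complex 0 x)"
    by (simp only: Gamma_reflection_complex times_divide_eq_right)
  also have "sin (of_real pi * Complex 0 x) = \<i> * sinh (of_real (pi * x))"
    by (simp add: eq sinh_conv_sin mult_ac)
  also have "\<dots> = \<i> * of_real (sinh (pi * x))"
    by (simp only: sinh_cosh_of_real)
  also have "Complex 0 x * of_real pi / (\<i> * of_real (sinh (pi * x))) = of_real (pi * x / sinh (pi * x))"
    by (simp add: eq mult_ac)
  finally show ?thesis by (simp only: of_real_eq_iff)
qed

text \<open>The rate \<open>s\<close> stays free in the induction: half of it pays for the new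
  factor \<open>x\<close>, the other half for the remaining polynomial.\<close>

lemma poly_exp_bounded:
  fixes p :: "real poly"
  assumes "s > 0"
  shows "\<exists>C. \<forall>x\<ge>0. \<bar>poly p x\<bar> * exp (- s * x) \<le> C"
  using assms
proof (induction p arbitrary: s)
  case 0
  show ?case by (intro exI [of _ 0]) simp
next
  case (pCons a p)
  from pCons.IH [of "s / 2"] pCons.prems obtain C where
    C: "\<And>x. x \<ge> 0 \<Longrightarrow> \<bar>poly p x\<bar> * exp (- (s / 2) * x) \<le> C" by auto
  show ?case
  proof (intro exI allI impI)
    fix x :: real assume x: "x \<ge> 0"
    have "s / 2 * x \<le> exp (s / 2 * x)" by (metis exp_ge_add_one_self add.commute le_add_same_cancel1 order_trans zero_le_one)
    hence e: "x * exp (- (s / 2) * x) \<le> 2 / s"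
      using pCons.prems by (simp add: exp_minus field_simps)
    have "\<bar>poly (pCons a p) x\<bar> * exp (- s * x) \<le> (\<bar>a\<bar> + x * \<bar>poly p x\<bar>) * exp (- s * x)"
      using x by (intro mult_right_mono) (auto simp: abs_mult intro: order_trans [OF abs_triangle_ineq])
    also have "\<dots> = \<bar>a\<bar> * exp (- s * x) + (x * exp (- (s / 2) * x)) * (\<bar>poly p x\<bar> * exp (- (s / 2) * x))"
      by (simp add: distrib_left distrib_right mult_ac flip: exp_add)
    also have "\<dots> \<le> \<bar>a\<bar> * 1 + 2 / s * C"
      using x pCons.prems C[OF x] e by (intro add_mono mult_mono mult_left_mono) auto
    finally show "\<bar>poly (pCons a p) x\<bar> * exp (- s * x) \<le> \<bar>a\<bar> * 1 + 2 / s * C" .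
  qed
qed

text \<open>Any rate below \<open>pi\<close> will do, so polynomial factors can be absorbed. The
  value at \<open>b = 1\<close> is explicit, the functional equation climbs through the integers at
  the cost of a little rate, and monotonicity in \<open>b\<close> covers the rest.\<close>

lemma cmod_Gamma_exp_bound:
  assumes "b > 0" "0 < r" "r < pi"
  shows "\<exists>C. \<forall>x\<ge>0. (cmod (Gamma (Complex b x)))\<^sup>2 \<le> C * exp (- r * x)"
proof -
  have nat: "\<exists>C. \<forall>x\<ge>0. (cmod (Gamma (Complex (real (Suc n)) x)))\<^sup>2 \<le> C * exp (- r * x)"
    if "0 < r" "r < pi" for n r
    using that
  proof (induction n arbitrary: r)
    case 0
    obtain C where C: "\<And>x. x \<ge> 0 \<Longrightarrow> \<bar>poly [:0, 4 * pi:] x\<bar> * exp (- (pi - r) * x) \<le> C"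
      using poly_exp_bounded [of "pi - r" "[:0, 4 * pi:]"] 0 by auto
    show ?case
    proof (intro exI [of _ "max C (exp r)"] allI impI)
      fix x :: real assume x: "x \<ge> 0"
      show "(cmod (Gamma (Complex (real (Suc 0)) x)))\<^sup>2 \<le> max C (exp r) * exp (- r * x)"
      proof (cases "x \<ge> 1")
        case True
        have "exp (- pi * x) \<le> 1" using x by simp
        moreover have "1 + pi * x \<le> exp (pi * x)" by (rule exp_ge_add_one_self)
        moreover have "pi * x \<ge> 1" using True pi_gt3 mult_mono [of 1 pi 1 x] by simp
        ultimately have e: "exp (- (pi * x)) \<le> 1" "2 \<le> exp (pi * x)" by (simp, linarith)
        have "2 * exp (- (pi * x)) \<le> 2 * 1" by (intro mult_left_mono e) simp
        also have "2 * 1 \<le> exp (pi * x)" using e(2) by simp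
        finally have "2 * exp (- (pi * x)) \<le> exp (pi * x)" .
        hence "sinh (pi * x) \<ge> exp (pi * x) / 4"
          by (simp add: sinh_field_def field_simps)
        hence "pi * x / sinh (pi * x) \<le> pi * x / (exp (pi * x) / 4)"
          using x by (intro divide_left_mono) (auto intro: mult_pos_pos simp: True less_le_trans [OF _ True])
        also have "\<dots> = (4 * pi * x * exp (- (pi - r) * x)) * exp (- r * x)"
          by (simp add: exp_minus exp_diff field_simps flip: exp_add)
        also have "\<dots> \<le> max C (exp r) * exp (- r * x)"
          using C[OF x] x by (intro mult_right_mono) (auto simp: mult_ac)
        finally show ?thesis using cmod_Gamma_1 [of x] True by simp
      next
        case False
        have "cmod (Gamma (Complex 1 x)) \<le> 1" using cmod_Gamma_le [of 1 x] by simp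
        hence "(cmod (Gamma (Complex 1 x)))\<^sup>2 \<le> 1" by (simp add: power_le_one)
        also have "1 \<le> exp r * exp (- r * x)"
          using False 0 by (simp flip: exp_add)
        also have "\<dots> \<le> max C (exp r) * exp (- r * x)" by (intro mult_right_mono) auto
        finally show ?thesis by simp
      qed
    qed
  next
    case (Suc n)
    \<comment> \<open>The midpoint between \<open>r\<close> and \<open>pi\<close>: the gap between
      \<open>r'\<close> and \<open>r\<close> pays for the quadratic factor of the functional
      equation.\<close>
    define r' where "r' = (r + pi) / 2"
    have r': "r < r'" "r' < pi" "0 < r'" using Suc.prems by (auto simp: r'_def)
    obtain C where C: "\<And>x. x \<ge> 0 \<Longrightarrow> (cmod (Gamma (Complex (real (Suc n)) x)))\<^sup>2 \<le> C * exp (- r' * x)"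
      using Suc.IH [OF r'(3,2)] by blast
    obtain D where D: "\<And>x. x \<ge> 0 \<Longrightarrow> \<bar>poly [:(real (Suc n))\<^sup>2, 0, 1:] x\<bar> * exp (- (r' - r) * x) \<le> D"
      using poly_exp_bounded [of "r' - r" "[:(real (Suc n))\<^sup>2, 0, 1:]"] r' by auto
    have "C \<ge> 0" using C[of 0] by (simp add: order_trans [OF zero_le_power2])
    show ?case
    proof (intro exI [of _ "C * D"] allI impI)
      fix x :: real assume x: "x \<ge> 0"
      have "(cmod (Gamma (Complex (real (Suc (Suc n))) x)))\<^sup>2
         = ((real (Suc n))\<^sup>2 + x\<^sup>2) * (cmod (Gamma (Complex (real (Suc n)) x)))\<^sup>2"
        using cmod_Gamma_Complex_plus1 [of x "real (Suc n)"] by (simp add: add_ac)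
      also have "\<dots> \<le> ((real (Suc n))\<^sup>2 + x\<^sup>2) * (C * exp (- r' * x))"
        by (intro mult_left_mono C x) auto
      also have "\<dots> = C * (((real (Suc n))\<^sup>2 + x\<^sup>2) * exp (- (r' - r) * x)) * exp (- r * x)"
        by (simp add: mult_exp_exp algebra_simps flip: exp_add)
      also have "\<dots> \<le> C * D * exp (- r * x)"
        using D[OF x] x \<open>C \<ge> 0\<close>
        by (intro mult_right_mono mult_left_mono) (auto simp: power2_eq_square abs_of_nonneg)
      finally show "(cmod (Gamma (Complex (real (Suc (Suc n))) x)))\<^sup>2 \<le> C * D * exp (- r * x)" .
    qed
  qed
  obtain n :: nat where n: "b \<le> real (Suc n)"
    using real_arch_simple [of b] by (metis le_SucI of_nat_le_iff order_trans le_refl)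
  obtain C where C: "\<And>x. x \<ge> 0 \<Longrightarrow> (cmod (Gamma (Complex (real (Suc n)) x)))\<^sup>2 \<le> C * exp (- r * x)"
    using nat [OF assms(2,3), of n] by blast
  define G where "G = (Gamma b / Gamma (real (Suc n)))\<^sup>2"
  show ?thesis
  proof (intro exI [of _ "G * C"] allI impI)
    fix x :: real assume x: "x \<ge> 0"
    have "cmod (Gamma (Complex b x)) \<le> cmod (Gamma (Complex (real (Suc n)) x)) * (Gamma b / Gamma (real (Suc n)))"
      using cmod_Gamma_mono [OF assms(1) n, of x] Gamma_real_pos [of "real (Suc n)"] by (simp add: field_simps del: of_nat_Suc)
    hence "(cmod (Gamma (Complex b x)))\<^sup>2 \<le> (cmod (Gamma (Complex (real (Suc n)) x)))\<^sup>2 * G"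
      unfolding G_def power_mult_distrib [symmetric] by (intro power_mono) auto
    also have "\<dots> \<le> (C * exp (- r * x)) * G"
      by (intro mult_right_mono C x) (simp add: G_def)
    finally show "(cmod (Gamma (Complex b x)))\<^sup>2 \<le> G * C * exp (- r * x)" by (simp add: mult_ac)
  qed
qed

section \<open>The weight common to all \<open>p\<close>\<close>

definition kap :: "real \<Rightarrow> real \<Rightarrow> real" where
  "kap \<alpha> x = sinh (2 * pi * x) / (cosh (2 * pi * x) - cos (2 * pi * \<alpha>))"

text \<open>Up to normalisation the square of the density at \<open>p = 0\<close>. By reflection,
  the squared modulus of \<open>Gamma (\<alpha> + i x) * Gamma (1 - \<alpha> + i x)\<close> is
  \<open>2 pi^2\<close> over the denominator of \<open>kap\<close>, and that of
  \<open>Gamma (2 i x)\<close> is \<open>pi / (2 x sinh (2 pi x))\<close>; their quotient is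
  \<open>2 pi\<close> times \<open>2 x kap\<close>.\<close>

definition wt :: "real \<Rightarrow> real \<Rightarrow> real \<Rightarrow> real" where
  "wt \<alpha> B x = 2 * x * kap \<alpha> x * (cmod (Gamma (Complex B x)))\<^sup>2"

lemma cosh_gt_1: "(x::real) \<noteq> 0 \<Longrightarrow> cosh x > 1"
  using cosh_real_ge_1 [of x] cosh_square_eq [of x] sinh_real_zero_iff [of x]
  by (metis add_cancel_right_left antisym_conv2 one_power2 power_eq_0_iff)

lemma kap_denom_pos: "x \<noteq> 0 \<Longrightarrow> cosh (2 * pi * x) - cos (2 * pi * \<alpha>) > 0"
proof -
  assume "x \<noteq> 0"
  hence "cosh (2 * pi * x) > 1" by (intro cosh_gt_1) simp
  thus ?thesis using cos_le_one [of "2 * pi * \<alpha>"] by linarith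
qed

lemma kap_pos: "x > 0 \<Longrightarrow> kap \<alpha> x > 0"
  unfolding kap_def using kap_denom_pos [of x \<alpha>] by (intro divide_pos_pos) auto

lemma kap_minus: "kap \<alpha> (- x) = - kap \<alpha> x"
  by (simp add: kap_def)

text \<open>The worst case is cosine 1, where the quotient is the hyperbolic cotangent of
  \<open>pi x\<close>. Thus the bound is uniform in \<alpha>, as dominated convergence in \<alpha>
  requires.\<close>

lemma kap_le:
  assumes "x > 0"
  shows "x * kap \<alpha> x \<le> x + 1"
proof -
  have s: "sinh (pi * x) > 0" using assms by simp
  have "kap \<alpha> x \<le> sinh (2 * (pi * x)) / (cosh (2 * (pi * x)) - 1)"
    unfolding kap_def mult.assoc using assms cosh_gt_1 [of "2 * (pi * x)"] kap_denom_pos [of x \<alpha>]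
    by (intro divide_left_mono) (auto intro!: mult_pos_pos simp: mult.assoc)
  also have "\<dots> = cosh (pi * x) / sinh (pi * x)"
  proof -
    have "cosh (2 * (pi * x)) - 1 = 2 * sinh (pi * x) * sinh (pi * x)"
      unfolding cosh_double using cosh_square_eq [of "pi * x"] by (simp add: power2_eq_square)
    thus ?thesis using s by (simp only: sinh_double) simp
  qed
  finally have "x * kap \<alpha> x \<le> x * (cosh (pi * x) / sinh (pi * x))"
    using assms by (intro mult_left_mono) auto
  also have "\<dots> = x + x * exp (- (pi * x)) / sinh (pi * x)"
  proof -
    have "cosh (pi * x) = sinh (pi * x) + exp (- (pi * x))"
      using cosh_minus_sinh [of "pi * x"] by simp
    thus ?thesis using s by (simp only: add_divide_distrib distrib_left) simp
  qed
  also have "x * exp (- (pi * x)) / sinh (pi * x) \<le> x * 1 / x"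
  proof (intro frac_le mult_left_mono)
    have "x \<le> pi * x" using assms pi_gt3 by simp
    also have "\<dots> \<le> sinh (pi * x)" using real_le_x_sinh [of "pi * x"] assms by (simp add: sinh_field_def exp_minus)
    finally show "x \<le> sinh (pi * x)" .
  qed (use assms in auto)
  finally show ?thesis using assms by simp
qed

text \<open>At \<open>B = 0\<close> the squared modulus of \<open>Gamma (i x)\<close> behaves like
  \<open>1 / x^2\<close> near 0. The factor \<open>x * kap\<close> compensates this if
  \<open>kap\<close> vanishes linearly, which it does once its denominator stays positive at
  0.\<close>

lemma kap_le_linear:
  assumes "cos (2 * pi * \<alpha>) < 1"
  shows "\<exists>C>0. \<forall>x>0. kap \<alpha> x \<le> C * x"
proof -
  define c where "c = 1 - cos (2 * pi * \<alpha>)"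
  have c: "c > 0" using assms by (simp add: c_def)
  define C where "C = max 3 (2 * pi * cosh (2 * pi) / c)"
  have "kap \<alpha> x \<le> C * x" if x: "x > 0" for x
  proof (cases "x \<ge> 1")
    case True
    have "kap \<alpha> x \<le> 1 + 1 / x" using kap_le [OF x, of \<alpha>] x by (simp add: field_simps)
    also have "\<dots> \<le> 3 * x"
    proof -
      have "1 / x \<le> 1" using True by simp
      thus ?thesis using True by linarith
    qed
    also have "\<dots> \<le> C * x" using x by (intro mult_right_mono) (auto simp: C_def)
    finally show ?thesis .
  next
    case False
    have "sinh t \<le> t * cosh t" if "t \<ge> 0" for t :: real
    proof -
      have "((\<lambda>t. t * cosh t - sinh t) has_real_derivative t * sinh t) (at t)" for t :: real
        by (auto intro!: derivative_eq_intros)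
      hence "0 * cosh 0 - sinh 0 \<le> t * cosh t - sinh t"
        using that by (intro DERIV_nonneg_imp_nondecreasing [of 0 t "\<lambda>t. t * cosh t - sinh t"]) (auto intro!: exI)
      thus ?thesis by simp
    qed
    from this [of "2 * pi * x"] have "sinh (2 * pi * x) \<le> 2 * pi * x * cosh (2 * pi * x)" using x by simp
    also have "\<dots> \<le> 2 * pi * x * cosh (2 * pi)"
      using x False by (intro mult_left_mono) (auto simp: cosh_real_nonneg_le_iff)
    finally have "sinh (2 * pi * x) \<le> 2 * pi * x * cosh (2 * pi)" .
    hence "kap \<alpha> x \<le> 2 * pi * x * cosh (2 * pi) / c"
      unfolding kap_def using x c cosh_gt_1 [of "2 * pi * x"] by (intro frac_le) (auto simp: c_def)
    also have "\<dots> = (2 * pi * cosh (2 * pi) / c) * x" by simp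
    also have "\<dots> \<le> C * x" using x by (intro mult_right_mono) (simp_all add: C_def)
    finally show ?thesis .
  qed
  moreover have "C > 0" by (simp add: C_def less_max_iff_disj)
  ultimately show ?thesis by blast
qed

lemma wt_minus: "wt \<alpha> B (- x) = wt \<alpha> B x"
proof -
  have "Complex B (- x) = cnj (Complex B x)" by (simp add: complex_eq_iff)
  thus ?thesis by (simp add: wt_def kap_minus flip: cnj_Gamma)
qed

lemma wt_pos:
  assumes "x > 0"
  shows "wt \<alpha> B x > 0"
proof -
  have "Complex B x \<notin> \<int>\<^sub>\<le>\<^sub>0" using assms by (auto elim!: nonpos_Ints_cases simp: complex_eq_iff)
  thus ?thesis
    using assms kap_pos [OF assms, of \<alpha>] by (simp add: wt_def Gamma_eq_zero_iff)
qed

lemma wt_shift: "x \<noteq> 0 \<Longrightarrow> wt \<alpha> (B + 1) x = (B\<^sup>2 + x\<^sup>2) * wt \<alpha> B x"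
  by (simp add: wt_def cmod_Gamma_Complex_plus1)

text \<open>Raising \<open>B\<close> by one brings the Gamma factor into the range where its decay
  is known, at the price of dividing by \<open>B^2 + x^2\<close>. This hurts near 0 only for
  \<open>B = 0\<close>, where the other alternative of the hypothesis supplies the linear bound on
  \<open>kap\<close>. Of the rate \<open>3 < pi\<close> one unit absorbs the factor
  \<open>x + 1\<close>.\<close>

lemma wt_exp_bound:
  assumes B: "B > -1" and "B \<noteq> 0 \<or> cos (2 * pi * \<alpha>) < 1"
  shows "\<exists>C. \<forall>x>0. wt \<alpha> B x \<le> C * exp (- 2 * x)"
proof -
  have "\<exists>C. \<forall>x\<ge>0. (cmod (Gamma (Complex (B + 1) x)))\<^sup>2 \<le> C * exp (- 3 * x)"
    using B pi_gt3 by (intro cmod_Gamma_exp_bound) auto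
  then obtain C where C: "\<And>x. x \<ge> 0 \<Longrightarrow> (cmod (Gamma (Complex (B + 1) x)))\<^sup>2 \<le> C * exp (- 3 * x)"
    by blast
  have C0: "C \<ge> 0" using C[of 0] by (simp add: order_trans [OF zero_le_power2])
  have eq: "wt \<alpha> B x = 2 * (x * kap \<alpha> x) / (B\<^sup>2 + x\<^sup>2) * (cmod (Gamma (Complex (B + 1) x)))\<^sup>2" if "x > 0" for x
    using that by (simp add: wt_def cmod_Gamma_Complex_plus1 sum_power2_eq_zero_iff)
  obtain D where D: "D \<ge> 0" "\<And>x. x > 0 \<Longrightarrow> x * kap \<alpha> x / (B\<^sup>2 + x\<^sup>2) \<le> D * (x + 1)"
  proof (cases "B = 0")
    case False
    show ?thesis
    proof (rule that [of "1 / B\<^sup>2"])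
      fix x :: real assume x: "x > 0"
      have "x * kap \<alpha> x / (B\<^sup>2 + x\<^sup>2) \<le> (x + 1) / B\<^sup>2"
        using kap_le [OF x] False x by (intro frac_le) auto
      thus "x * kap \<alpha> x / (B\<^sup>2 + x\<^sup>2) \<le> 1 / B\<^sup>2 * (x + 1)" by simp
    qed simp
  next
    case True
    then obtain E where E: "E > 0" "\<And>x. x > 0 \<Longrightarrow> kap \<alpha> x \<le> E * x"
      using kap_le_linear [of \<alpha>] assms(2) by blast
    show ?thesis
    proof (rule that [of E])
      fix x :: real assume x: "x > 0"
      have "x * kap \<alpha> x / (B\<^sup>2 + x\<^sup>2) = kap \<alpha> x / x" using True x by (simp add: power2_eq_square)
      also have "\<dots> \<le> E" using E(2)[OF x] x by (simp add: field_simps)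
      also have "\<dots> \<le> E * (x + 1)" using E x by (simp add: distrib_left)
      finally show "x * kap \<alpha> x / (B\<^sup>2 + x\<^sup>2) \<le> E * (x + 1)" .
    qed (use E in simp)
  qed
  from poly_exp_bounded [OF zero_less_one, of "[:1, 1:]"]
  obtain K where "\<forall>x\<ge>0::real. \<bar>poly [:1, 1:] x\<bar> * exp (- 1 * x) \<le> K" ..
  hence K: "(x + 1) * exp (- x) \<le> K" if "x \<ge> 0" for x
    using that by (auto simp: add_ac dest: spec [of _ x])
  show ?thesis
  proof (intro exI [of _ "2 * D * C * K"] allI impI)
    fix x :: real assume x: "x > 0"
    have "wt \<alpha> B x = 2 * (x * kap \<alpha> x / (B\<^sup>2 + x\<^sup>2)) * (cmod (Gamma (Complex (B + 1) x)))\<^sup>2"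
      using eq [OF x] by simp
    also have "\<dots> \<le> 2 * (D * (x + 1)) * (C * exp (- 3 * x))"
      using x D C[of x] kap_pos [OF x, of \<alpha>] by (intro mult_mono) auto
    also have "\<dots> = 2 * D * C * ((x + 1) * exp (- x)) * exp (- 2 * x)"
      by (simp add: mult_ac flip: exp_add)
    also have "\<dots> \<le> 2 * D * C * K * exp (- 2 * x)"
      using x D C0 K[of x] by (intro mult_right_mono mult_left_mono) auto
    finally show "wt \<alpha> B x \<le> 2 * D * C * K * exp (- 2 * x)" .
  qed
qed

section \<open>The total mass of the weight\<close>

text \<open>The quotient by \<open>cD\<close> is \<open>Gamma (B + s) * Gamma (B + 1 - s) * sin (2
  pi s) / (cos (2 pi \<alpha>) - cos (2 pi s))\<close>. Both Gamma arguments are raised by one so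
  that, for \<open>B > - 1/2\<close>, the numerator is holomorphic near the closed strip
  \<open>0 \<le> Re s \<le> 1\<close> and every pole is a zero of \<open>cD\<close>.\<close>

definition cN :: "real \<Rightarrow> complex \<Rightarrow> complex" where
  "cN B s = Gamma (of_real B + 1 + s) * Gamma (of_real B + 2 - s) * sin (of_real (2 * pi) * s)"

definition cD :: "real \<Rightarrow> real \<Rightarrow> complex \<Rightarrow> complex" where
  "cD \<alpha> B s = (of_real B + s) * (of_real B + 1 - s) * (of_real (cos (2 * pi * \<alpha>)) - cos (of_real (2 * pi) * s))"

text \<open>Unit shifts of \<open>cN B s / cD \<alpha> B s\<close> telescope to the weight on the imaginary axis.\<close>

lemma contour_integrand_shift:
  assumes "B \<noteq> 0"
  shows "cN B (Complex 1 y) / cD \<alpha> B (Complex 1 y) - cN B (Complex 0 y) / cD \<alpha> B (Complex 0 y) = of_real (wt \<alpha> B y)"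
proof (cases "y = 0")
  \<comment> \<open>At \<open>y = 0\<close> the sine annihilates both numerators, so the quotients
    are 0 even where a denominator vanishes too; the weight is 0 through its factor
    \<open>x\<close>.\<close>
  case True
  have "sin (complex_of_real (2 * pi)) = 0"
    by (metis of_real_0 sin_of_real sin_two_pi)
  thus ?thesis using True by (simp add: wt_def cN_def flip: one_complex.code zero_complex.code)
next
  case False
  define G where "G = Gamma (Complex B y)"
  have nz: "Complex u y \<noteq> 0" "Complex u (- y) \<noteq> 0" for u using False by (simp_all add: complex_eq_iff)
  have g1: "Gamma (Complex (u + 1) w) = Complex u w * Gamma (Complex u w)" if "w \<noteq> 0" for u w
    using that by (intro Gamma_Complex_plus1) simp
  have G': "Gamma (Complex B (- y)) = cnj G"
  proof -
    have "Complex B (- y) = cnj (Complex B y)" by (simp add: complex_eq_iff)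
    thus ?thesis by (simp add: G_def cnj_Gamma)
  qed
  have e: "sin (of_real (2 * pi) * Complex 0 y) = \<i> * of_real (sinh (2 * pi * y))"
    "cos (of_real (2 * pi) * Complex 0 y) = of_real (cosh (2 * pi * y))"
  proof -
    have eq: "of_real (2 * pi) * Complex 0 y = \<i> * of_real (2 * pi * y)" by (simp add: complex_eq_iff)
    show "sin (of_real (2 * pi) * Complex 0 y) = \<i> * of_real (sinh (2 * pi * y))"
      unfolding eq sinh_cosh_of_real [symmetric] sinh_conv_sin by simp
    show "cos (of_real (2 * pi) * Complex 0 y) = of_real (cosh (2 * pi * y))"
      unfolding eq sinh_cosh_of_real [symmetric] cosh_conv_cos by simp
  qed
  have sh: "of_real (2 * pi) * Complex 1 y = of_real (2 * pi) * Complex 0 y + of_real (2 * pi)"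
    by (simp add: complex_eq_iff)
  have per: "sin (w + of_real (2 * pi)) = sin w" "cos (w + of_real (2 * pi)) = cos w" for w :: complex
    by (simp_all add: sin_add cos_add sin_of_real [symmetric] cos_of_real [symmetric] del: of_real_mult sin_of_real cos_of_real)
       (simp_all add: sin_of_real cos_of_real del: of_real_mult)
  define K where "K = \<i> * of_real (sinh (2 * pi * y)) / (of_real (cos (2 * pi * \<alpha>)) - of_real (cosh (2 * pi * y)))"
  have arg: "of_real B + 1 + Complex u y = Complex (B + 1 + u) y" "of_real B + 2 - Complex u y = Complex (B + 2 - u) (- y)"
    "of_real B + Complex u y = Complex (B + u) y" "of_real B + 1 - Complex u y = Complex (B + 1 - u) (- y)" for u
    by (simp_all add: complex_eq_iff)
  have f0: "cN B (Complex 0 y) / cD \<alpha> B (Complex 0 y) = G * (Complex B (- y) * cnj G) * K"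
  proof -
    have "Gamma (Complex (B + 1 + 0) y) = Complex (B + 0) y * G"
      using g1 [of y B] False by (simp add: G_def)
    moreover have "Gamma (Complex (B + 2 - 0) (- y)) = Complex (B + 1 - 0) (- y) * (Complex B (- y) * cnj G)"
      using g1 [of "- y" "B + 1"] g1 [of "- y" B] False by (simp add: G' add.assoc)
    ultimately show ?thesis
      unfolding cN_def cD_def arg e K_def using nz by simp
  qed
  have f1: "cN B (Complex 1 y) / cD \<alpha> B (Complex 1 y) = (Complex B y * G) * cnj G * K"
  proof -
    have "Gamma (Complex (B + 1 + 1) y) = Complex (B + 1) y * (Complex B y * G)"
      using g1 [of y "B + 1"] g1 [of y B] False by (simp add: G_def)
    moreover have "Gamma (Complex (B + 2 - 1) (- y)) = Complex (B + 1 - 1) (- y) * cnj G"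
      using g1 [of "- y" B] False by (simp add: G' add.commute)
    ultimately show ?thesis
      unfolding cN_def cD_def arg sh per e K_def using nz by simp
  qed
  have "cN B (Complex 1 y) / cD \<alpha> B (Complex 1 y) - cN B (Complex 0 y) / cD \<alpha> B (Complex 0 y)
      = (Complex B y - Complex B (- y)) * (G * cnj G) * K"
    unfolding f0 f1 by (simp add: algebra_simps)
  \<comment> \<open>The two Gamma products differ in one linear factor only, \<open>B + i y\<close>
    against \<open>B - i y\<close>; the difference is the source of the factor \<open>2 x\<close> in
    \<open>wt\<close>.\<close>
  also have "Complex B y - Complex B (- y) = 2 * \<i> * of_real y" by (simp add: complex_eq_iff)
  also have "G * cnj G = of_real ((cmod G)\<^sup>2)" by (simp only: complex_norm_square)
  also have "K = - \<i> * of_real (kap \<alpha> y)"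
  proof -
    have "K = \<i> * of_real (sinh (2 * pi * y)) / (- (of_real (cosh (2 * pi * y)) - of_real (cos (2 * pi * \<alpha>))))"
      by (simp only: K_def minus_diff_eq)
    thus ?thesis unfolding kap_def by (simp only: divide_minus_right of_real_divide of_real_diff) simp
  qed
  also have "2 * \<i> * of_real y * of_real ((cmod G)\<^sup>2) * (- \<i> * of_real (kap \<alpha> y)) = of_real (wt \<alpha> B y)"
    by (simp add: wt_def G_def)
  finally show ?thesis .
qed

lemma norm_sin_cos_bounds:
  fixes z :: complex
  shows "cmod (sin z) \<le> cosh (Im z)" "cmod (cos z) \<ge> sinh \<bar>Im z\<bar>"
proof -
  have n: "cmod (exp (\<i> * z)) = exp (- Im z)" "cmod (exp (- (\<i> * z))) = exp (Im z)"
    by (simp_all add: norm_exp_eq_Re)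
  have "cmod (sin z) = cmod (exp (\<i> * z) - exp (- (\<i> * z))) / 2"
    by (simp add: sin_exp_eq norm_divide norm_mult)
  also have "\<dots> \<le> (exp (- Im z) + exp (Im z)) / 2"
    using norm_triangle_ineq4 [of "exp (\<i> * z)" "exp (- (\<i> * z))"] by (simp add: n)
  finally show "cmod (sin z) \<le> cosh (Im z)" by (simp add: cosh_field_def add.commute)
  have "sinh \<bar>Im z\<bar> = \<bar>exp (- Im z) - exp (Im z)\<bar> / 2"
    unfolding sinh_field_def by (cases "Im z \<ge> 0") simp_all
  also have "\<dots> \<le> cmod (exp (\<i> * z) + exp (- (\<i> * z))) / 2"
    using norm_triangle_ineq3 [of "exp (\<i> * z)" "- exp (- (\<i> * z))"] by (simp add: n)
  also have "\<dots> = cmod (cos z)"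
    by (simp add: cos_exp_eq norm_divide)
  finally show "cmod (cos z) \<ge> sinh \<bar>Im z\<bar>" .
qed

text \<open>The trigonometric quotient is bounded away from the real axis, the Gamma factors are
  bounded by their values on the real axis, and the two linear factors of \<open>cD\<close> give the
  square. This suffices for the horizontal sides of the rectangle to vanish in the limit.\<close>

lemma contour_integrand_bound:
  assumes B: "B > -1"
  shows "\<exists>M\<ge>0. \<forall>s. 0 \<le> Re s \<and> Re s \<le> 1 \<and> \<bar>Im s\<bar> \<ge> 1 \<longrightarrow> cmod (cN B s / cD \<alpha> B s) \<le> M / (Im s)\<^sup>2"
proof -
  have "continuous_on {0..1} (\<lambda>t. Gamma (B + 1 + t) * Gamma (B + 2 - t))"
    using B by (intro continuous_at_imp_continuous_on ballI continuous_intros) (auto elim!: nonpos_Ints_cases)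
  hence "bounded ((\<lambda>t. Gamma (B + 1 + t) * Gamma (B + 2 - t)) ` {0..1})"
    by (intro compact_imp_bounded compact_continuous_image) auto
  then obtain M where "\<forall>t\<in>{0..1}. \<bar>Gamma (B + 1 + t) * Gamma (B + 2 - t)\<bar> \<le> M"
    unfolding bounded_iff by auto
  hence M: "\<bar>Gamma (B + 1 + t) * Gamma (B + 2 - t)\<bar> \<le> M" if "0 \<le> t" "t \<le> 1" for t
    using that by auto
  have M0: "M \<ge> 0" using M[of 0] by simp
  have "cmod (cN B s / cD \<alpha> B s) \<le> 2 * M / (Im s)\<^sup>2" if s: "0 \<le> Re s" "Re s \<le> 1" "\<bar>Im s\<bar> \<ge> 1" for s
  proof -
    have g1: "cmod (Gamma (of_real B + 1 + s)) \<le> Gamma (B + 1 + Re s)"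
      using cmod_Gamma_le [of "B + 1 + Re s" "Im s"] B s by (simp add: complex_eq_iff flip: complex_surj)
         (metis (no_types, lifting) complex.sel complex_eqI one_complex.sel plus_complex.sel Re_complex_of_real Im_complex_of_real add_0)
    have g2: "cmod (Gamma (of_real B + 2 - s)) \<le> Gamma (B + 2 - Re s)"
    proof -
      have "of_real B + 2 - s = Complex (B + 2 - Re s) (- Im s)" by (simp add: complex_eq_iff)
      thus ?thesis using cmod_Gamma_le [of "B + 2 - Re s" "- Im s"] B s by simp
    qed
    define u where "u = 2 * pi * Im s"
    have imu: "Im (of_real (2 * pi) * s) = u" by (simp add: u_def)
    have "6 * 1 \<le> 2 * pi * \<bar>Im s\<bar>" using pi_gt3 s by (intro mult_mono) auto
    hence u: "\<bar>u\<bar> \<ge> 6" by (simp add: u_def abs_mult)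
    have den: "cmod (of_real (cos (2 * pi * \<alpha>)) - cos (of_real (2 * pi) * s)) \<ge> cosh u / 2"
    proof -
      define p q where "p = exp (- \<bar>u\<bar>)" and "q = exp \<bar>u\<bar>"
      \<comment> \<open>The claim below amounts to \<open>q \<ge> 3 * p + 4\<close>, which is just
        what \<open>q \<ge> 7\<close> and \<open>p \<le> 1\<close> yield.\<close>
      have "q \<ge> 7" using exp_ge_add_one_self [of "\<bar>u\<bar>"] u unfolding q_def by linarith
      moreover have "p \<le> 1" by (simp add: p_def)
      ultimately have "sinh \<bar>u\<bar> - 1 \<ge> cosh \<bar>u\<bar> / 2"
        unfolding sinh_field_def cosh_field_def p_def [symmetric] q_def [symmetric] by (simp add: field_simps)
      moreover have "cmod (of_real (cos (2 * pi * \<alpha>)) :: complex) \<le> 1" by (simp only: norm_of_real abs_cos_le_one)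
      moreover have "cmod (cos (of_real (2 * pi) * s)) \<ge> sinh \<bar>u\<bar>"
        using norm_sin_cos_bounds(2) [of "of_real (2 * pi) * s"] unfolding imu .
      moreover have "cmod (cos (of_real (2 * pi) * s)) - cmod (of_real (cos (2 * pi * \<alpha>)) :: complex)
         \<le> cmod (of_real (cos (2 * pi * \<alpha>)) - cos (of_real (2 * pi) * s))"
        by (metis norm_minus_commute norm_triangle_ineq2)
      ultimately show ?thesis by (simp only: cosh_real_abs)
    qed
    have a: "cmod (of_real B + s) \<ge> \<bar>Im s\<bar>" "cmod (of_real B + 1 - s) \<ge> \<bar>Im s\<bar>"
      using abs_Im_le_cmod [of "of_real B + s"] abs_Im_le_cmod [of "of_real B + 1 - s"] by simp_all
    have "cmod (cN B s) \<le> (Gamma (B + 1 + Re s) * Gamma (B + 2 - Re s)) * cosh u"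
    proof -
      have "cmod (sin (of_real (2 * pi) * s)) \<le> cosh u"
        using norm_sin_cos_bounds(1) [of "of_real (2 * pi) * s"] unfolding imu .
      moreover have "Gamma (B + 1 + Re s) > 0" "Gamma (B + 2 - Re s) > 0"
        using B s by (auto intro!: Gamma_real_pos)
      ultimately show ?thesis
        unfolding cN_def norm_mult using g1 g2 by (intro mult_mono) auto
    qed
    also have "\<dots> \<le> M * cosh u"
      using M [OF s(1,2)] by (intro mult_right_mono) auto
    finally have num: "cmod (cN B s) \<le> M * cosh u" .
    have "\<bar>Im s\<bar> * \<bar>Im s\<bar> * (cosh u / 2) \<le> cmod (cD \<alpha> B s)"
      unfolding cD_def norm_mult using a den by (intro mult_mono) auto
    hence den': "(Im s)\<^sup>2 * (cosh u / 2) \<le> cmod (cD \<alpha> B s)" by (simp add: power2_eq_square)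
    have "cmod (cN B s / cD \<alpha> B s) \<le> (M * cosh u) / ((Im s)\<^sup>2 * (cosh u / 2))"
    proof -
      have "(Im s)\<^sup>2 * (cosh u / 2) > 0" using s by (intro mult_pos_pos) auto
      thus ?thesis
        unfolding norm_divide using num M0 den' by (intro frac_le) auto
    qed
    also have "\<dots> = 2 * M / (Im s)\<^sup>2" by (simp add: field_simps less_imp_neq [OF cosh_real_pos, symmetric])
    finally show ?thesis .
  qed
  thus ?thesis using M0 by (intro exI [of _ "2 * M"]) auto
qed

lemma cD_deriv:
  "(cD \<alpha> B has_field_derivative
     ((of_real B + 1 - s) - (of_real B + s)) * (of_real (cos (2 * pi * \<alpha>)) - cos (of_real (2 * pi) * s))
     + (of_real B + s) * (of_real B + 1 - s) * (of_real (2 * pi) * sin (of_real (2 * pi) * s))) (at s)"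
  unfolding cD_def by (rule derivative_eq_intros refl | simp add: algebra_simps)+

lemma cos_eq_real_iff:
  fixes s :: complex
  shows "cos (of_real (2 * pi) * s) = of_real (cos (2 * pi * \<alpha>)) \<longleftrightarrow>
    (\<exists>n\<in>\<int>. s = of_real (\<alpha> + n) \<or> s = of_real (n - \<alpha>))"
proof -
  have "cos (of_real (2 * pi) * s) = of_real (cos (2 * pi * \<alpha>)) \<longleftrightarrow> cos (of_real (2 * pi) * s) = cos (of_real (2 * pi) * of_real \<alpha>)"
    by (metis cos_of_real of_real_mult)
  also have "\<dots> \<longleftrightarrow> (\<exists>n\<in>\<int>. of_real (2 * pi) * s = of_real (2 * pi) * of_real (\<alpha> + n) \<or> of_real (2 * pi) * s = of_real (2 * pi) * of_real (n - \<alpha>))"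
    unfolding complex_cos_eq by (intro bex_cong refl arg_cong2 [where f = "(\<or>)"]) (auto simp: algebra_simps)
  also have "\<dots> \<longleftrightarrow> (\<exists>n\<in>\<int>. s = of_real (\<alpha> + n) \<or> s = of_real (n - \<alpha>))"
    by (intro bex_cong refl) (simp only: mult_cancel_left, simp)
  finally show ?thesis .
qed

text \<open>Equal to \<open>- 2 pi\<close> times the residue of \<open>cN / cD\<close> at
  \<open>- B\<close>, and likewise at \<open>1 + B\<close>; these poles lie inside the strip only
  for \<open>B < 0\<close>.\<close>

definition atom0 :: "real \<Rightarrow> real \<Rightarrow> real" where
  "atom0 \<alpha> B = (if B < 0 then - 2 * pi * Gamma (2 * B + 1) * sin (2 * pi * B) / (cos (2 * pi * B) - cos (2 * pi * \<alpha>)) else 0)"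

text \<open>The hypotheses place \<open>- B\<close> strictly between 0 and both \<alpha> and
  \<open>1 - \<alpha>\<close>, so it is congruent to neither \<alpha> nor \<open>- \<alpha>\<close>
  modulo 1. Hence the poles from the Gamma factors stay apart from those of the trigonometric
  quotient.\<close>

lemma cos_neq:
  assumes "B < 0" "\<alpha> + B > 0" "1 - \<alpha> + B > 0"
  shows "cos (2 * pi * \<alpha>) \<noteq> cos (2 * pi * B)"
proof
  assume "cos (2 * pi * \<alpha>) = cos (2 * pi * B)"
  hence "cos (of_real (2 * pi) * of_real (- B)) = (of_real (cos (2 * pi * \<alpha>)) :: complex)"
    by (simp only: of_real_mult [symmetric] cos_of_real of_real_eq_iff) simp
  then obtain n where "n \<in> \<int>" "complex_of_real (- B) = of_real (\<alpha> + n) \<or> complex_of_real (- B) = of_real (n - \<alpha>)"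
    unfolding cos_eq_real_iff by blast
  then obtain m :: int where "- B = \<alpha> + of_int m \<or> - B = of_int m - \<alpha>"
    unfolding of_real_eq_iff by (auto elim!: Ints_cases)
  thus False
  proof
    assume "- B = \<alpha> + of_int m"
    hence "- 1 < real_of_int m" "real_of_int m < 0" using assms by linarith+
    hence "- 1 < m" "m < 0" by simp_all
    thus False by linarith
  next
    assume "- B = of_int m - \<alpha>"
    hence "0 < real_of_int m" "real_of_int m < 1" using assms by linarith+
    hence "0 < m" "m < 1" by simp_all
    thus False by linarith
  qed
qed

text \<open>Since \<open>\<alpha> \<noteq> 1/2\<close> separates \<alpha> from
  \<open>1 - \<alpha>\<close> and \<open>B \<noteq> 0\<close> keeps \<open>- B\<close> and
  \<open>1 + B\<close> off the contour, all poles are simple. The residues at \<alpha> and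
  \<open>1 - \<alpha>\<close> agree, and so do those at \<open>- B\<close> and \<open>1 + B\<close>.
  Continuity on the boundary is recorded because the integral is later split into its four
  sides.\<close>

lemma contour_rectangle:
  assumes \<alpha>: "0 < \<alpha>" "\<alpha> < 1" "\<alpha> \<noteq> 1 / 2" and B: "B > - 1 / 2" "B \<noteq> 0" "\<alpha> + B > 0" "1 - \<alpha> + B > 0"
    and T: "T > 0"
  defines "f \<equiv> \<lambda>s. cN B s / cD \<alpha> B s"
  shows "contour_integral (rectpath (Complex 0 (- T)) (Complex 1 T)) f
           = 2 * \<i> * of_real (Gamma (B + \<alpha>) * Gamma (B + 1 - \<alpha>) - atom0 \<alpha> B)"
    and "\<And>s. s \<in> path_image (rectpath (Complex 0 (- T)) (Complex 1 T)) \<Longrightarrow> isCont f s"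
proof -
  \<comment> \<open>Widening the strip by \<delta> admits no new zero of \<open>cD\<close>: \<delta>
    is less than \<alpha> and \<open>1 - \<alpha>\<close>, which keeps the other integer translates
    of \<alpha> and \<open>- \<alpha>\<close> out, and less than \<open>|B|\<close>, which keeps
    \<open>- B\<close> and \<open>1 + B\<close> out for positive \<open>B\<close>.\<close>
  define \<delta> where "\<delta> = min (min \<alpha> (1 - \<alpha>)) (\<bar>B\<bar>) / 2"
  have \<delta>: "\<delta> > 0" "\<delta> < \<alpha>" "\<delta> < 1 - \<alpha>" "\<delta> < \<bar>B\<bar>" "\<delta> < 1 / 2"
    using \<alpha> B by (auto simp: \<delta>_def min_def)
  define S where "S = {s. - \<delta> < Re s \<and> Re s < 1 + \<delta>}"
  define Z where "Z = complex_of_real ` ({\<alpha>, 1 - \<alpha>} \<union> (if B < 0 then {- B, 1 + B} else {}))"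
  have "open S" unfolding S_def by (intro open_Collect_conj open_halfspace_Re_gt open_halfspace_Re_lt)
  have "convex S" unfolding S_def Collect_conj_eq
    by (intro convex_Int convex_halfspace_Re_gt convex_halfspace_Re_lt)
  hence "connected S" by (rule convex_connected)
  have "finite Z" by (simp add: Z_def)
  have ZS: "Z \<subseteq> S" using \<alpha> B \<delta> by (auto simp: Z_def S_def)
  have Zbox: "Z \<subseteq> box (Complex 0 (- T)) (Complex 1 T)"
    using \<alpha> B T by (auto simp: Z_def in_box_complex_iff split: if_splits)
  have sinB: "sin (2 * pi * B) \<noteq> 0" if "B < 0"
  proof -
    have "2 * pi * (- 1 / 2) < 2 * pi * B" "2 * pi * B < 0"
      using B that by (intro mult_strict_left_mono mult_pos_neg; simp)+
    hence "sin (- (2 * pi * B)) > 0" by (intro sin_gt_zero) auto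
    thus ?thesis by simp
  qed
  have sin\<alpha>: "sin (2 * pi * \<alpha>) \<noteq> 0"
  proof (cases "\<alpha> < 1 / 2")
    case True
    thus ?thesis using sin_gt_zero [of "2 * pi * \<alpha>"] \<alpha> by auto
  next
    case False
    hence "sin (2 * pi * \<alpha> - pi) > 0" using \<alpha> by (intro sin_gt_zero) auto
    thus ?thesis by (simp add: sin_diff)
  qed
  have zeros: "s \<in> Z" if s: "s \<in> S" and z: "cD \<alpha> B s = 0" for s
  proof -
    from z consider "s = of_real (- B)" | "s = of_real (B + 1)" | "cos (of_real (2 * pi) * s) = of_real (cos (2 * pi * \<alpha>))"
    proof -
      have "of_real B + s = 0 \<or> of_real B + 1 - s = 0 \<or> of_real (cos (2 * pi * \<alpha>)) - cos (of_real (2 * pi) * s) = 0"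
        using z by (simp only: cD_def mult_eq_0_iff disj_assoc)
      thus ?thesis
      proof (elim disjE)
        assume "of_real B + s = 0"
        hence "s = of_real (- B)" by (simp add: add_eq_0_iff)
        thus thesis by (rule that(1))
      next
        assume "of_real B + 1 - s = 0"
        hence "s = of_real (B + 1)" by simp
        thus thesis by (rule that(2))
      next
        assume "of_real (cos (2 * pi * \<alpha>)) - cos (of_real (2 * pi) * s) = 0"
        hence "of_real (cos (2 * pi * \<alpha>)) = cos (of_real (2 * pi) * s)" by (simp only: right_minus_eq)
        thus thesis by (rule that(3) [OF sym])
      qed
    qed
    thus ?thesis
    proof cases
      case 3
      then obtain n where "n \<in> \<int>" and "s = of_real (\<alpha> + n) \<or> s = of_real (n - \<alpha>)"
        unfolding cos_eq_real_iff by blast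
      moreover then obtain m :: int where "n = of_int m" by (auto elim!: Ints_cases)
      ultimately have "s = of_real (\<alpha> + of_int m) \<or> s = of_real (of_int m - \<alpha>)" by simp
      thus ?thesis
      proof
        assume m: "s = of_real (\<alpha> + of_int m)"
        hence "- 1 < real_of_int m" "real_of_int m < 1" using s \<delta> \<alpha> by (auto simp: S_def)
        hence "m = 0" by linarith
        thus ?thesis using m by (simp add: Z_def)
      next
        assume m: "s = of_real (of_int m - \<alpha>)"
        hence "0 < real_of_int m" "real_of_int m < 2" using s \<delta> \<alpha> by (auto simp: S_def)
        hence "m = 1" by linarith
        thus ?thesis using m by (simp add: Z_def)
      qed
    qed (use s \<delta> B in \<open>auto simp: Z_def S_def\<close>)
  qed
  have N_hol: "cN B holomorphic_on S"
    unfolding cN_def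
    by (intro holomorphic_intros) (use B \<delta> in \<open>auto simp: S_def elim!: nonpos_Ints_cases dest!: arg_cong [where f = Re]\<close>)
  have D_hol: "cD \<alpha> B holomorphic_on S"
    unfolding cD_def by (intro holomorphic_intros)
  have f_hol: "f holomorphic_on S - Z"
    unfolding f_def using zeros N_hol D_hol by (intro holomorphic_on_divide) (auto intro: holomorphic_on_subset)
  have path: "path_image (rectpath (Complex 0 (- T)) (Complex 1 T)) \<subseteq> S - Z"
  proof -
    have "path_image (rectpath (Complex 0 (- T)) (Complex 1 T)) \<subseteq> cbox (Complex 0 (- T)) (Complex 1 T)"
      using T by (intro path_image_rectpath_subset_cbox) auto
    also have "\<dots> \<subseteq> S" using \<delta> by (auto simp: S_def in_cbox_complex_iff)
    finally show ?thesis
      using path_image_rectpath_inter_box [of "Complex 0 (- T)" "Complex 1 T"] T Zbox by auto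
  qed
  show "isCont f s" if "s \<in> path_image (rectpath (Complex 0 (- T)) (Complex 1 T))" for s
  proof -
    have "open (S - Z)" using \<open>open S\<close> \<open>finite Z\<close> by (intro open_Diff finite_imp_closed)
    thus ?thesis
      using holomorphic_on_imp_continuous_on [OF f_hol] path that
      by (auto simp: continuous_on_eq_continuous_at)
  qed
  have res: "residue f p = cN B p / d"
    if "p \<in> S" "cN B p \<noteq> 0" "cD \<alpha> B p = 0" "d \<noteq> 0"
      and "((of_real B + 1 - p) - (of_real B + p)) * (of_real (cos (2 * pi * \<alpha>)) - cos (of_real (2 * pi) * p))
     + (of_real B + p) * (of_real B + 1 - p) * (of_real (2 * pi) * sin (of_real (2 * pi) * p)) = d" for p d
    unfolding f_def using that cD_deriv [of \<alpha> B p]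
    by (intro residue_simple_pole_deriv [OF N_hol D_hol \<open>open S\<close> \<open>connected S\<close>]) auto
  have real: "cN B (of_real t) = of_real (Gamma (B + 1 + t) * Gamma (B + 2 - t) * sin (2 * pi * t))"
    "cD \<alpha> B (of_real t) = of_real ((B + t) * (B + 1 - t) * (cos (2 * pi * \<alpha>) - cos (2 * pi * t)))" for t
  proof -
    show "cN B (of_real t) = of_real (Gamma (B + 1 + t) * Gamma (B + 2 - t) * sin (2 * pi * t))"
      unfolding cN_def of_real_mult [symmetric] sin_of_real
      by (simp flip: Gamma_complex_of_real)
    show "cD \<alpha> B (of_real t) = of_real ((B + t) * (B + 1 - t) * (cos (2 * pi * \<alpha>) - cos (2 * pi * t)))"
      unfolding cD_def of_real_mult [symmetric] cos_of_real by simp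
  qed
  have real_res: "residue f (of_real t) = of_real (Gamma (B + 1 + t) * Gamma (B + 2 - t) * sin (2 * pi * t) / d)"
    if "of_real t \<in> Z" "sin (2 * pi * t) \<noteq> 0" "(B + t) * (B + 1 - t) * (cos (2 * pi * \<alpha>) - cos (2 * pi * t)) = 0" "d \<noteq> 0"
      "((B + 1 - t) - (B + t)) * (cos (2 * pi * \<alpha>) - cos (2 * pi * t))
        + (B + t) * (B + 1 - t) * (2 * pi * sin (2 * pi * t)) = d" for t d
  proof -
    have t: "0 < t" "t < 1" using that(1) Zbox by (auto simp: in_box_complex_iff)
    have "Gamma (B + 1 + t) > 0" "Gamma (B + 2 - t) > 0" using B t by (auto intro!: Gamma_real_pos)
    hence "cN B (of_real t) \<noteq> 0" using that(2) by (simp add: real)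
    moreover have "((of_real B + 1 - of_real t) - (of_real B + of_real t)) * (of_real (cos (2 * pi * \<alpha>)) - cos (of_real (2 * pi) * of_real t))
        + (of_real B + of_real t) * (of_real B + 1 - of_real t) * (of_real (2 * pi) * sin (of_real (2 * pi) * of_real t)) = (of_real d :: complex)"
      unfolding of_real_mult [symmetric] cos_of_real sin_of_real that(5) [symmetric] by simp
    moreover have "of_real t \<in> S" using that(1) ZS by blast
    moreover have "cD \<alpha> B (of_real t) = 0" by (simp only: real that(3) of_real_0)
    moreover have "complex_of_real d \<noteq> 0" using that(4) by simp
    ultimately have "residue f (of_real t) = cN B (of_real t) / of_real d"
      by (intro res)
    thus ?thesis by (simp add: real)
  qed
  define R where "R = Gamma (B + \<alpha>) * Gamma (B + 1 - \<alpha>) / (2 * pi)"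
  have pos: "B + \<alpha> > 0" "B + 1 - \<alpha> > 0" using B by auto
  have gam: "Gamma (B + 1 + \<alpha>) = (B + \<alpha>) * Gamma (B + \<alpha>)" "Gamma (B + 2 - \<alpha>) = (B + 1 - \<alpha>) * Gamma (B + 1 - \<alpha>)"
    using Gamma_plus1_pos [OF pos(1)] Gamma_plus1_pos [OF pos(2)] by (simp_all add: algebra_simps)
  have r1: "residue f (of_real \<alpha>) = of_real R"
    using pos sin\<alpha> by (subst real_res [OF _ _ _ _ refl]) (auto simp: Z_def gam R_def)
  have s1: "sin (2 * pi * (1 - \<alpha>)) = - sin (2 * pi * \<alpha>)" "cos (2 * pi * (1 - \<alpha>)) = cos (2 * pi * \<alpha>)"
    by (simp_all add: right_diff_distrib sin_diff cos_diff)
  have r2: "residue f (of_real (1 - \<alpha>)) = of_real R"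
  proof -
    have "Gamma (B + 1 + (1 - \<alpha>)) = (B + 1 - \<alpha>) * Gamma (B + 1 - \<alpha>)" "Gamma (B + 2 - (1 - \<alpha>)) = (B + \<alpha>) * Gamma (B + \<alpha>)"
      using gam by (simp_all add: algebra_simps)
    moreover define d where "d = (B + 1 - \<alpha>) * (B + \<alpha>) * (2 * pi * - sin (2 * pi * \<alpha>))"
    have "residue f (of_real (1 - \<alpha>))
        = of_real (Gamma (B + 1 + (1 - \<alpha>)) * Gamma (B + 2 - (1 - \<alpha>)) * sin (2 * pi * (1 - \<alpha>)) / d)"
    proof (rule real_res)
      show "of_real (1 - \<alpha>) \<in> Z" by (simp add: Z_def)
      show "d \<noteq> 0" using pos sin\<alpha> by (simp add: d_def)
      show "(B + 1 - (1 - \<alpha>) - (B + (1 - \<alpha>))) * (cos (2 * pi * \<alpha>) - cos (2 * pi * (1 - \<alpha>))) +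
        (B + (1 - \<alpha>)) * (B + 1 - (1 - \<alpha>)) * (2 * pi * sin (2 * pi * (1 - \<alpha>))) = d"
        unfolding s1 d_def by (simp add: add_diff_eq)
    qed (use sin\<alpha> in \<open>simp_all add: s1\<close>)
    moreover have "((B + 1 - \<alpha>) * Gamma (B + 1 - \<alpha>)) * ((B + \<alpha>) * Gamma (B + \<alpha>)) * sin (2 * pi * (1 - \<alpha>)) / d = R"
      using pos sin\<alpha> by (simp add: s1 d_def R_def)
    ultimately show ?thesis by simp
  qed
  have "contour_integral (rectpath (Complex 0 (- T)) (Complex 1 T)) f
      = 2 * pi * \<i> * (\<Sum>p\<in>Z. winding_number (rectpath (Complex 0 (- T)) (Complex 1 T)) p * residue f p)"
  proof (rule Residue_theorem [OF \<open>open S\<close> \<open>connected S\<close> \<open>finite Z\<close> f_hol valid_path_rectpath _ path])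
    show "\<forall>z. z \<notin> S \<longrightarrow> winding_number (rectpath (Complex 0 (- T)) (Complex 1 T)) z = 0"
      using path by (intro allI impI winding_number_zero_outside [OF _ \<open>convex S\<close>]) auto
  qed simp
  also have "(\<Sum>p\<in>Z. winding_number (rectpath (Complex 0 (- T)) (Complex 1 T)) p * residue f p) = (\<Sum>p\<in>Z. residue f p)"
    using Zbox by (intro sum.cong refl) (auto simp: winding_number_rectpath)
  also have "\<dots> = of_real (2 * R - atom0 \<alpha> B / pi)"
  proof (cases "B < 0")
    case False
    have "(\<Sum>p\<in>Z. residue f p) = residue f (of_real \<alpha>) + residue f (of_real (1 - \<alpha>))"
      using False \<alpha> by (simp add: Z_def del: of_real_diff)
    thus ?thesis using False by (simp only: r1 r2 atom0_def) simp
  next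
    case True
    define d where "d = (2 * B + 1) * (cos (2 * pi * \<alpha>) - cos (2 * pi * B))"
    have "cos (2 * pi * \<alpha>) \<noteq> cos (2 * pi * B)"
      using \<alpha> B True by (intro cos_neq) auto
    hence d: "d \<noteq> 0" using B by (simp add: d_def)
    have g: "Gamma (2 * B + 2) = (2 * B + 1) * Gamma (2 * B + 1)"
      using Gamma_plus1_pos [of "2 * B + 1"] B by (simp add: add.assoc)
    have sB: "sin (2 * pi * (1 + B)) = sin (2 * pi * B)" "cos (2 * pi * (1 + B)) = cos (2 * pi * B)"
      by (simp_all add: distrib_left sin_add cos_add)
    have r3: "residue f (of_real (- B)) = of_real (- (Gamma (2 * B + 2) * sin (2 * pi * B)) / d)"
    proof -
      have "residue f (of_real (- B)) = of_real (Gamma (B + 1 + - B) * Gamma (B + 2 - - B) * sin (2 * pi * - B) / d)"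
        using True d sinB by (intro real_res) (auto simp: Z_def d_def)
      thus ?thesis by (simp add: add_ac)
    qed
    have r4: "residue f (of_real (1 + B)) = of_real (- (Gamma (2 * B + 2) * sin (2 * pi * B)) / d)"
    proof -
      have "residue f (of_real (1 + B)) = of_real (Gamma (B + 1 + (1 + B)) * Gamma (B + 2 - (1 + B)) * sin (2 * pi * (1 + B)) / (- d))"
      proof (rule real_res)
        show "of_real (1 + B) \<in> Z" using True by (simp add: Z_def)
        show "(B + 1 - (1 + B) - (B + (1 + B))) * (cos (2 * pi * \<alpha>) - cos (2 * pi * (1 + B))) +
          (B + (1 + B)) * (B + 1 - (1 + B)) * (2 * pi * sin (2 * pi * (1 + B))) = - d"
          unfolding sB d_def by (simp add: algebra_simps)
      qed (use d sinB True in \<open>simp_all add: sB\<close>)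
      moreover have "B + 1 + (1 + B) = 2 * B + 2" "B + 2 - (1 + B) = 1" by simp_all
      ultimately show ?thesis by (simp only: sB) simp
    qed
    have "distinct [\<alpha>, 1 - \<alpha>, - B, 1 + B]" using \<alpha> B True by auto
    hence "(\<Sum>p\<in>Z. residue f p) = residue f (of_real \<alpha>) + residue f (of_real (1 - \<alpha>))
        + residue f (of_real (- B)) + residue f (of_real (1 + B))"
      using True by (simp add: Z_def del: of_real_diff of_real_minus of_real_add add: sum.reindex)
    also have "\<dots> = of_real (2 * R - 2 * (Gamma (2 * B + 2) * sin (2 * pi * B)) / d)"
      unfolding r1 r2 r3 r4 by (simp add: algebra_simps)
    also have "2 * (Gamma (2 * B + 2) * sin (2 * pi * B)) / d = atom0 \<alpha> B / pi"
      using True d B by (simp add: atom0_def g d_def divide_simps) (simp add: algebra_simps)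
    finally show ?thesis .
  qed
  also have "2 * pi * \<i> * of_real (2 * R - atom0 \<alpha> B / pi) = 2 * \<i> * of_real (Gamma (B + \<alpha>) * Gamma (B + 1 - \<alpha>) - atom0 \<alpha> B)"
    by (simp add: R_def complex_eq_iff field_simps)
  finally show "contour_integral (rectpath (Complex 0 (- T)) (Complex 1 T)) f
           = 2 * \<i> * of_real (Gamma (B + \<alpha>) * Gamma (B + 1 - \<alpha>) - atom0 \<alpha> B)" .
qed


section \<open>From the rectangle to the integral over the half line\<close>

lemma wt_continuous: "continuous_on (- {0}) (wt \<alpha> B)"
proof -
  have "Complex B x \<notin> \<int>\<^sub>\<le>\<^sub>0" if "x \<noteq> 0" for x
    using that by (auto elim!: nonpos_Ints_cases simp: complex_eq_iff)
  moreover have "isCont (\<lambda>x. Complex B x) x" for x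
    unfolding Complex_eq by (intro continuous_intros)
  moreover have "cosh (2 * pi * x) - cos (2 * pi * \<alpha>) \<noteq> 0" if "x \<noteq> 0" for x
    using kap_denom_pos [OF that, of \<alpha>] by simp
  ultimately show ?thesis
    unfolding wt_def kap_def
    by (intro continuous_at_imp_continuous_on ballI continuous_intros) auto
qed

lemma wt_measurable [measurable]: "wt \<alpha> B \<in> borel_measurable borel"
proof (rule borel_measurable_continuous_countable_exceptions [of "{0}"])
  show "continuous_on (- {0}) (wt \<alpha> B)" by (rule wt_continuous)
qed simp

lemma half_line_integral_iff:
  fixes f :: "real \<Rightarrow> 'a :: {banach, second_countable_topology}"
  shows "integrable half_line f \<longleftrightarrow> set_integrable lborel {0<..} f"
    and "integral\<^sup>L half_line f = set_lebesgue_integral lborel {0<..} f"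
  unfolding half_line_def by (simp_all add: integrable_restrict_space set_integrable_def
      integral_restrict_space set_lebesgue_integral_def)

lemma half_line_exp_bound_integrable:
  fixes f :: "real \<Rightarrow> 'a :: {banach, second_countable_topology}"
  assumes "c > 0" and f: "f \<in> borel_measurable half_line" and bound: "\<And>x. x > 0 \<Longrightarrow> norm (f x) \<le> C * exp (- c * x)"
  shows "integrable half_line f"
proof -
  have "(\<lambda>x. exp (- c * x) :: real) absolutely_integrable_on {0..}"
    using \<open>c > 0\<close> by (intro nonnegative_absolutely_integrable_1 integrable_on_exp_minus_to_infinity) auto
  hence "set_integrable lborel {0..} (\<lambda>x. exp (- c * x) :: real)"
    unfolding set_integrable_def by (subst (asm) integrable_completion) auto
  hence "set_integrable lborel {0<..} (\<lambda>x. exp (- c * x) :: real)"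
    by (rule set_integrable_subset) auto
  hence "integrable half_line (\<lambda>x. C * exp (- c * x))"
    unfolding half_line_integral_iff(1) [symmetric] by simp
  thus ?thesis
    using f
  proof (rule Bochner_Integration.integrable_bound)
    show "AE x in half_line. norm (f x) \<le> norm (C * exp (- c * x))"
      using bound by (intro AE_I2) (auto simp: half_line_def space_restrict_space intro: order_trans [OF _ abs_ge_self])
  qed
qed

lemma half_line_measurable [measurable (raw)]: "f \<in> borel_measurable borel \<Longrightarrow> f \<in> borel_measurable half_line"
  unfolding half_line_def by (intro measurable_restrict_space1) simp

lemma half_line_integral_limit:
  fixes f :: "real \<Rightarrow> real"
  assumes f: "integrable half_line f"
  shows "(\<lambda>n. integral {0..real n} f) \<longlonglongrightarrow> (\<integral>x. f x \<partial>half_line)"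
proof -
  have "(\<lambda>n. \<integral>x. indicator {..real n} x * f x \<partial>half_line) \<longlonglongrightarrow> (\<integral>x. f x \<partial>half_line)"
  proof (rule integral_dominated_convergence)
    show "integrable half_line (\<lambda>x. norm (f x))" using f by simp
    show "f \<in> borel_measurable half_line" using f by simp
    show "(\<lambda>x. indicator {..real n} x * f x) \<in> borel_measurable half_line" for n
      by (intro borel_measurable_times borel_measurable_integrable [OF f] half_line_measurable) auto
    show "AE x in half_line. (\<lambda>n. indicator {..real n} x * f x) \<longlonglongrightarrow> f x"
    proof (intro AE_I2 tendsto_eventually)
      fix x :: real
      show "\<forall>\<^sub>F n in sequentially. indicator {..real n} x * f x = f x"
        using eventually_ge_at_top [of "nat \<lceil>x\<rceil>"]
        by eventually_elim (auto simp: indicator_def nat_le_iff ceiling_le_iff)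
    qed
    show "AE x in half_line. norm (indicator {..real n} x * f x) \<le> norm (f x)" for n
      by (intro AE_I2) (auto simp: indicator_def)
  qed
  moreover have "(\<integral>x. indicator {..real n} x * f x \<partial>half_line) = integral {0..real n} f" for n
  proof -
    have "(\<integral>x. indicator {..real n} x * f x \<partial>half_line) = set_lebesgue_integral lborel {0<..real n} f"
      unfolding half_line_integral_iff set_lebesgue_integral_def
      by (intro Bochner_Integration.integral_cong) (auto simp: indicator_def)
    also have "\<dots> = integral {0<..real n} f"
    proof (rule set_borel_integral_eq_integral)
      show "set_integrable lborel {0<..real n} f"
        using f unfolding half_line_integral_iff by (rule set_integrable_subset) auto
    qed
    also have "\<dots> = integral {0..real n} f"
      by (rule integral_spike_set) (auto intro: negligible_subset [of "{0}"])
    finally show ?thesis .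
  qed
  ultimately show ?thesis by simp
qed

text \<open>On the vertical sides the integrand differs by the weight, which is even, so together
  they give \<open>2 i\<close> times its integral over \<open>{0..T}\<close>. The horizontal sides
  are of order \<open>1 / T^2\<close>.\<close>

lemma wt_integral_generic:
  assumes \<alpha>: "0 < \<alpha>" "\<alpha> < 1" "\<alpha> \<noteq> 1 / 2" and B: "B > - 1 / 2" "B \<noteq> 0" "\<alpha> + B > 0" "1 - \<alpha> + B > 0"
  shows "(\<integral>x. wt \<alpha> B x \<partial>half_line) = Gamma (B + \<alpha>) * Gamma (B + 1 - \<alpha>) - atom0 \<alpha> B"
proof -
  define f where "f = (\<lambda>s. cN B s / cD \<alpha> B s)"
  define R where "R = Gamma (B + \<alpha>) * Gamma (B + 1 - \<alpha>) - atom0 \<alpha> B"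
  obtain M where M: "\<And>s. 0 \<le> Re s \<Longrightarrow> Re s \<le> 1 \<Longrightarrow> \<bar>Im s\<bar> \<ge> 1 \<Longrightarrow> cmod (f s) \<le> M / (Im s)\<^sup>2" and M0: "M \<ge> 0"
    using contour_integrand_bound [of B \<alpha>] B unfolding f_def by fastforce
  obtain C where "\<And>x. x > 0 \<Longrightarrow> wt \<alpha> B x \<le> C * exp (- 2 * x)"
    using wt_exp_bound [of B \<alpha>] B by auto
  hence int: "integrable half_line (wt \<alpha> B)"
    using wt_pos by (intro half_line_exp_bound_integrable [of 2]) (auto simp: less_imp_le)
  have est: "\<bar>2 * integral {0..T} (wt \<alpha> B) - 2 * R\<bar> \<le> 2 * (M / T\<^sup>2)" if T: "T \<ge> 1" for T
  proof -
    define a1 a2 a3 a4 where "a1 = Complex 0 (- T)" and "a2 = Complex 1 (- T)" and "a3 = Complex 1 T" and "a4 = Complex 0 T"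
    have rp: "rectpath a1 a3 = linepath a1 a2 +++ linepath a2 a3 +++ linepath a3 a4 +++ linepath a4 a1"
      by (simp add: rectpath_def a1_def a2_def a3_def a4_def Let_def)
    have "path_image (rectpath a1 a3) = closed_segment a1 a2 \<union> closed_segment a2 a3 \<union> closed_segment a3 a4 \<union> closed_segment a4 a1"
      by (simp add: rp path_image_join Un_assoc)
    hence cont: "continuous_on (closed_segment a1 a2) f" "continuous_on (closed_segment a2 a3) f"
      "continuous_on (closed_segment a3 a4) f" "continuous_on (closed_segment a4 a1) f"
      using contour_rectangle(2) [OF \<alpha> B, of T] T unfolding f_def a1_def a3_def
      by (auto intro!: continuous_at_imp_continuous_on)
    note ci = cont [THEN contour_integrable_continuous_linepath]
    have "contour_integral (rectpath a1 a3) f = contour_integral (linepath a1 a2) f + contour_integral (linepath a2 a3) f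
        + contour_integral (linepath a3 a4) f + contour_integral (linepath a4 a1) f"
      unfolding rp using ci by (simp add: add_ac)
    also have "contour_integral (linepath a2 a3) f = \<i> * integral {- T..T} (\<lambda>y. f (Complex 1 y))"
      using T by (intro contour_integral_linepath_same_Re) (auto simp: a2_def a3_def)
    also have "contour_integral (linepath a4 a1) f = - contour_integral (linepath a1 a4) f"
      using contour_integral_reversepath [of "linepath a1 a4" f] by simp
    also have "contour_integral (linepath a1 a4) f = \<i> * integral {- T..T} (\<lambda>y. f (Complex 0 y))"
      using T by (intro contour_integral_linepath_same_Re) (auto simp: a1_def a4_def)
    finally have eq: "\<i> * (integral {- T..T} (\<lambda>y. f (Complex 1 y)) - integral {- T..T} (\<lambda>y. f (Complex 0 y)))
        = 2 * \<i> * of_real R - contour_integral (linepath a1 a2) f - contour_integral (linepath a3 a4) f"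
      using contour_rectangle(1) [OF \<alpha> B, of T] T
      by (simp add: a1_def a3_def f_def R_def algebra_simps)
    have seg: "Complex 1 ` {- T..T} \<subseteq> closed_segment a2 a3" "Complex 0 ` {- T..T} \<subseteq> closed_segment a4 a1"
      using T by (auto simp: a1_def a2_def a3_def a4_def closed_segment_same_Re closed_segment_eq_real_ivl)
    have cC: "continuous_on {- T..T} (Complex u)" for u
      unfolding Complex_eq [abs_def] by (intro continuous_intros)
    have c1: "continuous_on {- T..T} (\<lambda>y. f (Complex 1 y))"
      using continuous_on_compose2 [OF cont(2) cC seg(1)] .
    have c0: "continuous_on {- T..T} (\<lambda>y. f (Complex 0 y))"
      using continuous_on_compose2 [OF cont(4) cC seg(2)] .
    have shift: "f (Complex 1 y) - f (Complex 0 y) = of_real (wt \<alpha> B y)" for y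
      unfolding f_def using B by (intro contour_integrand_shift) auto
    have "continuous_on {- T..T} (\<lambda>y. f (Complex 1 y) - f (Complex 0 y))"
      by (intro continuous_intros c0 c1)
    from continuous_on_Re [OF this] have cw: "continuous_on {- T..T} (wt \<alpha> B)" by (simp add: shift)
    have "integral {- T..T} (\<lambda>y. f (Complex 1 y)) - integral {- T..T} (\<lambda>y. f (Complex 0 y))
        = integral {- T..T} (\<lambda>y. of_real (wt \<alpha> B y))"
      using c0 c1 unfolding shift [symmetric]
      by (intro Henstock_Kurzweil_Integration.integral_diff [symmetric] integrable_continuous_real)
    also have "\<dots> = of_real (integral {- T..T} (wt \<alpha> B))"
      using integral_linear [OF integrable_continuous_real [OF cw] bounded_linear_of_real] by (simp add: o_def)
    also have "integral {- T..T} (wt \<alpha> B) = integral {- T..0} (wt \<alpha> B) + integral {0..T} (wt \<alpha> B)"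
      using T by (intro Henstock_Kurzweil_Integration.integral_combine [symmetric] integrable_continuous_real cw) auto
    also have "integral {- T..0} (wt \<alpha> B) = integral {0..T} (wt \<alpha> B)"
      using Henstock_Kurzweil_Integration.integral_reflect_real [of T 0 "wt \<alpha> B"] by (simp add: wt_minus)
    finally have "\<i> * of_real (2 * integral {0..T} (wt \<alpha> B) - 2 * R)
        = - contour_integral (linepath a1 a2) f - contour_integral (linepath a3 a4) f"
      using eq by (simp add: algebra_simps)
    hence "\<bar>2 * integral {0..T} (wt \<alpha> B) - 2 * R\<bar>
        = cmod (- contour_integral (linepath a1 a2) f - contour_integral (linepath a3 a4) f)"
      by (metis norm_ii norm_mult norm_of_real mult_1)
    also have "\<dots> \<le> cmod (contour_integral (linepath a1 a2) f) + cmod (contour_integral (linepath a3 a4) f)"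
      by (metis norm_minus_cancel norm_triangle_ineq4)
    also have "cmod (contour_integral (linepath a1 a2) f) \<le> M / T\<^sup>2 * cmod (a2 - a1)"
    proof (intro contour_integral_bound_linepath ci)
      show "cmod (f s) \<le> M / T\<^sup>2" if "s \<in> closed_segment a1 a2" for s
        using that M [of s] T by (auto simp: a1_def a2_def closed_segment_same_Im closed_segment_eq_real_ivl)
    qed (use M0 in simp)
    also have "cmod (contour_integral (linepath a3 a4) f) \<le> M / T\<^sup>2 * cmod (a4 - a3)"
    proof (intro contour_integral_bound_linepath ci)
      show "cmod (f s) \<le> M / T\<^sup>2" if "s \<in> closed_segment a3 a4" for s
        using that M [of s] T by (auto simp: a3_def a4_def closed_segment_same_Im closed_segment_eq_real_ivl)
    qed (use M0 in simp)
    also have "cmod (a2 - a1) = 1" by (simp add: a1_def a2_def cmod_def)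
    also have "cmod (a4 - a3) = 1" by (simp add: a3_def a4_def cmod_def)
    finally show ?thesis by simp
  qed
  have "(\<lambda>n. 2 * integral {0..real n} (wt \<alpha> B) - 2 * R) \<longlonglongrightarrow> 0"
  proof (rule Lim_null_comparison)
    show "\<forall>\<^sub>F n in sequentially. norm (2 * integral {0..real n} (wt \<alpha> B) - 2 * R) \<le> 2 * (M / (real n)\<^sup>2)"
      using eventually_ge_at_top [of 1] by eventually_elim (use est in simp)
    show "(\<lambda>n. 2 * (M / (real n)\<^sup>2)) \<longlonglongrightarrow> 0"
      by (intro tendsto_mult_right_zero tendsto_divide_0 [OF tendsto_const] filterlim_at_top_imp_at_infinity
           filterlim_pow_at_top filterlim_real_sequentially) auto
  qed
  moreover have "(\<lambda>n. 2 * integral {0..real n} (wt \<alpha> B) - 2 * R) \<longlonglongrightarrow> 2 * (\<integral>x. wt \<alpha> B x \<partial>half_line) - 2 * R"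
    by (intro tendsto_intros half_line_integral_limit int)
  ultimately show ?thesis
    using LIMSEQ_unique unfolding R_def by fastforce
qed

lemma kap_tendsto:
  assumes "x > 0" "a \<longlonglongrightarrow> \<alpha>"
  shows "(\<lambda>n. kap (a n) x) \<longlonglongrightarrow> kap \<alpha> x"
  unfolding kap_def using kap_denom_pos [of x \<alpha>] assms by (intro tendsto_intros) auto

lemma half_line_AE: "(\<And>x. x > 0 \<Longrightarrow> P x) \<Longrightarrow> AE x in half_line. P x"
  by (intro AE_I2) (simp add: half_line_def space_restrict_space)

lemma tendsto_Gamma_real:
  fixes b :: "nat \<Rightarrow> real"
  assumes "b \<longlonglongrightarrow> \<beta>" "\<beta> > 0"
  shows "(\<lambda>n. Gamma (b n)) \<longlonglongrightarrow> Gamma \<beta>"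
  using assms by (intro isCont_tendsto_compose [OF isCont_Gamma]) (auto elim!: nonpos_Ints_cases)

text \<open>At \<open>\<alpha> = 0\<close> poles lie on the contour, at
  \<open>\<alpha> = 1/2\<close> two of them coincide. Both values are limits of generic ones, with a
  dominating function independent of \<alpha>.\<close>

lemma wt_integral_nonzero:
  assumes \<alpha>: "0 \<le> \<alpha>" "\<alpha> < 1" and B: "B > - 1 / 2" "B \<noteq> 0" "\<alpha> + B > 0" "1 - \<alpha> + B > 0"
  shows "(\<integral>x. wt \<alpha> B x \<partial>half_line) = Gamma (B + \<alpha>) * Gamma (B + 1 - \<alpha>) - atom0 \<alpha> B"
proof -
  \<comment> \<open>The sequence \<open>a\<close> approaches \<alpha> from the right; this distance
    keeps it below 1, below \<open>1 + B\<close>, and below \<open>1/2\<close> in case \<alpha>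
    is.\<close>
  define \<delta> where "\<delta> = min (min (1 - \<alpha>) (1 - \<alpha> + B)) (if \<alpha> < 1 / 2 then 1 / 2 - \<alpha> else 1)"
  define a where "a n = \<alpha> + \<delta> * (1 / (real n + 2))" for n
  have \<delta>: "\<delta> > 0" using \<alpha> B by (auto simp: \<delta>_def)
  have "0 < \<delta> * (1 / (real n + 2)) \<and> \<delta> * (1 / (real n + 2)) < \<delta>" for n
    using \<delta> mult_strict_left_mono [of "1 / (real n + 2)" 1 \<delta>] by simp
  hence a1: "\<alpha> < a n" "a n < \<alpha> + \<delta>" for n by (simp_all add: a_def)
  have a: "0 < a n" "a n < 1" "a n \<noteq> 1 / 2" "a n + B > 0" "1 - a n + B > 0" for n
    using a1[of n] \<alpha> B by (auto simp: \<delta>_def min_def split: if_splits)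
  have "(\<lambda>n. 1 / (real n + 2)) \<longlonglongrightarrow> 0"
    using LIMSEQ_Suc [OF LIMSEQ_Suc [OF lim_1_over_n [where ?'a = real]]] by (simp add: add_ac)
  hence lim: "a \<longlonglongrightarrow> \<alpha>"
    unfolding a_def [abs_def] using tendsto_add [OF tendsto_const tendsto_mult [OF tendsto_const]] by fastforce
  obtain C where "\<forall>x\<ge>0. (cmod (Gamma (Complex (B + 1) x)))\<^sup>2 \<le> C * exp (- 3 * x)"
    using cmod_Gamma_exp_bound [of "B + 1" 3] B pi_gt3 by auto
  hence C: "(cmod (Gamma (Complex (B + 1) x)))\<^sup>2 \<le> C * exp (- 3 * x)" if "x \<ge> 0" for x using that by blast
  have C0: "C \<ge> 0" using C[of 0] by (simp add: order_trans [OF zero_le_power2])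
  have GC: "(cmod (Gamma (Complex B x)))\<^sup>2 \<le> C / B\<^sup>2 * exp (- 3 * x)" if x: "x > 0" for x
  proof -
    have "B\<^sup>2 * (cmod (Gamma (Complex B x)))\<^sup>2 \<le> (B\<^sup>2 + x\<^sup>2) * (cmod (Gamma (Complex B x)))\<^sup>2"
      by (intro mult_right_mono) auto
    also have "\<dots> \<le> C * exp (- 3 * x)"
      using C[of x] x by (simp add: cmod_Gamma_Complex_plus1)
    finally show ?thesis using B by (simp add: field_simps)
  qed
  have wt_bound: "wt \<beta> B x \<le> 2 * C / B\<^sup>2 * exp (- 2 * x)" if x: "x > 0" for x \<beta>
  proof -
    have xk: "x * kap \<beta> x \<le> exp x"
      using kap_le [OF x, of \<beta>] exp_ge_add_one_self [of x] by linarith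
    have "wt \<beta> B x = 2 * (x * kap \<beta> x) * (cmod (Gamma (Complex B x)))\<^sup>2" by (simp add: wt_def)
    also have "\<dots> \<le> 2 * exp x * (C / B\<^sup>2 * exp (- 3 * x))"
      using xk kap_pos [OF x, of \<beta>] GC [OF x] x C0
      by (intro mult_mono mult_left_mono) (auto intro: mult_nonneg_nonneg)
    also have "\<dots> = 2 * C / B\<^sup>2 * exp (- 2 * x)" by (simp add: mult_ac flip: exp_add)
    finally show ?thesis .
  qed
  have "(\<lambda>n. \<integral>x. wt (a n) B x \<partial>half_line) \<longlonglongrightarrow> (\<integral>x. wt \<alpha> B x \<partial>half_line)"
  proof (rule integral_dominated_convergence)
    show "integrable half_line (\<lambda>x. 2 * C / B\<^sup>2 * exp (- 2 * x))"
      using C0 by (intro half_line_exp_bound_integrable [of 2 _ "2 * C / B\<^sup>2"]) auto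
    show "AE x in half_line. (\<lambda>n. wt (a n) B x) \<longlonglongrightarrow> wt \<alpha> B x"
      unfolding wt_def by (intro half_line_AE tendsto_intros kap_tendsto lim)
    show "AE x in half_line. norm (wt (a n) B x) \<le> 2 * C / B\<^sup>2 * exp (- 2 * x)" for n
      using wt_bound wt_pos by (intro half_line_AE) (auto simp: less_imp_le)
  qed simp_all
  moreover have "(\<lambda>n. \<integral>x. wt (a n) B x \<partial>half_line) = (\<lambda>n. Gamma (B + a n) * Gamma (B + 1 - a n) - atom0 (a n) B)"
    using a B by (intro ext wt_integral_generic)
  moreover have "(\<lambda>n. Gamma (B + a n) * Gamma (B + 1 - a n) - atom0 (a n) B)
      \<longlonglongrightarrow> Gamma (B + \<alpha>) * Gamma (B + 1 - \<alpha>) - atom0 \<alpha> B"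
  proof (intro tendsto_diff tendsto_mult tendsto_Gamma_real tendsto_intros lim)
    show "(\<lambda>n. atom0 (a n) B) \<longlonglongrightarrow> atom0 \<alpha> B"
      using cos_neq [of B \<alpha>] B unfolding atom0_def
      by (cases "B < 0") (auto intro!: tendsto_intros lim)
  qed (use B in auto)
  ultimately show ?thesis using LIMSEQ_unique by metis
qed

text \<open>At \<open>B = 0\<close> the poles \<open>- B\<close> and \<open>1 + B\<close> lie on the
  contour. Positive \<open>b n\<close> tending to 0 carry no atom. Raising \<open>b n\<close> by one
  and using the linear bound on \<open>kap\<close> removes the singularity at \<open>x = 0\<close>
  uniformly in \<open>n\<close>.\<close>

lemma wt_integral_zero:
  assumes \<alpha>: "0 < \<alpha>" "\<alpha> < 1"
  shows "(\<integral>x. wt \<alpha> 0 x \<partial>half_line) = Gamma \<alpha> * Gamma (1 - \<alpha>)"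
proof -
  define b where "b n = 1 / real (Suc n)" for n
  have b: "0 < b n" "b n \<le> 1" for n by (simp_all add: b_def)
  have lim: "b \<longlonglongrightarrow> 0" unfolding b_def [abs_def] by (rule LIMSEQ_Suc [OF lim_1_over_n])
  have "cos (2 * pi * \<alpha>) < 1"
  proof -
    have "cos (2 * pi * \<alpha>) \<noteq> 1"
    proof
      assume "cos (2 * pi * \<alpha>) = 1"
      then obtain m :: int where "2 * pi * \<alpha> = of_int m * 2 * pi" by (auto simp: cos_one_2pi_int)
      hence "\<alpha> = of_int m" by simp
      thus False using \<alpha> by simp
    qed
    thus ?thesis using cos_le_one [of "2 * pi * \<alpha>"] by linarith
  qed
  then obtain E where E: "E > 0" "\<And>x. x > 0 \<Longrightarrow> kap \<alpha> x \<le> E * x"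
    using kap_le_linear [of \<alpha>] by blast
  obtain C where "\<forall>x\<ge>0. (cmod (Gamma (Complex 2 x)))\<^sup>2 \<le> C * exp (- 2 * x)"
    using cmod_Gamma_exp_bound [of 2 2] pi_gt3 by auto
  hence C: "(cmod (Gamma (Complex 2 x)))\<^sup>2 \<le> C * exp (- 2 * x)" if "x \<ge> 0" for x using that by blast
  have "(\<lambda>n. Gamma (b n + 1)) \<longlonglongrightarrow> Gamma (0 + 1)"
    by (intro tendsto_Gamma_real tendsto_intros lim) simp
  hence "Bseq (\<lambda>n. Gamma (b n + 1))" by (intro convergent_imp_Bseq convergentI)
  then obtain G where G: "G > 0" "\<And>n. \<bar>Gamma (b n + 1)\<bar> \<le> G" by (auto elim!: BseqE)
  have bound: "wt \<alpha> (b n) x \<le> 2 * E * G\<^sup>2 * C * exp (- 2 * x)" if x: "x > 0" for n x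
  proof -
    have "wt \<alpha> (b n) x = 2 * (x * kap \<alpha> x / ((b n)\<^sup>2 + x\<^sup>2)) * (cmod (Gamma (Complex (b n + 1) x)))\<^sup>2"
      using x by (simp add: wt_def cmod_Gamma_Complex_plus1 sum_power2_eq_zero_iff)
    also have "\<dots> \<le> 2 * E * (G\<^sup>2 * (C * exp (- 2 * x)))"
    proof (intro mult_mono mult_left_mono)
      have "x * kap \<alpha> x \<le> E * x\<^sup>2"
        using E(2) [OF x] x by (simp add: power2_eq_square mult.left_commute)
      also have "\<dots> \<le> E * ((b n)\<^sup>2 + x\<^sup>2)" using E by (intro mult_left_mono) auto
      finally show "x * kap \<alpha> x / ((b n)\<^sup>2 + x\<^sup>2) \<le> E"
        using x by (subst pos_divide_le_eq) (auto simp: add_nonneg_pos)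
      have "cmod (Gamma (Complex (b n + 1) x)) \<le> Gamma (b n + 1) * cmod (Gamma (Complex 2 x))"
        using cmod_Gamma_mono [of "b n + 1" 2 x] b[of n] Gamma_fact [of 1, where ?'a = real] by (simp add: mult.commute)
      also have "\<dots> \<le> G * cmod (Gamma (Complex 2 x))"
        using G(2) [of n] by (intro mult_right_mono) auto
      finally have "(cmod (Gamma (Complex (b n + 1) x)))\<^sup>2 \<le> (G * cmod (Gamma (Complex 2 x)))\<^sup>2"
        by (intro power_mono) auto
      also have "\<dots> \<le> G\<^sup>2 * (C * exp (- 2 * x))"
        unfolding power_mult_distrib using C[of x] x by (intro mult_left_mono) auto
      finally show "(cmod (Gamma (Complex (b n + 1) x)))\<^sup>2 \<le> G\<^sup>2 * (C * exp (- 2 * x))" .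
    qed (use E kap_pos [OF x, of \<alpha>] x in auto)
    finally show ?thesis by (simp add: mult_ac)
  qed
  have "(\<lambda>n. \<integral>x. wt \<alpha> (b n) x \<partial>half_line) \<longlonglongrightarrow> (\<integral>x. wt \<alpha> 0 x \<partial>half_line)"
  proof (rule integral_dominated_convergence)
    have "C \<ge> 0" using C[of 0] by (simp add: order_trans [OF zero_le_power2])
    hence "0 \<le> 2 * E * G\<^sup>2 * C" using E by simp
    thus "integrable half_line (\<lambda>x. 2 * E * G\<^sup>2 * C * exp (- 2 * x))"
      by (intro half_line_exp_bound_integrable [of 2]) auto
    show "AE x in half_line. (\<lambda>n. wt \<alpha> (b n) x) \<longlonglongrightarrow> wt \<alpha> 0 x"
    proof (rule half_line_AE)
      fix x :: real assume x: "x > 0"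
      have "(\<lambda>n. Complex (b n) x) \<longlonglongrightarrow> Complex 0 x" by (intro tendsto_Complex lim tendsto_const)
      moreover have "Complex 0 x \<notin> \<int>\<^sub>\<le>\<^sub>0" using x by (auto elim!: nonpos_Ints_cases simp: complex_eq_iff)
      ultimately have g: "(\<lambda>n. Gamma (Complex (b n) x)) \<longlonglongrightarrow> Gamma (Complex 0 x)"
        by (intro isCont_tendsto_compose [OF isCont_Gamma]) auto
      show "(\<lambda>n. wt \<alpha> (b n) x) \<longlonglongrightarrow> wt \<alpha> 0 x"
        unfolding wt_def by (intro tendsto_mult tendsto_const tendsto_power tendsto_norm g)
    qed
    show "AE x in half_line. norm (wt \<alpha> (b n) x) \<le> 2 * E * G\<^sup>2 * C * exp (- 2 * x)" for n
      using bound wt_pos by (intro half_line_AE) (auto simp: less_imp_le)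
  qed simp_all
  moreover have "(\<integral>x. wt \<alpha> (b n) x \<partial>half_line) = Gamma (b n + \<alpha>) * Gamma (b n + 1 - \<alpha>)" for n
    using wt_integral_nonzero [of \<alpha> "b n"] b[of n] \<alpha> by (simp add: atom0_def)
  moreover have "(\<lambda>n. Gamma (b n + \<alpha>) * Gamma (b n + 1 - \<alpha>)) \<longlonglongrightarrow> Gamma (0 + \<alpha>) * Gamma (0 + 1 - \<alpha>)"
    using \<alpha> by (intro tendsto_mult tendsto_Gamma_real tendsto_intros lim) auto
  ultimately show ?thesis using LIMSEQ_unique by fastforce
qed

lemma wt_integral:
  assumes "0 \<le> \<alpha>" "\<alpha> < 1" "B > - 1 / 2" "\<alpha> + B > 0" "1 - \<alpha> + B > 0"
  shows "(\<integral>x. wt \<alpha> B x \<partial>half_line) = Gamma (B + \<alpha>) * Gamma (B + 1 - \<alpha>) - atom0 \<alpha> B"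
  using assms wt_integral_nonzero [of \<alpha> B] wt_integral_zero [of \<alpha>]
  by (cases "B = 0") (auto simp: atom0_def)

section \<open>Determinacy of the moment problem\<close>

lemma power_le_exp_bound:
  assumes "s > 0"
  shows "\<exists>C\<ge>0. \<forall>x\<ge>0::real. x ^ n \<le> C * exp (s * x)"
proof -
  obtain C where C: "\<forall>x\<ge>0. \<bar>poly (monom 1 n) x\<bar> * exp (- s * x) \<le> C"
    using poly_exp_bounded [of s "monom 1 n"] assms by auto
  from C have "\<bar>poly (monom 1 n) 0\<bar> * exp (- s * 0) \<le> C" by blast
  hence "C \<ge> 0" by (rule order_trans [rotated]) simp
  moreover have "x ^ n \<le> C * exp (s * x)" if "x \<ge> 0" for x
    using C that by (auto simp: poly_monom exp_minus field_simps)
  ultimately show ?thesis by blast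
qed

text \<open>The power series of \<open>iexp (h * x)\<close> reduces the integral at
  \<open>t + h\<close> to moments at \<open>t\<close>. Half of the exponential weight pays for the
  series and half for \<open>x ^ n\<close>, so the admissible step depends neither on
  \<open>n\<close> nor on \<open>t\<close>.\<close>

lemma exp_moments_shift:
  fixes g :: "real \<Rightarrow> real"
  assumes [measurable]: "g \<in> borel_measurable borel" and \<delta>: "\<delta> > 0"
    and int: "integrable lborel (\<lambda>x. exp (\<delta> * \<bar>x\<bar>) * \<bar>g x\<bar>)"
    and zero: "\<And>n. (\<integral>x. (\<i> * of_real x) ^ n * (iexp (t * x) * of_real (g x)) \<partial>lborel) = 0"
    and h: "\<bar>h\<bar> \<le> \<delta> / 2"
  shows "(\<integral>x. (\<i> * of_real x) ^ n * (iexp ((t + h) * x) * of_real (g x)) \<partial>lborel) = 0"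
proof -
  obtain C where C0: "C \<ge> 0" and C': "\<forall>x\<ge>0. x ^ n \<le> C * exp (\<delta> / 2 * x)"
    using power_le_exp_bound [of "\<delta> / 2" n] \<delta> by auto
  have C: "x ^ n * exp (- (\<delta> / 2) * x) \<le> C" if "x \<ge> 0" for x
  proof -
    have "x ^ n * exp (- (\<delta> / 2) * x) \<le> C * exp (\<delta> / 2 * x) * exp (- (\<delta> / 2) * x)"
      using that C' by (intro mult_right_mono) auto
    also have "\<dots> = C" by (simp add: mult.assoc flip: exp_add)
    finally show ?thesis .
  qed
  define f where "f k x = of_real h ^ k / fact k * ((\<i> * of_real x) ^ (n + k) * (iexp (t * x) * of_real (g x)))" for k and x :: real
  have f_eq: "f k x = (\<i> * of_real x) ^ n * (iexp (t * x) * of_real (g x)) * ((\<i> * of_real (h * x)) ^ k / fact k)" for k x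
    by (simp add: f_def power_add power_mult_distrib)
  have f_norm: "cmod (f k x) = \<bar>x\<bar> ^ n * \<bar>g x\<bar> * (\<bar>h * x\<bar> ^ k / fact k)" for k x
    unfolding f_eq by (simp add: norm_mult norm_power norm_divide power_mult_distrib abs_mult)
  have bound: "(\<Sum>k<K. cmod (f k x)) \<le> C * (exp (\<delta> * \<bar>x\<bar>) * \<bar>g x\<bar>)" for K x
  proof -
    have "(\<Sum>k<K. \<bar>h * x\<bar> ^ k / fact k) \<le> exp \<bar>h * x\<bar>"
      unfolding exp_def using summable_exp_generic [of "\<bar>h * x\<bar>"]
      by (intro order_trans [OF eq_refl sum_le_suminf]) (auto simp: divide_inverse mult.commute)
    also have "\<dots> \<le> exp (\<delta> / 2 * \<bar>x\<bar>)"
      using mult_right_mono [OF h, of "\<bar>x\<bar>"] by (simp add: abs_mult)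
    finally have e: "(\<Sum>k<K. \<bar>h * x\<bar> ^ k / fact k) \<le> exp (\<delta> / 2 * \<bar>x\<bar>)" .
    have "(\<Sum>k<K. cmod (f k x)) = \<bar>x\<bar> ^ n * \<bar>g x\<bar> * (\<Sum>k<K. \<bar>h * x\<bar> ^ k / fact k)"
      by (simp add: f_norm sum_distrib_left)
    also have "\<dots> \<le> \<bar>x\<bar> ^ n * \<bar>g x\<bar> * exp (\<delta> / 2 * \<bar>x\<bar>)"
      using e by (intro mult_left_mono) auto
    also have "\<dots> = (\<bar>x\<bar> ^ n * exp (- (\<delta> / 2) * \<bar>x\<bar>)) * (exp (\<delta> * \<bar>x\<bar>) * \<bar>g x\<bar>)"
      by (simp add: mult_ac flip: exp_add)
    also have "\<dots> \<le> C * (exp (\<delta> * \<bar>x\<bar>) * \<bar>g x\<bar>)"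
      by (intro mult_right_mono C) auto
    finally show ?thesis .
  qed
  have [measurable]: "f k \<in> borel_measurable borel" for k unfolding f_def by measurable
  have f_int: "integrable lborel (f k)" for k
  proof (rule Bochner_Integration.integrable_bound)
    show "integrable lborel (\<lambda>x. C * (exp (\<delta> * \<bar>x\<bar>) * \<bar>g x\<bar>))" using int by simp
    have "cmod (f k x) \<le> (\<Sum>k<Suc k. cmod (f k x))" for x
      by (simp add: sum_nonneg)
    thus "AE x in lborel. cmod (f k x) \<le> norm (C * (exp (\<delta> * \<bar>x\<bar>) * \<bar>g x\<bar>))"
      using bound [of _ "Suc k"] by (intro AE_I2) (smt (verit) abs_ge_self real_norm_def)
  qed simp
  have "(\<lambda>K. \<integral>x. (\<Sum>k<K. f k x) \<partial>lborel) \<longlonglongrightarrow>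
      (\<integral>x. (\<i> * of_real x) ^ n * (iexp ((t + h) * x) * of_real (g x)) \<partial>lborel)"
  proof (rule integral_dominated_convergence)
    show "integrable lborel (\<lambda>x. C * (exp (\<delta> * \<bar>x\<bar>) * \<bar>g x\<bar>))" using int by simp
    show "AE x in lborel. (\<lambda>K. \<Sum>k<K. f k x) \<longlonglongrightarrow> (\<i> * of_real x) ^ n * (iexp ((t + h) * x) * of_real (g x))"
    proof (rule AE_I2)
      fix x :: real
      have "(\<lambda>k. (\<i> * of_real (h * x)) ^ k / fact k) sums iexp (h * x)"
        using exp_converges [of "\<i> * of_real (h * x)"] by (simp add: scaleR_conv_of_real divide_inverse mult.commute)
      hence "(\<lambda>k. f k x) sums ((\<i> * of_real x) ^ n * (iexp (t * x) * of_real (g x)) * iexp (h * x))"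
        unfolding f_eq by (rule sums_mult)
      also have "(\<i> * of_real x) ^ n * (iexp (t * x) * of_real (g x)) * iexp (h * x)
          = (\<i> * of_real x) ^ n * (iexp ((t + h) * x) * of_real (g x))"
        by (simp add: algebra_simps flip: exp_add)
      finally show "(\<lambda>K. \<Sum>k<K. f k x) \<longlonglongrightarrow> (\<i> * of_real x) ^ n * (iexp ((t + h) * x) * of_real (g x))"
        by (simp add: sums_def)
    qed
    show "AE x in lborel. norm (\<Sum>k<K. f k x) \<le> C * (exp (\<delta> * \<bar>x\<bar>) * \<bar>g x\<bar>)" for K
      by (intro AE_I2 order_trans [OF norm_sum bound])
  qed simp_all
  moreover have "(\<integral>x. (\<Sum>k<K. f k x) \<partial>lborel) = 0" for K
  proof -
    have "(\<integral>x. f k x \<partial>lborel) = 0" for k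
      unfolding f_def by (simp only: integral_mult_right_zero zero mult_zero_right)
    thus ?thesis using f_int by simp
  qed
  ultimately show ?thesis using LIMSEQ_unique [OF _ tendsto_const] by fastforce
qed

text \<open>Finitely many steps from 0 reach any \<open>t\<close>, so the Fourier transform
  vanishes. The positive and negative parts have equal mass by the moment of order 0; normalised to
  probability distributions they have the same characteristic function.\<close>

lemma exp_moments_zero:
  fixes g :: "real \<Rightarrow> real"
  assumes [measurable]: "g \<in> borel_measurable borel" and \<delta>: "\<delta> > 0"
    and int: "integrable lborel (\<lambda>x. exp (\<delta> * \<bar>x\<bar>) * \<bar>g x\<bar>)"
    and zero: "\<And>n. (\<integral>x. x ^ n * g x \<partial>lborel) = 0"
  shows "AE x in lborel. g x = 0"
proof -
  have fourier: "(\<integral>x. iexp (t * x) * of_real (g x) \<partial>lborel) = 0" for t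
  proof -
    obtain N :: nat where N: "N > 0" "\<bar>t\<bar> / real N \<le> \<delta> / 2"
    proof -
      obtain N :: nat where "2 * \<bar>t\<bar> / \<delta> < real N" using reals_Archimedean2 by blast
      moreover have "0 \<le> 2 * \<bar>t\<bar> / \<delta>" using \<delta> by simp
      ultimately have N: "N > 0" by linarith
      moreover have "\<bar>t\<bar> / real N \<le> \<delta> / 2"
        using \<open>2 * \<bar>t\<bar> / \<delta> < real N\<close> N \<delta> by (simp add: field_simps)
      ultimately show ?thesis by (rule that)
    qed
    have "(\<integral>x. (\<i> * of_real x) ^ n * (iexp ((real m * (t / real N)) * x) * of_real (g x)) \<partial>lborel) = 0" for m n
    proof (induction m arbitrary: n)
      case 0
      have "(\<integral>x. (\<i> * of_real x) ^ n * of_real (g x) \<partial>lborel) = (\<integral>x. \<i> ^ n * of_real (x ^ n * g x) \<partial>lborel)"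
        by (intro Bochner_Integration.integral_cong) (auto simp: power_mult_distrib)
      also have "\<dots> = \<i> ^ n * of_real (\<integral>x. x ^ n * g x \<partial>lborel)"
        by (simp only: integral_mult_right_zero integral_complex_of_real)
      finally show ?case by (simp add: zero)
    next
      case (Suc m)
      have "(\<integral>x. (\<i> * of_real x) ^ n * (iexp ((real m * (t / real N) + t / real N) * x) * of_real (g x)) \<partial>lborel) = 0"
        using N by (intro exp_moments_shift [OF _ \<delta> int Suc.IH]) auto
      moreover have "real (Suc m) * (t / real N) = real m * (t / real N) + t / real N"
        by (simp add: distrib_right add_divide_distrib add.commute)
      ultimately show ?case by (simp only:)
    qed
    from this [of 0 N] N(1) show ?thesis by simp
  qed
  define p q where "p x = max (g x) 0" and "q x = max (- g x) 0" for x
  have [measurable]: "p \<in> borel_measurable borel" "q \<in> borel_measurable borel"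
    unfolding p_def q_def by measurable
  have pq: "g x = p x - q x" "p x \<ge> 0" "q x \<ge> 0" "\<bar>p x\<bar> \<le> \<bar>g x\<bar>" "\<bar>q x\<bar> \<le> \<bar>g x\<bar>" for x
    by (auto simp: p_def q_def)
  have gint: "integrable lborel g"
  proof (rule Bochner_Integration.integrable_bound [OF int])
    show "AE x in lborel. norm (g x) \<le> norm (exp (\<delta> * \<bar>x\<bar>) * \<bar>g x\<bar>)"
      using \<delta> by (intro AE_I2) (auto simp: abs_mult mult_le_cancel_right1)
  qed simp
  have int_p: "integrable lborel p" and int_q: "integrable lborel q"
    using pq(4,5) by (auto intro!: Bochner_Integration.integrable_bound [OF gint])
  define m where "m = (\<integral>x. p x \<partial>lborel)"
  have "(\<integral>x. p x \<partial>lborel) - (\<integral>x. q x \<partial>lborel) = (\<integral>x. g x \<partial>lborel)"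
    unfolding pq(1) using int_p int_q by simp
  hence mq: "(\<integral>x. q x \<partial>lborel) = m" using zero [of 0] by (simp add: m_def)
  show ?thesis
  proof (cases "m = 0")
    case True
    have "AE x in lborel. p x = 0" "AE x in lborel. q x = 0"
      using integral_nonneg_eq_0_iff_AE [OF int_p] integral_nonneg_eq_0_iff_AE [OF int_q] pq True mq
      by (auto simp: m_def)
    thus ?thesis by eventually_elim (simp add: pq(1))
  next
    case False
    hence m: "m > 0" using pq(2) Bochner_Integration.integral_nonneg [of lborel p] by (simp add: m_def less_le)
    have dist: "real_distribution (density lborel (\<lambda>x. ennreal (r x / m)))"
      if [measurable]: "r \<in> borel_measurable borel" and r: "\<And>x. r x \<ge> 0" "integrable lborel r" "(\<integral>x. r x \<partial>lborel) = m" for r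
    proof -
      have "(\<integral>\<^sup>+x. ennreal (r x / m) \<partial>lborel) = ennreal (\<integral>x. r x / m \<partial>lborel)"
        using r m by (intro nn_integral_eq_integral) auto
      also have "\<dots> = 1" using r m by simp
      finally have "prob_space (density lborel (\<lambda>x. ennreal (r x / m)))"
        by (intro prob_spaceI) (simp add: emeasure_density)
      thus ?thesis by (simp add: real_distribution_def real_distribution_axioms_def)
    qed
    have char: "char (density lborel (\<lambda>x. ennreal (r x / m))) t = (\<integral>x. iexp (t * x) * of_real (r x) \<partial>lborel) / of_real m"
      if [measurable]: "r \<in> borel_measurable borel" and r: "\<And>x. r x \<ge> 0" for r t
    proof -
      have "char (density lborel (\<lambda>x. ennreal (r x / m))) t = (\<integral>x. (r x / m) *\<^sub>R iexp (t * x) \<partial>lborel)"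
        unfolding char_def using r m by (intro integral_density) auto
      also have "\<dots> = (\<integral>x. iexp (t * x) * of_real (r x) / of_real m \<partial>lborel)"
        by (intro Bochner_Integration.integral_cong) (auto simp: scaleR_conv_of_real)
      finally show ?thesis by simp
    qed
    have intc: "integrable lborel (\<lambda>x. iexp (t * x) * of_real (r x))" if "integrable lborel r" for r and t :: real
      using that by (intro Bochner_Integration.integrable_bound [OF that]) (auto simp: norm_mult)
    have "(\<integral>x. iexp (t * x) * of_real (p x) \<partial>lborel) - (\<integral>x. iexp (t * x) * of_real (q x) \<partial>lborel)
        = (\<integral>x. iexp (t * x) * of_real (g x) \<partial>lborel)" for t
      using intc [OF int_p, of t] intc [OF int_q, of t] by (simp add: pq(1) right_diff_distrib)
    hence "char (density lborel (\<lambda>x. ennreal (p x / m))) = char (density lborel (\<lambda>x. ennreal (q x / m)))"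
      using pq fourier by (simp add: fun_eq_iff char)
    hence "density lborel (\<lambda>x. ennreal (p x / m)) = density lborel (\<lambda>x. ennreal (q x / m))"
      using pq int_p int_q mq by (intro Levy_uniqueness dist) (auto simp: m_def)
    hence "AE x in lborel. ennreal (p x / m) = ennreal (q x / m)"
      by (intro sigma_finite_measure.density_unique [OF sigma_finite_lborel]) auto
    thus ?thesis
      using pq m by (auto elim!: eventually_mono simp: pq(1))
  qed
qed

text \<open>The even extension has vanishing odd moments by symmetry, and its even moments are twice
  the given ones. So powers of \<open>x^2\<close> are enough on a half line.\<close>

lemma half_line_even_moments_zero_real:
  fixes f :: "real \<Rightarrow> real"
  assumes f: "f \<in> borel_measurable half_line" and \<delta>: "\<delta> > 0"
    and int: "integrable half_line (\<lambda>x. exp (\<delta> * x) * \<bar>f x\<bar>)"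
    and zero: "\<And>n. (\<integral>x. x ^ (2 * n) * f x \<partial>half_line) = 0"
  shows "AE x in half_line. f x = 0"
proof -
  define F where "F x = indicator {0<..} x * f x" for x :: real
  have [measurable]: "F \<in> borel_measurable borel"
    using f unfolding half_line_def F_def by (subst (asm) borel_measurable_restrict_space_iff) auto
  define g where "g x = F x + F (- x)" for x
  have [measurable]: "g \<in> borel_measurable borel" unfolding g_def by measurable
  have reflect: "integrable lborel (\<lambda>x. k (- x))" "(\<integral>x. k (- x) \<partial>lborel) = (\<integral>x. k x \<partial>lborel)"
    if "integrable lborel k" for k :: "real \<Rightarrow> real"
    using lborel_integrable_real_affine [OF that, of "-1" 0] lborel_integral_real_affine [of "-1" k 0] by simp_all
  have hl: "integrable half_line k \<longleftrightarrow> integrable lborel (\<lambda>x. indicator {0<..} x * k x)"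
    "(\<integral>x. k x \<partial>half_line) = (\<integral>x. indicator {0<..} x * k x \<partial>lborel)" for k :: "real \<Rightarrow> real"
    by (simp_all add: half_line_integral_iff set_integrable_def set_lebesgue_integral_def)
  have int_exp: "integrable lborel (\<lambda>x. exp (\<delta> * \<bar>x\<bar>) * \<bar>F x\<bar>)"
  proof -
    have "exp (\<delta> * \<bar>x\<bar>) * \<bar>F x\<bar> = indicator {0<..} x * (exp (\<delta> * x) * \<bar>f x\<bar>)" for x
      by (simp add: F_def indicator_def)
    thus ?thesis using int by (simp add: hl)
  qed
  have int_g: "integrable lborel (\<lambda>x. exp (\<delta> * \<bar>x\<bar>) * \<bar>g x\<bar>)"
  proof (rule Bochner_Integration.integrable_bound)
    show "integrable lborel (\<lambda>x. exp (\<delta> * \<bar>x\<bar>) * \<bar>F x\<bar> + exp (\<delta> * \<bar>x\<bar>) * \<bar>F (- x)\<bar>)"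
      using int_exp reflect(1) [OF int_exp] by simp
    show "AE x in lborel. norm (exp (\<delta> * \<bar>x\<bar>) * \<bar>g x\<bar>) \<le> norm (exp (\<delta> * \<bar>x\<bar>) * \<bar>F x\<bar> + exp (\<delta> * \<bar>x\<bar>) * \<bar>F (- x)\<bar>)"
      by (intro AE_I2) (auto simp: g_def abs_mult simp flip: distrib_left intro!: mult_left_mono)
  qed simp
  have "AE x in lborel. g x = 0"
  proof (rule exp_moments_zero [OF _ \<delta> int_g])
    fix n
    have int_n: "integrable lborel (\<lambda>x. x ^ n * F x)"
    proof -
      obtain C where C0: "C \<ge> 0" and C: "\<forall>x\<ge>0. x ^ n \<le> C * exp (\<delta> * x)"
        using power_le_exp_bound [of \<delta> n] \<delta> by auto
      show ?thesis
      proof (rule Bochner_Integration.integrable_bound)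
        show "integrable lborel (\<lambda>x. C * (exp (\<delta> * \<bar>x\<bar>) * \<bar>F x\<bar>))" using int_exp by simp
        show "AE x in lborel. norm (x ^ n * F x) \<le> norm (C * (exp (\<delta> * \<bar>x\<bar>) * \<bar>F x\<bar>))"
        proof (rule AE_I2)
          fix x :: real
          have "\<bar>x\<bar> ^ n * \<bar>F x\<bar> \<le> C * exp (\<delta> * \<bar>x\<bar>) * \<bar>F x\<bar>"
            using C by (intro mult_right_mono) auto
          thus "norm (x ^ n * F x) \<le> norm (C * (exp (\<delta> * \<bar>x\<bar>) * \<bar>F x\<bar>))"
            using C0 by (simp add: abs_mult power_abs mult.assoc)
        qed
      qed simp
    qed
    have "(\<integral>x. x ^ n * g x \<partial>lborel) = (\<integral>x. x ^ n * F x + (-1) ^ n * ((- x) ^ n * F (- x)) \<partial>lborel)"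
    proof (rule Bochner_Integration.integral_cong [OF refl])
      fix x :: real
      have "(-1) ^ n * (- x) ^ n = x ^ n" unfolding power_mult_distrib [symmetric] by simp
      thus "x ^ n * g x = x ^ n * F x + (-1) ^ n * ((- x) ^ n * F (- x))"
        by (simp only: g_def distrib_left mult.assoc [symmetric])
    qed
    also have "\<dots> = (1 + (-1) ^ n) * (\<integral>x. x ^ n * F x \<partial>lborel)"
      using int_n reflect [OF int_n] by (simp add: distrib_right)
    also have "\<dots> = 0"
    proof (cases "even n")
      case True
      then obtain k where n: "n = 2 * k" by (auto elim: evenE)
      have "(\<integral>x. x ^ n * F x \<partial>lborel) = (\<integral>x. x ^ (2 * k) * f x \<partial>half_line)"
        unfolding hl F_def n by (intro Bochner_Integration.integral_cong) auto
      thus ?thesis by (simp add: zero)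
    qed simp
    finally show "(\<integral>x. x ^ n * g x \<partial>lborel) = 0" .
  qed simp
  hence "AE x in lborel. x \<in> {0<..} \<longrightarrow> f x = 0"
    by eventually_elim (auto simp: g_def F_def)
  thus ?thesis
    unfolding half_line_def by (subst AE_restrict_space_iff) auto
qed

lemma half_line_even_moments_zero:
  fixes f :: "real \<Rightarrow> complex"
  assumes f: "f \<in> borel_measurable half_line" and \<delta>: "\<delta> > 0"
    and int: "integrable half_line (\<lambda>x. exp (\<delta> * x) * cmod (f x))"
    and zero: "\<And>n. (\<integral>x. of_real (x ^ (2 * n)) * f x \<partial>half_line) = 0"
  shows "AE x in half_line. f x = 0"
proof -
  have id [measurable]: "(\<lambda>x. x) \<in> borel_measurable half_line" by (rule half_line_measurable) simp
  have int_n: "integrable half_line (\<lambda>x. of_real (x ^ (2 * n)) * f x)" for n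
  proof -
    obtain C where C0: "C \<ge> 0" and C: "\<forall>x\<ge>0. x ^ (2 * n) \<le> C * exp (\<delta> * x)"
      using power_le_exp_bound [of \<delta> "2 * n"] \<delta> by auto
    show ?thesis
    proof (rule Bochner_Integration.integrable_bound)
      show "integrable half_line (\<lambda>x. C * (exp (\<delta> * x) * cmod (f x)))" using int by simp
      show "(\<lambda>x. of_real (x ^ (2 * n)) * f x) \<in> borel_measurable half_line" using f by measurable
      show "AE x in half_line. norm (of_real (x ^ (2 * n)) * f x) \<le> norm (C * (exp (\<delta> * x) * cmod (f x)))"
      proof (intro AE_I2)
        fix x assume "x \<in> space half_line"
        hence "x > 0" by (simp add: half_line_def space_restrict_space)
        hence "x ^ (2 * n) * cmod (f x) \<le> C * exp (\<delta> * x) * cmod (f x)"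
          using C by (intro mult_right_mono) auto
        thus "norm (of_real (x ^ (2 * n)) * f x) \<le> norm (C * (exp (\<delta> * x) * cmod (f x)))"
          using C0 by (simp only: norm_mult norm_of_real mult.assoc [symmetric]) (simp add: power_mult)
      qed
    qed
  qed
  have "(\<integral>x. x ^ (2 * n) * Re (f x) \<partial>half_line) = 0" "(\<integral>x. x ^ (2 * n) * Im (f x) \<partial>half_line) = 0" for n
    using arg_cong [OF zero [of n], of Re] arg_cong [OF zero [of n], of Im] integral_Re [OF int_n [of n]] integral_Im [OF int_n [of n]]
    by simp_all
  moreover have "integrable half_line (\<lambda>x. exp (\<delta> * x) * \<bar>Re (f x)\<bar>)" "integrable half_line (\<lambda>x. exp (\<delta> * x) * \<bar>Im (f x)\<bar>)"
    using f abs_Re_le_cmod abs_Im_le_cmod by (auto intro!: Bochner_Integration.integrable_bound [OF int] simp: abs_mult)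
  ultimately have "AE x in half_line. Re (f x) = 0" "AE x in half_line. Im (f x) = 0"
    using f by (auto intro!: half_line_even_moments_zero_real [OF _ \<delta>])
  thus ?thesis by eventually_elim (simp add: complex_eq_iff)
qed

section \<open>Hilbert spaces\<close>

lemma cnj_mult_self: "cnj z * z = of_real ((cmod z)\<^sup>2)" "z * cnj z = of_real ((cmod z)\<^sup>2)"
  using complex_norm_square [of z] by (simp_all add: mult.commute)

section \<open>Semi-inner product spaces of representatives\<close>

definition vdiff :: "'v hilb_rep \<Rightarrow> 'v \<Rightarrow> 'v \<Rightarrow> 'v" where
  "vdiff V v w = vplus V v (vscale V (-1) w)"

definition vnsq :: "'v hilb_rep \<Rightarrow> 'v \<Rightarrow> real" where
  "vnsq V v = Re (vinner V v v)"

text \<open>The elements are representatives, so no vector space axioms are imposed on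
  \<open>vplus\<close> and \<open>vscale\<close>. Everything is derived from the laws of the inner
  product, modulo vectors of norm zero.\<close>

locale semi_inner =
  fixes V :: "'v hilb_rep"
  assumes nonempty: "vecs V \<noteq> {}"
    and plus_closed: "v \<in> vecs V \<Longrightarrow> w \<in> vecs V \<Longrightarrow> vplus V v w \<in> vecs V"
    and scale_closed: "v \<in> vecs V \<Longrightarrow> vscale V c v \<in> vecs V"
    and inner_plus: "u \<in> vecs V \<Longrightarrow> v \<in> vecs V \<Longrightarrow> w \<in> vecs V \<Longrightarrow>
        vinner V u (vplus V v w) = vinner V u v + vinner V u w"
    and inner_scale: "u \<in> vecs V \<Longrightarrow> v \<in> vecs V \<Longrightarrow> vinner V u (vscale V c v) = c * vinner V u v"
    and inner_cnj: "u \<in> vecs V \<Longrightarrow> v \<in> vecs V \<Longrightarrow> vinner V v u = cnj (vinner V u v)"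
    and nsq_nonneg: "v \<in> vecs V \<Longrightarrow> vnsq V v \<ge> 0"

locale semi_hilbert = semi_inner V for V :: "'v hilb_rep" +
  assumes complete: "\<And>X :: nat \<Rightarrow> 'v. (\<And>n. X n \<in> vecs V) \<Longrightarrow>
      (\<And>e. e > 0 \<Longrightarrow> \<exists>N. \<forall>m\<ge>N. \<forall>n\<ge>N. vnsq V (vdiff V (X m) (X n)) < e) \<Longrightarrow>
      \<exists>x\<in>vecs V. (\<lambda>n. vnsq V (vdiff V (X n) x)) \<longlonglongrightarrow> 0"

context semi_inner
begin

lemma diff_closed: "v \<in> vecs V \<Longrightarrow> w \<in> vecs V \<Longrightarrow> vdiff V v w \<in> vecs V"
  by (simp add: vdiff_def plus_closed scale_closed)

lemma inner_plus_left: "u \<in> vecs V \<Longrightarrow> v \<in> vecs V \<Longrightarrow> w \<in> vecs V \<Longrightarrow>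
    vinner V (vplus V v w) u = vinner V v u + vinner V w u"
  using inner_cnj[of u "vplus V v w"] inner_cnj[of u v] inner_cnj[of u w]
  by (simp add: inner_plus plus_closed)

lemma inner_scale_left: "u \<in> vecs V \<Longrightarrow> v \<in> vecs V \<Longrightarrow> vinner V (vscale V c v) u = cnj c * vinner V v u"
  using inner_cnj[of u "vscale V c v"] inner_cnj[of u v]
  by (simp add: inner_scale scale_closed)

lemma inner_diff: "u \<in> vecs V \<Longrightarrow> v \<in> vecs V \<Longrightarrow> w \<in> vecs V \<Longrightarrow>
    vinner V u (vdiff V v w) = vinner V u v - vinner V u w"
  by (simp add: vdiff_def inner_plus inner_scale scale_closed)

lemma inner_diff_left: "u \<in> vecs V \<Longrightarrow> v \<in> vecs V \<Longrightarrow> w \<in> vecs V \<Longrightarrow>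
    vinner V (vdiff V v w) u = vinner V v u - vinner V w u"
  by (simp add: vdiff_def inner_plus_left inner_scale_left scale_closed)

lemma inner_self: "v \<in> vecs V \<Longrightarrow> vinner V v v = of_real (vnsq V v)"
  using arg_cong [OF inner_cnj [of v v], of Im] by (simp add: vnsq_def complex_eq_iff)

lemma nsq_diff:
  assumes "v \<in> vecs V" "w \<in> vecs V"
  shows "vnsq V (vdiff V v w) = vnsq V v + vnsq V w - 2 * Re (vinner V v w)"
proof -
  have "vinner V (vdiff V v w) (vdiff V v w) =
     vinner V v v - vinner V v w - (vinner V w v - vinner V w w)"
    using assms by (simp add: inner_diff inner_diff_left diff_closed)
  thus ?thesis
    using inner_cnj[OF assms] by (simp add: vnsq_def)
qed

lemma cauchy_schwarz:
  assumes v: "v \<in> vecs V" and w: "w \<in> vecs V"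
  shows "(cmod (vinner V v w))\<^sup>2 \<le> vnsq V v * vnsq V w"
proof -
  define z where "z = vinner V v w"
  have key: "0 \<le> vnsq V w + t\<^sup>2 * (cmod z)\<^sup>2 * vnsq V v - 2 * t * (cmod z)\<^sup>2" for t :: real
  proof -
    have "0 \<le> vnsq V (vdiff V w (vscale V (of_real t * z) v))"
      using v w by (intro nsq_nonneg diff_closed scale_closed)
    also have "\<dots> = vnsq V w + vnsq V (vscale V (of_real t * z) v)
        - 2 * Re (vinner V w (vscale V (of_real t * z) v))"
      using v w by (simp add: nsq_diff scale_closed)
    also have "vinner V w (vscale V (of_real t * z) v) = of_real (t * (cmod z)\<^sup>2)"
      using v w by (simp add: inner_scale inner_cnj[of v w] z_def [symmetric] cnj_mult_self mult.assoc)
    also have "vnsq V (vscale V (of_real t * z) v) = t\<^sup>2 * (cmod z)\<^sup>2 * vnsq V v"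
    proof -
      have "vinner V (vscale V (of_real t * z) v) (vscale V (of_real t * z) v)
         = of_real (t\<^sup>2) * (z * cnj z) * vinner V v v"
        using v by (simp add: inner_scale inner_scale_left scale_closed power2_eq_square mult_ac)
      also have "\<dots> = of_real (t\<^sup>2 * (cmod z)\<^sup>2 * vnsq V v)"
        using v by (simp add: inner_self complex_norm_square [symmetric])
      finally show ?thesis unfolding vnsq_def by simp
    qed
    finally show ?thesis by simp
  qed
  show ?thesis
  proof (cases "vnsq V v = 0")
    case True
    have "(cmod z)\<^sup>2 = 0"
    proof (rule ccontr)
      assume "(cmod z)\<^sup>2 \<noteq> 0"
      thus False
        \<comment> \<open>For \<open>vnsq V v = 0\<close> this choice of \<open>t\<close> makes the
          right-hand side of \<open>key\<close> equal to -1.\<close>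
        using key[of "(vnsq V w + 1) / (2 * (cmod z)\<^sup>2)"] True by (simp add: field_simps)
    qed
    thus ?thesis using True by (simp add: z_def)
  next
    case False
    hence pos: "vnsq V v > 0" using nsq_nonneg[OF v] by simp
    have "0 \<le> vnsq V w - (cmod z)\<^sup>2 / vnsq V v"
      using key[of "1 / vnsq V v"] pos by (simp add: power2_eq_square field_simps)
    thus ?thesis using pos by (simp add: z_def field_simps)
  qed
qed

lemma hilb_eq_iff: "hilb_eq V v w \<longleftrightarrow> v \<in> vecs V \<and> w \<in> vecs V \<and> vnsq V (vdiff V v w) = 0"
proof -
  have "(vinner V d d = 0) = (vnsq V d = 0)" if "d \<in> vecs V" for d
    using inner_self [OF that] by simp
  thus ?thesis
    unfolding hilb_eq_def Let_def vdiff_def [symmetric] using diff_closed by blast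
qed

text \<open>The signature has no zero vector; \<open>vscale V 0 (E 0)\<close> takes its
  place.\<close>

fun partial_comb :: "(nat \<Rightarrow> complex) \<Rightarrow> (nat \<Rightarrow> 'v) \<Rightarrow> nat \<Rightarrow> 'v" where
  "partial_comb c E 0 = vscale V 0 (E 0)"
| "partial_comb c E (Suc n) = vplus V (partial_comb c E n) (vscale V (c n) (E n))"

context
  fixes E :: "nat \<Rightarrow> 'v"
  assumes E: "\<And>i. E i \<in> vecs V"
    and orth: "\<And>i j. vinner V (E i) (E j) = (if i = j then 1 else 0)"
begin

lemma partial_comb_closed: "partial_comb c E n \<in> vecs V"
  by (induction n) (simp_all add: E plus_closed scale_closed)

lemma partial_comb_inner:
  assumes "w \<in> vecs V"
  shows "vinner V (partial_comb c E n) w = (\<Sum>i<n. cnj (c i) * vinner V (E i) w)"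
  using assms
  by (induction n)
     (simp_all add: inner_plus_left inner_scale_left E scale_closed partial_comb_closed)

lemma partial_comb_coeff: "vinner V (E i) (partial_comb c E n) = (if i < n then c i else 0)"
proof -
  have "vinner V (E i) (partial_comb c E n) = cnj (\<Sum>j<n. cnj (c j) * (if j = i then 1 else 0))"
    using inner_cnj[OF partial_comb_closed E] by (simp add: partial_comb_inner E orth)
  thus ?thesis by (simp add: sum.delta' if_distrib cong: if_cong)
qed

lemma partial_comb_inner_self:
  "vinner V (partial_comb c E m) (partial_comb c E n) = of_real (\<Sum>i<min m n. (cmod (c i))\<^sup>2)"
proof -
  have "vinner V (partial_comb c E m) (partial_comb c E n) = (\<Sum>i<m. if i < n then cnj (c i) * c i else 0)"
    by (subst partial_comb_inner [OF partial_comb_closed])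
       (intro sum.cong refl, simp add: partial_comb_coeff)
  also have "\<dots> = (\<Sum>i<min m n. cnj (c i) * c i)"
    by (intro sum.mono_neutral_cong_right) auto
  also have "\<dots> = of_real (\<Sum>i<min m n. (cmod (c i))\<^sup>2)"
    by (simp add: cnj_mult_self)
  finally show ?thesis .
qed

lemma partial_comb_nsq_diff:
  "m \<le> n \<Longrightarrow> vnsq V (vdiff V (partial_comb c E n) (partial_comb c E m)) = (\<Sum>i\<in>{m..<n}. (cmod (c i))\<^sup>2)"
  "m \<le> n \<Longrightarrow> vnsq V (vdiff V (partial_comb c E m) (partial_comb c E n)) = (\<Sum>i\<in>{m..<n}. (cmod (c i))\<^sup>2)"
  using sum_diff_nat_ivl [of 0 m n "\<lambda>i. (cmod (c i))\<^sup>2"]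
  unfolding nsq_diff [OF partial_comb_closed partial_comb_closed]
  by (simp_all add: vnsq_def partial_comb_inner_self min_def atLeast0LessThan)

lemma bessel:
  assumes w: "w \<in> vecs V"
  shows "summable (\<lambda>i. (cmod (vinner V (E i) w))\<^sup>2)"
proof (rule summableI_nonneg_bounded)
  fix n
  define s where "s = partial_comb (\<lambda>i. vinner V (E i) w) E n"
  have s: "s \<in> vecs V" by (simp add: s_def partial_comb_closed)
  have "vinner V s w = of_real (\<Sum>i<n. (cmod (vinner V (E i) w))\<^sup>2)"
    unfolding s_def by (subst partial_comb_inner [OF w]) (simp add: cnj_mult_self)
  moreover have "vnsq V s = (\<Sum>i<n. (cmod (vinner V (E i) w))\<^sup>2)"
    by (simp add: s_def vnsq_def partial_comb_inner_self)
  moreover have "0 \<le> vnsq V (vdiff V s w)"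
    using s w by (intro nsq_nonneg diff_closed)
  ultimately show "(\<Sum>i<n. (cmod (vinner V (E i) w))\<^sup>2) \<le> vnsq V w"
    using nsq_diff[OF s w] by simp
qed auto

end

end

context semi_hilbert
begin

text \<open>Cauchy-Schwarz makes the inner product continuous along the partial sums. This yields
  the coefficients of the limit and also its inner product with an arbitrary \<open>u\<close>, from
  which Parseval's identity is read off later.\<close>

lemma riesz_fischer:
  assumes E: "\<And>i. E i \<in> vecs V"
    and orth: "\<And>i j. vinner V (E i) (E j) = (if i = j then 1 else 0)"
    and c: "summable (\<lambda>i. (cmod (c i))\<^sup>2)"
  obtains w where "w \<in> vecs V" and "\<And>i. vinner V (E i) w = c i"
    and "\<And>u. u \<in> vecs V \<Longrightarrow> (\<lambda>i. cnj (c i) * vinner V (E i) u) sums vinner V w u"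
proof -
  note closed = partial_comb_closed [of E, OF E orth]
  define s where "s = partial_comb c E"
  have s: "s n \<in> vecs V" for n unfolding s_def by (rule closed)
  have "\<exists>N. \<forall>m\<ge>N. \<forall>n\<ge>N. vnsq V (vdiff V (s m) (s n)) < e" if "e > 0" for e
  proof -
    from c that obtain N where N: "\<And>m n. m \<ge> N \<Longrightarrow> norm (\<Sum>i=m..<n. (cmod (c i))\<^sup>2) < e"
      unfolding summable_Cauchy by blast
    have "vnsq V (vdiff V (s m) (s n)) < e" if "m \<ge> N" "n \<ge> N" for m n
    proof (cases "m \<le> n")
      case True
      thus ?thesis using N[of m n] that
        by (simp add: s_def partial_comb_nsq_diff [OF E orth] sum_nonneg)
    next
      case False
      thus ?thesis using N[of n m] that
        by (simp add: s_def partial_comb_nsq_diff [OF E orth] sum_nonneg)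
    qed
    thus ?thesis by blast
  qed
  from complete [OF s this] obtain w where w: "w \<in> vecs V"
    and lim: "(\<lambda>n. vnsq V (vdiff V (s n) w)) \<longlonglongrightarrow> 0" by blast
  have conv: "(\<lambda>n. vinner V (s n) u) \<longlonglongrightarrow> vinner V w u" if u: "u \<in> vecs V" for u
  proof -
    have "(\<lambda>n. vnsq V (vdiff V (s n) w) * vnsq V u) \<longlonglongrightarrow> 0"
      using tendsto_mult_right [OF lim, of "vnsq V u"] by simp
    hence "(\<lambda>n. (cmod (vinner V (vdiff V (s n) w) u))\<^sup>2) \<longlonglongrightarrow> 0"
      by (rule Lim_null_comparison [OF always_eventually, rotated])
         (use cauchy_schwarz [OF diff_closed [OF s w] u] in simp)
    hence "(\<lambda>n. vinner V (vdiff V (s n) w) u) \<longlonglongrightarrow> 0"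
      by (simp add: tendsto_norm_zero_iff)
    hence "(\<lambda>n. vinner V (s n) u - vinner V w u) \<longlonglongrightarrow> 0"
      using u w s by (simp add: inner_diff_left)
    thus ?thesis by (rule LIM_zero_cancel)
  qed
  show ?thesis
  proof
    show "w \<in> vecs V" by fact
    show "(\<lambda>i. cnj (c i) * vinner V (E i) u) sums vinner V w u" if u: "u \<in> vecs V" for u
      using conv[OF u] unfolding sums_def s_def by (simp add: partial_comb_inner [OF E orth u])
    show "vinner V (E i) w = c i" for i
    proof -
      have "(\<lambda>n. cnj (vinner V (s n) (E i))) \<longlonglongrightarrow> cnj (vinner V w (E i))"
        by (intro tendsto_cnj conv E)
      hence "(\<lambda>n. vinner V (E i) (s n)) \<longlonglongrightarrow> vinner V (E i) w"
        by (simp add: inner_cnj [OF s E] inner_cnj [OF w E])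
      moreover have "(\<lambda>n. vinner V (E i) (s n)) \<longlonglongrightarrow> c i"
        by (rule tendsto_eventually)
           (use eventually_gt_at_top [of i] in eventually_elim, simp add: s_def partial_comb_coeff [OF E orth])
      ultimately show ?thesis by (rule LIMSEQ_unique)
    qed
  qed
qed

end

section \<open>Completeness of the space of square integrable functions\<close>

definition L2_rep :: "'x measure \<Rightarrow> ('x \<Rightarrow> complex) hilb_rep" where
  "L2_rep N = \<lparr>vecs = {g \<in> borel_measurable N. integrable N (\<lambda>x. (cmod (g x))\<^sup>2)},
     vplus = (\<lambda>g h x. g x + h x), vscale = (\<lambda>c g x. c * g x),
     vinner = (\<lambda>g h. \<integral>x. cnj (g x) * h x \<partial>N), vact = (\<lambda>Y g. g)\<rparr>"

lemma L2_rep_simps [simp]: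
  "g \<in> vecs (L2_rep N) \<longleftrightarrow> g \<in> borel_measurable N \<and> integrable N (\<lambda>x. (cmod (g x))\<^sup>2)"
  "vplus (L2_rep N) g h = (\<lambda>x. g x + h x)" "vscale (L2_rep N) c g = (\<lambda>x. c * g x)"
  "vinner (L2_rep N) g h = (\<integral>x. cnj (g x) * h x \<partial>N)"
  by (simp_all add: L2_rep_def)

lemma sq_cmod_add_le: "(cmod (u + v))\<^sup>2 \<le> 2 * (cmod u)\<^sup>2 + 2 * (cmod v)\<^sup>2"
proof -
  have "(cmod (u + v))\<^sup>2 \<le> (cmod u + cmod v)\<^sup>2"
    by (intro power_mono norm_triangle_ineq) auto
  also have "\<dots> \<le> 2 * (cmod u)\<^sup>2 + 2 * (cmod v)\<^sup>2"
    using sum_squares_bound [of "cmod u" "cmod v"] by (simp add: power2_sum)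
  finally show ?thesis .
qed

lemma cmod_mult_le: "cmod u * cmod v \<le> (cmod u)\<^sup>2 + (cmod v)\<^sup>2"
proof -
  have "2 * (cmod u * cmod v) \<le> (cmod u)\<^sup>2 + (cmod v)\<^sup>2"
    using sum_squares_bound [of "cmod u" "cmod v"] by (simp only: mult.assoc)
  moreover have "0 \<le> cmod u * cmod v" by simp
  ultimately show ?thesis by linarith
qed

lemma borel_measurable_cnj [measurable]:
  "f \<in> borel_measurable N \<Longrightarrow> (\<lambda>x. cnj (f x)) \<in> borel_measurable N"
  by (rule borel_measurable_continuous_on [of cnj]) (auto intro: continuous_intros)

lemma L2_inner_integrable:
  assumes "g \<in> vecs (L2_rep N)" "h \<in> vecs (L2_rep N)"
  shows "integrable N (\<lambda>x. cnj (g x) * h x)"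
proof (rule Bochner_Integration.integrable_bound)
  show "integrable N (\<lambda>x. (cmod (g x))\<^sup>2 + (cmod (h x))\<^sup>2)"
    using assms by simp
  have [measurable]: "g \<in> borel_measurable N" "h \<in> borel_measurable N"
    using assms by simp_all
  show "(\<lambda>x. cnj (g x) * h x) \<in> borel_measurable N"
    by measurable
qed (use cmod_mult_le in \<open>auto simp: norm_mult\<close>)

lemma L2_nsq: "vnsq (L2_rep N) g = (\<integral>x. (cmod (g x))\<^sup>2 \<partial>N)"
proof -
  have "vinner (L2_rep N) g g = (\<integral>x. of_real ((cmod (g x))\<^sup>2) \<partial>N)"
    by (simp only: L2_rep_simps cnj_mult_self)
  thus ?thesis by (simp add: vnsq_def del: of_real_power)
qed

lemma L2_semi_inner: "semi_inner (L2_rep N)"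
proof
  show "vecs (L2_rep N) \<noteq> {}"
  proof -
    have "(\<lambda>_. 0) \<in> vecs (L2_rep N)" by simp
    thus ?thesis by blast
  qed
  show "vplus (L2_rep N) g h \<in> vecs (L2_rep N)" if "g \<in> vecs (L2_rep N)" "h \<in> vecs (L2_rep N)" for g h
  proof -
    have "integrable N (\<lambda>x. (cmod (g x + h x))\<^sup>2)"
    proof (rule Bochner_Integration.integrable_bound)
      show "integrable N (\<lambda>x. 2 * (cmod (g x))\<^sup>2 + 2 * (cmod (h x))\<^sup>2)"
        using that by simp
    qed (use that sq_cmod_add_le in auto)
    thus ?thesis using that by (simp add: borel_measurable_add)
  qed
  show "vscale (L2_rep N) c g \<in> vecs (L2_rep N)" if "g \<in> vecs (L2_rep N)" for g c
    using that by (simp add: norm_mult power_mult_distrib borel_measurable_times)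
  show "vinner (L2_rep N) f (vplus (L2_rep N) g h) = vinner (L2_rep N) f g + vinner (L2_rep N) f h"
    if "f \<in> vecs (L2_rep N)" "g \<in> vecs (L2_rep N)" "h \<in> vecs (L2_rep N)" for f g h
    using L2_inner_integrable [OF that(1,2)] L2_inner_integrable [OF that(1,3)]
    by (simp add: distrib_left)
  show "vinner (L2_rep N) f (vscale (L2_rep N) c g) = c * vinner (L2_rep N) f g" for f g c
    by (simp add: mult.left_commute [of _ c])
  show "vinner (L2_rep N) g f = cnj (vinner (L2_rep N) f g)" for f g
  proof -
    have "cnj (\<integral>x. cnj (f x) * g x \<partial>N) = (\<integral>x. cnj (cnj (f x) * g x) \<partial>N)"
      by (rule Bochner_Integration.integral_cnj [symmetric])
    thus ?thesis by (simp add: mult.commute)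
  qed
  show "vnsq (L2_rep N) g \<ge> 0" for g
    by (simp add: L2_nsq)
qed

text \<open>The squared increments stay integrable in sum after multiplication by
  \<open>2 ^ k\<close>, and \<open>d \<le> 2 ^ k * d^2 + (1/2) ^ k\<close> turns finiteness of that
  sum into absolute summability of the increments.\<close>

lemma L2_norm_converge:
  fixes h :: "nat \<Rightarrow> 'x \<Rightarrow> complex"
  assumes [measurable]: "\<And>k. h k \<in> borel_measurable N"
    and cauchy: "\<And>k. (\<integral>\<^sup>+x. ennreal ((cmod (h (Suc k) x - h k x))\<^sup>2) \<partial>N) \<le> ennreal ((1/4) ^ k)"
  shows "AE x in N. convergent (\<lambda>k. h k x)"
proof -
  define d where "d k x = cmod (h (Suc k) x - h k x)" for k x
  have [measurable]: "d k \<in> borel_measurable N" for k unfolding d_def by measurable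
  have "(\<integral>\<^sup>+x. (\<Sum>k. ennreal (2 ^ k * (d k x)\<^sup>2)) \<partial>N) = (\<Sum>k. \<integral>\<^sup>+x. ennreal (2 ^ k * (d k x)\<^sup>2) \<partial>N)"
    by (intro nn_integral_suminf) measurable
  also have "\<dots> = (\<Sum>k. ennreal (2 ^ k) * (\<integral>\<^sup>+x. ennreal ((d k x)\<^sup>2) \<partial>N))"
    by (intro suminf_cong) (simp add: ennreal_mult nn_integral_cmult)
  also have "\<dots> \<le> (\<Sum>k. ennreal ((1/2) ^ k))"
  proof (intro suminf_le allI summableI)
    fix k
    have "ennreal (2 ^ k) * (\<integral>\<^sup>+x. ennreal ((d k x)\<^sup>2) \<partial>N) \<le> ennreal (2 ^ k) * ennreal ((1/4) ^ k)"
      unfolding d_def by (intro mult_left_mono cauchy) auto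
    also have "\<dots> = ennreal ((1/2) ^ k)"
      by (simp add: ennreal_mult [symmetric] power_mult_distrib [symmetric])
    finally show "ennreal (2 ^ k) * (\<integral>\<^sup>+x. ennreal ((d k x)\<^sup>2) \<partial>N) \<le> ennreal ((1/2) ^ k)" .
  qed
  also have "\<dots> = ennreal (\<Sum>k. (1/2) ^ k)"
    by (intro suminf_ennreal_eq summable_sums) (auto simp: summable_geometric)
  finally have "(\<integral>\<^sup>+x. (\<Sum>k. ennreal (2 ^ k * (d k x)\<^sup>2)) \<partial>N) \<noteq> \<infinity>"
    by (auto simp: top_unique)
  hence "AE x in N. (\<Sum>k. ennreal (2 ^ k * (d k x)\<^sup>2)) \<noteq> \<infinity>"
    by (intro nn_integral_PInf_AE) auto
  thus ?thesis
  proof eventually_elim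
    case (elim x)
    have s: "summable (\<lambda>k. 2 ^ k * (d k x)\<^sup>2)"
      using elim by (intro summable_suminf_not_top) auto
    have "summable (\<lambda>k. d k x)"
    proof (rule summable_comparison_test')
      show "summable (\<lambda>k. 2 ^ k * (d k x)\<^sup>2 + (1/2) ^ k)"
        using s by (intro summable_add) (auto simp: summable_geometric)
      show "norm (d k x) \<le> 2 ^ k * (d k x)\<^sup>2 + (1/2) ^ k" for k
      proof -
        have "0 \<le> (2 ^ k * d k x - 1 / 2)\<^sup>2" by simp
        hence "2 ^ k * d k x \<le> (2 ^ k * d k x)\<^sup>2 + 1 / 4"
          unfolding power2_diff by (simp add: power2_eq_square)
        also have "\<dots> \<le> (2 ^ k * d k x)\<^sup>2 + 2 ^ k * (1/2) ^ k"
          by (simp flip: power_mult_distrib)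
        also have "\<dots> = 2 ^ k * (2 ^ k * (d k x)\<^sup>2 + (1/2) ^ k)"
          by (simp add: power2_eq_square distrib_left mult_ac)
        finally show ?thesis by (simp add: d_def)
      qed
    qed
    hence "summable (\<lambda>k. h (Suc k) x - h k x)"
      unfolding d_def by (rule summable_norm_cancel)
    hence "convergent (\<lambda>n. h n x - h 0 x)"
      unfolding summable_iff_convergent sum_lessThan_telescope [of "\<lambda>k. h k x"] .
    thus ?case
      by (simp add: convergent_diff_const_right_iff)
  qed
qed

lemma L2_semi_hilbert: "semi_hilbert (L2_rep N)"
proof -
  interpret semi_inner "L2_rep N" by (rule L2_semi_inner)
  show ?thesis
  proof
    fix X :: "nat \<Rightarrow> 'a \<Rightarrow> complex"
    assume X: "\<And>n. X n \<in> vecs (L2_rep N)"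
      and cauchy: "\<And>e. e > 0 \<Longrightarrow> \<exists>n0. \<forall>m\<ge>n0. \<forall>n\<ge>n0. vnsq (L2_rep N) (vdiff (L2_rep N) (X m) (X n)) < e"
    have [measurable]: "X n \<in> borel_measurable N" for n using X[of n] by simp
    define D where "D m n = (\<integral>\<^sup>+x. ennreal ((cmod (X m x - X n x))\<^sup>2) \<partial>N)" for m n
    have D: "D m n = ennreal (vnsq (L2_rep N) (vdiff (L2_rep N) (X m) (X n)))" for m n
    proof -
      have "vdiff (L2_rep N) (X m) (X n) \<in> vecs (L2_rep N)"
        by (intro diff_closed X)
      hence "integrable N (\<lambda>x. (cmod (X m x - X n x))\<^sup>2)"
        by (simp add: vdiff_def)
      thus ?thesis
        unfolding D_def L2_nsq by (subst nn_integral_eq_integral) (auto simp: vdiff_def)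
    qed
    have "\<exists>n0. \<forall>m\<ge>n0. \<forall>n\<ge>n0. D m n \<le> ennreal e" if "e > 0" for e
      using cauchy [OF that] unfolding D by (meson ennreal_leI less_imp_le)
    then obtain N0 where N0: "\<And>e m n. e > 0 \<Longrightarrow> m \<ge> N0 e \<Longrightarrow> n \<ge> N0 e \<Longrightarrow> D m n \<le> ennreal e"
      by metis
    \<comment> \<open>A strictly increasing choice of indices whose \<open>k\<close>-th entry lies
      past the point where squared distances fall to \<open>(1/4) ^ k\<close>, the rate that
      \<open>L2_norm_converge\<close> asks for.\<close>
    define r where "r = rec_nat (N0 1) (\<lambda>k p. max (Suc p) (N0 ((1/4) ^ Suc k)))"
    have r_Suc: "r (Suc k) = max (Suc (r k)) (N0 ((1/4) ^ Suc k))" for k by (simp add: r_def)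
    have r_ge: "r k \<ge> N0 ((1/4) ^ k)" for k by (cases k) (simp_all add: r_def)
    have r_mono: "strict_mono r" by (rule strict_monoI_Suc) (simp add: r_Suc)
    define x where "x t = lim (\<lambda>k. X (r k) t)" for t
    have [measurable]: "x \<in> borel_measurable N" unfolding x_def by measurable
    have "AE t in N. convergent (\<lambda>k. X (r k) t)"
    proof (rule L2_norm_converge)
      show "(\<integral>\<^sup>+t. ennreal ((cmod (X (r (Suc k)) t - X (r k) t))\<^sup>2) \<partial>N) \<le> ennreal ((1/4) ^ k)" for k
        using N0[of "(1/4) ^ k" "r (Suc k)" "r k"] r_ge[of k] by (simp add: r_Suc D_def)
    qed simp
    hence lim: "AE t in N. (\<lambda>k. X (r k) t) \<longlonglongrightarrow> x t"
      by (simp add: x_def convergent_LIMSEQ_iff)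
    have bound: "(\<integral>\<^sup>+t. ennreal ((cmod (X m t - x t))\<^sup>2) \<partial>N) \<le> ennreal e" if "e > 0" "m \<ge> N0 e" for e m
    proof -
      have "(\<integral>\<^sup>+t. ennreal ((cmod (X m t - x t))\<^sup>2) \<partial>N)
          = (\<integral>\<^sup>+t. liminf (\<lambda>k. ennreal ((cmod (X m t - X (r k) t))\<^sup>2)) \<partial>N)"
      proof (rule nn_integral_cong_AE, use lim in eventually_elim)
        case (elim t)
        have "(\<lambda>k. ennreal ((cmod (X m t - X (r k) t))\<^sup>2)) \<longlonglongrightarrow> ennreal ((cmod (X m t - x t))\<^sup>2)"
          using elim by (intro tendsto_intros)
        thus ?case by (intro lim_imp_Liminf [symmetric]) auto
      qed
      also have "\<dots> \<le> liminf (\<lambda>k. D m (r k))"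
        unfolding D_def by (rule nn_integral_liminf) measurable
      also have "\<dots> \<le> ennreal e"
      proof (rule Liminf_le)
        show "\<forall>\<^sub>F k in sequentially. D m (r k) \<le> ennreal e"
          using eventually_ge_at_top[of "N0 e"]
        proof eventually_elim
          case (elim k)
          thus ?case using N0 [OF that] seq_suble [OF r_mono, of k] by fastforce
        qed
      qed simp
      finally show ?thesis .
    qed
    have diff: "(\<lambda>t. X m t - x t) \<in> vecs (L2_rep N)" if "m \<ge> N0 1" for m
    proof -
      have "(\<integral>\<^sup>+t. ennreal ((cmod (X m t - x t))\<^sup>2) \<partial>N) < \<infinity>"
        using bound[of 1 m] that by (simp add: order_le_less_trans)
      hence "integrable N (\<lambda>t. (cmod (X m t - x t))\<^sup>2)"
        by (intro integrableI_nonneg) auto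
      thus ?thesis by simp
    qed
    \<comment> \<open>The limit is a member because it is the difference of a member and of
      \<open>X m - x\<close>, which is square integrable by Fatou's lemma.\<close>
    have "vdiff (L2_rep N) (X (N0 1)) (\<lambda>t. X (N0 1) t - x t) \<in> vecs (L2_rep N)"
      by (intro diff_closed X diff) simp
    hence xv: "x \<in> vecs (L2_rep N)" by (simp add: vdiff_def)
    moreover have "(\<lambda>n. vnsq (L2_rep N) (vdiff (L2_rep N) (X n) x)) \<longlonglongrightarrow> 0"
    proof (rule LIMSEQ_I)
      fix e :: real assume e: "e > 0"
      show "\<exists>n0. \<forall>n\<ge>n0. norm (vnsq (L2_rep N) (vdiff (L2_rep N) (X n) x) - 0) < e"
      proof (intro exI allI impI)
        fix n assume n: "n \<ge> N0 (e / 2)"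
        have "vdiff (L2_rep N) (X n) x \<in> vecs (L2_rep N)"
          by (intro diff_closed X xv)
        hence "ennreal (vnsq (L2_rep N) (vdiff (L2_rep N) (X n) x)) = (\<integral>\<^sup>+t. ennreal ((cmod (X n t - x t))\<^sup>2) \<partial>N)"
          unfolding L2_nsq by (subst nn_integral_eq_integral) (auto simp: vdiff_def)
        also have "\<dots> \<le> ennreal (e / 2)" using bound[of "e / 2" n] e n by simp
        finally have "vnsq (L2_rep N) (vdiff (L2_rep N) (X n) x) \<le> e / 2"
          using e by (simp add: ennreal_le_iff)
        moreover have "vnsq (L2_rep N) (vdiff (L2_rep N) (X n) x) \<ge> 0" by (simp add: L2_nsq)
        ultimately show "norm (vnsq (L2_rep N) (vdiff (L2_rep N) (X n) x) - 0) < e" using e by simp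
      qed
    qed
    ultimately show "\<exists>x\<in>vecs (L2_rep N). (\<lambda>n. vnsq (L2_rep N) (vdiff (L2_rep N) (X n) x)) \<longlonglongrightarrow> 0" by blast
  qed
qed

text \<open>Every space of the statement gets its completeness from \<open>L2_rep\<close>, over
  counting measure or over a product with it. Surjectivity is asked for only up to null vectors: a
  square integrable function on a product has square summable fibres almost everywhere, a member of
  a direct integral has them everywhere.\<close>

lemma semi_hilbert_transfer:
  assumes W: "semi_hilbert W" and ne: "vecs V \<noteq> {}"
    and J: "\<And>v. v \<in> vecs V \<Longrightarrow> J v \<in> vecs W"
    and plus: "\<And>v w. v \<in> vecs V \<Longrightarrow> w \<in> vecs V \<Longrightarrow> vplus V v w \<in> vecs V \<and> J (vplus V v w) = vplus W (J v) (J w)"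
    and scale: "\<And>c v. v \<in> vecs V \<Longrightarrow> vscale V c v \<in> vecs V \<and> J (vscale V c v) = vscale W c (J v)"
    and inner: "\<And>v w. v \<in> vecs V \<Longrightarrow> w \<in> vecs V \<Longrightarrow> vinner V v w = vinner W (J v) (J w)"
    and surj: "\<And>w. w \<in> vecs W \<Longrightarrow> \<exists>v\<in>vecs V. vnsq W (vdiff W (J v) w) = 0"
  shows "semi_hilbert V"
proof -
  interpret W: semi_hilbert W by fact
  have nsq: "vnsq V v = vnsq W (J v)" if "v \<in> vecs V" for v
    using that by (simp add: vnsq_def inner)
  have Jd: "J (vdiff V v w) = vdiff W (J v) (J w)" "vdiff V v w \<in> vecs V" if "v \<in> vecs V" "w \<in> vecs V" for v w
    using that by (simp_all add: vdiff_def plus scale)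
  interpret semi_inner V
  proof
    show "vinner V u (vplus V v w) = vinner V u v + vinner V u w"
      if "u \<in> vecs V" "v \<in> vecs V" "w \<in> vecs V" for u v w
      using that by (simp add: inner plus W.inner_plus J)
    show "vinner V u (vscale V c v) = c * vinner V u v" if "u \<in> vecs V" "v \<in> vecs V" for u c v
      using that by (simp add: inner scale W.inner_scale J)
    show "vinner V v u = cnj (vinner V u v)" if "u \<in> vecs V" "v \<in> vecs V" for u v
      using W.inner_cnj [OF J [OF that(1)] J [OF that(2)]] that by (simp only: inner)
    show "vnsq V v \<ge> 0" if "v \<in> vecs V" for v
      using that by (simp add: nsq W.nsq_nonneg J)
  qed (use ne plus scale in auto)
  show ?thesis
  proof
    fix X :: "nat \<Rightarrow> 'b"
    assume X: "\<And>n. X n \<in> vecs V"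
      and cauchy: "\<And>e. e > 0 \<Longrightarrow> \<exists>N. \<forall>m\<ge>N. \<forall>n\<ge>N. vnsq V (vdiff V (X m) (X n)) < e"
    have "\<exists>y\<in>vecs W. (\<lambda>n. vnsq W (vdiff W (J (X n)) y)) \<longlonglongrightarrow> 0"
      using cauchy by (intro W.complete J X) (simp add: nsq Jd X)
    then obtain y where y: "y \<in> vecs W" and lim: "(\<lambda>n. vnsq W (vdiff W (J (X n)) y)) \<longlonglongrightarrow> 0" by blast
    obtain x where x: "x \<in> vecs V" and xy: "vnsq W (vdiff W (J x) y) = 0" using surj [OF y] by blast
    have "vnsq V (vdiff V (X n) x) = vnsq W (vdiff W (J (X n)) y)" for n
    proof -
      have eq: "vinner W u (J x) = vinner W u y" if "u \<in> vecs W" for u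
      proof -
        have "(cmod (vinner W u (vdiff W (J x) y)))\<^sup>2 \<le> vnsq W u * vnsq W (vdiff W (J x) y)"
          using x y that by (intro W.cauchy_schwarz W.diff_closed J)
        thus ?thesis using x y that xy by (simp add: W.inner_diff J)
      qed
      have "vnsq W (J x) = vnsq W y"
      proof -
        have "Re (cnj (vinner W (J x) y)) = vnsq W y"
          using eq [OF y] W.inner_cnj [OF J [OF x] y] W.inner_self [OF y] by simp
        thus ?thesis using eq [OF J [OF x]] by (simp add: vnsq_def)
      qed
      thus ?thesis using X x y by (simp add: nsq Jd W.nsq_diff J eq)
    qed
    thus "\<exists>x\<in>vecs V. (\<lambda>n. vnsq V (vdiff V (X n) x)) \<longlonglongrightarrow> 0"
      using x lim by (intro bexI [of _ x]) simp_all
  qed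
qed

section \<open>Sequence spaces, direct integrals and direct sums\<close>

lemma infsum_conv_integral:
  fixes f :: "'i \<Rightarrow> 'b :: {banach, second_countable_topology}"
  assumes "integrable (count_space UNIV) f"
  shows "infsum f UNIV = (\<integral>i. f i \<partial>count_space UNIV)"
  using assms infsetsum_infsum [of f UNIV]
  by (simp add: infsetsum_def abs_summable_on_def abs_summable_equivalent)

lemma integrable_count_space_summable_on:
  fixes f :: "'i \<Rightarrow> 'b :: {banach, second_countable_topology}"
  assumes "integrable (count_space UNIV) f"
  shows "f summable_on UNIV"
proof (rule abs_summable_summable)
  show "(\<lambda>i. norm (f i)) summable_on UNIV"
    unfolding abs_summable_equivalent abs_summable_on_def by (rule assms)
qed

lemma ell2_iff: "v \<in> ell2 \<longleftrightarrow> v \<in> vecs (L2_rep (count_space UNIV))"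
proof -
  have "v \<in> ell2 \<longleftrightarrow> (\<lambda>i. norm ((cmod (v i))\<^sup>2)) summable_on UNIV"
    by (simp add: ell2_def)
  also have "\<dots> \<longleftrightarrow> integrable (count_space UNIV) (\<lambda>i. (cmod (v i))\<^sup>2)"
    by (simp only: abs_summable_equivalent abs_summable_on_def)
  finally show ?thesis by simp
qed

lemma ell2_inner_eq:
  assumes "v \<in> ell2" "w \<in> ell2"
  shows "ell2_inner v w = vinner (L2_rep (count_space UNIV)) v w"
  using infsum_conv_integral [OF L2_inner_integrable [OF assms [unfolded ell2_iff]]]
  by (simp add: ell2_inner_def)

lemma ell2_rep_simps:
  "vecs (ell2_rep \<pi>) = ell2" "vplus (ell2_rep \<pi>) = avec" "vscale (ell2_rep \<pi>) = svec"
  "vinner (ell2_rep \<pi>) = ell2_inner" "vact (ell2_rep \<pi>) Y = lin_ext (\<pi> Y)"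
  by (simp_all add: ell2_rep_def)

lemma ell2_semi_hilbert: "semi_hilbert (ell2_rep \<pi>)"
proof -
  let ?C = "L2_rep (count_space UNIV) :: (_ \<Rightarrow> complex) hilb_rep"
  interpret semi_hilbert ?C by (rule L2_semi_hilbert)
  have ell2: "vecs (ell2_rep \<pi>) = vecs ?C"
    by (intro set_eqI) (simp only: ell2_rep_simps ell2_iff)
  have ops: "vplus (ell2_rep \<pi>) = vplus ?C" "vscale (ell2_rep \<pi>) = vscale ?C"
    by (simp_all add: ell2_rep_simps avec_def svec_def fun_eq_iff)
  show ?thesis
  proof (rule semi_hilbert_transfer [OF L2_semi_hilbert, where J = "\<lambda>v. v"], unfold ell2 ops)
    show "\<exists>v\<in>vecs ?C. vnsq ?C (vdiff ?C v w) = 0" if "w \<in> vecs ?C" for w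
      using that by (intro bexI [of _ w]) (simp_all add: L2_nsq vdiff_def)
    show "vinner (ell2_rep \<pi>) v w = vinner ?C v w" if "v \<in> vecs ?C" "w \<in> vecs ?C" for v w
      using that unfolding ell2_iff [symmetric] by (simp add: ell2_inner_eq ell2_rep_simps)
  qed (use nonempty plus_closed scale_closed in blast)+
qed

text \<open>Tonelli's theorem for the product with counting measure. Countability of the index type
  makes componentwise measurability equivalent to measurability on the product.\<close>

lemma direct_integral_vecs:
  fixes f :: "'r \<Rightarrow> ('i :: countable) vec"
  shows "f \<in> vecs (direct_integral M \<pi>) \<longleftrightarrow>
    (\<forall>r\<in>space M. f r \<in> ell2) \<and> case_prod f \<in> vecs (L2_rep (M \<Otimes>\<^sub>M count_space UNIV))"
proof -
  interpret C: sigma_finite_measure "count_space (UNIV :: 'i set)"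
    by (rule sigma_finite_measure_count_space)
  have meas: "(\<forall>i. (\<lambda>r. f r i) \<in> borel_measurable M) \<longleftrightarrow> case_prod f \<in> borel_measurable (M \<Otimes>\<^sub>M count_space UNIV)"
  proof
    assume "\<forall>i. (\<lambda>r. f r i) \<in> borel_measurable M"
    hence "(\<lambda>p. f (fst p) (snd p)) \<in> borel_measurable (M \<Otimes>\<^sub>M count_space UNIV)"
      by (intro measurable_compose_countable' [where I = UNIV and f = "\<lambda>i p. f (fst p) i" and g = snd])
         (auto intro: measurable_compose [OF measurable_fst])
    thus "case_prod f \<in> borel_measurable (M \<Otimes>\<^sub>M count_space UNIV)"
      by (simp add: case_prod_beta')
  next
    assume [measurable]: "case_prod f \<in> borel_measurable (M \<Otimes>\<^sub>M count_space UNIV)"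
    show "\<forall>i. (\<lambda>r. f r i) \<in> borel_measurable M"
    proof
      fix i
      have "(\<lambda>r. case_prod f (r, i)) \<in> borel_measurable M" by measurable
      thus "(\<lambda>r. f r i) \<in> borel_measurable M" by simp
    qed
  qed
  have "integrable M (\<lambda>r. \<Sum>\<^sub>\<infinity>i. (cmod (f r i))\<^sup>2) \<longleftrightarrow>
      integrable (M \<Otimes>\<^sub>M count_space UNIV) (\<lambda>p. (cmod (case_prod f p))\<^sup>2)"
    if ell2: "\<forall>r\<in>space M. f r \<in> ell2"
      and [measurable]: "case_prod f \<in> borel_measurable (M \<Otimes>\<^sub>M count_space UNIV)"
  proof -
    have sum_eq: "(\<Sum>\<^sub>\<infinity>i. (cmod (f r i))\<^sup>2) = (\<integral>i. (cmod (f r i))\<^sup>2 \<partial>count_space UNIV)" if "r \<in> space M" for r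
      using ell2 that by (intro infsum_conv_integral) (simp add: ell2_iff)
    have "integrable M (\<lambda>r. \<Sum>\<^sub>\<infinity>i. (cmod (f r i))\<^sup>2) \<longleftrightarrow>
        integrable M (\<lambda>r. \<integral>i. (cmod (f r i))\<^sup>2 \<partial>count_space UNIV)"
      by (intro Bochner_Integration.integrable_cong refl sum_eq)
    also have "\<dots> \<longleftrightarrow> (\<integral>\<^sup>+r. ennreal (\<integral>i. (cmod (f r i))\<^sup>2 \<partial>count_space UNIV) \<partial>M) < \<infinity>"
    proof -
      have "(\<lambda>r. \<integral>i. (cmod (f r i))\<^sup>2 \<partial>count_space UNIV) \<in> borel_measurable M"
        by measurable
      thus ?thesis by (simp add: integrable_iff_bounded)
    qed
    also have "(\<integral>\<^sup>+r. ennreal (\<integral>i. (cmod (f r i))\<^sup>2 \<partial>count_space UNIV) \<partial>M)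
        = (\<integral>\<^sup>+r. (\<integral>\<^sup>+i. ennreal ((cmod (f r i))\<^sup>2) \<partial>count_space UNIV) \<partial>M)"
      using ell2 by (intro nn_integral_cong) (simp add: ell2_iff nn_integral_eq_integral)
    also have "\<dots> = (\<integral>\<^sup>+p. ennreal ((cmod (case_prod f p))\<^sup>2) \<partial>(M \<Otimes>\<^sub>M count_space UNIV))"
      by (subst C.nn_integral_fst [symmetric]) simp_all
    also have "\<dots> < \<infinity> \<longleftrightarrow> integrable (M \<Otimes>\<^sub>M count_space UNIV) (\<lambda>p. (cmod (case_prod f p))\<^sup>2)"
      by (simp add: integrable_iff_bounded)
    finally show ?thesis .
  qed
  thus ?thesis
    using meas by (auto simp: direct_integral_def)
qed

lemma direct_integral_simps:
  "vplus (direct_integral M \<pi>) = (\<lambda>f g r. avec (f r) (g r))"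
  "vscale (direct_integral M \<pi>) = (\<lambda>c f r. svec c (f r))"
  "vinner (direct_integral M \<pi>) f g = (\<integral>r. ell2_inner (f r) (g r) \<partial>M)"
  "vact (direct_integral M \<pi>) Y f = (\<lambda>r. lin_ext (\<pi> r Y) (f r))"
  by (simp_all add: direct_integral_def)

lemma direct_integral_inner:
  fixes f g :: "'r \<Rightarrow> ('i :: countable) vec"
  assumes f: "f \<in> vecs (direct_integral M \<pi>)" and g: "g \<in> vecs (direct_integral M \<pi>)"
    and "sigma_finite_measure M"
  shows "vinner (direct_integral M \<pi>) f g = vinner (L2_rep (M \<Otimes>\<^sub>M count_space UNIV)) (case_prod f) (case_prod g)"
proof -
  interpret M: sigma_finite_measure M by fact
  interpret C: sigma_finite_measure "count_space (UNIV :: 'i set)"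
    by (rule sigma_finite_measure_count_space)
  interpret MC: pair_sigma_finite M "count_space (UNIV :: 'i set)" ..
  have int: "integrable (M \<Otimes>\<^sub>M count_space UNIV) (\<lambda>p. cnj (case_prod f p) * case_prod g p)"
    using f g unfolding direct_integral_vecs by (intro L2_inner_integrable) auto
  have "vinner (direct_integral M \<pi>) f g = (\<integral>r. (\<integral>i. cnj (f r i) * g r i \<partial>count_space UNIV) \<partial>M)"
    unfolding direct_integral_simps using f g
    by (intro Bochner_Integration.integral_cong) (simp_all add: direct_integral_vecs ell2_inner_eq)
  also have "\<dots> = (\<integral>p. cnj (case_prod f p) * case_prod g p \<partial>(M \<Otimes>\<^sub>M count_space UNIV))"
    using MC.integral_fst' [OF int] by simp
  finally show ?thesis by simp
qed

lemma direct_integral_semi_hilbert: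
  fixes \<pi> :: "'r \<Rightarrow> ('i :: countable) basis_rep"
  assumes M: "sigma_finite_measure M"
  shows "semi_hilbert (direct_integral M \<pi>)"
proof -
  interpret M: sigma_finite_measure M by fact
  interpret C: sigma_finite_measure "count_space (UNIV :: 'i set)"
    by (rule sigma_finite_measure_count_space)
  interpret MC: pair_sigma_finite M "count_space (UNIV :: 'i set)" ..
  let ?N = "M \<Otimes>\<^sub>M count_space (UNIV :: 'i set)"
  interpret semi_hilbert "L2_rep ?N" by (rule L2_semi_hilbert)
  interpret E: semi_hilbert "ell2_rep (\<lambda>_ _. undefined) :: 'i vec hilb_rep" by (rule ell2_semi_hilbert)
  have zero: "(\<lambda>r i. 0) \<in> vecs (direct_integral M \<pi>)"
    unfolding direct_integral_vecs by (auto simp: ell2_def case_prod_beta')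
  show ?thesis
  proof (rule semi_hilbert_transfer [OF L2_semi_hilbert [of ?N], where J = case_prod])
    show "vecs (direct_integral M \<pi>) \<noteq> {}" using zero by blast
    show "case_prod f \<in> vecs (L2_rep ?N)" if "f \<in> vecs (direct_integral M \<pi>)" for f
      using that unfolding direct_integral_vecs by blast
    show "vplus (direct_integral M \<pi>) f g \<in> vecs (direct_integral M \<pi>) \<and>
        case_prod (vplus (direct_integral M \<pi>) f g) = vplus (L2_rep ?N) (case_prod f) (case_prod g)"
      if "f \<in> vecs (direct_integral M \<pi>)" "g \<in> vecs (direct_integral M \<pi>)" for f g
    proof -
      have eq: "case_prod (vplus (direct_integral M \<pi>) f g) = vplus (L2_rep ?N) (case_prod f) (case_prod g)"
        by (auto simp: direct_integral_simps avec_def fun_eq_iff)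
      thus ?thesis
        using that plus_closed [of "case_prod f" "case_prod g"] E.plus_closed
        unfolding direct_integral_vecs eq by (auto simp: direct_integral_simps ell2_rep_simps simp del: L2_rep_simps)
    qed
    show "vscale (direct_integral M \<pi>) c f \<in> vecs (direct_integral M \<pi>) \<and>
        case_prod (vscale (direct_integral M \<pi>) c f) = vscale (L2_rep ?N) c (case_prod f)"
      if "f \<in> vecs (direct_integral M \<pi>)" for f c
    proof -
      have eq: "case_prod (vscale (direct_integral M \<pi>) c f) = vscale (L2_rep ?N) c (case_prod f)"
        by (auto simp: direct_integral_simps svec_def fun_eq_iff)
      thus ?thesis
        using that scale_closed [of "case_prod f" c] E.scale_closed
        unfolding direct_integral_vecs eq by (auto simp: direct_integral_simps ell2_rep_simps simp del: L2_rep_simps)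
    qed
    show "vinner (direct_integral M \<pi>) f g = vinner (L2_rep ?N) (case_prod f) (case_prod g)"
      if "f \<in> vecs (direct_integral M \<pi>)" "g \<in> vecs (direct_integral M \<pi>)" for f g
      using that M by (rule direct_integral_inner)
    show "\<exists>f\<in>vecs (direct_integral M \<pi>). vnsq (L2_rep ?N) (vdiff (L2_rep ?N) (case_prod f) g) = 0"
      if g: "g \<in> vecs (L2_rep ?N)" for g
    proof -
      have [measurable]: "g \<in> borel_measurable ?N" and int: "integrable ?N (\<lambda>p. (cmod (g p))\<^sup>2)"
        using g by auto
      have AE: "AE r in M. integrable (count_space UNIV) (\<lambda>i. (cmod (g (r, i)))\<^sup>2)"
        using MC.AE_integrable_fst' [OF int] by simp
      have int_meas [measurable]: "Measurable.pred M (\<lambda>r. integrable (count_space UNIV) (\<lambda>i. (cmod (g (r, i)))\<^sup>2))"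
        by measurable
      \<comment> \<open>Fibres that fail to be square summable occur over a null set only and are
        replaced by 0.\<close>
      define f where "f r i = (if integrable (count_space UNIV) (\<lambda>i. (cmod (g (r, i)))\<^sup>2) then g (r, i) else 0)" for r i
      have "f r \<in> ell2" for r
        by (cases "integrable (count_space UNIV) (\<lambda>i. (cmod (g (r, i)))\<^sup>2)") (simp_all add: ell2_iff f_def)
      moreover have meas: "case_prod f \<in> borel_measurable ?N"
        unfolding f_def case_prod_beta' by measurable
      moreover have ae: "AE p in ?N. case_prod f p = g p"
      proof (rule MC.AE_pair_measure)
        show "{x \<in> space ?N. case_prod f x = g x} \<in> sets ?N" using meas by measurable
        show "AE r in M. AE i in count_space UNIV. case_prod f (r, i) = g (r, i)"
          using AE by eventually_elim (simp add: f_def)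
      qed
      moreover have "integrable ?N (\<lambda>p. (cmod (case_prod f p))\<^sup>2)"
        by (rule integrable_cong_AE_imp [OF int]) (use meas ae in auto)
      ultimately have "f \<in> vecs (direct_integral M \<pi>)"
        unfolding direct_integral_vecs by simp
      moreover have "vnsq (L2_rep ?N) (vdiff (L2_rep ?N) (case_prod f) g) = 0"
      proof -
        have "(\<integral>p. (cmod (case_prod f p - g p))\<^sup>2 \<partial>?N) = (\<integral>p. 0 \<partial>?N)"
          by (intro integral_cong_AE) (use meas ae in auto)
        thus ?thesis by (simp add: L2_nsq vdiff_def)
      qed
      ultimately show ?thesis by blast
    qed
  qed
qed

lemma direct_sum_simps:
  "vecs (direct_sum V W) = vecs V \<times> vecs W"
  "vplus (direct_sum V W) p q = (vplus V (fst p) (fst q), vplus W (snd p) (snd q))"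
  "vscale (direct_sum V W) c p = (vscale V c (fst p), vscale W c (snd p))"
  "vinner (direct_sum V W) p q = vinner V (fst p) (fst q) + vinner W (snd p) (snd q)"
  "vact (direct_sum V W) Y p = (vact V Y (fst p), vact W Y (snd p))"
  "vdiff (direct_sum V W) p q = (vdiff V (fst p) (fst q), vdiff W (snd p) (snd q))"
  "vnsq (direct_sum V W) p = vnsq V (fst p) + vnsq W (snd p)"
  by (simp_all add: direct_sum_def vdiff_def vnsq_def case_prod_beta)

lemma direct_sum_semi_hilbert:
  assumes "semi_hilbert V" "semi_hilbert W"
  shows "semi_hilbert (direct_sum V W)"
proof -
  interpret V: semi_hilbert V by fact
  interpret W: semi_hilbert W by fact
  interpret semi_inner "direct_sum V W"
  proof
    show "vinner (direct_sum V W) v u = cnj (vinner (direct_sum V W) u v)"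
      if "u \<in> vecs (direct_sum V W)" "v \<in> vecs (direct_sum V W)" for u v
      using that V.inner_cnj [of "fst u" "fst v"] W.inner_cnj [of "snd u" "snd v"]
      by (auto simp: direct_sum_simps)
  qed (use V.nonempty W.nonempty in \<open>auto simp: direct_sum_simps V.plus_closed W.plus_closed
        V.scale_closed W.scale_closed V.inner_plus W.inner_plus V.inner_scale W.inner_scale distrib_left
        V.nsq_nonneg W.nsq_nonneg\<close>)
  show ?thesis
  proof
    fix X :: "nat \<Rightarrow> 'a \<times> 'b"
    assume X: "\<And>n. X n \<in> vecs (direct_sum V W)"
      and cauchy: "\<And>e. e > 0 \<Longrightarrow> \<exists>N. \<forall>m\<ge>N. \<forall>n\<ge>N. vnsq (direct_sum V W) (vdiff (direct_sum V W) (X m) (X n)) < e"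
    have X1: "fst (X n) \<in> vecs V" and X2: "snd (X n) \<in> vecs W" for n
      using X[of n] by (auto simp: direct_sum_simps)
    have pos: "vnsq V (vdiff V (fst (X m)) (fst (X n))) \<ge> 0" "vnsq W (vdiff W (snd (X m)) (snd (X n))) \<ge> 0" for m n
      by (intro V.nsq_nonneg W.nsq_nonneg V.diff_closed W.diff_closed X1 X2)+
    have "\<exists>x\<in>vecs V. (\<lambda>n. vnsq V (vdiff V (fst (X n)) x)) \<longlonglongrightarrow> 0"
    proof (rule V.complete [OF X1])
      fix e :: real assume "e > 0"
      from cauchy [OF this] show "\<exists>N. \<forall>m\<ge>N. \<forall>n\<ge>N. vnsq V (vdiff V (fst (X m)) (fst (X n))) < e"
        unfolding direct_sum_simps fst_conv snd_conv using pos(2) by (smt (verit, best))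
    qed
    moreover have "\<exists>x\<in>vecs W. (\<lambda>n. vnsq W (vdiff W (snd (X n)) x)) \<longlonglongrightarrow> 0"
    proof (rule W.complete [OF X2])
      fix e :: real assume "e > 0"
      from cauchy [OF this] show "\<exists>N. \<forall>m\<ge>N. \<forall>n\<ge>N. vnsq W (vdiff W (snd (X m)) (snd (X n))) < e"
        unfolding direct_sum_simps fst_conv snd_conv using pos(1) by (smt (verit, best))
    qed
    ultimately obtain x y where "x \<in> vecs V" "y \<in> vecs W"
      and "(\<lambda>n. vnsq V (vdiff V (fst (X n)) x)) \<longlonglongrightarrow> 0" "(\<lambda>n. vnsq W (vdiff W (snd (X n)) y)) \<longlonglongrightarrow> 0"
      by blast
    thus "\<exists>x\<in>vecs (direct_sum V W). (\<lambda>n. vnsq (direct_sum V W) (vdiff (direct_sum V W) (X n) x)) \<longlonglongrightarrow> 0"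
      by (intro bexI [of _ "(x, y)"]) (auto simp: direct_sum_simps intro: tendsto_add_zero)
  qed
qed

lemma direct_Sum_simps:
  assumes "finite J"
  shows "v \<in> vecs (direct_Sum J V) \<longleftrightarrow> (\<forall>j\<in>J. v j \<in> vecs (V j))"
    and "vplus (direct_Sum J V) v w = (\<lambda>j. vplus (V j) (v j) (w j))"
    and "vscale (direct_Sum J V) c v = (\<lambda>j. vscale (V j) c (v j))"
    and "vinner (direct_Sum J V) v w = (\<Sum>j\<in>J. vinner (V j) (v j) (w j))"
    and "vact (direct_Sum J V) Y v = (\<lambda>j. vact (V j) Y (v j))"
    and "vdiff (direct_Sum J V) v w = (\<lambda>j. vdiff (V j) (v j) (w j))"
    and "vnsq (direct_Sum J V) v = (\<Sum>j\<in>J. vnsq (V j) (v j))"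
  using assms by (simp_all add: direct_Sum_def vdiff_def vnsq_def)

lemma direct_Sum_semi_hilbert:
  assumes J: "finite J" and V: "\<And>j. j \<in> J \<Longrightarrow> semi_hilbert (V j)"
  shows "semi_hilbert (direct_Sum J V)"
proof -
  note simps = direct_Sum_simps [OF J]
  have I: "semi_inner (V j)" if "j \<in> J" for j
    using V [OF that] by (simp add: semi_hilbert_def)
  interpret semi_inner "direct_Sum J V"
  proof
    have "\<forall>j\<in>J. \<exists>v. v \<in> vecs (V j)" using semi_inner.nonempty [OF I] by blast
    then obtain v where "\<forall>j\<in>J. v j \<in> vecs (V j)" by metis
    thus "vecs (direct_Sum J V) \<noteq> {}" using simps(1) by blast
    show "vinner (direct_Sum J V) v u = cnj (vinner (direct_Sum J V) u v)"
      if "u \<in> vecs (direct_Sum J V)" "v \<in> vecs (direct_Sum J V)" for u v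
      unfolding simps cnj_sum
      by (intro sum.cong refl semi_inner.inner_cnj [OF I]) (use that in \<open>auto simp: simps\<close>)
  qed (auto simp: simps semi_inner.plus_closed [OF I] semi_inner.scale_closed [OF I]
        semi_inner.inner_plus [OF I] semi_inner.inner_scale [OF I] sum.distrib sum_distrib_left
        intro!: sum_nonneg semi_inner.nsq_nonneg [OF I])
  show ?thesis
  proof
    fix X :: "nat \<Rightarrow> 'a \<Rightarrow> 'b"
    assume X: "\<And>n. X n \<in> vecs (direct_Sum J V)"
      and cauchy: "\<And>e. e > 0 \<Longrightarrow> \<exists>N. \<forall>m\<ge>N. \<forall>n\<ge>N. vnsq (direct_Sum J V) (vdiff (direct_Sum J V) (X m) (X n)) < e"
    have Xj: "X n j \<in> vecs (V j)" if "j \<in> J" for n j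
      using X[of n] that by (simp add: simps)
    have "\<exists>x\<in>vecs (V j). (\<lambda>n. vnsq (V j) (vdiff (V j) (X n j) x)) \<longlonglongrightarrow> 0" if j: "j \<in> J" for j
    proof (rule semi_hilbert.complete [OF V [OF j] Xj [OF j]])
      fix e :: real assume "e > 0"
      from cauchy [OF this] obtain N where N: "\<And>m n. m \<ge> N \<Longrightarrow> n \<ge> N \<Longrightarrow>
          (\<Sum>j\<in>J. vnsq (V j) (vdiff (V j) (X m j) (X n j))) < e"
        unfolding simps by blast
      have "vnsq (V j) (vdiff (V j) (X m j) (X n j)) < e" if "m \<ge> N" "n \<ge> N" for m n
      proof -
        have "vnsq (V j) (vdiff (V j) (X m j) (X n j)) \<le> (\<Sum>j\<in>J. vnsq (V j) (vdiff (V j) (X m j) (X n j)))"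
          using J j by (intro member_le_sum) (auto intro: semi_inner.nsq_nonneg [OF I] semi_inner.diff_closed [OF I] Xj)
        thus ?thesis using N [OF that] by simp
      qed
      thus "\<exists>N. \<forall>m\<ge>N. \<forall>n\<ge>N. vnsq (V j) (vdiff (V j) (X m j) (X n j)) < e" by blast
    qed
    then obtain x where "\<And>j. j \<in> J \<Longrightarrow> x j \<in> vecs (V j)"
      and "\<And>j. j \<in> J \<Longrightarrow> (\<lambda>n. vnsq (V j) (vdiff (V j) (X n j) (x j))) \<longlonglongrightarrow> 0"
      by metis
    thus "\<exists>x\<in>vecs (direct_Sum J V). (\<lambda>n. vnsq (direct_Sum J V) (vdiff (direct_Sum J V) (X n) x)) \<longlonglongrightarrow> 0"
      by (intro bexI [of _ x]) (auto simp: simps intro: tendsto_null_sum)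
  qed
qed

section \<open>A criterion for the decomposition\<close>

lemma fin_comb_ell2: "v \<in> fin_comb \<Longrightarrow> v \<in> ell2"
proof -
  assume "v \<in> fin_comb"
  hence "finite {i. v i \<noteq> 0}" by (simp add: fin_comb_def)
  moreover have "(\<lambda>i. (cmod (v i))\<^sup>2) summable_on UNIV \<longleftrightarrow> (\<lambda>i. (cmod (v i))\<^sup>2) summable_on {i. v i \<noteq> 0}"
    by (intro summable_on_cong_neutral) auto
  ultimately show ?thesis by (simp add: ell2_def)
qed

lemma tensor_ket: "tensor_vec (ket i) (ket j) = ket (i, j)"
  by (auto simp: tensor_vec_def ket_def fun_eq_iff)

lemma ket_fin_comb: "ket i \<in> fin_comb"
  by (simp add: fin_comb_def ket_def)

text \<open>A total orthonormal family determines a unitary through its coefficients. The action on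
  \<open>W\<close> is computed on representatives, so on finite combinations the image is prescribed
  as the explicit vector \<open>F v\<close>, for which the intertwining relation can be checked;
  elsewhere any vector with the right coefficients will do.\<close>

lemma decomposes_viaI:
  fixes W :: "'w hilb_rep" and \<Lambda> :: "nat \<Rightarrow> nat \<Rightarrow> 'w"
  assumes W: "semi_hilbert W" and \<Lambda>: "\<And>i j. \<Lambda> i j \<in> vecs W"
    and orth: "\<And>i j i' j'. vinner W (\<Lambda> i j) (\<Lambda> i' j') = (if i = i' \<and> j = j' then 1 else 0)"
    and total: "\<And>w. w \<in> vecs W \<Longrightarrow> (\<And>i j. vinner W (\<Lambda> i j) w = 0) \<Longrightarrow> vinner W w w = 0"
    and F: "\<And>v. v \<in> fin_comb \<Longrightarrow> F v \<in> vecs W"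
    and F_coeff: "\<And>v i j. v \<in> fin_comb \<Longrightarrow> vinner W (\<Lambda> i j) (F v) = v (i, j)"
    and fin: "\<And>Y v. v \<in> fin_comb \<Longrightarrow> lin_ext (\<pi> Y) v \<in> fin_comb"
    and act: "\<And>Y v. v \<in> fin_comb \<Longrightarrow> hilb_eq W (F (lin_ext (\<pi> Y) v)) (vact W Y (F v))"
  shows "decomposes_via \<pi> W \<Lambda>"
proof -
  interpret semi_hilbert W by fact
  define E where "E n = case_prod \<Lambda> (prod_decode n)" for n
  have E: "E n \<in> vecs W" for n by (simp add: E_def \<Lambda> case_prod_beta)
  have E_orth: "vinner W (E m) (E n) = (if m = n then 1 else 0)" for m n
    using inj_prod_decode [THEN inj_eq, of m n] by (simp add: E_def orth case_prod_beta prod_eq_iff)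
  have bij: "bij_betw prod_decode UNIV UNIV" by (rule bij_prod_decode)
  have summable_iff: "summable (\<lambda>n. (cmod (v (prod_decode n)))\<^sup>2) \<longleftrightarrow> v \<in> ell2" for v :: "(nat \<times> nat) vec"
    unfolding ell2_def mem_Collect_eq
    using summable_on_reindex_bij_betw [OF bij, of "\<lambda>q. (cmod (v q))\<^sup>2"]
    by (simp add: summable_on_UNIV_nonneg_real_iff)
  define coeff where "coeff w = (\<lambda>(i, j). vinner W (\<Lambda> i j) w)" for w
  have coeff_E: "vinner W (E n) w = coeff w (prod_decode n)" for n w
    by (simp add: E_def coeff_def case_prod_beta)
  have eqI: "hilb_eq W w w'" if "w \<in> vecs W" "w' \<in> vecs W" "coeff w = coeff w'" for w w'
  proof -
    have "vinner W (vdiff W w w') (vdiff W w w') = 0"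
    proof (rule total [OF diff_closed [OF that(1,2)]])
      fix i j
      show "vinner W (\<Lambda> i j) (vdiff W w w') = 0"
        using fun_cong [OF that(3), of "(i, j)"] that(1,2) by (simp add: coeff_def inner_diff \<Lambda>)
    qed
    thus ?thesis using that by (simp add: hilb_eq_iff vnsq_def)
  qed
  define U where "U v = (if v \<in> fin_comb then F v else SOME w. w \<in> vecs W \<and> coeff w = v)" for v
  have U: "U v \<in> vecs W \<and> coeff (U v) = v" if "v \<in> ell2" for v
  proof (cases "v \<in> fin_comb")
    case True
    thus ?thesis by (auto simp: U_def F F_coeff coeff_def)
  next
    case False
    have "summable (\<lambda>n. (cmod (v (prod_decode n)))\<^sup>2)" using summable_iff that by blast
    then obtain w where "w \<in> vecs W" "\<And>n. vinner W (E n) w = v (prod_decode n)"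
      using riesz_fischer [OF E E_orth] by metis
    moreover have "coeff w q = v q" for q
      using calculation(2) [of "prod_encode q"] by (simp add: coeff_E)
    ultimately have "\<exists>w. w \<in> vecs W \<and> coeff w = v" by blast
    from someI_ex [OF this] show ?thesis using False by (simp add: U_def)
  qed
  have coeff_ell2: "coeff w \<in> ell2" if "w \<in> vecs W" for w
    using bessel [OF E E_orth that] by (simp add: coeff_E summable_iff)
  \<comment> \<open>Parseval: the vector rebuilt from the coefficients of \<open>w\<close> differs
    from \<open>w\<close> by a null vector, by totality, and its inner products are given by the
    series.\<close>
  have coeff_inner: "vinner W w w' = ell2_inner (coeff w) (coeff w')"
    if w: "w \<in> vecs W" and w': "w' \<in> vecs W" for w w'
  proof -
    have sm: "summable (\<lambda>n. (cmod (coeff w (prod_decode n)))\<^sup>2)"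
      using coeff_ell2 [OF w] summable_iff by blast
    obtain x where x: "x \<in> vecs W" "\<And>n. vinner W (E n) x = coeff w (prod_decode n)"
      and sums: "\<And>u. u \<in> vecs W \<Longrightarrow> (\<lambda>n. cnj (coeff w (prod_decode n)) * vinner W (E n) u) sums vinner W x u"
      by (rule riesz_fischer [OF E E_orth sm]) (rule that, assumption+)
    have "coeff x q = coeff w q" for q
      using x(2) [of "prod_encode q"] by (simp add: coeff_E)
    hence "vnsq W (vdiff W w x) = 0"
      using eqI [OF w x(1)] by (simp add: hilb_eq_iff fun_eq_iff)
    hence "(cmod (vinner W (vdiff W w x) w'))\<^sup>2 \<le> 0"
      using cauchy_schwarz [OF diff_closed [OF w x(1)] w'] by simp
    hence "vinner W w w' = vinner W x w'"
      using w w' x(1) by (simp add: inner_diff_left)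
    moreover have "(\<lambda>n. cnj (coeff w (prod_decode n)) * coeff w' (prod_decode n)) sums vinner W x w'"
      using sums [OF w'] by (simp add: coeff_E)
    moreover have "(\<lambda>n. cnj (coeff w (prod_decode n)) * coeff w' (prod_decode n)) sums ell2_inner (coeff w) (coeff w')"
    proof -
      have "integrable (count_space UNIV) (\<lambda>q. cnj (coeff w q) * coeff w' q)"
        using L2_inner_integrable coeff_ell2 w w' unfolding ell2_iff by blast
      hence "(\<lambda>q. cnj (coeff w q) * coeff w' q) summable_on UNIV"
        by (rule integrable_count_space_summable_on)
      hence "((\<lambda>q. cnj (coeff w q) * coeff w' q) has_sum ell2_inner (coeff w) (coeff w')) UNIV"
        unfolding ell2_inner_def by (rule has_sum_infsum)
      hence "((\<lambda>n. cnj (coeff w (prod_decode n)) * coeff w' (prod_decode n)) has_sum ell2_inner (coeff w) (coeff w')) UNIV"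
        using has_sum_reindex_bij_betw [OF bij, of "\<lambda>q. cnj (coeff w q) * coeff w' q"] by simp
      thus ?thesis by (rule has_sum_imp_sums)
    qed
    ultimately show ?thesis using sums_unique2 by metis
  qed
  have coeff_plus: "coeff (vplus W w w') = avec (coeff w) (coeff w')" if "w \<in> vecs W" "w' \<in> vecs W" for w w'
    using that by (auto simp: coeff_def avec_def inner_plus \<Lambda> fun_eq_iff)
  have coeff_scale: "coeff (vscale W c w) = svec c (coeff w)" if "w \<in> vecs W" for c w
    using that by (auto simp: coeff_def svec_def inner_scale \<Lambda> fun_eq_iff)
  interpret L: semi_hilbert "ell2_rep \<pi>" by (rule ell2_semi_hilbert)
  note L_closed = L.plus_closed L.scale_closed
  have "unitary_onto (ell2_rep \<pi>) W U"
    unfolding unitary_onto_def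
  proof (intro conjI ballI allI)
    show "U v \<in> vecs W" if "v \<in> vecs (ell2_rep \<pi>)" for v
      using that U by (simp add: ell2_rep_simps)
    show "hilb_eq W (U (vplus (ell2_rep \<pi>) v w)) (vplus W (U v) (U w))"
      if "v \<in> vecs (ell2_rep \<pi>)" "w \<in> vecs (ell2_rep \<pi>)" for v w
      using that U L_closed(1) [OF that] by (intro eqI) (auto simp: ell2_rep_simps coeff_plus plus_closed)
    show "hilb_eq W (U (vscale (ell2_rep \<pi>) c v)) (vscale W c (U v))" if "v \<in> vecs (ell2_rep \<pi>)" for c v
      using that U L_closed(2) [OF that, of c] by (intro eqI) (auto simp: ell2_rep_simps coeff_scale scale_closed)
    show "vinner W (U v) (U w) = vinner (ell2_rep \<pi>) v w"
      if "v \<in> vecs (ell2_rep \<pi>)" "w \<in> vecs (ell2_rep \<pi>)" for v w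
      using that U by (simp add: ell2_rep_simps coeff_inner)
    show "\<exists>v\<in>vecs (ell2_rep \<pi>). hilb_eq W (U v) w" if "w \<in> vecs W" for w
      using that U [OF coeff_ell2 [OF that]] coeff_ell2 [OF that]
      by (intro bexI [of _ "coeff w"] eqI) (auto simp: ell2_rep_simps)
  qed
  moreover have "hilb_eq W (U (tensor_vec (ket i) (ket j))) (\<Lambda> i j)" for i j
  proof (rule eqI)
    have "ket (i, j) \<in> (ell2 :: (nat \<times> nat) vec set)" by (intro fin_comb_ell2 ket_fin_comb)
    moreover have "coeff (\<Lambda> i j) = ket (i, j)"
      by (auto simp: coeff_def orth ket_def fun_eq_iff)
    ultimately show "U (tensor_vec (ket i) (ket j)) \<in> vecs W"
      and "coeff (U (tensor_vec (ket i) (ket j))) = coeff (\<Lambda> i j)"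
      using U unfolding tensor_ket by auto
  qed (rule \<Lambda>)
  moreover have "hilb_eq W (U (vact (ell2_rep \<pi>) Y v)) (vact W Y (U v))" if "v \<in> fin_comb" for Y v
    using that fin [OF that, of Y] act [OF that, of Y] by (simp add: ell2_rep_simps U_def)
  ultimately show ?thesis
    unfolding decomposes_via_def by blast
qed

section \<open>Matrix coefficients\<close>

text \<open>With \<open>y = x^2\<close>, the ratio of the squared modulus of
  \<open>Gamma (a_p + i x) * Gamma (c_p + i x)\<close> to its value at \<open>p = 0\<close>. At the
  mass point attached to a discrete series it vanishes exactly for the weights missing
  there.\<close>

definition PiP :: "real \<Rightarrow> int \<Rightarrow> real poly" where
  "PiP \<alpha> p = (if p \<ge> 0 then phi (nat p) \<alpha> else phi (nat (- p)) (1 - \<alpha>))"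

lemma PiP_uminus: "PiP (1 - \<alpha>) (- p) = PiP \<alpha> p"
  by (auto simp: PiP_def)

lemma poly_PiP_up:
  assumes "p \<ge> 0"
  shows "poly (PiP \<alpha> (p + 1)) y = ((of_int p + \<alpha>)\<^sup>2 + y) * poly (PiP \<alpha> p) y"
  using assms by (simp add: PiP_def nat_add_distrib phi_Suc algebra_simps)

lemma poly_PiP_down:
  assumes "p < 0"
  shows "poly (PiP \<alpha> p) y = ((of_int p + \<alpha>)\<^sup>2 + y) * poly (PiP \<alpha> (p + 1)) y"
proof -
  have n: "nat (- p) = Suc (nat (- p - 1))" using assms by simp
  have "(1 - \<alpha> + real (nat (- p - 1)))\<^sup>2 = (of_int p + \<alpha>)\<^sup>2"
    using assms by (simp add: power2_eq_square algebra_simps)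
  moreover have "PiP \<alpha> (p + 1) = phi (nat (- p - 1)) (1 - \<alpha>)"
    using assms by (cases "p = -1") (auto simp: PiP_def)
  ultimately show ?thesis
    using assms by (simp add: PiP_def n phi_Suc algebra_simps)
qed

text \<open>The root of \<open>nrm\<close> times the squared norm of the polynomial of degree
  \<open>min n1 n2\<close>, in a form without case distinction on the sign of
  \<open>n1 - n2\<close>; see \<open>nN_sq\<close>.\<close>

definition nN :: "real \<Rightarrow> real \<Rightarrow> nat \<Rightarrow> nat \<Rightarrow> real" where
  "nN k1 k2 n1 n2 = sqrt (fact n1 * fact n2 * Gamma (2 * k1 + real n1) * Gamma (2 * k2 + real n2))"

text \<open>The sign \<open>(-1) ^ n2\<close> of the asserted formula times the sign
  \<open>(-1) ^ min n1 n2\<close> inside \<open>S_hat\<close>.\<close>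

definition sg :: "nat \<Rightarrow> nat \<Rightarrow> real" where
  "sg n1 n2 = (if n1 \<ge> n2 then 1 else (-1) ^ (n2 - n1))"

definition Sd :: "real \<Rightarrow> real \<Rightarrow> nat \<Rightarrow> int \<Rightarrow> real poly" where
  "Sd k1 k2 n p = dh n (par_a k1 k2 p) (par_b k1 k2 p) (par_c k1 k2 p)"

text \<open>The argument \<open>w\<close> is the weight at \<open>y\<close>: a density on the
  continuous part, a mass at an atom. Both parts of the spectrum then share the same
  algebra.\<close>

definition Tc :: "real \<Rightarrow> real \<Rightarrow> nat \<Rightarrow> nat \<Rightarrow> real \<Rightarrow> real \<Rightarrow> real" where
  "Tc k1 k2 n1 n2 y w = (let p = int n1 - int n2 in
     sg n1 n2 * poly (Sd k1 k2 (min n1 n2) p) y * sqrt (poly (PiP (k1 - k2 + 1/2) p) y * w) / nN k1 k2 n1 n2)"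

lemma par_sums:
  "p \<le> 0 \<Longrightarrow> par_a k1 k2 p + par_b k1 k2 p = 2 * k1"
  "p \<le> 0 \<Longrightarrow> par_a k1 k2 p + par_c k1 k2 p = 1 - of_int p"
  "p \<le> 0 \<Longrightarrow> par_b k1 k2 p + par_c k1 k2 p = 2 * k2 - of_int p"
  "p > 0 \<Longrightarrow> par_a k1 k2 p + par_b k1 k2 p = 2 * k2"
  "p > 0 \<Longrightarrow> par_a k1 k2 p + par_c k1 k2 p = 1 + of_int p"
  "p > 0 \<Longrightarrow> par_b k1 k2 p + par_c k1 k2 p = 2 * k1 + of_int p"
  by (simp_all add: par_a_def par_b_def par_c_def)

lemma Sd_swap: "Sd k2 k1 n (- p) = Sd k1 k2 n p"
proof (cases "p = 0")
  case True
  have *: "dh n a b c = dh n c b a" for a b c using dh_swap by metis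
  show ?thesis
    unfolding Sd_def True using *[of "k1 - k2 + 1/2"] by (simp add: par_a_def par_b_def par_c_def add.commute)
next
  case False
  thus ?thesis by (auto simp: Sd_def par_a_def par_b_def par_c_def add.commute)
qed

text \<open>For \<open>p = 0\<close> the two parametrisations agree up to a permutation.\<close>

lemma Sd_nonneg: "p \<ge> 0 \<Longrightarrow> Sd k1 k2 n p = dh n (k2 - k1 + 1/2) (k1 + k2 - 1/2) (k1 - k2 + of_int p + 1/2)"
  using Sd_swap [of k1 k2 n "- p"] by (simp add: Sd_def par_a_def par_b_def par_c_def add.commute)

lemma Sd_nonpos: "p \<le> 0 \<Longrightarrow> Sd k1 k2 n p = dh n (k1 - k2 + 1/2) (k1 + k2 - 1/2) (k2 - k1 - of_int p + 1/2)"
  by (simp add: Sd_def par_a_def par_b_def par_c_def)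

lemma sg_swap: "sg n2 n1 = (-1) ^ (n1 + n2) * sg n1 n2"
proof (cases "n1 = n2")
  case True
  thus ?thesis by (simp add: sg_def flip: mult_2)
next
  case False
  have "(-1) ^ (m - n) = ((-1) ^ (m + n) :: real)" if "n \<le> m" for m n :: nat
  proof -
    have "m + n = (m - n) + 2 * n" using that by simp
    thus ?thesis by (simp only: power_add power_mult) simp
  qed
  moreover have "(-1) ^ (m + n) * (-1) ^ (m - n) = (1 :: real)" if "n \<le> m" for m n :: nat
  proof -
    have "m + n + (m - n) = 2 * m" using that by simp
    hence "(-1) ^ (m + n + (m - n)) = (1 :: real)" by simp
    thus ?thesis by (simp only: power_add)
  qed
  ultimately show ?thesis using False
    by (cases "n1 < n2") (simp_all add: sg_def add.commute)
qed

lemma nN_swap: "nN k2 k1 n2 n1 = nN k1 k2 n1 n2"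
  by (simp add: nN_def mult_ac)

text \<open>Exchanging the tensor factors turns \<open>p\<close> into \<open>- p\<close> and swaps
  the two branches of the parametrisation. This derives the relation for \<open>C\<close> from the
  one for \<open>B\<close>.\<close>

lemma Tc_swap: "Tc k2 k1 n2 n1 y w = (-1) ^ (n1 + n2) * Tc k1 k2 n1 n2 y w"
proof -
  have "PiP (k2 - k1 + 1/2) (int n2 - int n1) = PiP (k1 - k2 + 1/2) (int n1 - int n2)"
    using PiP_uminus [of "k1 - k2 + 1/2" "int n1 - int n2"] by (simp add: algebra_simps)
  moreover have "Sd k2 k1 n (int n2 - int n1) = Sd k1 k2 n (int n1 - int n2)" for n
    using Sd_swap [of k2 k1 n "int n1 - int n2"] by simp
  ultimately show ?thesis
    by (simp add: Tc_def Let_def sg_swap [of n2 n1] nN_swap [of k2 k1] min.commute)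
qed

lemma nN_pos: "k1 > 0 \<Longrightarrow> k2 > 0 \<Longrightarrow> nN k1 k2 n1 n2 > 0"
  by (simp add: nN_def Gamma_real_pos add_pos_nonneg)

lemma nN_Suc:
  assumes "k1 > 0"
  shows "nN k1 k2 (Suc n1) n2 = sqrt ((real n1 + 1) * (2 * k1 + real n1)) * nN k1 k2 n1 n2"
proof -
  have "Gamma (2 * k1 + real (Suc n1)) = (2 * k1 + real n1) * Gamma (2 * k1 + real n1)"
    using Gamma_plus1_pos [of "2 * k1 + real n1"] assms by (simp add: add_ac)
  thus ?thesis
    by (simp only: nN_def real_sqrt_mult [symmetric] fact_Suc) (simp add: mult_ac add_ac)
qed

text \<open>The case distinction on the sign of \<open>n1 - n2\<close> matches the two contiguous relations.\<close>

lemma Tc_raise: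
  assumes k: "k1 > 0" "k2 > 0" and p: "p = int n1 - int n2"
    and nonneg: "p < 0 \<Longrightarrow> (of_int p + (k1 - k2 + 1/2))\<^sup>2 + y \<ge> 0 \<or> poly (PiP (k1 - k2 + 1/2) (p + 1)) y * w = 0"
  shows "sqrt ((real n1 + 1) * (2 * k1 + real n1)) * Tc k1 k2 (Suc n1) n2 y w
      - sqrt (real n2 * (2 * k2 + real n2 - 1)) * Tc k1 k2 n1 (n2 - 1) y w
      = sqrt ((of_int p + (k1 - k2 + 1/2))\<^sup>2 + y) * Tc k1 k2 n1 n2 y w"
proof -
  define \<alpha> where "\<alpha> = k1 - k2 + 1/2"
  define r2 where "r2 = (of_int p + \<alpha>)\<^sup>2 + y"
  define N where "N = nN k1 k2 n1 n2"
  define m where "m = real n2 * (2 * k2 + real n2 - 1)"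
  define u where "u = sqrt (poly (PiP \<alpha> (p + 1)) y * w)"
  have N: "N > 0" using k by (simp add: N_def nN_pos)
  have p1: "int (Suc n1) - int n2 = p + 1" using p by simp
  have up: "sqrt ((real n1 + 1) * (2 * k1 + real n1)) * Tc k1 k2 (Suc n1) n2 y w
      = sg (Suc n1) n2 * poly (Sd k1 k2 (min (Suc n1) n2) (p + 1)) y * u / N"
  proof -
    define q where "q = sqrt ((real n1 + 1) * (2 * k1 + real n1))"
    have "q > 0" using k by (simp add: q_def add_pos_nonneg)
    thus ?thesis
      unfolding q_def [symmetric] Tc_def Let_def p1 nN_Suc [OF k(1), folded q_def] N_def u_def \<alpha>_def by simp
  qed
  have down: "sqrt m * Tc k1 k2 n1 (n2 - 1) y w = m * sg n1 (n2 - 1) * poly (Sd k1 k2 (min n1 (n2 - 1)) (p + 1)) y * u / N"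
  proof (cases n2)
    case 0
    thus ?thesis by (simp add: m_def)
  next
    case (Suc l)
    have m: "m > 0" using Suc k by (simp add: m_def add_pos_nonneg)
    have "nN k2 k1 (Suc l) n1 = sqrt ((real l + 1) * (2 * k2 + real l)) * nN k2 k1 l n1" by (rule nN_Suc [OF k(2)])
    hence NN: "N = sqrt m * nN k1 k2 n1 l"
      by (simp add: N_def Suc m_def nN_swap [of k1 k2] add_ac)
    have "int n1 - int l = p + 1" using p Suc by simp
    hence "sqrt m * Tc k1 k2 n1 (n2 - 1) y w = sqrt m * (sg n1 l * poly (Sd k1 k2 (min n1 l) (p + 1)) y * u / nN k1 k2 n1 l)"
      by (simp add: Suc Tc_def Let_def u_def \<alpha>_def)
    also have "\<dots> = m * sg n1 l * poly (Sd k1 k2 (min n1 l) (p + 1)) y * u / N"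
    proof -
      have "m * sg n1 l * poly (Sd k1 k2 (min n1 l) (p + 1)) y * u / N
          = (m / sqrt m) * (sg n1 l * poly (Sd k1 k2 (min n1 l) (p + 1)) y * u / nN k1 k2 n1 l)"
        unfolding NN by simp
      thus ?thesis using m by (simp only: real_div_sqrt less_imp_le)
    qed
    finally show ?thesis by (simp add: Suc)
  qed
  have mid: "Tc k1 k2 n1 n2 y w = sg n1 n2 * poly (Sd k1 k2 (min n1 n2) p) y * sqrt (poly (PiP \<alpha> p) y * w) / N"
    by (simp add: Tc_def Let_def p \<alpha>_def N_def)
  have "(sg (Suc n1) n2 * poly (Sd k1 k2 (min (Suc n1) n2) (p + 1)) y
      - m * sg n1 (n2 - 1) * poly (Sd k1 k2 (min n1 (n2 - 1)) (p + 1)) y) * u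
      = sqrt r2 * (sg n1 n2 * poly (Sd k1 k2 (min n1 n2) p) y * sqrt (poly (PiP \<alpha> p) y * w))"
  proof (cases "p \<ge> 0")
    case True
    hence n: "n2 \<le> n1" using p by simp
    \<comment> \<open>The real \<open>sqrt\<close> is odd, hence multiplicative on all reals, and
      the equation holds for either sign of \<open>r2\<close>.\<close>
    have "u = sqrt r2 * sqrt (poly (PiP \<alpha> p) y * w)"
      by (simp add: u_def poly_PiP_up [OF True] r2_def real_sqrt_mult)
    moreover have key: "poly (Sd k1 k2 n2 (p + 1)) y - m * poly (Sd k1 k2 (n2 - 1) (p + 1)) y = poly (Sd k1 k2 n2 p) y"
      using True poly_dh_contiguous(1) [of n2 "k2 - k1 + 1/2" "k1 + k2 - 1/2" "k1 - k2 + of_int p + 1/2" y]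
      by (simp add: Sd_nonneg m_def algebra_simps)
    moreover have "min (Suc n1) n2 = n2" "min n1 (n2 - 1) = n2 - 1" "min n1 n2 = n2" using n by auto
    moreover have "sg (Suc n1) n2 = 1" "sg n1 (n2 - 1) = 1" "sg n1 n2 = 1" using n by (auto simp: sg_def)
    ultimately show ?thesis
      by (simp only: mult_1_right mult_1_left mult_ac)
  next
    case False
    hence n: "n1 < n2" using p by simp
    define c where "c = k2 - k1 - of_int (p + 1) + 1/2"
    have c2: "c\<^sup>2 + y = r2" by (simp add: c_def r2_def \<alpha>_def power2_eq_square algebra_simps)
    have S1: "Sd k1 k2 n' (p + 1) = dh n' (k1 - k2 + 1/2) (k1 + k2 - 1/2) c" for n'
      using False by (subst Sd_nonpos) (auto simp: c_def)
    have S0: "Sd k1 k2 n' p = dh n' (k1 - k2 + 1/2) (k1 + k2 - 1/2) (c + 1)" for n'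
      using False by (subst Sd_nonpos) (auto simp: c_def algebra_simps)
    have rp: "real_of_int p = real n1 - real n2" using p by simp
    have coef: "(real n1 + (k1 - k2 + 1/2) + c) * (real n1 + (k1 + k2 - 1/2) + c) = m"
      by (simp add: c_def m_def rp)
    have key: "r2 * poly (Sd k1 k2 n1 p) y = m * poly (Sd k1 k2 n1 (p + 1)) y - poly (Sd k1 k2 (Suc n1) (p + 1)) y"
      using poly_dh_contiguous(2) [of c y n1 "k1 - k2 + 1/2" "k1 + k2 - 1/2"] unfolding c2 coef S1 S0 .
    have s: "sqrt (poly (PiP \<alpha> p) y * w) = sqrt r2 * u"
      using False by (simp add: u_def poly_PiP_down r2_def real_sqrt_mult)
    \<comment> \<open>Here a root is squared, which returns the radicand only if that is
      nonnegative; in the other alternative of the hypothesis \<open>u\<close> is zero.\<close>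
    have r2: "sqrt r2 * sqrt r2 * u = r2 * u" using nonneg False by (auto simp: r2_def \<alpha>_def u_def)
    have "sg (Suc n1) n2 = - sg n1 n2" "sg n1 (n2 - 1) = - sg n1 n2"
    proof -
      have "n2 - n1 = Suc (n2 - Suc n1)" "n2 - 1 - n1 = n2 - Suc n1" using n by auto
      thus "sg (Suc n1) n2 = - sg n1 n2" "sg n1 (n2 - 1) = - sg n1 n2"
        using n by (auto simp: sg_def)
    qed
    moreover have "min (Suc n1) n2 = Suc n1" "min n1 (n2 - 1) = n1" "min n1 n2 = n1" using n by auto
    ultimately have "(sg (Suc n1) n2 * poly (Sd k1 k2 (min (Suc n1) n2) (p + 1)) y
      - m * sg n1 (n2 - 1) * poly (Sd k1 k2 (min n1 (n2 - 1)) (p + 1)) y) * u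
      = sg n1 n2 * (m * poly (Sd k1 k2 n1 (p + 1)) y - poly (Sd k1 k2 (Suc n1) (p + 1)) y) * u"
      by (simp only:) (simp add: algebra_simps)
    also have "\<dots> = sg n1 n2 * poly (Sd k1 k2 n1 p) y * (sqrt r2 * sqrt r2 * u)"
      unfolding key [symmetric] r2 by (simp add: mult_ac)
    also have "\<dots> = sqrt r2 * (sg n1 n2 * poly (Sd k1 k2 (min n1 n2) p) y * sqrt (poly (PiP \<alpha> p) y * w))"
      unfolding s \<open>min n1 n2 = n1\<close> by (simp add: mult_ac)
    finally show ?thesis .
  qed
  hence "sg (Suc n1) n2 * poly (Sd k1 k2 (min (Suc n1) n2) (p + 1)) y * u / N
      - m * sg n1 (n2 - 1) * poly (Sd k1 k2 (min n1 (n2 - 1)) (p + 1)) y * u / N = sqrt r2 * Tc k1 k2 n1 n2 y w"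
    unfolding mid diff_divide_distrib [symmetric] by (simp add: algebra_simps)
  hence "sqrt ((real n1 + 1) * (2 * k1 + real n1)) * Tc k1 k2 (Suc n1) n2 y w - sqrt m * Tc k1 k2 n1 (n2 - 1) y w
      = sqrt r2 * Tc k1 k2 n1 n2 y w"
    unfolding up [symmetric] down [symmetric] .
  thus ?thesis
    unfolding m_def r2_def \<alpha>_def .
qed

text \<open>This is \<open>Tc_raise\<close> with the tensor factors exchanged. Both terms on the
  left have an index sum of the opposite parity, so the signs of \<open>Tc_swap\<close> produce the
  minus on the right.\<close>

lemma Tc_lower:
  assumes k: "k1 > 0" "k2 > 0" and p: "p = int n1 - int n2"
    and nonneg: "p > 0 \<Longrightarrow> (of_int p - 1 + (k1 - k2 + 1/2))\<^sup>2 + y \<ge> 0 \<or> poly (PiP (k1 - k2 + 1/2) (p - 1)) y * w = 0"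
  shows "sqrt ((real n2 + 1) * (2 * k2 + real n2)) * Tc k1 k2 n1 (Suc n2) y w
      - sqrt (real n1 * (2 * k1 + real n1 - 1)) * Tc k1 k2 (n1 - 1) n2 y w
      = - sqrt ((of_int p - 1 + (k1 - k2 + 1/2))\<^sup>2 + y) * Tc k1 k2 n1 n2 y w"
proof -
  have sq: "(of_int (- p) + (k2 - k1 + 1/2))\<^sup>2 = (of_int p - 1 + (k1 - k2 + 1/2))\<^sup>2"
    by (simp add: power2_eq_square algebra_simps)
  have s: "(-1) ^ (n1 + n2) * (-1) ^ (n1 + n2) = (1 :: real)"
    by (simp add: mult_2 [symmetric] flip: power_add)
  have "sqrt ((real n2 + 1) * (2 * k2 + real n2)) * Tc k2 k1 (Suc n2) n1 y w
      - sqrt (real n1 * (2 * k1 + real n1 - 1)) * Tc k2 k1 n2 (n1 - 1) y w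
      = sqrt ((of_int (- p) + (k2 - k1 + 1/2))\<^sup>2 + y) * Tc k2 k1 n2 n1 y w"
  proof (rule Tc_raise [OF k(2,1)])
    have "PiP (k2 - k1 + 1/2) (- p + 1) = PiP (k1 - k2 + 1/2) (p - 1)"
      using PiP_uminus [of "k1 - k2 + 1/2" "p - 1"] by (simp add: algebra_simps)
    thus "0 \<le> (of_int (- p) + (k2 - k1 + 1/2))\<^sup>2 + y \<or> poly (PiP (k2 - k1 + 1/2) (- p + 1)) y * w = 0" if "- p < 0"
      using nonneg that unfolding sq by simp
  qed (simp add: p)
  also have "Tc k2 k1 (Suc n2) n1 y w = - ((-1) ^ (n1 + n2)) * Tc k1 k2 n1 (Suc n2) y w"
    by (simp add: Tc_swap [of k2 k1])
  also have "sqrt (real n1 * (2 * k1 + real n1 - 1)) * Tc k2 k1 n2 (n1 - 1) y w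
     = - ((-1) ^ (n1 + n2)) * (sqrt (real n1 * (2 * k1 + real n1 - 1)) * Tc k1 k2 (n1 - 1) n2 y w)"
    by (cases n1) (simp_all add: Tc_swap [of k2 k1])
  also have "Tc k2 k1 n2 n1 y w = (-1) ^ (n1 + n2) * Tc k1 k2 n1 n2 y w"
    by (rule Tc_swap)
  finally have "(-1) ^ (n1 + n2) * (sqrt ((real n2 + 1) * (2 * k2 + real n2)) * Tc k1 k2 n1 (Suc n2) y w
      - sqrt (real n1 * (2 * k1 + real n1 - 1)) * Tc k1 k2 (n1 - 1) n2 y w)
      = (-1) ^ (n1 + n2) * (- sqrt ((of_int p - 1 + (k1 - k2 + 1/2))\<^sup>2 + y) * Tc k1 k2 n1 n2 y w)"
    unfolding sq by (simp add: algebra_simps)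
  thus ?thesis by (rule mult_left_cancel [THEN iffD1, rotated]) simp
qed

section \<open>Orthonormality and completeness for a density with finitely many atoms\<close>

definition nrm :: "real \<Rightarrow> real \<Rightarrow> int \<Rightarrow> real" where
  "nrm k1 k2 p = Gamma (par_a k1 k2 p + par_b k1 k2 p) * Gamma (par_a k1 k2 p + par_c k1 k2 p) * Gamma (par_b k1 k2 p + par_c k1 k2 p)"

lemma par_sums_pos:
  assumes k1: "k1 > 0" and k2: "k2 > 0"
  shows "par_a k1 k2 p + par_b k1 k2 p > 0" "par_a k1 k2 p + par_c k1 k2 p > 0" "par_b k1 k2 p + par_c k1 k2 p > 0"
  using k1 k2 by (cases "p \<le> 0"; simp add: par_sums)+

lemma nN_sq:
  fixes k1 k2 :: real and n1 n2 :: nat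
  assumes k1: "k1 > 0" and k2: "k2 > 0"
  defines "p \<equiv> int n1 - int n2" and "n \<equiv> min n1 n2"
  shows "(nN k1 k2 n1 n2)\<^sup>2 = nrm k1 k2 p * (fact n *
      pochhammer (par_a k1 k2 p + par_b k1 k2 p) n * pochhammer (par_a k1 k2 p + par_c k1 k2 p) n
      * pochhammer (par_b k1 k2 p + par_c k1 k2 p) n)"
proof -
  have g: "Gamma z * pochhammer z n = Gamma (z + real n)" if "z > 0" for z :: real
  proof -
    have "z \<notin> \<int>\<^sub>\<le>\<^sub>0" using that by (auto elim!: nonpos_Ints_cases)
    thus ?thesis using Gamma_real_pos [OF that] by (simp add: pochhammer_Gamma)
  qed
  have "nrm k1 k2 p * (fact n * pochhammer (par_a k1 k2 p + par_b k1 k2 p) n * pochhammer (par_a k1 k2 p + par_c k1 k2 p) n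
      * pochhammer (par_b k1 k2 p + par_c k1 k2 p) n)
      = fact n * Gamma (par_a k1 k2 p + par_b k1 k2 p + real n) * Gamma (par_a k1 k2 p + par_c k1 k2 p + real n)
        * Gamma (par_b k1 k2 p + par_c k1 k2 p + real n)"
    unfolding nrm_def g [OF par_sums_pos(1) [OF k1 k2], symmetric] g [OF par_sums_pos(2) [OF k1 k2], symmetric] g [OF par_sums_pos(3) [OF k1 k2], symmetric]
    by (simp only: mult_ac)
  also have "\<dots> = fact n1 * fact n2 * Gamma (2 * k1 + real n1) * Gamma (2 * k2 + real n2)"
  proof (cases "p \<le> 0")
    case True
    hence "n = n1" "real_of_int p = real n1 - real n2" by (auto simp: n_def p_def)
    thus ?thesis
      using True Gamma_fact [of n2, where ?'a = real] by (simp add: par_sums add_ac)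
  next
    case False
    hence "n = n2" "real_of_int p = real n1 - real n2" by (auto simp: n_def p_def)
    thus ?thesis
      using False Gamma_fact [of n1, where ?'a = real] by (simp add: par_sums add_ac)
  qed
  also have "\<dots> = (nN k1 k2 n1 n2)\<^sup>2"
    using k1 k2 by (simp add: nN_def Gamma_real_pos add_pos_nonneg less_imp_le)
  finally show ?thesis ..
qed

text \<open>By the recurrence \<open>y * dh n\<close> is a combination of \<open>dh\<close>
  polynomials of neighbouring degrees. So vanishing on all \<open>dh n\<close> survives
  multiplication by powers of \<open>y\<close>, and \<open>dh 0 = 1\<close> then gives all
  monomials.\<close>

lemma poly_span:
  fixes E :: "real poly \<Rightarrow> complex"
  assumes add: "\<And>P Q. E (P + Q) = E P + E Q" and smult: "\<And>c P. E (smult c P) = of_real c * E P"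
    and zero: "\<And>n. E (dh n a b c) = 0"
  shows "E P = 0"
proof -
  have E0: "E 0 = 0" using smult [of 0 0] by simp
  have diff: "E (P - Q) = E P - E Q" for P Q using add [of P "- Q"] smult [of "-1" Q] by simp
  have X: "E (monom 1 k * dh n a b c) = 0" for k n
  proof (induction k arbitrary: n)
    case 0
    thus ?case by (simp add: zero one_pCons [symmetric] monom_0)
  next
    case (Suc k)
    define d e where "d = 2 * (real n)\<^sup>2 + real n * (2 * a + 2 * b + 2 * c - 1) + a * b + a * c + b * c"
      and "e = real n * (real n - 1 + a + b) * (real n - 1 + a + c) * (real n - 1 + b + c)"
    have rec: "dh (Suc n) a b c = [:d, -1:] * dh n a b c - smult e (dh (n - 1) a b c)"
      unfolding d_def e_def by (rule dh_Suc)
    have "monom 1 (Suc k) * dh n a b c = monom 1 k * (smult d (dh n a b c) - dh (Suc n) a b c - smult e (dh (n - 1) a b c))"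
      by (subst poly_eq_poly_eq_iff [symmetric]) (simp add: fun_eq_iff rec poly_monom algebra_simps)
    thus ?case by (simp add: right_diff_distrib diff smult Suc.IH)
  qed
  have mon: "E (monom 1 k) = 0" for k using X [of k 0] by simp
  have "E (\<Sum>i\<in>I. smult (coeff P i) (monom 1 i)) = 0" if "finite I" for I
    using that by induction (simp_all add: E0 add smult mon)
  moreover have "(\<Sum>i\<le>degree P. smult (coeff P i) (monom 1 i)) = P"
    using poly_as_sum_of_monoms [of P] by (simp add: smult_monom)
  ultimately show ?thesis by (metis finite_atMost)
qed

text \<open>The three cases of the theorem as one: \<open>J\<close> is empty, a single point, or the
  index set of the discrete series. \<open>moments\<close> is the analytic input, with
  \<open>2 * k1 = B + \<alpha>\<close> and \<open>2 * k2 = B + 1 - \<alpha>\<close>.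
  \<open>adm\<close> excludes the configuration in which the weight has a nonintegrable singularity
  at 0.\<close>

locale cdh_data =
  fixes k1 k2 :: real and J :: "'j set" and ya A :: "'j \<Rightarrow> real"
  assumes k1: "k1 > 0" and k2: "k2 > 0" and J: "finite J" and ya_inj: "inj_on ya J"
    and ya_neg: "j \<in> J \<Longrightarrow> ya j < 0" and A_pos: "j \<in> J \<Longrightarrow> A j > 0"
    and adm: "k1 + k2 - 1/2 \<noteq> 0 \<or> cos (2 * pi * (k1 - k2 + 1/2)) < 1"
    and moments: "(\<integral>x. poly (phi k (k1 + k2 - 1/2)) (x\<^sup>2) * wt (k1 - k2 + 1/2) (k1 + k2 - 1/2) x \<partial>half_line)
        + (\<Sum>j\<in>J. A j * poly (phi k (k1 + k2 - 1/2)) (ya j)) = Gamma (2 * k1 + real k) * Gamma (2 * k2 + real k)"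
    and PiP_ya_nonneg: "j \<in> J \<Longrightarrow> poly (PiP (k1 - k2 + 1/2) p) (ya j) \<ge> 0"
begin

abbreviation "\<alpha> \<equiv> k1 - k2 + 1/2"
abbreviation "B \<equiv> k1 + k2 - 1/2"
abbreviation "w \<equiv> wt \<alpha> B"

lemma B: "B > - 1/2" "B > -1"
  using k1 k2 by auto

lemma poly_w_bound:
  obtains C where "C \<ge> 0" and "\<And>x. x > 0 \<Longrightarrow> \<bar>poly P (x\<^sup>2)\<bar> * w x \<le> C * exp (- x)"
proof -
  obtain C where C: "\<And>x. x > 0 \<Longrightarrow> w x \<le> C * exp (- 2 * x)"
    using wt_exp_bound [OF B(2) adm] by blast
  obtain D where D: "\<forall>x\<ge>0. \<bar>poly (pcompose P [:0, 0, 1:]) x\<bar> * exp (- 1 * x) \<le> D"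
    using poly_exp_bounded [of 1 "pcompose P [:0, 0, 1:]"] by auto
  have C0: "C > 0"
  proof -
    have "0 < C * exp (- 2 * 1)" using wt_pos [of 1 \<alpha> B] C [of 1] by simp
    thus ?thesis by (simp add: zero_less_mult_iff)
  qed
  have D0: "D \<ge> 0"
  proof -
    have "0 \<le> \<bar>poly (pcompose P [:0, 0, 1:]) 0\<bar> * exp (- 1 * 0)" by simp
    also have "\<dots> \<le> D" using D by blast
    finally show ?thesis .
  qed
  have "\<bar>poly P (x\<^sup>2)\<bar> * w x \<le> (C * D) * exp (- x)" if x: "x > 0" for x
  proof -
    have "\<bar>poly P (x\<^sup>2)\<bar> * w x \<le> \<bar>poly P (x\<^sup>2)\<bar> * (C * exp (- 2 * x))"
      by (intro mult_left_mono C x) auto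
    also have "\<dots> = C * (\<bar>poly (pcompose P [:0, 0, 1:]) x\<bar> * exp (- 1 * x)) * exp (- x)"
      by (simp add: poly_pcompose power2_eq_square mult_ac flip: exp_add)
    also have "\<dots> \<le> C * D * exp (- x)"
      using C0 D x by (intro mult_right_mono mult_left_mono) auto
    finally show ?thesis .
  qed
  thus ?thesis using C0 D0 by (intro that [of "C * D"]) auto
qed

lemma poly_sq_measurable [measurable]: "(\<lambda>x. poly P (x\<^sup>2)) \<in> borel_measurable half_line" for P :: "real poly"
  by (intro half_line_measurable borel_measurable_continuous_onI continuous_intros)

lemma poly_w_integrable: "integrable half_line (\<lambda>x. poly P (x\<^sup>2) * w x)"
proof -
  obtain C where "C \<ge> 0" "\<And>x. x > 0 \<Longrightarrow> \<bar>poly P (x\<^sup>2)\<bar> * w x \<le> C * exp (- x)"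
    using poly_w_bound [of P] by blast
  thus ?thesis
    using wt_pos by (intro half_line_exp_bound_integrable [of 1 _ C]) (auto simp: abs_mult less_imp_le)
qed

definition L :: "real poly \<Rightarrow> real" where
  "L P = (\<integral>x. poly P (x\<^sup>2) * w x \<partial>half_line) + (\<Sum>j\<in>J. A j * poly P (ya j))"

lemma L_add: "L (P + Q) = L P + L Q"
  using poly_w_integrable [of P] poly_w_integrable [of Q]
  by (simp add: L_def distrib_right distrib_left sum.distrib)

lemma L_smult: "L (smult c P) = c * L P"
  by (simp add: L_def distrib_left sum_distrib_left mult.assoc mult.left_commute [of _ c])

text \<open>The factor \<open>(v + N)^2 + y\<close> equals \<open>(B + k)^2 + y\<close> plus a
  constant, so a factor of \<open>phi N v\<close> is traded for one more factor of
  \<open>phi k B\<close> and a scalar. It is \<open>u + v = 1\<close> that combines the two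
  contributions into a single product.\<close>

lemma L_phi:
  assumes uv: "u + v = 1" and vals: "\<And>k. L (phi k B) = Gamma (B + u + real k) * Gamma (B + v + real k)"
    and pos: "B + u > 0" "B + v > 0"
  shows "L (phi N v * phi k B) = Gamma (B + u + real k) * fact N * Gamma (B + v + real k + real N)"
proof (induction N arbitrary: k)
  case 0
  show ?case by (simp add: vals)
next
  case (Suc N)
  define X Y where "X = B + u + real k" and "Y = B + v + real k + real N"
  have XY: "X > 0" "Y > 0" using pos by (auto simp: X_def Y_def)
  have "phi (Suc N) v * phi k B = phi N v * phi (Suc k) B + smult ((v + real N)\<^sup>2 - (B + real k)\<^sup>2) (phi N v * phi k B)"
    by (subst poly_eq_poly_eq_iff [symmetric]) (simp add: fun_eq_iff phi_Suc algebra_simps)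
  hence "L (phi (Suc N) v * phi k B) = L (phi N v * phi (Suc k) B) + ((v + real N)\<^sup>2 - (B + real k)\<^sup>2) * L (phi N v * phi k B)"
    by (simp only: L_add L_smult)
  also have "L (phi N v * phi (Suc k) B) = X * Gamma X * fact N * (Y * Gamma Y)"
    unfolding Suc.IH using Gamma_plus1_pos [OF XY(1)] Gamma_plus1_pos [OF XY(2)] by (simp add: X_def Y_def add_ac)
  also have "L (phi N v * phi k B) = Gamma X * fact N * Gamma Y"
    unfolding Suc.IH by (simp add: X_def Y_def)
  also have "X * Gamma X * fact N * (Y * Gamma Y) + ((v + real N)\<^sup>2 - (B + real k)\<^sup>2) * (Gamma X * fact N * Gamma Y)
      = Gamma X * fact N * Gamma Y * (X * Y + ((v + real N)\<^sup>2 - (B + real k)\<^sup>2))"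
    by (simp add: algebra_simps)
  also have "X * Y + ((v + real N)\<^sup>2 - (B + real k)\<^sup>2) = Y * (real N + 1)"
  proof -
    have u: "u = 1 - v" using uv by simp
    have "(b + (1 - v) + r) * (b + v + r + m) + ((v + m)\<^sup>2 - (b + r)\<^sup>2) = (b + v + r + m) * (m + 1)" for b r m :: real
      by (simp add: power2_eq_square algebra_simps)
    thus ?thesis unfolding X_def Y_def u .
  qed
  also have "Gamma X * fact N * Gamma Y * (Y * (real N + 1)) = Gamma X * fact (Suc N) * Gamma (Y + 1)"
    using Gamma_plus1_pos [OF XY(2)] by simp
  finally show ?case by (simp add: X_def Y_def add_ac)
qed

lemma L_PiP_phi:
  fixes p :: int
  defines "a \<equiv> par_a k1 k2 p" and "c \<equiv> par_c k1 k2 p"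
  shows "L (PiP \<alpha> p * phi k B) = Gamma (a + B + real k) * Gamma (a + c) * Gamma (B + c + real k)"
proof (cases "p \<le> 0")
  case True
  have "L (phi (nat (- p)) (1 - \<alpha>) * phi k B)
      = Gamma (B + \<alpha> + real k) * fact (nat (- p)) * Gamma (B + (1 - \<alpha>) + real k + real (nat (- p)))"
    using k1 k2 moments by (intro L_phi) (auto simp: L_def)
  moreover have "Gamma (a + c) = fact (nat (- p))"
    using True Gamma_fact [of "nat (- p)", where ?'a = real] by (simp add: a_def c_def par_sums)
  ultimately show ?thesis
    using True by (cases "p = 0") (simp_all add: PiP_def a_def c_def par_a_def par_c_def add_ac)
next
  case False
  have "L (phi (nat p) \<alpha> * phi k B)
      = Gamma (B + (1 - \<alpha>) + real k) * fact (nat p) * Gamma (B + \<alpha> + real k + real (nat p))"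
    using k1 k2 moments by (intro L_phi) (auto simp: L_def mult.commute)
  moreover have "Gamma (a + c) = fact (nat p)"
    using False Gamma_fact [of "nat p", where ?'a = real] by (simp add: a_def c_def par_sums)
  ultimately show ?thesis
    using False by (simp add: PiP_def a_def c_def par_a_def par_c_def add_ac)
qed

text \<open>By symmetry \<open>B\<close> may serve as the parameter of expansion. The Pochhammer
  factors then complete every Gamma product to the same value, and the alternating sum of binomial
  coefficients that remains is 0.\<close>

lemma L_PiP_Sd_zero:
  assumes "n > 0"
  shows "L (PiP \<alpha> p * Sd k1 k2 n p) = 0"
proof -
  define a c where "a = par_a k1 k2 p" and "c = par_c k1 k2 p"
  have ac: "a + B > 0" "B + c > 0" using par_sums_pos [OF k1 k2, of p] by (auto simp: a_def c_def par_b_def)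
  have "Sd k1 k2 n p = dh n B a c"
    using dh_swap(1) [of n B a c] by (simp add: Sd_def a_def c_def par_b_def)
  also have "\<dots> = (\<Sum>k\<le>n. smult ((-1) ^ k * real (n choose k) * pochhammer (B + a + real k) (n - k)
      * pochhammer (B + c + real k) (n - k)) (phi k B))"
    by (subst poly_eq_poly_eq_iff [symmetric]) (auto simp: poly_dh_expansion poly_sum fun_eq_iff mult_ac)
  finally have "PiP \<alpha> p * Sd k1 k2 n p = (\<Sum>k\<le>n. smult ((-1) ^ k * real (n choose k) * pochhammer (B + a + real k) (n - k)
      * pochhammer (B + c + real k) (n - k)) (PiP \<alpha> p * phi k B))"
    by (simp add: sum_distrib_left)
  hence "L (PiP \<alpha> p * Sd k1 k2 n p) = (\<Sum>k\<le>n. ((-1) ^ k * real (n choose k) * pochhammer (B + a + real k) (n - k)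
      * pochhammer (B + c + real k) (n - k)) * (Gamma (a + B + real k) * Gamma (a + c) * Gamma (B + c + real k)))"
    by (simp add: poly_functional_sum [OF L_add L_smult] L_smult L_PiP_phi a_def c_def)
  also have "\<dots> = (\<Sum>k\<le>n. (-1) ^ k * real (n choose k) * (Gamma (a + B + real n) * Gamma (a + c) * Gamma (B + c + real n)))"
  proof (intro sum.cong refl)
    fix k assume "k \<in> {..n}"
    hence k: "k \<le> n" by simp
    have g: "pochhammer (z + real k) (n - k) * Gamma (z + real k) = Gamma (z + real n)" if "z > 0" for z :: real
    proof -
      have "z + real k > 0" using that by simp
      hence "z + real k \<notin> \<int>\<^sub>\<le>\<^sub>0" by (auto elim!: nonpos_Ints_cases)
      moreover have "Gamma (z + real k) \<noteq> 0" using Gamma_real_pos [OF \<open>z + real k > 0\<close>] by simp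
      ultimately show ?thesis using k by (simp add: pochhammer_Gamma of_nat_diff)
    qed
    show "((-1) ^ k * real (n choose k) * pochhammer (B + a + real k) (n - k)
      * pochhammer (B + c + real k) (n - k)) * (Gamma (a + B + real k) * Gamma (a + c) * Gamma (B + c + real k))
      = (-1) ^ k * real (n choose k) * (Gamma (a + B + real n) * Gamma (a + c) * Gamma (B + c + real n))"
      unfolding g [OF ac(1), symmetric] g [OF ac(2), symmetric] add.commute [of B a] by (simp only: mult_ac)
  qed
  also have "\<dots> = (\<Sum>k\<le>n. (-1) ^ k * real (n choose k)) * (Gamma (a + B + real n) * Gamma (a + c) * Gamma (B + c + real n))"
    by (simp only: sum_distrib_right)
  also have "(\<Sum>k\<le>n. (-1) ^ k * real (n choose k)) = 0"
    using choose_alternating_sum [OF assms, where ?'a = real] .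
  finally show ?thesis by simp
qed

lemma L_orthogonal:
  "L (PiP \<alpha> p * (Sd k1 k2 m p * Sd k1 k2 n p)) = (if m = n then nrm k1 k2 p * (fact n *
      pochhammer (par_a k1 k2 p + par_b k1 k2 p) n * pochhammer (par_a k1 k2 p + par_c k1 k2 p) n
      * pochhammer (par_b k1 k2 p + par_c k1 k2 p) n) else 0)"
proof -
  have "L (PiP \<alpha> p * (dh m a b c * dh n a b c)) = (if m = n then L (PiP \<alpha> p * 1) *
     (fact n * pochhammer (a + b) n * pochhammer (a + c) n * pochhammer (b + c) n) else 0)"
    if "a = par_a k1 k2 p" "b = par_b k1 k2 p" "c = par_c k1 k2 p" for a b c
    using L_PiP_Sd_zero unfolding that Sd_def
    by (intro dh_orthogonal [of "\<lambda>P. L (PiP \<alpha> p * P)"]) (auto simp: distrib_left L_add L_smult)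
  moreover have "L (PiP \<alpha> p * 1) = nrm k1 k2 p"
    using L_PiP_phi [of p 0] by (simp add: nrm_def par_b_def)
  ultimately show ?thesis by (simp add: Sd_def)
qed

lemma PiP_pos: "poly (PiP \<alpha> p) (x\<^sup>2) > 0" if "x > 0"
  unfolding PiP_def using that by (auto simp: poly_phi intro!: prod_pos add_nonneg_pos)

text \<open>For a common \<open>p\<close> the two signs cancel and the two equal roots multiply to
  \<open>PiP\<close> times the weight, so orthonormality becomes a statement about the functional
  \<open>L\<close>.\<close>

lemma Tc_mult:
  assumes "int n1 - int n2 = p" "int m1 - int m2 = p" "poly (PiP \<alpha> p) y * v \<ge> 0"
  shows "Tc k1 k2 n1 n2 y v * Tc k1 k2 m1 m2 y v = poly (PiP \<alpha> p * (Sd k1 k2 (min n1 n2) p * Sd k1 k2 (min m1 m2) p)) y * v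
      / (nN k1 k2 n1 n2 * nN k1 k2 m1 m2)"
proof -
  have "sg n1 n2 * sg m1 m2 = 1"
  proof (cases "p \<ge> 0")
    case False
    hence "n2 - n1 = m2 - m1" "n1 < n2" "m1 < m2" using assms(1,2) by auto
    thus ?thesis by (simp add: sg_def flip: power_add mult_2)
  qed (use assms(1,2) in \<open>auto simp: sg_def\<close>)
  moreover have "sqrt (poly (PiP \<alpha> p) y * v) * sqrt (poly (PiP \<alpha> p) y * v) = poly (PiP \<alpha> p) y * v"
    using assms(3) by simp
  moreover have "Tc k1 k2 n1 n2 y v * Tc k1 k2 m1 m2 y v = (sg n1 n2 * sg m1 m2) * poly (Sd k1 k2 (min n1 n2) p) y * poly (Sd k1 k2 (min m1 m2) p) y
     * (sqrt (poly (PiP \<alpha> p) y * v) * sqrt (poly (PiP \<alpha> p) y * v)) / (nN k1 k2 n1 n2 * nN k1 k2 m1 m2)"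
    using assms(1,2) by (simp add: Tc_def Let_def mult_ac)
  ultimately show ?thesis by (simp add: mult_ac)
qed

lemma Tc_orthonormal:
  assumes "int n1 - int n2 = int m1 - int m2"
  shows "(\<integral>x. Tc k1 k2 n1 n2 (x\<^sup>2) (w x) * Tc k1 k2 m1 m2 (x\<^sup>2) (w x) \<partial>half_line)
      + (\<Sum>j\<in>J. Tc k1 k2 n1 n2 (ya j) (A j) * Tc k1 k2 m1 m2 (ya j) (A j)) = (if n1 = m1 \<and> n2 = m2 then 1 else 0)"
proof -
  define p where "p = int n1 - int n2"
  define P where "P = PiP \<alpha> p * (Sd k1 k2 (min n1 n2) p * Sd k1 k2 (min m1 m2) p)"
  define N where "N = nN k1 k2 n1 n2 * nN k1 k2 m1 m2"
  have "(\<integral>x. Tc k1 k2 n1 n2 (x\<^sup>2) (w x) * Tc k1 k2 m1 m2 (x\<^sup>2) (w x) \<partial>half_line) = (\<integral>x. poly P (x\<^sup>2) * w x / N \<partial>half_line)"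
  proof (rule Bochner_Integration.integral_cong [OF refl])
    fix x assume "x \<in> space half_line"
    hence "x > 0" by (simp add: half_line_def space_restrict_space)
    thus "Tc k1 k2 n1 n2 (x\<^sup>2) (w x) * Tc k1 k2 m1 m2 (x\<^sup>2) (w x) = poly P (x\<^sup>2) * w x / N"
      unfolding P_def N_def using assms PiP_pos [of x p] wt_pos [of x \<alpha> B]
      by (intro Tc_mult) (auto simp: p_def)
  qed
  moreover have "(\<Sum>j\<in>J. Tc k1 k2 n1 n2 (ya j) (A j) * Tc k1 k2 m1 m2 (ya j) (A j)) = (\<Sum>j\<in>J. poly P (ya j) * A j / N)"
    unfolding P_def N_def using assms PiP_ya_nonneg A_pos
    by (intro sum.cong refl Tc_mult) (auto simp: p_def less_imp_le)
  ultimately have "(\<integral>x. Tc k1 k2 n1 n2 (x\<^sup>2) (w x) * Tc k1 k2 m1 m2 (x\<^sup>2) (w x) \<partial>half_line)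
      + (\<Sum>j\<in>J. Tc k1 k2 n1 n2 (ya j) (A j) * Tc k1 k2 m1 m2 (ya j) (A j)) = L P / N"
    by (simp add: L_def add_divide_distrib sum_divide_distrib mult.commute)
  also have "\<dots> = (if n1 = m1 \<and> n2 = m2 then 1 else 0)"
  proof (cases "min n1 n2 = min m1 m2")
    case True
    hence eq: "n1 = m1" "n2 = m2" using assms by auto
    have "L P = (nN k1 k2 n1 n2)\<^sup>2"
      unfolding P_def L_orthogonal nN_sq [OF k1 k2] p_def eq by simp
    thus ?thesis using eq nN_pos [OF k1 k2, of n1 n2] by (simp add: N_def power2_eq_square)
  next
    case False
    hence "L P = 0" unfolding P_def L_orthogonal by simp
    thus ?thesis using False by auto
  qed
  finally show ?thesis .
qed

text \<open>A polynomial vanishing at all atoms isolates the continuous part, where the even moments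
  of an exponentially decaying function vanish. A polynomial vanishing at all atoms but one then
  isolates that atom, unless \<open>PiP\<close> is zero there and hides it from this
  \<open>p\<close>.\<close>

lemma Tc_total:
  fixes \<phi> :: "real \<Rightarrow> complex" and c :: "'j \<Rightarrow> complex"
  assumes \<phi> [measurable]: "\<phi> \<in> borel_measurable half_line" and \<phi>2: "integrable half_line (\<lambda>x. (cmod (\<phi> x))\<^sup>2)"
    and zero: "\<And>n1 n2. int n1 - int n2 = p \<Longrightarrow>
      (\<integral>x. of_real (Tc k1 k2 n1 n2 (x\<^sup>2) (w x)) * \<phi> x \<partial>half_line) + (\<Sum>j\<in>J. of_real (Tc k1 k2 n1 n2 (ya j) (A j)) * c j) = 0"
  shows "AE x in half_line. \<phi> x = 0" and "\<And>j. j \<in> J \<Longrightarrow> poly (PiP \<alpha> p) (ya j) \<noteq> 0 \<Longrightarrow> c j = 0"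
proof -
  define u where "u x = sqrt (poly (PiP \<alpha> p) (x\<^sup>2) * w x)" for x
  define m where "m j = sqrt (poly (PiP \<alpha> p) (ya j) * A j)" for j
  have [measurable]: "u \<in> borel_measurable half_line" unfolding u_def by measurable
  have space: "x > 0" if "x \<in> space half_line" for x
    using that by (simp add: half_line_def space_restrict_space)
  have u_sq: "(u x)\<^sup>2 = poly (PiP \<alpha> p) (x\<^sup>2) * w x" and u_pos: "u x > 0" if "x > 0" for x
    using PiP_pos [OF that, of p] wt_pos [OF that, of \<alpha> B] by (simp_all add: u_def)
  \<comment> \<open>\<open>\<phi>\<close> is merely square integrable, so the decay must come from
    \<open>u\<close>: its square times a polynomial is at most of order \<open>exp (- x)\<close>,
    and the factor \<open>exp (x / 4)\<close> leaves it square integrable.\<close>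
  have bound: "integrable half_line (\<lambda>x. exp (x / 4) * cmod (of_real (poly P (x\<^sup>2) * u x) * \<phi> x))" for P
  proof -
    obtain C where C: "C \<ge> 0" "\<And>x. x > 0 \<Longrightarrow> \<bar>poly (P * P * PiP \<alpha> p) (x\<^sup>2)\<bar> * w x \<le> C * exp (- x)"
      using poly_w_bound [of "P * P * PiP \<alpha> p"] by blast
    have [measurable]: "(\<lambda>x. x) \<in> borel_measurable half_line" by (rule half_line_measurable) simp
    have sq: "integrable half_line (\<lambda>x. (exp (x / 4) * poly P (x\<^sup>2) * u x)\<^sup>2)"
    proof (rule half_line_exp_bound_integrable [of "1/2" _ C])
      fix x :: real assume x: "x > 0"
      have "(exp (x / 4) * poly P (x\<^sup>2) * u x)\<^sup>2 = exp (x / 2) * (poly (P * P * PiP \<alpha> p) (x\<^sup>2) * w x)"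
        using u_sq [OF x] by (simp add: power_mult_distrib power2_eq_square [of "exp _"] power2_eq_square [of "poly P _"] mult_ac flip: exp_add)
      also have "\<dots> \<le> exp (x / 2) * (\<bar>poly (P * P * PiP \<alpha> p) (x\<^sup>2)\<bar> * w x)"
        using wt_pos [OF x, of \<alpha> B] by (intro mult_left_mono mult_right_mono) auto
      also have "\<dots> \<le> exp (x / 2) * (C * exp (- x))"
        using C x by (intro mult_left_mono) auto
      also have "\<dots> = C * exp (- (1/2) * x)" by (simp add: mult.left_commute flip: exp_add)
      finally show "norm ((exp (x / 4) * poly P (x\<^sup>2) * u x)\<^sup>2) \<le> C * exp (- (1/2) * x)" by simp
    qed simp_all
    show ?thesis
    proof (rule Bochner_Integration.integrable_bound [OF Bochner_Integration.integrable_add [OF sq \<phi>2]])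
      show "AE x in half_line. norm (exp (x / 4) * cmod (of_real (poly P (x\<^sup>2) * u x) * \<phi> x))
          \<le> norm ((exp (x / 4) * poly P (x\<^sup>2) * u x)\<^sup>2 + (cmod (\<phi> x))\<^sup>2)"
      proof (rule AE_I2)
        fix x
        define z where "z = exp (x / 4) * poly P (x\<^sup>2) * u x"
        have "norm (exp (x / 4) * cmod (of_real (poly P (x\<^sup>2) * u x) * \<phi> x)) = cmod (of_real z) * cmod (\<phi> x)"
          by (simp add: z_def norm_mult abs_mult mult.assoc)
        also have "\<dots> \<le> (cmod (of_real z))\<^sup>2 + (cmod (\<phi> x))\<^sup>2"
          by (rule cmod_mult_le)
        also have "\<dots> = norm (z\<^sup>2 + (cmod (\<phi> x))\<^sup>2)" by simp
        finally show "norm (exp (x / 4) * cmod (of_real (poly P (x\<^sup>2) * u x) * \<phi> x))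
          \<le> norm ((exp (x / 4) * poly P (x\<^sup>2) * u x)\<^sup>2 + (cmod (\<phi> x))\<^sup>2)"
          unfolding z_def .
      qed
    qed measurable
  qed
  have int: "integrable half_line (\<lambda>x. of_real (poly P (x\<^sup>2) * u x) * \<phi> x)" for P
  proof (rule Bochner_Integration.integrable_bound [OF bound [of P]])
    show "AE x in half_line. norm (of_real (poly P (x\<^sup>2) * u x) * \<phi> x)
        \<le> norm (exp (x / 4) * cmod (of_real (poly P (x\<^sup>2) * u x) * \<phi> x))"
      by (intro AE_I2) (auto dest: space simp: abs_mult mult_le_cancel_right1)
  qed measurable
  define E where "E P = (\<integral>x. of_real (poly P (x\<^sup>2) * u x) * \<phi> x \<partial>half_line) + (\<Sum>j\<in>J. of_real (poly P (ya j) * m j) * c j)" for P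
  have E: "E P = 0" for P
  proof (rule poly_span)
    show "E (P + Q) = E P + E Q" for P Q
      using int [of P] int [of Q] by (simp add: E_def distrib_right sum.distrib flip: Bochner_Integration.integral_add)
    show "E (smult r P) = of_real r * E P" for r P
      by (simp add: E_def distrib_left sum_distrib_left mult.assoc)
    show "E (dh n (par_a k1 k2 p) (par_b k1 k2 p) (par_c k1 k2 p)) = 0" for n
    proof -
      \<comment> \<open>The pair with difference \<open>p\<close> and minimum \<open>n\<close>; this
        is how every degree occurs for every \<open>p\<close>.\<close>
      define n1 n2 where "n1 = n + nat p" and "n2 = n + nat (- p)"
      have n: "int n1 - int n2 = p" "min n1 n2 = n" by (auto simp: n1_def n2_def)
      define r where "r = sg n1 n2 / nN k1 k2 n1 n2"
      have r: "r \<noteq> 0" using nN_pos [OF k1 k2, of n1 n2] by (simp add: r_def sg_def)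
      have T: "Tc k1 k2 n1 n2 y v = r * (poly (Sd k1 k2 n p) y * sqrt (poly (PiP \<alpha> p) y * v))" for y v
        using n by (simp add: Tc_def Let_def r_def)
      have "of_real r * E (Sd k1 k2 n p) = 0"
        using zero [OF n(1)] by (simp add: T E_def u_def m_def distrib_left sum_distrib_left mult.assoc)
      thus ?thesis using r by (simp add: Sd_def)
    qed
  qed
  define Q where "Q = (\<Prod>j\<in>J. [:- ya j, 1:])"
  \<comment> \<open>The atoms sit at negative points, so \<open>Q\<close> has no zero on the half
    line and can be divided out at the end.\<close>
  have Q_pos: "poly Q (x\<^sup>2) > 0" for x
    unfolding Q_def poly_prod using less_le_trans [OF ya_neg zero_le_power2] by (intro prod_pos) auto
  have [measurable]: "(\<lambda>x. complex_of_real (poly Q (x\<^sup>2) * u x) * \<phi> x) \<in> borel_measurable half_line" by measurable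
  have "AE x in half_line. of_real (poly Q (x\<^sup>2) * u x) * \<phi> x = 0"
  proof (rule half_line_even_moments_zero [of _ "1/4"])
    show "integrable half_line (\<lambda>x. exp (1 / 4 * x) * cmod (of_real (poly Q (x\<^sup>2) * u x) * \<phi> x))"
      using bound [of Q] by simp
    show "(\<integral>x. of_real (x ^ (2 * n)) * (of_real (poly Q (x\<^sup>2) * u x) * \<phi> x) \<partial>half_line) = 0" for n
    proof -
      have "poly Q (ya j) = 0" if "j \<in> J" for j
        using that J by (auto simp: Q_def poly_prod)
      hence "E (monom 1 n * Q) = (\<integral>x. of_real (poly (monom 1 n * Q) (x\<^sup>2) * u x) * \<phi> x \<partial>half_line)"
        by (simp add: E_def)
      also have "\<dots> = (\<integral>x. of_real (x ^ (2 * n)) * (of_real (poly Q (x\<^sup>2) * u x) * \<phi> x) \<partial>half_line)"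
        by (intro Bochner_Integration.integral_cong) (auto simp: poly_monom power_mult)
      finally show ?thesis using E by simp
    qed
  qed simp_all
  thus ae: "AE x in half_line. \<phi> x = 0"
  proof (rule AE_mp, intro AE_I2 impI)
    fix x assume "x \<in> space half_line" "of_real (poly Q (x\<^sup>2) * u x) * \<phi> x = 0"
    thus "\<phi> x = 0" using Q_pos [of x] u_pos [OF space, of x] by simp
  qed
  fix j assume j: "j \<in> J" and nz: "poly (PiP \<alpha> p) (ya j) \<noteq> 0"
  define P where "P = (\<Prod>i\<in>J - {j}. [:- ya i, 1:])"
  have P0: "poly P (ya i) = 0" if "i \<in> J" "i \<noteq> j" for i
    using that J by (auto simp: P_def poly_prod)
  have "poly P (ya j) \<noteq> 0"
    using J j ya_inj by (auto simp: P_def poly_prod inj_on_def)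
  have "(\<integral>x. of_real (poly P (x\<^sup>2) * u x) * \<phi> x \<partial>half_line) = (\<integral>x. 0 \<partial>half_line)"
    using ae by (intro integral_cong_AE) (auto elim: eventually_mono)
  hence "0 = (\<Sum>i\<in>J. of_real (poly P (ya i) * m i) * c i)" using E [of P] by (simp add: E_def)
  also have "\<dots> = (\<Sum>i\<in>J. if i = j then of_real (poly P (ya j) * m j) * c j else 0)"
    using P0 by (intro sum.cong) auto
  also have "\<dots> = of_real (poly P (ya j) * m j) * c j" using J j by simp
  finally show "c j = 0" using \<open>poly P (ya j) \<noteq> 0\<close> nz A_pos [OF j] by (simp add: m_def)
qed

end

section \<open>The decomposition\<close>

definition gsum :: "('i \<Rightarrow> 'k vec) \<Rightarrow> 'i vec \<Rightarrow> 'k vec" where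
  "gsum g v = (\<lambda>k. \<Sum>i | v i \<noteq> 0. v i * g i k)"

text \<open>\<open>lin_ext\<close> stays within one index type, whereas \<open>gsum\<close> also
  expresses the map out of the tensor product. Intertwining then reduces to basis vectors by
  associativity of linear extensions, \<open>gsum_gsum\<close>.\<close>

lemma lin_ext_gsum: "lin_ext T = gsum T"
  by (simp add: lin_ext_def gsum_def fun_eq_iff)

lemma gsum_superset:
  assumes "finite S" "\<And>i. v i \<noteq> 0 \<Longrightarrow> i \<in> S"
  shows "gsum g v k = (\<Sum>i\<in>S. v i * g i k)"
  unfolding gsum_def using assms by (intro sum.mono_neutral_left) auto

lemma gsum_support:
  assumes "gsum T v k \<noteq> 0"
  shows "\<exists>i. v i \<noteq> 0 \<and> T i k \<noteq> 0"
proof (rule ccontr)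
  assume "\<nexists>i. v i \<noteq> 0 \<and> T i k \<noteq> 0"
  hence "gsum T v k = 0" unfolding gsum_def by (intro sum.neutral) auto
  thus False using assms by simp
qed

lemma gsum_fin_comb:
  assumes v: "v \<in> fin_comb" and T: "\<And>i. T i \<in> fin_comb"
  shows "gsum T v \<in> fin_comb"
proof -
  have "{k. gsum T v k \<noteq> 0} \<subseteq> (\<Union>i\<in>{i. v i \<noteq> 0}. {k. T i k \<noteq> 0})"
    using gsum_support [of T v] by blast
  moreover have "finite (\<Union>i\<in>{i. v i \<noteq> 0}. {k. T i k \<noteq> 0})"
    using v T by (auto simp: fin_comb_def)
  ultimately show ?thesis by (auto simp: fin_comb_def intro: finite_subset)
qed

lemma gsum_gsum:
  assumes v: "v \<in> fin_comb" and T: "\<And>i. T i \<in> fin_comb"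
  shows "gsum g (gsum T v) = gsum (\<lambda>i. gsum g (T i)) v"
proof
  fix k
  define S where "S = {i. v i \<noteq> 0}"
  define R where "R = (\<Union>i\<in>S. {k. T i k \<noteq> 0})"
  have fin: "finite S" "finite R" using v T by (auto simp: fin_comb_def S_def R_def)
  have "gsum g (gsum T v) k = (\<Sum>l\<in>R. gsum T v l * g l k)"
    using gsum_support [of T v] by (intro gsum_superset fin) (auto simp: R_def S_def)
  also have "\<dots> = (\<Sum>l\<in>R. \<Sum>i\<in>S. v i * T i l * g l k)"
    by (simp add: gsum_def S_def sum_distrib_right)
  also have "\<dots> = (\<Sum>i\<in>S. \<Sum>l\<in>R. v i * T i l * g l k)"
    by (rule sum.swap)
  also have "\<dots> = (\<Sum>i\<in>S. v i * gsum g (T i) k)"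
  proof (intro sum.cong refl)
    fix i assume "i \<in> S"
    hence "gsum g (T i) k = (\<Sum>l\<in>R. T i l * g l k)"
      by (intro gsum_superset fin) (auto simp: R_def)
    thus "(\<Sum>l\<in>R. v i * T i l * g l k) = v i * gsum g (T i) k"
      by (simp add: sum_distrib_left mult.assoc)
  qed
  finally show "gsum g (gsum T v) k = gsum (\<lambda>i. gsum g (T i)) v k"
    by (simp add: gsum_def S_def)
qed

lemma gsum_ket: "gsum g (svec c (ket i)) = svec c (g i)"
proof
  fix k
  have "gsum g (svec c (ket i)) k = (\<Sum>l\<in>{i}. svec c (ket i) l * g l k)"
    by (rule gsum_superset) (auto simp: svec_def ket_def split: if_splits)
  thus "gsum g (svec c (ket i)) k = svec c (g i) k"
    by (simp add: svec_def ket_def)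
qed

lemma gsum_avec:
  assumes "v \<in> fin_comb" "w \<in> fin_comb"
  shows "gsum g (avec v w) = avec (gsum g v) (gsum g w)"
proof
  fix k
  define S where "S = {i. v i \<noteq> 0} \<union> {i. w i \<noteq> 0}"
  have fin: "finite S" using assms by (auto simp: fin_comb_def S_def)
  have "gsum g (avec v w) k = (\<Sum>i\<in>S. avec v w i * g i k)" "gsum g v k = (\<Sum>i\<in>S. v i * g i k)"
    "gsum g w k = (\<Sum>i\<in>S. w i * g i k)"
    by (intro gsum_superset fin; auto simp: S_def avec_def)+
  thus "gsum g (avec v w) k = avec (gsum g v) (gsum g w) k"
    by (simp add: avec_def distrib_right sum.distrib)
qed

lemma svec_fin_comb: "v \<in> fin_comb \<Longrightarrow> svec c v \<in> fin_comb"
  by (auto simp: fin_comb_def svec_def intro: finite_subset)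

lemma avec_fin_comb: "v \<in> fin_comb \<Longrightarrow> w \<in> fin_comb \<Longrightarrow> avec v w \<in> fin_comb"
  by (auto simp: fin_comb_def avec_def intro: finite_subset [of _ "{i. v i \<noteq> 0} \<union> {i. w i \<noteq> 0}"])

lemma tensor_svec_ket: "tensor_vec (ket i) (svec c (ket j)) = svec c (ket (i, j))"
  "tensor_vec (svec c (ket i)) (ket j) = svec c (ket (i, j))"
  by (auto simp: tensor_vec_def svec_def ket_def fun_eq_iff)

text \<open>What the intertwining argument needs from a constituent: vectors on which the algebra
  acts as in a principal series with \<open>\<rho>^2\<close> replaced by \<open>y\<close>. Some
  \<open>E p\<close> may be zero, for weights missing from a discrete series. The scalar
  \<open>c\<close> builds in homogeneity of \<open>lin_ext\<close>.\<close>

definition weight_rep :: "real \<Rightarrow> real \<Rightarrow> real \<Rightarrow> (int \<Rightarrow> 'k vec) \<Rightarrow> 'k basis_rep \<Rightarrow> bool" where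
  "weight_rep k1 k2 y E \<pi> \<longleftrightarrow> (\<forall>p c. E p \<in> fin_comb \<and>
     lin_ext (\<pi> SU_H) (svec c (E p)) = svec (c * of_real (2 * (k1 - k2 + of_int p))) (E p) \<and>
     lin_ext (\<pi> SU_B) (svec c (E p)) = svec (c * of_real (sqrt ((of_int p + (k1 - k2 + 1/2))\<^sup>2 + y))) (E (p + 1)) \<and>
     lin_ext (\<pi> SU_C) (svec c (E p)) = svec (c * of_real (- sqrt ((of_int p - 1 + (k1 - k2 + 1/2))\<^sup>2 + y))) (E (p - 1)))"

definition Tvec :: "real \<Rightarrow> real \<Rightarrow> (int \<Rightarrow> 'k vec) \<Rightarrow> real \<Rightarrow> real \<Rightarrow> nat \<times> nat \<Rightarrow> 'k vec" where
  "Tvec k1 k2 E y w = (\<lambda>(n1, n2). svec (of_real (Tc k1 k2 n1 n2 y w)) (E (int n1 - int n2)))"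

text \<open>On basis vectors, comparing coefficients gives \<open>Tc_raise\<close> and
  \<open>Tc_lower\<close>. The radicand at \<open>p\<close> governs \<open>B\<close> from
  \<open>p\<close> to \<open>p + 1\<close> and \<open>C\<close> back; where it may be negative,
  among the weights missing from a discrete series, the coefficients at both ends vanish.\<close>

lemma Tvec_intertwines:
  fixes k1 k2 y w :: real
  assumes rep: "weight_rep k1 k2 y E \<pi>" and k: "k1 > 0" "k2 > 0"
    and nonneg: "\<And>p. (of_int p + (k1 - k2 + 1/2))\<^sup>2 + y \<ge> 0 \<or>
      (poly (PiP (k1 - k2 + 1/2) p) y * w = 0 \<and> poly (PiP (k1 - k2 + 1/2) (p + 1)) y * w = 0)"
    and v: "v \<in> fin_comb"
  shows "gsum (Tvec k1 k2 E y w) (lin_ext (tensor_rep (pi_plus k1) (pi_minus k2) Y) v)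
    = lin_ext (\<pi> Y) (gsum (Tvec k1 k2 E y w) v)"
proof -
  let ?T = "tensor_rep (pi_plus k1) (pi_minus k2) Y" and ?g = "Tvec k1 k2 E y w"
  have T_fin: "?T i \<in> fin_comb" for i
    by (cases i; cases Y) (auto simp: tensor_rep_def tensor_svec_ket intro!: avec_fin_comb svec_fin_comb ket_fin_comb)
  have g_fin: "?g i \<in> fin_comb" for i
    using rep by (cases i) (auto simp: Tvec_def weight_rep_def intro!: svec_fin_comb)
  have basis: "gsum ?g (?T i) = lin_ext (\<pi> Y) (?g i)" for i
  proof (cases i)
    case (Pair n1 n2)
    define p where "p = int n1 - int n2"
    have ket: "gsum ?g (avec (svec c (ket (n1, m))) (svec d (ket (m', n2)))) =
      avec (svec c (?g (n1, m))) (svec d (?g (m', n2)))" for c d m m'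
      by (simp add: gsum_avec gsum_ket svec_fin_comb ket_fin_comb)
    have ap: "?g (n1, n2) = svec (of_real (Tc k1 k2 n1 n2 y w)) (E p)"
      by (simp add: Tvec_def p_def)
    show ?thesis
    proof (cases Y)
      case SU_H
      have "gsum ?g (?T i) = avec (svec (of_real (- 2 * (k2 + real n2))) (?g (n1, n2))) (svec (of_real (2 * (k1 + real n1))) (?g (n1, n2)))"
        unfolding Pair SU_H tensor_rep_def prod.case pi_plus.simps pi_minus.simps tensor_svec_ket ket ..
      also have "\<dots> = svec (of_real (Tc k1 k2 n1 n2 y w) * of_real (2 * (k1 - k2 + of_int p))) (E p)"
        unfolding ap by (simp add: fun_eq_iff avec_def svec_def p_def algebra_simps)
      finally show ?thesis using rep unfolding Pair SU_H ap by (simp add: weight_rep_def)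
    next
      case SU_B
      have "gsum ?g (?T i) = avec (svec (of_real (- sqrt (real n2 * (2 * k2 + real n2 - 1)))) (?g (n1, n2 - 1)))
          (svec (of_real (sqrt ((real n1 + 1) * (2 * k1 + real n1)))) (?g (n1 + 1, n2)))"
        unfolding Pair SU_B tensor_rep_def prod.case pi_plus.simps pi_minus.simps tensor_svec_ket ket ..
      also have "\<dots> = svec (of_real (sqrt ((real n1 + 1) * (2 * k1 + real n1)) * Tc k1 k2 (Suc n1) n2 y w
          - sqrt (real n2 * (2 * k2 + real n2 - 1)) * Tc k1 k2 n1 (n2 - 1) y w)) (E (p + 1))"
      \<comment> \<open>For \<open>n2 = 0\<close> the truncated index \<open>n2 - 1\<close> gives a
        vector of the wrong weight, but its coefficient is zero.\<close>
      proof (cases n2)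
        case 0
        thus ?thesis by (simp add: Tvec_def fun_eq_iff avec_def svec_def p_def algebra_simps)
      next
        case (Suc m)
        hence "int n1 - int (n2 - 1) = p + 1" "int (n1 + 1) - int n2 = p + 1" by (simp_all add: p_def)
        thus ?thesis by (simp only: Tvec_def fun_eq_iff avec_def svec_def prod.case) (simp add: algebra_simps)
      qed
      also have "\<dots> = svec (of_real (Tc k1 k2 n1 n2 y w) * of_real (sqrt ((of_int p + (k1 - k2 + 1/2))\<^sup>2 + y))) (E (p + 1))"
        using nonneg [of p] by (subst Tc_raise [OF k p_def]) (auto simp: mult_ac)
      finally show ?thesis using rep unfolding Pair SU_B ap by (simp add: weight_rep_def)
    next
      case SU_C
      have "gsum ?g (?T i) = avec (svec (of_real (sqrt ((real n2 + 1) * (2 * k2 + real n2)))) (?g (n1, n2 + 1)))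
          (svec (of_real (- sqrt (real n1 * (2 * k1 + real n1 - 1)))) (?g (n1 - 1, n2)))"
        unfolding Pair SU_C tensor_rep_def prod.case pi_plus.simps pi_minus.simps tensor_svec_ket ket ..
      also have "\<dots> = svec (of_real (sqrt ((real n2 + 1) * (2 * k2 + real n2)) * Tc k1 k2 n1 (Suc n2) y w
          - sqrt (real n1 * (2 * k1 + real n1 - 1)) * Tc k1 k2 (n1 - 1) n2 y w)) (E (p - 1))"
      proof (cases n1)
        case 0
        have "int n1 - int (n2 + 1) = p - 1" "sqrt (real n1 * (2 * k1 + real n1 - 1)) = 0" by (simp_all add: p_def 0)
        thus ?thesis by (simp only: Tvec_def fun_eq_iff avec_def svec_def prod.case) (simp add: algebra_simps)
      next
        case (Suc m)
        hence "int (n1 - 1) - int n2 = p - 1" "int n1 - int (n2 + 1) = p - 1" by (simp_all add: p_def)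
        thus ?thesis by (simp only: Tvec_def fun_eq_iff avec_def svec_def prod.case) (simp add: algebra_simps)
      qed
      also have "\<dots> = svec (of_real (Tc k1 k2 n1 n2 y w) * of_real (- sqrt ((of_int p - 1 + (k1 - k2 + 1/2))\<^sup>2 + y))) (E (p - 1))"
        using nonneg [of "p - 1"] by (subst Tc_lower [OF k p_def]) (auto simp: mult_ac)
      finally show ?thesis using rep unfolding Pair SU_C ap by (simp add: weight_rep_def)
    qed
  qed
  have "gsum ?g (lin_ext ?T v) = gsum (\<lambda>i. gsum ?g (?T i)) v"
    unfolding lin_ext_gsum by (intro gsum_gsum v T_fin)
  also have "\<dots> = lin_ext (\<pi> Y) (gsum ?g v)"
    unfolding basis unfolding lin_ext_gsum by (intro gsum_gsum [symmetric] v g_fin)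
  finally show ?thesis .
qed

lemma tensor_rep_fin_comb: "tensor_rep (pi_plus k1) (pi_minus k2) Y i \<in> fin_comb"
  by (cases i; cases Y) (auto simp: tensor_rep_def tensor_svec_ket intro!: avec_fin_comb svec_fin_comb ket_fin_comb)

lemma infsum_single:
  assumes "\<And>i. i \<noteq> k \<Longrightarrow> h i = 0"
  shows "infsum h UNIV = h k"
proof -
  have "infsum h UNIV = infsum h {k}" using assms by (intro infsum_cong_neutral) auto
  thus ?thesis by simp
qed

lemma ell2_inner_ket: "ell2_inner (svec c (ket k)) v = cnj c * v k"
  unfolding ell2_inner_def by (subst infsum_single [of k]) (auto simp: svec_def ket_def)

lemma ell2_inner_ket1: "ell2_inner (ket k) v = v k"
  using ell2_inner_ket [of 1 k v] by (simp add: svec_def)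

lemma half_line_sigma_finite: "sigma_finite_measure half_line"
  unfolding half_line_def using lborel.sigma_finite_measure_axioms
  by (intro sigma_finite_measure_restrict_space) auto

text \<open>Removes traces of the uniform treatment: without atoms the second summand is trivial,
  with one atom it is a sum over a single index. \<open>T\<close> may identify elements, since
  components outside the index set are invisible to the inner product.\<close>

lemma decomposes_via_transfer:
  assumes dec: "decomposes_via \<pi> W' \<Lambda>'" and W': "semi_hilbert W'"
    and T: "\<And>w. w \<in> vecs W' \<Longrightarrow> T w \<in> vecs W"
    and surj: "\<And>w. w \<in> vecs W \<Longrightarrow> \<exists>w'\<in>vecs W'. T w' = w"
    and plus: "\<And>v w. v \<in> vecs W' \<Longrightarrow> w \<in> vecs W' \<Longrightarrow> T (vplus W' v w) = vplus W (T v) (T w)"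
    and scale: "\<And>c v. v \<in> vecs W' \<Longrightarrow> T (vscale W' c v) = vscale W c (T v)"
    and inner: "\<And>v w. v \<in> vecs W' \<Longrightarrow> w \<in> vecs W' \<Longrightarrow> vinner W (T v) (T w) = vinner W' v w"
    and act: "\<And>Y v. v \<in> vecs W' \<Longrightarrow> T (vact W' Y v) = vact W Y (T v)"
    and \<Lambda>: "\<And>i j. T (\<Lambda>' i j) = \<Lambda> i j"
  shows "decomposes_via \<pi> W \<Lambda>"
proof -
  interpret semi_hilbert W' by fact
  have eq: "hilb_eq W (T v) (T w)" if "hilb_eq W' v w" for v w
  proof -
    have vw: "v \<in> vecs W'" "w \<in> vecs W'" and 0: "vinner W' (vdiff W' v w) (vdiff W' v w) = 0"
      using that by (auto simp: hilb_eq_def Let_def vdiff_def)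
    have "T (vdiff W' v w) = vdiff W (T v) (T w)"
      using vw by (simp add: vdiff_def plus scale scale_closed)
    hence "vinner W (vdiff W (T v) (T w)) (vdiff W (T v) (T w)) = 0"
      using 0 inner [OF diff_closed diff_closed, OF vw vw] by simp
    thus ?thesis using T vw by (simp add: hilb_eq_def Let_def vdiff_def)
  qed
  obtain U where U: "unitary_onto (ell2_rep \<pi>) W' U"
    and UL: "\<And>i j. hilb_eq W' (U (tensor_vec (ket i) (ket j))) (\<Lambda>' i j)"
    and UA: "\<And>Y v. v \<in> fin_comb \<Longrightarrow> hilb_eq W' (U (vact (ell2_rep \<pi>) Y v)) (vact W' Y (U v))"
    using dec unfolding decomposes_via_def by blast
  have Uv: "U v \<in> vecs W'" if "v \<in> ell2" for v
    using U that by (auto simp: unitary_onto_def ell2_rep_simps)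
  have "unitary_onto (ell2_rep \<pi>) W (\<lambda>v. T (U v))"
    unfolding unitary_onto_def
  proof (intro conjI ballI allI)
    fix v w c assume v: "v \<in> vecs (ell2_rep \<pi>)"
    hence v': "U v \<in> vecs W'" by (simp add: Uv ell2_rep_simps)
    show "T (U v) \<in> vecs W" using T v' .
    show "hilb_eq W (T (U (vscale (ell2_rep \<pi>) c v))) (vscale W c (T (U v)))"
      unfolding scale [OF v', symmetric] using U v by (intro eq) (simp add: unitary_onto_def)
    assume w: "w \<in> vecs (ell2_rep \<pi>)"
    hence w': "U w \<in> vecs W'" by (simp add: Uv ell2_rep_simps)
    show "hilb_eq W (T (U (vplus (ell2_rep \<pi>) v w))) (vplus W (T (U v)) (T (U w)))"
      unfolding plus [OF v' w', symmetric] using U v w by (intro eq) (simp add: unitary_onto_def)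
    show "vinner W (T (U v)) (T (U w)) = vinner (ell2_rep \<pi>) v w"
      using U v w v' w' by (simp add: inner unitary_onto_def)
  next
    fix w assume "w \<in> vecs W"
    then obtain w' where w': "w' \<in> vecs W'" "T w' = w" using surj by blast
    then obtain v where "v \<in> vecs (ell2_rep \<pi>)" "hilb_eq W' (U v) w'" using U unfolding unitary_onto_def by blast
    thus "\<exists>v\<in>vecs (ell2_rep \<pi>). hilb_eq W (T (U v)) w" using w'(2) eq by blast
  qed
  moreover have "hilb_eq W (T (U (tensor_vec (ket i) (ket j)))) (\<Lambda> i j)" for i j
    using eq [OF UL [of i j]] by (simp add: \<Lambda>)
  moreover have "hilb_eq W (T (U (vact (ell2_rep \<pi>) Y v))) (vact W Y (T (U v)))" if "v \<in> fin_comb" for Y v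
    using eq [OF UA [OF that, of Y]] Uv [OF fin_comb_ell2 [OF that]] by (simp add: act)
  ultimately show ?thesis
    unfolding decomposes_via_def by (intro exI [of _ "\<lambda>v. T (U v)"]) auto
qed

text \<open>The prescribed images agree with \<open>Lam\<close> only for positive
  \<open>\<rho>\<close> and for indices in \<open>J\<close>, so the images have to be exchangeable
  up to null vectors. The point is transitivity of \<open>hilb_eq\<close>, which rests on
  Cauchy-Schwarz.\<close>

lemma decomposes_via_cong:
  assumes dec: "decomposes_via \<pi> W \<Lambda>" and W: "semi_hilbert W" and eq: "\<And>i j. hilb_eq W (\<Lambda> i j) (\<Lambda>' i j)"
  shows "decomposes_via \<pi> W \<Lambda>'"
proof -
  interpret semi_hilbert W by fact
  have inner_cong: "vinner W u v = vinner W u w" if "hilb_eq W v w" "u \<in> vecs W" for u v w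
  proof -
    have vw: "v \<in> vecs W" "w \<in> vecs W" "vnsq W (vdiff W v w) = 0"
      using that(1) by (auto simp: hilb_eq_iff)
    hence "(cmod (vinner W u (vdiff W v w)))\<^sup>2 \<le> 0"
      using cauchy_schwarz [OF that(2) diff_closed [OF vw(1,2)]] by simp
    thus ?thesis using vw that(2) by (simp add: inner_diff)
  qed
  have "hilb_eq W u w" if "hilb_eq W u v" "hilb_eq W v w" for u v w
  proof -
    have mem: "u \<in> vecs W" "w \<in> vecs W" using that by (auto simp: hilb_eq_iff)
    note d = diff_closed [OF mem]
    have "vinner W (vdiff W u w) (vdiff W u w) = vinner W (vdiff W u w) u - vinner W (vdiff W u w) w"
      using mem d by (simp add: inner_diff)
    also have "\<dots> = 0" using inner_cong [OF that(1) d] inner_cong [OF that(2) d] by simp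
    finally show ?thesis using mem by (simp add: hilb_eq_iff vnsq_def)
  qed
  thus ?thesis using dec eq unfolding decomposes_via_def by blast
qed

text \<open>In the constituent at the atom \<open>j\<close>, the basis vector \<open>k\<close>
  belongs to \<open>p = q j k\<close>, and \<open>\<sigma>\<close> is its phase. So
  \<open>E j p\<close> is a unit vector, or 0 if no basis vector has this weight.
  \<open>range\<close> says that the missing weights are the zeros of \<open>PiP\<close>. The
  integer \<open>s\<close> shifts \<open>p\<close> to the index in the principal series.\<close>

locale tensor_data = cdh_data k1 k2 J ya A
  for k1 k2 :: real and J :: "'j set" and ya A :: "'j \<Rightarrow> real" +
  fixes \<epsilon> :: real and s :: int and E :: "'j \<Rightarrow> int \<Rightarrow> 'k :: countable vec" and \<pi> :: "'j \<Rightarrow> 'k basis_rep"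
    and q :: "'j \<Rightarrow> 'k \<Rightarrow> int" and \<sigma> :: "'j \<Rightarrow> 'k \<Rightarrow> complex"
  assumes \<epsilon>: "\<epsilon> = k1 - k2 + of_int s"
    and q_inj: "j \<in> J \<Longrightarrow> inj (q j)" and \<sigma>: "j \<in> J \<Longrightarrow> cmod (\<sigma> j k) = 1"
    and E: "E j p = (\<lambda>k. if q j k = p then \<sigma> j k else 0)"
    and rep: "j \<in> J \<Longrightarrow> weight_rep k1 k2 (ya j) (E j) (\<pi> j)"
    and range: "j \<in> J \<Longrightarrow> poly (PiP (k1 - k2 + 1/2) p) (ya j) \<noteq> 0 \<longleftrightarrow> p \<in> range (q j)"
    and nonneg: "j \<in> J \<Longrightarrow> (of_int p + (k1 - k2 + 1/2))\<^sup>2 + ya j \<ge> 0 \<or>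
      (p \<notin> range (q j) \<and> p + 1 \<notin> range (q j))"
begin

abbreviation "W1 \<equiv> direct_integral half_line (\<lambda>\<rho>. pi_principal \<rho> \<epsilon>)"
abbreviation "W2 \<equiv> direct_Sum J (\<lambda>j. ell2_rep (\<pi> j))"
abbreviation "g1 \<rho> \<equiv> Tvec k1 k2 (\<lambda>p. ket (p - s)) (\<rho>\<^sup>2) (w \<rho>)"
abbreviation "g2 j \<equiv> Tvec k1 k2 (E j) (ya j) (A j)"

definition Lam :: "nat \<Rightarrow> nat \<Rightarrow> (real \<Rightarrow> int vec) \<times> ('j \<Rightarrow> 'k vec)" where
  "Lam n1 n2 = (\<lambda>\<rho>. g1 \<rho> (n1, n2), \<lambda>j. g2 j (n1, n2))"

lemma space: "\<rho> \<in> space half_line \<longleftrightarrow> \<rho> > 0"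
  by (simp add: half_line_def space_restrict_space)

lemma principal_weight_rep: "weight_rep k1 k2 (\<rho>\<^sup>2) (\<lambda>p. ket (p - s)) (pi_principal \<rho> \<epsilon>)"
  by (auto simp: weight_rep_def ket_fin_comb lin_ext_gsum gsum_ket \<epsilon>)
    (auto simp: svec_def fun_eq_iff algebra_simps)

lemma W1_vecs: "f \<in> vecs W1 \<longleftrightarrow> (\<forall>i. (\<lambda>r. f r i) \<in> borel_measurable half_line) \<and> (\<forall>r\<in>space half_line. f r \<in> ell2) \<and>
    integrable half_line (\<lambda>r. \<Sum>\<^sub>\<infinity>i. (cmod (f r i))\<^sup>2)"
  by (simp add: direct_integral_def)

lemma Tc_measurable [measurable]: "(\<lambda>x. Tc k1 k2 n1 n2 (x\<^sup>2) (w x)) \<in> borel_measurable half_line"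
  unfolding Tc_def Let_def by measurable

lemma Tc_sq_integrable: "integrable half_line (\<lambda>x. (Tc k1 k2 n1 n2 (x\<^sup>2) (w x))\<^sup>2)"
proof -
  define p where "p = int n1 - int n2"
  define P where "P = PiP \<alpha> p * (Sd k1 k2 (min n1 n2) p * Sd k1 k2 (min n1 n2) p)"
  have "integrable half_line (\<lambda>x. poly P (x\<^sup>2) * w x / (nN k1 k2 n1 n2 * nN k1 k2 n1 n2))"
    using poly_w_integrable [of P] by simp
  moreover have "(Tc k1 k2 n1 n2 (x\<^sup>2) (w x))\<^sup>2 = poly P (x\<^sup>2) * w x / (nN k1 k2 n1 n2 * nN k1 k2 n1 n2)"
    if "x \<in> space half_line" for x
    unfolding P_def power2_eq_square [of "Tc _ _ _ _ _ _"] using that PiP_pos [of x p] wt_pos [of x \<alpha> B]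
    by (intro Tc_mult) (auto simp: p_def space)
  ultimately show ?thesis
    by (subst Bochner_Integration.integrable_cong [OF refl]) auto
qed

lemma g1_vecs: "(\<lambda>\<rho>. g1 \<rho> (n1, n2)) \<in> vecs W1"
proof -
  let ?p = "int n1 - int n2"
  have *: "(\<lambda>i. (cmod (g1 \<rho> (n1, n2) i))\<^sup>2) = (\<lambda>i. if i = ?p - s then (Tc k1 k2 n1 n2 (\<rho>\<^sup>2) (w \<rho>))\<^sup>2 else 0)" for \<rho>
    by (auto simp: Tvec_def svec_def ket_def fun_eq_iff)
  have "(\<Sum>\<^sub>\<infinity>i. (cmod (g1 \<rho> (n1, n2) i))\<^sup>2) = (Tc k1 k2 n1 n2 (\<rho>\<^sup>2) (w \<rho>))\<^sup>2" for \<rho>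
    unfolding * by (subst infsum_single [of "?p - s"]) auto
  moreover have "(\<lambda>\<rho>. g1 \<rho> (n1, n2) i) \<in> borel_measurable half_line" for i
    unfolding Tvec_def svec_def ket_def by simp
  moreover have "g1 \<rho> (n1, n2) \<in> ell2" for \<rho>
    by (intro fin_comb_ell2) (auto simp: Tvec_def intro!: svec_fin_comb ket_fin_comb)
  ultimately show ?thesis
    by (simp add: direct_integral_def Tc_sq_integrable)
qed

lemma E_fin_comb: "j \<in> J \<Longrightarrow> E j p \<in> fin_comb"
  using rep by (auto simp: weight_rep_def)

lemma g2_fin_comb: "j \<in> J \<Longrightarrow> g2 j i \<in> fin_comb"
  by (cases i) (auto simp: Tvec_def intro!: svec_fin_comb E_fin_comb)

lemma W_vecs: "vecs (direct_sum W1 W2) = {w. fst w \<in> vecs W1 \<and> (\<forall>j\<in>J. snd w j \<in> ell2)}"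
  by (auto simp: direct_sum_simps direct_Sum_simps [OF J] ell2_rep_simps)

lemma Lam_vecs: "Lam n1 n2 \<in> vecs (direct_sum W1 W2)"
  by (auto simp: W_vecs Lam_def intro!: g1_vecs fin_comb_ell2 g2_fin_comb)

lemma W_semi_hilbert: "semi_hilbert (direct_sum W1 W2)"
  by (intro direct_sum_semi_hilbert direct_integral_semi_hilbert half_line_sigma_finite
      direct_Sum_semi_hilbert J ell2_semi_hilbert)

lemma inner_E:
  assumes j: "j \<in> J"
  shows "ell2_inner (E j p) v = (if p \<in> range (q j) then cnj (\<sigma> j (inv (q j) p)) * v (inv (q j) p) else 0)"
proof (cases "p \<in> range (q j)")
  case True
  then obtain k where k: "p = q j k" by blast
  have "inv (q j) p = k" using q_inj [OF j] k by simp
  moreover have "ell2_inner (E j p) v = cnj (E j p k) * v k"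
    unfolding ell2_inner_def using k inj_eq [OF q_inj [OF j]] by (subst infsum_single [of k]) (auto simp: E)
  ultimately show ?thesis using k by (simp add: E)
next
  case False
  hence "E j p = (\<lambda>k. 0)" by (intro ext) (auto simp: E)
  thus ?thesis using False by (simp add: ell2_inner_def)
qed

lemma inner_svec: "ell2_inner (svec c u) v = cnj c * ell2_inner u v"
  by (simp add: ell2_inner_def svec_def infsum_cmult_right' mult.assoc)

lemma Tc_out_of_range:
  assumes "j \<in> J" "int n1 - int n2 \<notin> range (q j)"
  shows "Tc k1 k2 n1 n2 (ya j) (A j) = 0"
  using range [OF assms(1), of "int n1 - int n2"] assms(2) by (simp add: Tc_def Let_def)

lemma W_inner: "vinner (direct_sum W1 W2) (Lam n1 n2) u =
  (\<integral>x. of_real (Tc k1 k2 n1 n2 (x\<^sup>2) (w x)) * fst u x (int n1 - int n2 - s) \<partial>half_line)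
  + (\<Sum>j\<in>J. of_real (Tc k1 k2 n1 n2 (ya j) (A j)) * ell2_inner (E j (int n1 - int n2)) (snd u j))"
  by (simp add: direct_sum_simps direct_integral_simps direct_Sum_simps [OF J] ell2_rep_simps Lam_def Tvec_def
      ell2_inner_ket1 inner_svec)

lemma hilb_eqI:
  assumes u: "u \<in> vecs (direct_sum W1 W2)" and fst: "\<And>\<rho>. \<rho> > 0 \<Longrightarrow> fst u \<rho> = fst v \<rho>"
    and snd: "\<And>j. j \<in> J \<Longrightarrow> snd u j = snd v j"
  shows "hilb_eq (direct_sum W1 W2) u v"
proof -
  have space_eq: "fst u \<rho> = fst v \<rho>" if "\<rho> \<in> space half_line" for \<rho>
    using that fst by (simp add: space)
  have "(\<lambda>\<rho>. fst u \<rho> i) \<in> borel_measurable half_line \<longleftrightarrow> (\<lambda>\<rho>. fst v \<rho> i) \<in> borel_measurable half_line" for i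
    by (intro measurable_cong) (simp add: space_eq)
  moreover have "integrable half_line (\<lambda>\<rho>. \<Sum>\<^sub>\<infinity>i. (cmod (fst u \<rho> i))\<^sup>2) \<longleftrightarrow>
      integrable half_line (\<lambda>\<rho>. \<Sum>\<^sub>\<infinity>i. (cmod (fst v \<rho> i))\<^sup>2)"
    by (intro Bochner_Integration.integrable_cong refl) (simp add: space_eq)
  ultimately have v: "v \<in> vecs (direct_sum W1 W2)"
    using u snd by (auto simp: W_vecs W1_vecs space_eq [symmetric])
  interpret semi_hilbert "direct_sum W1 W2" by (rule W_semi_hilbert)
  have "(\<integral>\<rho>. ell2_inner (vdiff W1 (fst u) (fst v) \<rho>) (vdiff W1 (fst u) (fst v) \<rho>) \<partial>half_line) = (\<integral>\<rho>. 0 \<partial>half_line)"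
    by (intro Bochner_Integration.integral_cong refl)
      (simp add: vdiff_def direct_integral_simps space_eq avec_def svec_def ell2_inner_def)
  thus ?thesis
    using u v snd
    by (simp add: hilb_eq_iff vnsq_def direct_sum_simps direct_Sum_simps [OF J] direct_integral_simps [of half_line]
        vdiff_def [of "ell2_rep _"] ell2_rep_simps avec_def svec_def ell2_inner_def)
qed

text \<open>For different \<open>n1 - n2\<close> the images use different basis vectors in every
  constituent. For equal differences the phases cancel and the claim is
  \<open>Tc_orthonormal\<close>.\<close>

lemma Lam_orthonormal:
  "vinner (direct_sum W1 W2) (Lam n1 n2) (Lam m1 m2) = (if n1 = m1 \<and> n2 = m2 then 1 else 0)"
proof (cases "int n1 - int n2 = int m1 - int m2")
  case True
  have "of_real (Tc k1 k2 n1 n2 (ya j) (A j)) * ell2_inner (E j (int n1 - int n2)) (snd (Lam m1 m2) j)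
     = complex_of_real (Tc k1 k2 n1 n2 (ya j) (A j) * Tc k1 k2 m1 m2 (ya j) (A j))" if j: "j \<in> J" for j
  proof (cases "int n1 - int n2 \<in> range (q j)")
    case in_range: True
    then obtain k where k: "int n1 - int n2 = q j k" by blast
    have "cnj (\<sigma> j k) * \<sigma> j k = 1" using \<sigma> [OF j, of k] by (simp add: cnj_mult_self)
    moreover have "ell2_inner (E j (int n1 - int n2)) (snd (Lam m1 m2) j)
        = (cnj (\<sigma> j k) * \<sigma> j k) * of_real (Tc k1 k2 m1 m2 (ya j) (A j))"
      unfolding inner_E [OF j] using k True q_inj [OF j] by (simp add: Lam_def Tvec_def svec_def E mult_ac)
    ultimately show ?thesis by simp
  qed (use j in \<open>simp add: Tc_out_of_range\<close>)
  moreover have "(\<lambda>x. of_real (Tc k1 k2 n1 n2 (x\<^sup>2) (w x)) * fst (Lam m1 m2) x (int n1 - int n2 - s))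
     = (\<lambda>x. complex_of_real (Tc k1 k2 n1 n2 (x\<^sup>2) (w x) * Tc k1 k2 m1 m2 (x\<^sup>2) (w x)))"
    using True by (simp add: fun_eq_iff Lam_def Tvec_def svec_def ket_def)
  ultimately have "vinner (direct_sum W1 W2) (Lam n1 n2) (Lam m1 m2)
     = complex_of_real ((\<integral>x. Tc k1 k2 n1 n2 (x\<^sup>2) (w x) * Tc k1 k2 m1 m2 (x\<^sup>2) (w x) \<partial>half_line)
      + (\<Sum>j\<in>J. Tc k1 k2 n1 n2 (ya j) (A j) * Tc k1 k2 m1 m2 (ya j) (A j)))"
    unfolding W_inner by (simp only: integral_complex_of_real of_real_add of_real_sum cong: sum.cong)
  thus ?thesis unfolding Tc_orthonormal [OF True] by simp
next
  case False
  have "ell2_inner (E j (int n1 - int n2)) (snd (Lam m1 m2) j) = 0" if j: "j \<in> J" for j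
    unfolding inner_E [OF j] using False q_inj [OF j] by (auto simp: Lam_def Tvec_def svec_def E)
  moreover have "fst (Lam m1 m2) x (int n1 - int n2 - s) = 0" for x
    using False by (simp add: Lam_def Tvec_def svec_def ket_def)
  ultimately show ?thesis unfolding W_inner using False by auto
qed

text \<open>For each \<open>p\<close>, \<open>Tc_total\<close> applies to one component of the field
  together with the coefficients along the vectors \<open>E j p\<close>. Countably many
  \<open>p\<close> still give one null set, and every basis vector at an atom is, up to a phase,
  some \<open>E j p\<close> with \<open>PiP\<close> nonzero.\<close>

lemma Lam_total:
  assumes w: "u \<in> vecs (direct_sum W1 W2)" and zero: "\<And>n1 n2. vinner (direct_sum W1 W2) (Lam n1 n2) u = 0"
  shows "vinner (direct_sum W1 W2) u u = 0"
proof -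
  have f: "fst u \<in> vecs W1" using w by (simp add: W_vecs)
  have meas [measurable]: "(\<lambda>x. fst u x i) \<in> borel_measurable half_line" for i
    using f by (simp add: direct_integral_def)
  have L2: "integrable half_line (\<lambda>x. (cmod (fst u x i))\<^sup>2)" for i
  proof (rule Bochner_Integration.integrable_bound)
    show "integrable half_line (\<lambda>x. \<Sum>\<^sub>\<infinity>i. (cmod (fst u x i))\<^sup>2)"
      using f by (simp add: direct_integral_def)
    show "AE x in half_line. norm ((cmod (fst u x i))\<^sup>2) \<le> norm (\<Sum>\<^sub>\<infinity>i. (cmod (fst u x i))\<^sup>2)"
    proof (rule AE_I2)
      fix x assume "x \<in> space half_line"
      hence "(\<lambda>i. (cmod (fst u x i))\<^sup>2) summable_on UNIV"
        using f by (auto simp: direct_integral_def ell2_def)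
      from finite_sum_le_infsum [OF this, of "{i}"]
      have "(cmod (fst u x i))\<^sup>2 \<le> (\<Sum>\<^sub>\<infinity>i. (cmod (fst u x i))\<^sup>2)" by simp
      thus "norm ((cmod (fst u x i))\<^sup>2) \<le> norm (\<Sum>\<^sub>\<infinity>i. (cmod (fst u x i))\<^sup>2)" by simp
    qed
  qed measurable
  have tot: "AE x in half_line. fst u x (p - s) = 0"
    "\<And>j. j \<in> J \<Longrightarrow> poly (PiP \<alpha> p) (ya j) \<noteq> 0 \<Longrightarrow> ell2_inner (E j p) (snd u j) = 0" for p
  proof -
    have z: "(\<integral>x. of_real (Tc k1 k2 n1 n2 (x\<^sup>2) (w x)) * fst u x (p - s) \<partial>half_line)
        + (\<Sum>j\<in>J. of_real (Tc k1 k2 n1 n2 (ya j) (A j)) * ell2_inner (E j p) (snd u j)) = 0"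
      if "int n1 - int n2 = p" for n1 n2
      using zero [of n1 n2] unfolding W_inner that .
    show "AE x in half_line. fst u x (p - s) = 0"
      by (rule Tc_total(1) [OF meas L2 z])
    show "ell2_inner (E j p) (snd u j) = 0" if "j \<in> J" "poly (PiP \<alpha> p) (ya j) \<noteq> 0" for j
      by (rule Tc_total(2) [OF meas L2 z that])
  qed
  have "AE x in half_line. \<forall>i. fst u x i = 0"
    unfolding AE_all_countable using tot(1) [of "_ + s"] by simp
  hence "AE x in half_line. ell2_inner (fst u x) (fst u x) = 0"
    by (rule AE_mp) (auto simp: ell2_inner_def)
  hence "(\<integral>x. ell2_inner (fst u x) (fst u x) \<partial>half_line) = 0"
    by (rule integral_eq_zero_AE)
  moreover have "snd u j k = 0" if j: "j \<in> J" for j k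
  proof -
    have "ell2_inner (E j (q j k)) (snd u j) = 0" using tot(2) [OF j] range [OF j] by blast
    moreover have "\<sigma> j k \<noteq> 0" using \<sigma> [OF j, of k] by auto
    ultimately show ?thesis using q_inj [OF j] by (simp add: inner_E [OF j])
  qed
  ultimately show ?thesis
    by (simp add: direct_sum_simps direct_integral_simps direct_Sum_simps [OF J] ell2_rep_simps ell2_inner_def)
qed

theorem decomposition: "decomposes_via (tensor_rep (pi_plus k1) (pi_minus k2)) (direct_sum W1 W2) Lam"
proof -
  interpret W: semi_hilbert "direct_sum W1 W2" by (rule W_semi_hilbert)
  define F where "F v = (\<lambda>\<rho>. gsum (g1 \<rho>) v, \<lambda>j. gsum (g2 j) v)" for v
  \<comment> \<open>\<open>F\<close> with the support of \<open>v\<close> replaced by an arbitrary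
    finite set, over which membership and coefficients are proved by induction.\<close>
  define X where "X v S = (\<lambda>\<rho> k. \<Sum>i\<in>S. v i * g1 \<rho> i k, \<lambda>j k. \<Sum>i\<in>S. v i * g2 j i k)" for v S
  have X: "X v S \<in> vecs (direct_sum W1 W2) \<and>
     (\<forall>n1 n2. vinner (direct_sum W1 W2) (Lam n1 n2) (X v S) = (if (n1, n2) \<in> S then v (n1, n2) else 0))"
    if "finite S" for v S
    using that
  proof induction
    case empty
    have "X v {} = vscale (direct_sum W1 W2) 0 (Lam 0 0)"
      by (simp add: X_def direct_sum_simps direct_integral_simps direct_Sum_simps [OF J] ell2_rep_simps svec_def)
    thus ?case using Lam_vecs W.scale_closed by (simp add: W.inner_scale)
  next
    case (insert i S)
    have "X v (insert i S) = vplus (direct_sum W1 W2) (vscale (direct_sum W1 W2) (v i) (Lam (fst i) (snd i))) (X v S)"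
      using insert.hyps
      by (simp add: X_def direct_sum_simps direct_integral_simps direct_Sum_simps [OF J] ell2_rep_simps svec_def avec_def Lam_def)
    moreover have "vscale (direct_sum W1 W2) (v i) (Lam (fst i) (snd i)) \<in> vecs (direct_sum W1 W2)"
      using Lam_vecs W.scale_closed by blast
    moreover have "vinner (direct_sum W1 W2) (Lam n1 n2) (X v S) = (if (n1, n2) \<in> S then v (n1, n2) else 0)" for n1 n2
      using insert.IH by blast
    ultimately show ?case
      using insert.IH insert.hyps Lam_vecs
      by (cases i) (auto simp: W.plus_closed W.inner_plus W.inner_scale Lam_orthonormal)
  qed
  have FX: "F v = X v {i. v i \<noteq> 0}" for v by (simp add: F_def X_def gsum_def)
  show ?thesis
  proof (rule decomposes_viaI [where F = F, OF W_semi_hilbert Lam_vecs Lam_orthonormal Lam_total])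
    fix v :: "(nat \<times> nat) vec" and Y assume v: "v \<in> fin_comb"
    hence fin: "finite {i. v i \<noteq> 0}" by (simp add: fin_comb_def)
    show "F v \<in> vecs (direct_sum W1 W2)" using X [OF fin, of v] by (simp add: FX)
    show "vinner (direct_sum W1 W2) (Lam i j) (F v) = v (i, j)" for i j
      using X [OF fin, of v] by (simp add: FX)
    show "lin_ext (tensor_rep (pi_plus k1) (pi_minus k2) Y) v \<in> fin_comb"
      unfolding lin_ext_gsum by (intro gsum_fin_comb v tensor_rep_fin_comb)
    have "F (lin_ext (tensor_rep (pi_plus k1) (pi_minus k2) Y) v) \<in> vecs (direct_sum W1 W2)"
    proof -
      have "lin_ext (tensor_rep (pi_plus k1) (pi_minus k2) Y) v \<in> fin_comb"
        unfolding lin_ext_gsum by (intro gsum_fin_comb v tensor_rep_fin_comb)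
      hence "finite {i. lin_ext (tensor_rep (pi_plus k1) (pi_minus k2) Y) v i \<noteq> 0}"
        by (simp add: fin_comb_def)
      from X [OF this] show ?thesis unfolding FX by blast
    qed
    thus "hilb_eq (direct_sum W1 W2) (F (lin_ext (tensor_rep (pi_plus k1) (pi_minus k2) Y) v)) (vact (direct_sum W1 W2) Y (F v))"
    proof (rule hilb_eqI)
      show "fst (F (lin_ext (tensor_rep (pi_plus k1) (pi_minus k2) Y) v)) \<rho> = fst (vact (direct_sum W1 W2) Y (F v)) \<rho>"
        if "\<rho> > 0" for \<rho>
        using Tvec_intertwines [OF principal_weight_rep k1 k2 _ v, of \<rho> "w \<rho>" Y]
        by (simp add: F_def direct_sum_simps direct_integral_simps)
      show "snd (F (lin_ext (tensor_rep (pi_plus k1) (pi_minus k2) Y) v)) j = snd (vact (direct_sum W1 W2) Y (F v)) j"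
        if j: "j \<in> J" for j
      proof -
        have "(of_int p + \<alpha>)\<^sup>2 + ya j \<ge> 0 \<or> (poly (PiP \<alpha> p) (ya j) * A j = 0 \<and> poly (PiP \<alpha> (p + 1)) (ya j) * A j = 0)" for p
          using nonneg [OF j, of p] range [OF j] by auto
        from Tvec_intertwines [OF rep [OF j] k1 k2 this v] show ?thesis
          by (simp add: F_def direct_sum_simps direct_Sum_simps [OF J] ell2_rep_simps)
      qed
    qed
  qed
qed

corollary decomposition_cong:
  assumes "\<And>n1 n2 \<rho>. \<rho> > 0 \<Longrightarrow> fst (\<Lambda> n1 n2) \<rho> = g1 \<rho> (n1, n2)" and "\<And>n1 n2 j. j \<in> J \<Longrightarrow> snd (\<Lambda> n1 n2) j = g2 j (n1, n2)"
  shows "decomposes_via (tensor_rep (pi_plus k1) (pi_minus k2)) (direct_sum W1 W2) \<Lambda>"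
  using decomposition W_semi_hilbert
proof (rule decomposes_via_cong)
  show "hilb_eq (direct_sum W1 W2) (Lam n1 n2) (\<Lambda> n1 n2)" for n1 n2
    using assms by (intro hilb_eqI Lam_vecs) (auto simp: Lam_def)
qed

end

section \<open>The weights and masses of the measure\<close>

text \<open>The normalisation of \<open>S_hat\<close> and the factor \<open>nrm\<close> from the
  measure merge into \<open>nN\<close>, and the two signs merge into \<open>sg\<close>.\<close>

lemma S_hat_Tc:
  fixes k1 k2 :: real and n1 n2 :: nat
  assumes k: "k1 > 0" "k2 > 0"
  defines "p \<equiv> int n1 - int n2"
  shows "(-1) ^ n2 * (S_hat k1 k2 (min n1 n2) p y * of_real (sqrt (poly (PiP (k1 - k2 + 1/2) p) y * v / nrm k1 k2 p)))
    = of_real (Tc k1 k2 n1 n2 y v)"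
proof -
  define n where "n = min n1 n2"
  define F where "F = fact n * pochhammer (par_a k1 k2 p + par_b k1 k2 p) n * pochhammer (par_a k1 k2 p + par_c k1 k2 p) n
      * pochhammer (par_b k1 k2 p + par_c k1 k2 p) n"
  have nN: "nN k1 k2 n1 n2 = sqrt (nrm k1 k2 p) * sqrt F"
  proof -
    have "nN k1 k2 n1 n2 = sqrt ((nN k1 k2 n1 n2)\<^sup>2)" using nN_pos [OF k] by (simp add: less_imp_le)
    also have "(nN k1 k2 n1 n2)\<^sup>2 = nrm k1 k2 p * F"
      using nN_sq [OF k, of n1 n2] by (simp add: F_def n_def p_def)
    finally show ?thesis by (simp add: real_sqrt_mult)
  qed
  have S: "S_hat k1 k2 n p y = of_real ((-1) ^ n * poly (Sd k1 k2 n p) y / sqrt F)"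
    using par_sums_pos [OF k, of p] by (simp add: S_hat_def cdh_S_hat_def cdh_S_eq_dh Sd_def F_def)
  have sg: "(-1) ^ n2 * (-1) ^ n = sg n1 n2"
  proof (cases "n1 \<ge> n2")
    case False
    hence "n2 + n = (n2 - n1) + 2 * n1" by (simp add: n_def)
    hence "(-1) ^ (n2 + n) = (-1 :: real) ^ (n2 - n1)" by (simp add: power_add power_mult)
    thus ?thesis using False by (simp add: sg_def power_add)
  qed (simp add: sg_def n_def flip: power_add mult_2)
  have "(-1) ^ n2 * (S_hat k1 k2 n p y * of_real (sqrt (poly (PiP (k1 - k2 + 1/2) p) y * v / nrm k1 k2 p)))
     = of_real (((-1) ^ n2 * (-1) ^ n) * poly (Sd k1 k2 n p) y / sqrt F * sqrt (poly (PiP (k1 - k2 + 1/2) p) y * v / nrm k1 k2 p))"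
    unfolding S by simp
  also have "((-1) ^ n2 * (-1) ^ n) * poly (Sd k1 k2 n p) y / sqrt F * sqrt (poly (PiP (k1 - k2 + 1/2) p) y * v / nrm k1 k2 p)
     = Tc k1 k2 n1 n2 y v"
    unfolding sg by (simp add: Tc_def Let_def nN n_def p_def real_sqrt_divide)
  finally show ?thesis by (simp add: n_def)
qed

section \<open>The density of the measure\<close>

lemma cmod_Gamma_phi:
  assumes "x \<noteq> 0"
  shows "(cmod (Gamma (Complex (a + real N) x)))\<^sup>2 = poly (phi N a) (x\<^sup>2) * (cmod (Gamma (Complex a x)))\<^sup>2"
proof (induction N)
  case (Suc N)
  have "(cmod (Gamma (Complex (a + real (Suc N)) x)))\<^sup>2 = ((a + real N)\<^sup>2 + x\<^sup>2) * (cmod (Gamma (Complex (a + real N) x)))\<^sup>2"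
    using cmod_Gamma_Complex_plus1 [of x "a + real N"] assms by (simp add: add_ac)
  thus ?case by (simp add: Suc phi_Suc algebra_simps)
qed simp

lemma cmod_Gamma_reflection:
  "(cmod (Gamma (Complex a x)))\<^sup>2 * (cmod (Gamma (Complex (1 - a) x)))\<^sup>2 = 2 * pi\<^sup>2 / (cosh (2 * pi * x) - cos (2 * pi * a))"
proof -
  have eq: "cnj (Complex (1 - a) x) = 1 - Complex a x" by (simp add: complex_eq_iff)
  have "cmod (Gamma (Complex a x)) * cmod (Gamma (Complex (1 - a) x)) = cmod (Gamma (Complex a x) * Gamma (1 - Complex a x))"
    unfolding eq [symmetric] by (simp add: norm_mult flip: cnj_Gamma)
  also have "\<dots> = pi / cmod (sin (of_real pi * Complex a x))"
    by (simp add: Gamma_reflection_complex norm_divide)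
  finally have *: "(cmod (Gamma (Complex a x)))\<^sup>2 * (cmod (Gamma (Complex (1 - a) x)))\<^sup>2 = pi\<^sup>2 / (cmod (sin (of_real pi * Complex a x)))\<^sup>2"
    by (metis power_divide power_mult_distrib)
  have "(cmod (sin (of_real pi * Complex a x)))\<^sup>2 = (exp (2 * (pi * x)) + inverse (exp (2 * (pi * x))) - 2 * cos (2 * (pi * a))) / 4"
    unfolding norm_sin_squared by simp
  also have "\<dots> = (cosh (2 * pi * x) - cos (2 * pi * a)) / 2"
    by (simp add: cosh_field_def exp_minus field_simps)
  finally have e: "(cmod (sin (of_real pi * Complex a x)))\<^sup>2 = (cosh (2 * pi * x) - cos (2 * pi * a)) / 2" .
  show ?thesis unfolding * e by simp
qed

lemma cmod_Gamma_imaginary: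
  assumes "x > 0"
  shows "(cmod (Gamma (Complex 0 (2 * x))))\<^sup>2 = pi / (2 * x * sinh (2 * pi * x))"
proof -
  have "(cmod (Gamma (Complex 1 (2 * x))))\<^sup>2 = (2 * x)\<^sup>2 * (cmod (Gamma (Complex 0 (2 * x))))\<^sup>2"
    using cmod_Gamma_Complex_plus1 [of "2 * x" 0] assms by simp
  hence "(2 * x)\<^sup>2 * (cmod (Gamma (Complex 0 (2 * x))))\<^sup>2 = pi * (2 * x) / sinh (pi * (2 * x))"
    using cmod_Gamma_1 [of "2 * x"] assms by simp
  thus ?thesis using assms by (simp add: field_simps power2_eq_square)
qed

text \<open>The parameters \<open>a_p\<close> and \<open>c_p\<close> are \<alpha> and
  \<open>1 - \<alpha>\<close> in some order, the second one raised by \<open>|p|\<close>. Raising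
  produces \<open>PiP\<close>; reflection and the duplicated Gamma factor produce
  \<open>wt\<close>.\<close>

lemma mu_W_eq:
  assumes x: "x > 0"
  shows "mu_W k1 k2 p (x\<^sup>2) = sqrt (poly (PiP (k1 - k2 + 1/2) p) (x\<^sup>2) * wt (k1 - k2 + 1/2) (k1 + k2 - 1/2) x / nrm k1 k2 p)"
proof -
  define \<alpha> B where "\<alpha> = k1 - k2 + 1/2" and "B = k1 + k2 - 1/2"
  define a c where "a = par_a k1 k2 p" and "c = par_c k1 k2 p"
  define D where "D = cosh (2 * pi * x) - cos (2 * pi * \<alpha>)"
  have D: "D > 0" using kap_denom_pos x by (simp add: D_def)
  have r: "(cmod (Gamma (Complex \<alpha> x)))\<^sup>2 * (cmod (Gamma (Complex (1 - \<alpha>) x)))\<^sup>2 = 2 * pi\<^sup>2 / D"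
    unfolding D_def by (rule cmod_Gamma_reflection)
  have ph: "(cmod (Gamma (Complex (z + real N) x)))\<^sup>2 = poly (phi N z) (x\<^sup>2) * (cmod (Gamma (Complex z x)))\<^sup>2" for z N
    using x by (intro cmod_Gamma_phi) auto
  have ac: "(cmod (Gamma (Complex a x)))\<^sup>2 * (cmod (Gamma (Complex c x)))\<^sup>2 = poly (PiP \<alpha> p) (x\<^sup>2) * (2 * pi\<^sup>2 / D)"
  proof (cases "p \<le> 0")
    case True
    hence c: "a = \<alpha>" "c = (1 - \<alpha>) + real (nat (- p))" by (simp_all add: a_def c_def \<alpha>_def par_a_def par_c_def)
    have "PiP \<alpha> p = phi (nat (- p)) (1 - \<alpha>)" using True by (cases "p = 0") (auto simp: PiP_def)
    thus ?thesis unfolding c ph r [symmetric] by (simp only: mult_ac)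
  next
    case False
    hence c: "a = 1 - \<alpha>" "c = \<alpha> + real (nat p)" by (simp_all add: a_def c_def \<alpha>_def par_a_def par_c_def)
    have "PiP \<alpha> p = phi (nat p) \<alpha>" using False by (auto simp: PiP_def)
    thus ?thesis unfolding c ph r [symmetric] by (simp only: mult_ac)
  qed
  have s: "sinh (2 * pi * x) > 0" using x by simp
  have "mu_W k1 k2 p (x\<^sup>2) = cmod (Gamma (Complex a x)) * cmod (Gamma (Complex B x)) * cmod (Gamma (Complex c x)) / cmod (Gamma (Complex 0 (2 * x)))
        * (1 / sqrt (2 * pi * nrm k1 k2 p))"
    using x by (simp add: mu_W_def cdh_W_def Let_def norm_mult norm_divide nrm_def a_def c_def B_def par_b_def mult.assoc)
  also have "\<dots> = sqrt ((cmod (Gamma (Complex a x)))\<^sup>2 * (cmod (Gamma (Complex c x)))\<^sup>2 * (cmod (Gamma (Complex B x)))\<^sup>2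
      / (cmod (Gamma (Complex 0 (2 * x))))\<^sup>2 / (2 * pi * nrm k1 k2 p))"
    by (simp add: real_sqrt_divide real_sqrt_mult)
  also have "(cmod (Gamma (Complex a x)))\<^sup>2 * (cmod (Gamma (Complex c x)))\<^sup>2 * (cmod (Gamma (Complex B x)))\<^sup>2
      / (cmod (Gamma (Complex 0 (2 * x))))\<^sup>2 / (2 * pi * nrm k1 k2 p) = poly (PiP \<alpha> p) (x\<^sup>2) * wt \<alpha> B x / nrm k1 k2 p"
    unfolding ac cmod_Gamma_imaginary [OF x] wt_def kap_def D_def [symmetric]
    using s D x by (simp add: field_simps power2_eq_square)
  finally show ?thesis by (simp add: \<alpha>_def B_def)
qed

section \<open>The masses as Gamma quotients\<close>

lemma phi_Gamma:
  assumes "z - v > 0" "z + v > 0"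
  shows "poly (phi N z) (- v\<^sup>2) * (Gamma (z - v) * Gamma (z + v)) = Gamma (z + real N - v) * Gamma (z + real N + v)"
proof (induction N)
  case (Suc N)
  have g: "Gamma (z + real (Suc N) - v) = (z + real N - v) * Gamma (z + real N - v)"
    "Gamma (z + real (Suc N) + v) = (z + real N + v) * Gamma (z + real N + v)"
    using Gamma_plus1_pos [of "z + real N - v"] Gamma_plus1_pos [of "z + real N + v"] assms by (simp_all add: algebra_simps)
  have "poly (phi (Suc N) z) (- v\<^sup>2) * (Gamma (z - v) * Gamma (z + v))
      = ((z + real N)\<^sup>2 - v\<^sup>2) * (poly (phi N z) (- v\<^sup>2) * (Gamma (z - v) * Gamma (z + v)))"
    by (simp add: phi_Suc algebra_simps)
  also have "\<dots> = ((z + real N - v) * (z + real N + v)) * (Gamma (z + real N - v) * Gamma (z + real N + v))"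
    unfolding Suc by (simp add: power2_eq_square algebra_simps)
  finally show ?case unfolding g by (simp add: mult_ac)
qed simp

text \<open>In reversed order the bases change only by a sign, which the squares ignore. With it the
  masses for \<open>p > 0\<close>, where \<open>\<alpha> + p\<close> is the relevant parameter, take
  the same shape as those for \<open>p \<le> 0\<close>.\<close>

lemma phi_reflect: "phi N (z - real N) = phi N (1 - z)"
proof -
  have "phi N (z - real N) = (\<Prod>i<N. [:(z - real N + real (N - Suc i))\<^sup>2, 1:])"
    unfolding phi_def by (rule prod.nat_diff_reindex [symmetric])
  also have "\<dots> = phi N (1 - z)"
    unfolding phi_def by (intro prod.cong refl) (simp add: of_nat_diff power2_eq_square algebra_simps)
  finally show ?thesis .
qed

lemma pochhammer_Gamma_pos: "z > 0 \<Longrightarrow> pochhammer z n = Gamma (z + real n) / Gamma (z :: real)"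
  by (rule pochhammer_Gamma) (auto elim!: nonpos_Ints_cases)

lemma pochhammer_neg_Gamma:
  assumes "b - real k + 1 > (0 :: real)"
  shows "pochhammer (- b) k = (- 1) ^ k * (Gamma (b + 1) / Gamma (b - real k + 1))"
  unfolding pochhammer_minus pochhammer_Gamma_pos [OF assms] by simp

lemma cdh_m_swap: "cdh_m a b c k = cdh_m a c b k"
  by (simp add: cdh_m_def add.commute mult.commute mult.left_commute)

text \<open>Pochhammer symbols at negative arguments become quotients of Gamma values at positive
  ones. Then \<open>N\<close> appears only in \<open>phi\<close>, which is \<open>PiP\<close>, and
  in the denominator, which is \<open>nrm\<close>. The middle factor depends on \<open>a\<close> and
  \<open>k\<close> through \<open>a + k\<close> alone, hence on the mass point and not on
  \<open>p\<close>.\<close>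

lemma cdh_m_eq:
  assumes a: "a + real k < 0" and B: "B + a > 0"
  shows "cdh_m a B (1 - a + real N) k = poly (phi N (1 - a)) (- (a + real k)\<^sup>2)
    * (- 2 * (a + real k) * Gamma (B + a + real k) * Gamma (B - a - real k))
    / (Gamma (a + B) * Gamma (1 + real N) * Gamma (B + 1 - a + real N))"
proof -
  define e where "e = 1 - a + real N"
  have a0: "a < 0" using a by linarith
  have pos: "B > 0" "B - a > 0" "B - a - real k > 0" "1 - 2 * a - real k > 0" "1 - 2 * a + real N - real k > 0" "e + B > 0"
    using a B by (auto simp: e_def)
  have p1: "pochhammer (a + B) k = Gamma (a + B + real k) / Gamma (a + B)"
    using B by (intro pochhammer_Gamma_pos) simp
  have p2: "pochhammer (a + e) k = Gamma (1 + real N + real k) / Gamma (1 + real N)"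
    unfolding e_def by (simp add: pochhammer_Gamma_pos)
  have p3: "pochhammer (a + 1) k * a = pochhammer a k * (a + real k)"
    using pochhammer_rec [of a k] pochhammer_rec' [of a k] by (simp add: mult_ac)
  have p4: "pochhammer (a - B + 1) k = (- 1) ^ k * (Gamma (B - a) / Gamma (B - a - real k))"
    using pochhammer_neg_Gamma [of "B - a - 1" k] pos by (simp add: algebra_simps)
  have p5: "pochhammer (a - e + 1) k = (- 1) ^ k * (Gamma (1 - 2 * a + real N) / Gamma (1 - 2 * a + real N - real k))"
    using pochhammer_neg_Gamma [of "real N - 2 * a" k] pos by (simp add: algebra_simps e_def)
  have p6: "pochhammer (2 * a) k = (- 1) ^ k * (- 2 * a * Gamma (- 2 * a) / Gamma (1 - 2 * a - real k))"
    using pochhammer_neg_Gamma [of "- 2 * a" k] pos Gamma_plus1_pos [of "- 2 * a"] a0 by (simp add: algebra_simps)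
  have p7: "poly (phi N (1 - a)) (- (a + real k)\<^sup>2) * (Gamma (1 - 2 * a - real k) * fact k)
      = Gamma (1 - 2 * a + real N - real k) * Gamma (1 + real N + real k)"
    using phi_Gamma [of "1 - a" "a + real k" N] pos Gamma_fact [of k, where ?'a = real] by (simp add: algebra_simps)
  have a_nz: "pochhammer a k \<noteq> 0"
    using a by (auto simp: pochhammer_eq_0_iff)
  have nz: "Gamma (1 - 2 * a - real k) \<noteq> 0" "Gamma (B - a) \<noteq> 0" "Gamma (B - a - real k) \<noteq> 0" "Gamma (- 2 * a) \<noteq> 0"
    "Gamma (1 - 2 * a + real N) \<noteq> 0" "Gamma (1 - 2 * a + real N - real k) \<noteq> 0" "Gamma (a + B) \<noteq> 0" "Gamma (1 + real N) \<noteq> 0"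
    "Gamma (B + e) \<noteq> 0"
    using pos a0 B Gamma_real_pos [THEN less_imp_neq, THEN not_sym] by simp_all
  have "cdh_m a B e k = Gamma (B - a) * Gamma (1 - 2 * a + real N) / (Gamma (- 2 * a) * Gamma (B + e)) *
     (pochhammer (2 * a) k * (pochhammer (a + 1) k / pochhammer a k) * pochhammer (a + B) k * pochhammer (a + e) k * (- 1) ^ k
      / (pochhammer (a - B + 1) k * pochhammer (a - e + 1) k * fact k))"
    unfolding cdh_m_def by (simp add: e_def algebra_simps)
  also have "pochhammer (a + 1) k / pochhammer a k = (a + real k) / a"
    using p3 a_nz a0 by (simp add: field_simps)
  also have "pochhammer (2 * a) k * ((a + real k) / a) * pochhammer (a + B) k * pochhammer (a + e) k * (- 1) ^ k
      / (pochhammer (a - B + 1) k * pochhammer (a - e + 1) k * fact k)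
    = (- 2 * a * Gamma (- 2 * a) / Gamma (1 - 2 * a - real k)) * ((a + real k) / a) * (Gamma (a + B + real k) / Gamma (a + B))
      * (Gamma (1 + real N + real k) / Gamma (1 + real N))
      / ((Gamma (B - a) / Gamma (B - a - real k)) * (Gamma (1 - 2 * a + real N) / Gamma (1 - 2 * a + real N - real k)) * fact k)"
  proof -
    have "(s * u) * r * t * v * s / ((s * w) * (s * x) * f) = u * r * t * v / (w * x * f)" if "s \<noteq> 0" for s u r t v w x f :: real
      using that by (simp add: field_simps)
    thus ?thesis unfolding p1 p2 p4 p5 p6 by simp
  qed
  also have "Gamma (B - a) * Gamma (1 - 2 * a + real N) / (Gamma (- 2 * a) * Gamma (B + e)) * \<dots>
     = (Gamma (1 - 2 * a + real N - real k) * Gamma (1 + real N + real k)) / (Gamma (1 - 2 * a - real k) * fact k)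
       * (- 2 * (a + real k) * Gamma (B + a + real k) * Gamma (B - a - real k))
       / (Gamma (a + B) * Gamma (1 + real N) * Gamma (B + e))"
    using nz a0 by (simp add: divide_simps add.commute [of B a]) (simp add: algebra_simps)
  also have "(Gamma (1 - 2 * a + real N - real k) * Gamma (1 + real N + real k)) / (Gamma (1 - 2 * a - real k) * fact k)
     = poly (phi N (1 - a)) (- (a + real k)\<^sup>2)"
    unfolding p7 [symmetric] using nz by simp
  finally show ?thesis by (simp add: e_def algebra_simps)
qed

lemma Gamma_reflection_real: "Gamma x * Gamma (1 - x) = pi / sin (pi * x)" for x :: real
proof -
  have "complex_of_real (Gamma x * Gamma (1 - x)) = Gamma (of_real x) * Gamma (1 - of_real x)"
    by (simp add: Gamma_complex_of_real [symmetric])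
  also have "\<dots> = of_real (pi / sin (pi * x))"
    unfolding Gamma_reflection_complex by (simp add: sin_of_real [symmetric])
  finally show ?thesis by (simp only: of_real_eq_iff)
qed

text \<open>Reflection at \<open>\<alpha> - B\<close>, \<open>\<alpha> + B\<close> and
  \<open>- 2 * B\<close> converts the trigonometric form, natural for a residue, into the Gamma
  quotient in which the mass is prescribed.\<close>

lemma atom0_Gamma:
  assumes "B < 0" "\<alpha> + B > 0" "1 - \<alpha> + B > 0"
  shows "atom0 \<alpha> B = Gamma (\<alpha> - B) * Gamma (1 - \<alpha> - B) * Gamma (\<alpha> + B) * Gamma (1 - \<alpha> + B) / Gamma (- 2 * B)"
proof -
  have s: "sin (pi * (\<alpha> - B)) * sin (pi * (\<alpha> + B)) = (cos (2 * pi * B) - cos (2 * pi * \<alpha>)) / 2"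
    unfolding sin_times_sin by (simp add: algebra_simps)
  have G: "Gamma (- 2 * B) > 0" using assms by (intro Gamma_real_pos) simp
  have B: "B > - 1/2" using assms by simp
  have s0: "sin (2 * pi * B) \<noteq> 0"
  proof -
    have "0 < (- 2 * B) * pi" by (rule mult_pos_pos) (use assms(1) in auto)
    moreover have "(- 2 * B) * pi < 1 * pi" using B by (intro mult_strict_right_mono) auto
    ultimately have "sin (2 * pi * (- B)) > 0" by (intro sin_gt_zero) (simp_all add: mult_ac)
    thus ?thesis by simp
  qed
  have "Gamma (- 2 * B) * Gamma (2 * B + 1) = - pi / sin (2 * pi * B)"
    using Gamma_reflection_real [of "- 2 * B"] by (simp add: algebra_simps)
  hence "Gamma (2 * B + 1) * sin (2 * pi * B) = - pi / Gamma (- 2 * B)"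
    using G s0 by (simp add: field_simps)
  hence "atom0 \<alpha> B = 2 * pi\<^sup>2 / (cos (2 * pi * B) - cos (2 * pi * \<alpha>)) / Gamma (- 2 * B)"
    using assms(1) by (simp add: atom0_def power2_eq_square mult.assoc)
  moreover have "(Gamma (\<alpha> - B) * Gamma (1 - (\<alpha> - B))) * (Gamma (\<alpha> + B) * Gamma (1 - (\<alpha> + B)))
      = 2 * pi\<^sup>2 / (cos (2 * pi * B) - cos (2 * pi * \<alpha>))"
    unfolding Gamma_reflection_real times_divide_times_eq s by (simp add: power2_eq_square)
  ultimately show ?thesis by (simp add: algebra_simps)
qed

section \<open>The moments of the weight\<close>

lemma wt_phi: "x > 0 \<Longrightarrow> poly (phi k B) (x\<^sup>2) * wt \<alpha> B x = wt \<alpha> (B + real k) x"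
proof (induction k)
  case (Suc k)
  have "wt \<alpha> (B + real (Suc k)) x = ((B + real k)\<^sup>2 + x\<^sup>2) * wt \<alpha> (B + real k) x"
    using wt_shift [of x \<alpha> "B + real k"] Suc.prems by (simp add: add_ac)
  also have "\<dots> = ((B + real k)\<^sup>2 + x\<^sup>2) * (poly (phi k B) (x\<^sup>2) * wt \<alpha> B x)"
    using Suc by simp
  finally show ?case by (simp add: phi_Suc algebra_simps)
qed simp

text \<open>Since \<open>phi k B\<close> raises \<open>B\<close> by \<open>k\<close>, the moment is
  a total mass at \<open>B + k\<close>; for \<open>k > 0\<close> this is positive and
  \<open>atom0\<close> is 0.\<close>

lemma wt_phi_integral:
  assumes "0 \<le> \<alpha>" "\<alpha> < 1" "B > - 1 / 2" "\<alpha> + B > 0" "1 - \<alpha> + B > 0"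
  shows "(\<integral>x. poly (phi k B) (x\<^sup>2) * wt \<alpha> B x \<partial>half_line)
    = Gamma (B + \<alpha> + real k) * Gamma (B + 1 - \<alpha> + real k) - atom0 \<alpha> (B + real k)"
proof -
  have "(\<integral>x. poly (phi k B) (x\<^sup>2) * wt \<alpha> B x \<partial>half_line) = (\<integral>x. wt \<alpha> (B + real k) x \<partial>half_line)"
    by (intro Bochner_Integration.integral_cong refl wt_phi) (simp add: half_line_def space_restrict_space)
  also have "\<dots> = Gamma (B + real k + \<alpha>) * Gamma (B + real k + 1 - \<alpha>) - atom0 \<alpha> (B + real k)"
    using assms by (intro wt_integral) auto
  finally show ?thesis by (simp add: algebra_simps)
qed

lemma wt_periodic: "wt (\<alpha> + real M) B = wt \<alpha> B"
proof -
  have "cos (2 * pi * (\<alpha> + real M)) = cos (2 * pi * \<alpha> + real M * (2 * pi))" by (simp add: algebra_simps)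
  also have "\<dots> = cos (2 * pi * \<alpha>)"
    using cos.plus_of_nat [of "2 * pi * \<alpha>" M] by simp
  finally show ?thesis by (simp add: wt_def kap_def fun_eq_iff)
qed

text \<open>With \<open>z = \<alpha> + j\<close> each term is \<open>Gamma (C + z) * Gamma (C - z +
  1) - Gamma (C + z + 1) * Gamma (C - z)\<close>, because
  \<open>(C - z) - (C + z) = - 2 * z\<close>.\<close>

lemma Gamma_telescope:
  assumes "\<And>j. j < M \<Longrightarrow> C + (\<alpha> + real j) > 0" "\<And>j. j < M \<Longrightarrow> C - (\<alpha> + real j) > 0"
  shows "(\<Sum>j<M. - 2 * (\<alpha> + real j) * (Gamma (C + (\<alpha> + real j)) * Gamma (C - (\<alpha> + real j))))
    = Gamma (C + \<alpha>) * Gamma (C + 1 - \<alpha>) - Gamma (C + \<alpha> + real M) * Gamma (C + 1 - \<alpha> - real M)"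
  using assms
proof (induction M)
  case (Suc M)
  define z where "z = \<alpha> + real M"
  have pos: "C + z > 0" "C - z > 0" using Suc.prems [of M] by (simp_all add: z_def)
  have "(\<Sum>j<Suc M. - 2 * (\<alpha> + real j) * (Gamma (C + (\<alpha> + real j)) * Gamma (C - (\<alpha> + real j))))
      = Gamma (C + \<alpha>) * Gamma (C + 1 - \<alpha>) - Gamma (C + \<alpha> + real M) * Gamma (C + 1 - \<alpha> - real M)
        + - 2 * z * (Gamma (C + z) * Gamma (C - z))"
    unfolding sum.lessThan_Suc z_def using Suc by simp
  also have "C + \<alpha> + real M = C + z" by (simp add: z_def)
  also have "C + 1 - \<alpha> - real M = C - z + 1" by (simp add: z_def)
  also have "Gamma (C - z + 1) = (C - z) * Gamma (C - z)" by (rule Gamma_plus1_pos [OF pos(2)])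
  also have "Gamma (C + \<alpha>) * Gamma (C + 1 - \<alpha>) - Gamma (C + z) * ((C - z) * Gamma (C - z)) + - 2 * z * (Gamma (C + z) * Gamma (C - z))
      = Gamma (C + \<alpha>) * Gamma (C + 1 - \<alpha>) - ((C + z) * Gamma (C + z)) * Gamma (C - z)"
    by (simp add: left_diff_distrib right_diff_distrib distrib_right)
  also have "(C + z) * Gamma (C + z) = Gamma (C + \<alpha> + real (Suc M))"
    using Gamma_plus1_pos [OF pos(1)] by (simp add: z_def add_ac)
  also have "C - z = C + 1 - \<alpha> - real (Suc M)" by (simp add: z_def)
  finally show ?case .
qed simp

lemma image_cont_eq:
  assumes "k1 > 0" "k2 > 0" "\<rho> > 0"
  shows "image_cont k1 k2 s n1 n2 \<rho> = Tvec k1 k2 (\<lambda>p. ket (p - s)) (\<rho>\<^sup>2) (wt (k1 - k2 + 1/2) (k1 + k2 - 1/2) \<rho>) (n1, n2)"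
  unfolding image_cont_def integral_cont_def Let_def mu_W_eq [OF assms(3)] Tvec_def prod.case
    S_hat_Tc [OF assms(1,2), symmetric]
  by (simp add: svec_def mult.assoc)

lemma integral_atom_eq:
  fixes n1 n2 :: nat
  assumes "k1 > 0" "k2 > 0"
  defines "p \<equiv> int n1 - int n2"
  assumes "mu_mass k1 k2 p y = sqrt (poly (PiP (k1 - k2 + 1/2) p) y * v / nrm k1 k2 p)"
  shows "svec ((-1) ^ n2) (integral_atom k1 k2 p y (S_hat k1 k2 (min n1 n2) p) u) = svec (of_real (Tc k1 k2 n1 n2 y v)) u"
  using S_hat_Tc [OF assms(1,2), of n2 n1 y v] unfolding integral_atom_def assms(4) unfolding p_def
  by (simp add: svec_def fun_eq_iff mult.assoc [symmetric])

text \<open>A normal form for both signs of \<open>p\<close>, in which the complementary series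
  needs no further case distinction.\<close>

lemma par_cases:
  obtains N z where "par_a k1 k2 p = 1 - z" "par_c k1 k2 p = z + real N" "PiP (k1 - k2 + 1/2) p = phi N z"
    "z = k1 - k2 + 1/2 \<or> z = 1 - (k1 - k2 + 1/2)"
proof (cases "p \<le> 0")
  case True
  thus ?thesis
    by (intro that [of "1 - (k1 - k2 + 1/2)" "nat (- p)"]) (cases "p = 0"; auto simp: par_a_def par_c_def PiP_def)+
next
  case False
  thus ?thesis
    by (intro that [of "k1 - k2 + 1/2" "nat p"]) (auto simp: par_a_def par_c_def PiP_def)
qed

lemma cos_less_1: "0 < x \<Longrightarrow> x \<le> 1/2 \<Longrightarrow> cos (2 * pi * x) < 1"
  using cos_monotone_0_pi [of 0 "2 * pi * x"] by simp

lemma cdh_data_continuous: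
  assumes k: "0 < k1" "k1 \<le> k2" and c: "k1 - k2 \<ge> - 1/2" "k1 + k2 \<ge> 1/2"
  shows "cdh_data k1 k2 {} ya A"
proof
  show "k1 + k2 - 1/2 \<noteq> 0 \<or> cos (2 * pi * (k1 - k2 + 1/2)) < 1"
    \<comment> \<open>If \<open>B = 0\<close> then \<open>\<alpha> = 2 * k1\<close>, which lies in
      the interval from 0, excluded, to \<open>1/2\<close>.\<close>
    using k c by (cases "k1 + k2 = 1/2") (auto intro: cos_less_1)
  show "(\<integral>x. poly (phi k (k1 + k2 - 1/2)) (x\<^sup>2) * wt (k1 - k2 + 1/2) (k1 + k2 - 1/2) x \<partial>half_line)
      + (\<Sum>j\<in>{}. A j * poly (phi k (k1 + k2 - 1/2)) (ya j)) = Gamma (2 * k1 + real k) * Gamma (2 * k2 + real k)" for k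
    using k c by (subst wt_phi_integral) (auto simp: atom0_def)
qed (use k in auto)

lemma phi_pos:
  assumes "\<bar>v\<bar> < z"
  shows "poly (phi N z) (- v\<^sup>2) > 0"
  unfolding poly_phi
proof (intro prod_pos ballI)
  fix i
  have "\<bar>v\<bar> < \<bar>z + real i\<bar>" using assms by linarith
  thus "(z + real i)\<^sup>2 + - v\<^sup>2 > 0" using power_strict_mono [of "\<bar>v\<bar>" "\<bar>z + real i\<bar>" 2] by simp
qed

section \<open>The mass point of the complementary series\<close>

context
  fixes k1 k2 :: real
  assumes k: "0 < k1" "k1 \<le> k2" and c: "k1 + k2 < 1/2"
begin

lemma PiP_compl_pos: "poly (PiP (k1 - k2 + 1/2) p) (- ((k1 + k2 - 1/2)\<^sup>2)) > 0"
proof -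
  obtain N z where "PiP (k1 - k2 + 1/2) p = phi N z" "z = k1 - k2 + 1/2 \<or> z = 1 - (k1 - k2 + 1/2)"
    by (rule par_cases)
  thus ?thesis using k c by (auto intro!: phi_pos)
qed

lemma atom0_pos: "atom0 (k1 - k2 + 1/2) (k1 + k2 - 1/2) > 0"
  using k c by (subst atom0_Gamma) (auto intro!: divide_pos_pos mult_pos_pos Gamma_real_pos)

lemma cdh_data_compl:
  "cdh_data k1 k2 {()} (\<lambda>_. - ((k1 + k2 - 1/2)\<^sup>2)) (\<lambda>_. atom0 (k1 - k2 + 1/2) (k1 + k2 - 1/2))"
proof
  show "(\<integral>x. poly (phi n (k1 + k2 - 1/2)) (x\<^sup>2) * wt (k1 - k2 + 1/2) (k1 + k2 - 1/2) x \<partial>half_line)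
      + (\<Sum>j\<in>{()}. atom0 (k1 - k2 + 1/2) (k1 + k2 - 1/2) * poly (phi n (k1 + k2 - 1/2)) (- ((k1 + k2 - 1/2)\<^sup>2)))
      = Gamma (2 * k1 + real n) * Gamma (2 * k2 + real n)" for n
  proof -
    have "(\<integral>x. poly (phi n (k1 + k2 - 1/2)) (x\<^sup>2) * wt (k1 - k2 + 1/2) (k1 + k2 - 1/2) x \<partial>half_line)
        = Gamma (2 * k1 + real n) * Gamma (2 * k2 + real n) - atom0 (k1 - k2 + 1/2) (k1 + k2 - 1/2 + real n)"
      using k c by (subst wt_phi_integral) auto
    \<comment> \<open>The first factor of \<open>phi n B\<close> is \<open>B^2 + y\<close>, so the
      atom enters the moment of order 0 only, which is the one moment where the integral falls
      short.\<close>
    moreover have "poly (phi n (k1 + k2 - 1/2)) (- ((k1 + k2 - 1/2)\<^sup>2)) = (if n = 0 then 1 else 0)"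
      by (cases n) (auto simp: phi_Suc_shift)
    ultimately show ?thesis using k c by (cases n) (auto simp: atom0_def)
  qed
qed (use k c atom0_pos PiP_compl_pos in \<open>auto simp: less_imp_le\<close>)

text \<open>Here \<open>B\<close> is the only negative parameter, and \<open>B > - 1/2\<close>
  leaves a single mass point.\<close>

lemma mu_mass_compl:
  "mu_mass k1 k2 p (- ((k1 + k2 - 1/2)\<^sup>2))
    = sqrt (poly (PiP (k1 - k2 + 1/2) p) (- ((k1 + k2 - 1/2)\<^sup>2)) * atom0 (k1 - k2 + 1/2) (k1 + k2 - 1/2) / nrm k1 k2 p)"
proof -
  define B \<alpha> where "B = k1 + k2 - 1/2" and "\<alpha> = k1 - k2 + 1/2"
  obtain N z where ac: "par_a k1 k2 p = 1 - z" "par_c k1 k2 p = z + real N" and P: "PiP \<alpha> p = phi N z"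
    and z: "z = \<alpha> \<or> z = 1 - \<alpha>" unfolding \<alpha>_def by (rule par_cases)
  have pos: "z - B > 0" "z + B > 0" "1 - z - B > 0" "1 - z + B > 0" "B < 0"
    using z k c by (auto simp: B_def \<alpha>_def)
  have atoms: "{j. B + real j < 0 \<and> - (B\<^sup>2) = - ((B + real j)\<^sup>2)} = {0}"
    using pos by (auto simp: power2_eq_iff)
  have "mu_mass k1 k2 p (- (B\<^sup>2)) = cdh_mass_min B (1 - z) (z + real N) (- (B\<^sup>2))"
    using pos by (auto simp: mu_mass_def cdh_mass_def ac par_b_def B_def [symmetric])
  also have "\<dots> = sqrt (cdh_m B (1 - z) (z + real N) 0)"
    unfolding cdh_mass_min_def atoms by simp
  also have "cdh_m B (1 - z) (z + real N) 0 = Gamma (1 - z - B) * Gamma (z + real N - B) / (Gamma (- 2 * B) * Gamma (1 + real N))"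
    by (simp add: cdh_m_def)
  also have "\<dots> = poly (PiP \<alpha> p) (- (B\<^sup>2)) * atom0 \<alpha> B / nrm k1 k2 p"
  proof -
    have a: "atom0 \<alpha> B = Gamma (z - B) * Gamma (1 - z - B) * Gamma (z + B) * Gamma (1 - z + B) / Gamma (- 2 * B)"
    proof -
      have "atom0 \<alpha> B = Gamma (\<alpha> - B) * Gamma (1 - \<alpha> - B) * Gamma (\<alpha> + B) * Gamma (1 - \<alpha> + B) / Gamma (- 2 * B)"
        using z pos by (intro atom0_Gamma) auto
      moreover have "\<alpha> = z \<or> \<alpha> = 1 - z" using z by auto
      ultimately show ?thesis by (elim disjE) (simp_all add: mult_ac)
    qed
    have n: "nrm k1 k2 p = Gamma (1 - z + B) * Gamma (1 + real N) * Gamma (z + real N + B)"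
      by (simp add: nrm_def ac par_b_def B_def add_ac)
    have nz: "Gamma (1 - z + B) \<noteq> 0" "Gamma (z + real N + B) \<noteq> 0"
      using pos Gamma_real_pos [THEN less_imp_neq, THEN not_sym] by simp_all
    have "poly (PiP \<alpha> p) (- (B\<^sup>2)) * atom0 \<alpha> B / nrm k1 k2 p
       = (poly (phi N z) (- (B\<^sup>2)) * (Gamma (z - B) * Gamma (z + B))) * Gamma (1 - z - B) * Gamma (1 - z + B) / Gamma (- 2 * B) / nrm k1 k2 p"
      unfolding P a by simp
    also have "\<dots> = Gamma (1 - z - B) * Gamma (z + real N - B) / (Gamma (- 2 * B) * Gamma (1 + real N))"
      unfolding phi_Gamma [OF pos(1,2)] n using nz by simp
    finally show ?thesis ..
  qed
  finally show ?thesis by (simp add: B_def \<alpha>_def)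
qed

end

section \<open>The mass points of the discrete series\<close>

context
  fixes k1 k2 :: real
  assumes k: "0 < k1" "k1 \<le> k2" and c: "k1 - k2 < - 1/2"
begin

lemma minus_J_finite: "finite {j. k2 - k1 - 1/2 - real j > 0}"
proof (rule finite_subset)
  show "{j. k2 - k1 - 1/2 - real j > 0} \<subseteq> {..nat \<lceil>k2 - k1\<rceil>}" by (auto; linarith)
qed simp

text \<open>For \<open>p > j\<close> the factor of index \<open>j\<close> vanishes. For
  \<open>0 < p \<le> j\<close> every index \<open>i\<close> is below \<open>j\<close>, and
  \<open>\<alpha> + i < \<alpha> + j < 0\<close> makes the factor positive. For
  \<open>p \<le> 0\<close> the base \<open>1 - \<alpha>\<close> dominates.\<close>

lemma PiP_minus:
  assumes j: "k2 - k1 - 1/2 - real j > 0"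
  shows "poly (PiP (k1 - k2 + 1/2) p) (- ((k1 - k2 + 1/2 + real j)\<^sup>2)) \<ge> 0" (is ?nonneg)
    and "poly (PiP (k1 - k2 + 1/2) p) (- ((k1 - k2 + 1/2 + real j)\<^sup>2)) \<noteq> 0 \<longleftrightarrow> p \<le> int j" (is ?iff)
proof -
  define \<alpha> where "\<alpha> = k1 - k2 + 1/2"
  have neg: "\<alpha> + real j < 0" using j by (simp add: \<alpha>_def)
  have "(p \<le> int j \<and> poly (PiP \<alpha> p) (- ((\<alpha> + real j)\<^sup>2)) > 0) \<or> (p > int j \<and> poly (PiP \<alpha> p) (- ((\<alpha> + real j)\<^sup>2)) = 0)"
  proof -
    consider "p \<le> 0" | "0 < p" "p \<le> int j" | "p > int j" by linarith
    thus ?thesis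
    proof cases
      case 1
      hence "PiP \<alpha> p = phi (nat (- p)) (1 - \<alpha>)" by (cases "p = 0") (auto simp: PiP_def)
      thus ?thesis using 1 neg by (auto intro!: phi_pos)
    next
      case 2
      have "(\<alpha> + real i)\<^sup>2 + - ((\<alpha> + real j)\<^sup>2) > 0" if "i < nat p" for i
      proof -
        have "i < j" using that 2 by linarith
        hence "(- (\<alpha> + real j))\<^sup>2 < (- (\<alpha> + real i))\<^sup>2" using neg by (intro power_strict_mono) auto
        thus ?thesis unfolding power2_minus by simp
      qed
      hence "poly (phi (nat p) \<alpha>) (- ((\<alpha> + real j)\<^sup>2)) > 0"
        unfolding poly_phi by (intro prod_pos) auto
      thus ?thesis using 2 by (simp add: PiP_def)
    next
      case 3
      thus ?thesis by (auto simp: PiP_def poly_phi intro!: bexI [of _ j])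
    qed
  qed
  thus ?nonneg ?iff by (auto simp: \<alpha>_def)
qed

lemma cdh_data_minus:
  "cdh_data k1 k2 {j. k2 - k1 - 1/2 - real j > 0} (\<lambda>j. - ((k1 - k2 + 1/2 + real j)\<^sup>2))
    (\<lambda>j. - 2 * (k1 - k2 + 1/2 + real j) * (Gamma (k1 + k2 - 1/2 + (k1 - k2 + 1/2 + real j)) * Gamma (k1 + k2 - 1/2 - (k1 - k2 + 1/2 + real j))))"
proof
  define \<alpha> B where "\<alpha> = k1 - k2 + 1/2" and "B = k1 + k2 - 1/2"
  define J where "J = {j. k2 - k1 - 1/2 - real j > 0}"
  \<comment> \<open>The number of unit steps that bring \<alpha> into the range where the integral
    is known; it is also the number of atoms.\<close>
  define M where "M = nat \<lceil>- \<alpha>\<rceil>"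
  have \<alpha>: "\<alpha> < 0" and B: "B > 0" "B + \<alpha> > 0" using k c by (auto simp: \<alpha>_def B_def)
  have M: "0 \<le> \<alpha> + real M" "\<alpha> + real M < 1" using \<alpha> unfolding M_def by linarith+
  have J: "J = {..<M}"
  proof -
    have "\<alpha> + real j < 0 \<longleftrightarrow> j < M" for j
    proof
      assume "j < M"
      hence "real j + 1 \<le> real M" by linarith
      thus "\<alpha> + real j < 0" using M by linarith
    next
      assume "\<alpha> + real j < 0"
      hence "real j < real M" using M by linarith
      thus "j < M" by simp
    qed
    moreover have "j \<in> J \<longleftrightarrow> \<alpha> + real j < 0" for j
      unfolding J_def \<alpha>_def mem_Collect_eq by linarith
    ultimately show ?thesis by blast
  qed
  have Jneg: "\<alpha> + real j < 0" if "j \<in> J" for j using that by (simp add: J_def \<alpha>_def)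
  have Jpos: "B + (\<alpha> + real j) > 0" "B - (\<alpha> + real j) > 0" if "j \<in> J" for j
    using that Jneg [OF that] B by auto
  show "(\<integral>x. poly (phi n (k1 + k2 - 1/2)) (x\<^sup>2) * wt (k1 - k2 + 1/2) (k1 + k2 - 1/2) x \<partial>half_line)
      + (\<Sum>j | k2 - k1 - 1/2 - real j > 0. - 2 * (k1 - k2 + 1/2 + real j) * (Gamma (k1 + k2 - 1/2 + (k1 - k2 + 1/2 + real j)) * Gamma (k1 + k2 - 1/2 - (k1 - k2 + 1/2 + real j)))
        * poly (phi n (k1 + k2 - 1/2)) (- ((k1 - k2 + 1/2 + real j)\<^sup>2)))
      = Gamma (2 * k1 + real n) * Gamma (2 * k2 + real n)" for n
    unfolding \<alpha>_def [symmetric] B_def [symmetric] J_def [symmetric]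
  proof -
    define C where "C = B + real n"
    have "(\<integral>x. poly (phi n B) (x\<^sup>2) * wt \<alpha> B x \<partial>half_line) = (\<integral>x. poly (phi n B) (x\<^sup>2) * wt (\<alpha> + real M) B x \<partial>half_line)"
      by (simp add: wt_periodic)
    also have "\<dots> = Gamma (C + \<alpha> + real M) * Gamma (C + 1 - \<alpha> - real M)"
      using M B by (subst wt_phi_integral) (auto simp: C_def atom0_def algebra_simps)
    finally have int: "(\<integral>x. poly (phi n B) (x\<^sup>2) * wt \<alpha> B x \<partial>half_line) = \<dots>" .
    have "(\<Sum>j\<in>J. - 2 * (\<alpha> + real j) * (Gamma (B + (\<alpha> + real j)) * Gamma (B - (\<alpha> + real j))) * poly (phi n B) (- ((\<alpha> + real j)\<^sup>2)))
       = (\<Sum>j\<in>J. - 2 * (\<alpha> + real j) * (Gamma (C + (\<alpha> + real j)) * Gamma (C - (\<alpha> + real j))))"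
    proof (intro sum.cong refl)
      fix j assume j: "j \<in> J"
      \<comment> \<open>At a mass point \<open>phi n B\<close> raises \<open>B\<close> to
        \<open>C\<close>, just as it does under the integral; one telescoping sum therefore serves
        every \<open>n\<close>.\<close>
      have e: "poly (phi n B) (- ((\<alpha> + real j)\<^sup>2)) * (Gamma (B - (\<alpha> + real j)) * Gamma (B + (\<alpha> + real j)))
          = Gamma (C - (\<alpha> + real j)) * Gamma (C + (\<alpha> + real j))"
        unfolding C_def by (intro phi_Gamma Jpos j)
      have "r * (X * Y) * Q = r * (X' * Y')" if "Q * (Y * X) = Y' * X'" for r X Y Q X' Y' :: real
        using arg_cong [OF that, of "(*) r"] by (simp only: mult_ac)
      from this [OF e] show "- 2 * (\<alpha> + real j) * (Gamma (B + (\<alpha> + real j)) * Gamma (B - (\<alpha> + real j))) * poly (phi n B) (- ((\<alpha> + real j)\<^sup>2))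
        = - 2 * (\<alpha> + real j) * (Gamma (C + (\<alpha> + real j)) * Gamma (C - (\<alpha> + real j)))" .
    qed
    also have "\<dots> = Gamma (C + \<alpha>) * Gamma (C + 1 - \<alpha>) - Gamma (C + \<alpha> + real M) * Gamma (C + 1 - \<alpha> - real M)"
      unfolding J
    proof (rule Gamma_telescope)
      fix j assume "j < M"
      hence "j \<in> J" by (simp add: J)
      from Jpos [OF this] show "C + (\<alpha> + real j) > 0" "C - (\<alpha> + real j) > 0" by (simp_all add: C_def)
    qed
    finally show "(\<integral>x. poly (phi n B) (x\<^sup>2) * wt \<alpha> B x \<partial>half_line)
      + (\<Sum>j\<in>J. - 2 * (\<alpha> + real j) * (Gamma (B + (\<alpha> + real j)) * Gamma (B - (\<alpha> + real j))) * poly (phi n B) (- ((\<alpha> + real j)\<^sup>2)))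
      = Gamma (2 * k1 + real n) * Gamma (2 * k2 + real n)"
      unfolding int by (simp add: C_def \<alpha>_def B_def)
  qed
  show "inj_on (\<lambda>j. - ((k1 - k2 + 1/2 + real j)\<^sup>2)) {j. k2 - k1 - 1/2 - real j > 0}"
    unfolding \<alpha>_def [symmetric] J_def [symmetric]
  proof (rule inj_onI)
    fix i j assume "i \<in> J" "j \<in> J" and "- ((\<alpha> + real i)\<^sup>2) = - ((\<alpha> + real j)\<^sup>2)"
    thus "i = j" using Jneg [of i] Jneg [of j] by (auto simp: power2_eq_iff)
  qed
  show "- 2 * (k1 - k2 + 1/2 + real j) * (Gamma (k1 + k2 - 1/2 + (k1 - k2 + 1/2 + real j)) * Gamma (k1 + k2 - 1/2 - (k1 - k2 + 1/2 + real j))) > 0"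
    if "j \<in> {j. k2 - k1 - 1/2 - real j > 0}" for j
  proof -
    have j: "j \<in> J" using that by (simp add: J_def)
    have "- 2 * (\<alpha> + real j) > 0" using Jneg [OF j] by simp
    from mult_pos_pos [OF this mult_pos_pos [OF Gamma_real_pos Gamma_real_pos, OF Jpos [OF j]]]
    show ?thesis unfolding \<alpha>_def B_def .
  qed
qed (use k c minus_J_finite PiP_minus in auto)

text \<open>The parameter generating the atoms is \<alpha> for \<open>p \<le> 0\<close> and
  \<open>\<alpha> + p\<close> for \<open>p > 0\<close>. The given point has index \<open>j\<close>
  or \<open>j - p\<close> in its list, and for \<open>p > j\<close> it is absent, where
  \<open>PiP\<close> vanishes as well.\<close>

lemma mu_mass_minus:
  assumes j: "k2 - k1 - 1/2 - real j > 0"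
  defines "v \<equiv> - 2 * (k1 - k2 + 1/2 + real j) * (Gamma (k1 + k2 - 1/2 + (k1 - k2 + 1/2 + real j)) * Gamma (k1 + k2 - 1/2 - (k1 - k2 + 1/2 + real j)))"
  shows "mu_mass k1 k2 p (- ((k1 - k2 + 1/2 + real j)\<^sup>2))
    = sqrt (poly (PiP (k1 - k2 + 1/2) p) (- ((k1 - k2 + 1/2 + real j)\<^sup>2)) * v / nrm k1 k2 p)"
proof -
  define \<alpha> B where "\<alpha> = k1 - k2 + 1/2" and "B = k1 + k2 - 1/2"
  have v: "v = - 2 * (\<alpha> + real j) * (Gamma (B + (\<alpha> + real j)) * Gamma (B - (\<alpha> + real j)))"
    by (simp only: v_def \<alpha>_def B_def)
  have neg: "\<alpha> + real j < 0" "\<alpha> < 0" and B: "B > 0" "B + \<alpha> > 0" using j k c by (auto simp: \<alpha>_def B_def)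
  have "mu_mass k1 k2 p (- ((\<alpha> + real j)\<^sup>2)) = sqrt (poly (PiP \<alpha> p) (- ((\<alpha> + real j)\<^sup>2)) * v / nrm k1 k2 p)"
  proof (cases "p \<le> 0")
    case True
    define N where "N = nat (- p)"
    have ac: "par_a k1 k2 p = \<alpha>" "par_c k1 k2 p = 1 - \<alpha> + real N"
      using True by (auto simp: par_a_def par_c_def \<alpha>_def N_def)
    have P: "PiP \<alpha> p = phi N (1 - \<alpha>)" using True by (cases "p = 0") (auto simp: PiP_def N_def)
    have atoms: "{i. \<alpha> + real i < 0 \<and> - ((\<alpha> + real j)\<^sup>2) = - ((\<alpha> + real i)\<^sup>2)} = {j}"
      using neg by (auto simp: power2_eq_iff)
    have "mu_mass k1 k2 p (- ((\<alpha> + real j)\<^sup>2)) = cdh_mass_min \<alpha> B (1 - \<alpha> + real N) (- ((\<alpha> + real j)\<^sup>2))"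
      using neg B by (auto simp: mu_mass_def cdh_mass_def ac par_b_def B_def [symmetric])
    also have "\<dots> = sqrt (cdh_m \<alpha> B (1 - \<alpha> + real N) j)"
      unfolding cdh_mass_min_def atoms by simp
    also have "cdh_m \<alpha> B (1 - \<alpha> + real N) j = poly (PiP \<alpha> p) (- ((\<alpha> + real j)\<^sup>2)) * v / nrm k1 k2 p"
      unfolding cdh_m_eq [OF neg(1) B(2)] P v nrm_def ac par_b_def B_def [symmetric]
      by (simp add: algebra_simps)
    finally show ?thesis .
  next
    case False
    define N where "N = nat p"
    define a where "a = \<alpha> + real N"
    have ac: "par_a k1 k2 p = 1 - a + real N" "par_c k1 k2 p = a"
      using False by (auto simp: par_a_def par_c_def \<alpha>_def N_def a_def)
    have P: "PiP \<alpha> p = phi N (1 - a)" using False phi_reflect [of N a] by (auto simp: PiP_def N_def a_def)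
    have Ba: "B + a > 0" using B by (simp add: a_def)
    show ?thesis
    proof (cases "N \<le> j")
      case True
      define i where "i = j - N"
      have i: "a + real i = \<alpha> + real j" using True by (simp add: a_def i_def of_nat_diff)
      have atoms: "{i'. a + real i' < 0 \<and> - ((\<alpha> + real j)\<^sup>2) = - ((a + real i')\<^sup>2)} = {i}"
        using neg unfolding i [symmetric] by (auto simp: power2_eq_iff)
      have "mu_mass k1 k2 p (- ((\<alpha> + real j)\<^sup>2)) = cdh_mass_min a (1 - a + real N) B (- ((\<alpha> + real j)\<^sup>2))"
        using neg B i by (auto simp: mu_mass_def cdh_mass_def ac par_b_def B_def [symmetric])
      also have "\<dots> = sqrt (cdh_m a B (1 - a + real N) i)"
        unfolding cdh_mass_min_def atoms by (simp add: cdh_m_swap)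
      also have "cdh_m a B (1 - a + real N) i = poly (PiP \<alpha> p) (- ((\<alpha> + real j)\<^sup>2)) * v / nrm k1 k2 p"
      proof -
        have v': "v = - 2 * (a + real i) * (Gamma (B + (a + real i)) * Gamma (B - (a + real i)))" unfolding v i ..
        show ?thesis
          unfolding v' cdh_m_eq [OF neg(1) [folded i] Ba] P nrm_def ac par_b_def B_def [symmetric] i [symmetric]
          by (simp add: algebra_simps)
      qed
      finally show ?thesis .
    next
      case False
      \<comment> \<open>Which parameter is smallest need not be decided: none of the three has a
        mass point here.\<close>
      have atoms: "{i'. x + real i' < 0 \<and> - ((\<alpha> + real j)\<^sup>2) = - ((x + real i')\<^sup>2)} = {}"
        if x: "x = a \<or> x = B \<or> x = 1 - a + real N" for x
      proof -
        have "- ((\<alpha> + real j)\<^sup>2) \<noteq> - ((x + real i)\<^sup>2)" if i: "x + real i < 0" for i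
        proof -
          have "x = a" using x i B neg by (auto simp: a_def)
          hence "\<alpha> + real j < x + real i" using False by (simp add: a_def)
          thus ?thesis using neg i by (auto simp: power2_eq_iff)
        qed
        thus ?thesis by blast
      qed
      have "mu_mass k1 k2 p (- ((\<alpha> + real j)\<^sup>2)) = 0"
        using atoms [of a] atoms [of B] atoms [of "1 - a + real N"]
        by (simp only: mu_mass_def cdh_mass_def ac par_b_def B_def [symmetric] cdh_mass_min_def simp_thms sum.empty if_cancel)
      moreover have "poly (PiP \<alpha> p) (- ((\<alpha> + real j)\<^sup>2)) = 0"
        using PiP_minus(2) [OF j, of p] False by (auto simp: \<alpha>_def N_def)
      ultimately show ?thesis by simp
    qed
  qed
  thus ?thesis by (simp add: \<alpha>_def)
qed

end

section \<open>The representations\<close>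

lemma weight_rep_compl:
  assumes k: "0 < k1" "k1 \<le> k2" and \<epsilon>: "\<epsilon> = k1 - k2 + of_int s" and l: "l = - k1 - k2"
  shows "weight_rep k1 k2 (- ((k1 + k2 - 1/2)\<^sup>2)) (\<lambda>p. ket (p - s)) (pi_compl l \<epsilon>)"
  unfolding weight_rep_def
proof (intro allI conjI)
  fix p :: int and c :: complex
  show "ket (p - s) \<in> fin_comb" by (rule ket_fin_comb)
  show "lin_ext (pi_compl l \<epsilon> SU_H) (svec c (ket (p - s))) = svec (c * of_real (2 * (k1 - k2 + of_int p))) (ket (p - s))"
    unfolding lin_ext_gsum gsum_ket pi_compl.simps by (simp add: \<epsilon> svec_def algebra_simps)
  have "(of_int (p - s) + \<epsilon> + 1 + l) * (of_int (p - s) + \<epsilon> - l) = (of_int p + (k1 - k2 + 1/2))\<^sup>2 + - ((k1 + k2 - 1/2)\<^sup>2)"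
    unfolding \<epsilon> l by (simp add: power2_eq_square algebra_simps)
  thus "lin_ext (pi_compl l \<epsilon> SU_B) (svec c (ket (p - s)))
     = svec (c * of_real (sqrt ((of_int p + (k1 - k2 + 1/2))\<^sup>2 + - ((k1 + k2 - 1/2)\<^sup>2)))) (ket (p + 1 - s))"
    unfolding lin_ext_gsum gsum_ket pi_compl.simps by (simp add: svec_def mult.assoc flip: diff_add_eq)
  have "(of_int (p - s) + \<epsilon> + l) * (of_int (p - s) + \<epsilon> - l - 1) = (of_int p - 1 + (k1 - k2 + 1/2))\<^sup>2 + - ((k1 + k2 - 1/2)\<^sup>2)"
    unfolding \<epsilon> l by (simp add: power2_eq_square algebra_simps)
  thus "lin_ext (pi_compl l \<epsilon> SU_C) (svec c (ket (p - s)))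
     = svec (c * of_real (- sqrt ((of_int p - 1 + (k1 - k2 + 1/2))\<^sup>2 + - ((k1 + k2 - 1/2)\<^sup>2)))) (ket (p - 1 - s))"
  proof -
    assume e: "(of_int (p - s) + \<epsilon> + l) * (of_int (p - s) + \<epsilon> - l - 1) = (of_int p - 1 + (k1 - k2 + 1/2))\<^sup>2 + - ((k1 + k2 - 1/2)\<^sup>2)"
    have e': "p - s - 1 = p - 1 - s" by simp
    show ?thesis unfolding lin_ext_gsum gsum_ket pi_compl.simps e e' by (simp add: svec_def mult.assoc)
  qed
qed

text \<open>In \<open>pi_minus\<close> the coefficients of \<open>B\<close> and \<open>C\<close>
  have signs opposite to those in \<open>weight_rep\<close>; the alternating signs of the basis
  repair both at once.\<close>

lemma weight_rep_minus:
  assumes j: "k2 - k1 - 1/2 - real j > 0"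
  shows "weight_rep k1 k2 (- ((k1 - k2 + 1/2 + real j)\<^sup>2)) (\<lambda>p m. if int j - int m = p then (-1) ^ m else 0)
    (pi_minus (k2 - k1 - real j))"
proof -
  define \<alpha> where "\<alpha> = k1 - k2 + 1/2"
  define E :: "int \<Rightarrow> nat vec" where "E p = (\<lambda>m. if int j - int m = p then (-1) ^ m else 0)" for p
  have E_ket: "E (int j - int m) = svec ((-1) ^ m) (ket m)" for m
    by (auto simp: E_def svec_def ket_def fun_eq_iff)
  have E_0: "E p = (\<lambda>m. 0)" if "p > int j" for p
    using that by (auto simp: E_def fun_eq_iff)
  have gsum_0: "gsum T (\<lambda>m. 0) = (\<lambda>m. 0)" for T :: "nat \<Rightarrow> nat vec"
    by (simp add: gsum_def)
  have svec_svec: "svec a (svec b v) = svec (a * b) v" for a b and v :: "nat vec"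
    by (simp add: svec_def mult.assoc)
  have svec_0: "svec 0 v = (\<lambda>m. 0)" "svec a (\<lambda>m. 0) = (\<lambda>m. 0)" for a and v :: "nat vec"
    by (simp_all add: svec_def)
  have "weight_rep k1 k2 (- ((\<alpha> + real j)\<^sup>2)) E (pi_minus (k2 - k1 - real j))"
    unfolding weight_rep_def \<alpha>_def [symmetric]
  proof (intro allI)
    fix p c
    let ?\<pi> = "pi_minus (k2 - k1 - real j)"
    let ?P = "E p \<in> fin_comb \<and>
       lin_ext (?\<pi> SU_H) (svec c (E p)) = svec (c * of_real (2 * (k1 - k2 + of_int p))) (E p) \<and>
       lin_ext (?\<pi> SU_B) (svec c (E p)) = svec (c * of_real (sqrt ((of_int p + \<alpha>)\<^sup>2 + - ((\<alpha> + real j)\<^sup>2)))) (E (p + 1)) \<and>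
       lin_ext (?\<pi> SU_C) (svec c (E p)) = svec (c * of_real (- sqrt ((of_int p - 1 + \<alpha>)\<^sup>2 + - ((\<alpha> + real j)\<^sup>2)))) (E (p - 1))"
    show ?P
    proof (cases "p \<le> int j")
      case True
      define m where "m = nat (int j - p)"
      have p: "p = int j - int m" using True by (simp add: m_def)
      have B: "real m * (2 * (k2 - k1 - real j) + real m - 1) = (of_int p + \<alpha>)\<^sup>2 + - ((\<alpha> + real j)\<^sup>2)"
        unfolding p \<alpha>_def by (simp add: power2_eq_square algebra_simps)
      have C: "(real m + 1) * (2 * (k2 - k1 - real j) + real m) = (of_int p - 1 + \<alpha>)\<^sup>2 + - ((\<alpha> + real j)\<^sup>2)"
        unfolding p \<alpha>_def by (simp add: power2_eq_square algebra_simps)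
      have Ep: "svec c (E p) = svec (c * (-1) ^ m) (ket m)"
        unfolding p E_ket svec_svec ..
      have "E p \<in> fin_comb" unfolding p E_ket by (intro svec_fin_comb ket_fin_comb)
      moreover have "lin_ext (?\<pi> SU_H) (svec c (E p)) = svec (c * of_real (2 * (k1 - k2 + of_int p))) (E p)"
        unfolding lin_ext_gsum Ep gsum_ket pi_minus.simps unfolding p E_ket svec_svec
        by (simp add: mult_ac algebra_simps)
      moreover have "lin_ext (?\<pi> SU_B) (svec c (E p)) = svec (c * of_real (sqrt ((of_int p + \<alpha>)\<^sup>2 + - ((\<alpha> + real j)\<^sup>2)))) (E (p + 1))"
      proof (cases m)
        case 0
        thus ?thesis unfolding B [symmetric] lin_ext_gsum Ep gsum_ket pi_minus.simps svec_svec
          by (simp add: svec_0)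
      next
        case (Suc n)
        have "p + 1 = int j - int n" using p Suc by simp
        hence E1: "E (p + 1) = svec ((-1) ^ n) (ket n)" by (simp add: E_ket)
        show ?thesis unfolding B [symmetric] lin_ext_gsum Ep gsum_ket pi_minus.simps E1 svec_svec
          using Suc by (simp add: mult_ac)
      qed
      moreover have "lin_ext (?\<pi> SU_C) (svec c (E p)) = svec (c * of_real (- sqrt ((of_int p - 1 + \<alpha>)\<^sup>2 + - ((\<alpha> + real j)\<^sup>2)))) (E (p - 1))"
      proof -
        have "p - 1 = int j - int (m + 1)" using p by simp
        hence E1: "E (p - 1) = svec ((-1) ^ (m + 1)) (ket (m + 1))" by (simp only: E_ket)
        show ?thesis unfolding C [symmetric] lin_ext_gsum Ep gsum_ket pi_minus.simps E1 svec_svec by (simp add: mult_ac)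
      qed
      ultimately show ?thesis by blast
    next
      case False
      \<comment> \<open>The only way from a missing weight back into the representation is
        \<open>C\<close> at \<open>p = j + 1\<close>, and its coefficient is zero.\<close>
      have "sqrt ((of_int p - 1 + \<alpha>)\<^sup>2 + - ((\<alpha> + real j)\<^sup>2)) = 0" if "p = int j + 1"
        unfolding that by (simp add: add.commute)
      moreover have "E (p - 1) = (\<lambda>m. 0)" if "p \<noteq> int j + 1" using False that by (intro E_0) auto
      ultimately show ?thesis
        using False by (cases "p = int j + 1") (auto simp: E_0 lin_ext_gsum gsum_0 svec_0 fin_comb_def)
    qed
  qed
  moreover have "E = (\<lambda>p m. if int j - int m = p then (-1) ^ m else 0)"
    by (simp add: E_def fun_eq_iff)
  ultimately show ?thesis unfolding \<alpha>_def by simp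
qed

text \<open>Since \<open>k1 - k2\<close> lies above \<open>- 1/2\<close> and is at most 0,
  \<open>L\<close> is 0 if \<open>k1 = k2\<close> and 1 otherwise; this selects between the two
  parameter ranges.\<close>

lemma compl_paramsI:
  assumes "0 < k1" "k1 \<le> k2" and "\<epsilon> = k1 - k2 + of_int L" "0 \<le> \<epsilon>" "\<epsilon> < 1" "l = - k1 - k2" "k1 + k2 < 1/2"
  shows "compl_params l \<epsilon>"
proof (cases "k1 = k2")
  case True
  hence "\<epsilon> = of_int L" using assms(3) by simp
  hence "\<epsilon> = 0" using assms(4,5) by auto
  thus ?thesis using assms by (simp add: compl_params_def)
next
  case False
  have "0 < real_of_int L" "real_of_int L < 2" using assms False by linarith+
  hence "L = 1" by auto
  thus ?thesis using assms by (auto simp: compl_params_def)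
qed

theorem theorem2p2:
  fixes k1 k2 \<epsilon> l :: real and L :: int
  assumes "0 < k1" and "k1 \<le> k2"
    and "\<epsilon> = k1 - k2 + of_int L" and "0 \<le> \<epsilon>" and "\<epsilon> < 1"
    and "l = - k1 - k2"
  shows
    "(k1 - k2 \<ge> - 1/2 \<and> k1 + k2 \<ge> 1/2 \<longrightarrow>
        decomposes_via (tensor_rep (pi_plus k1) (pi_minus k2))
          (direct_integral half_line (\<lambda>\<rho>. pi_principal \<rho> \<epsilon>))
          (\<lambda>n1 n2. image_cont k1 k2 L n1 n2)) \<and>
     (k1 + k2 < 1/2 \<longrightarrow>
        compl_params l \<epsilon> \<and>
        decomposes_via (tensor_rep (pi_plus k1) (pi_minus k2))
          (direct_sum
             (direct_integral half_line (\<lambda>\<rho>. pi_principal \<rho> \<epsilon>))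
             (ell2_rep (pi_compl l \<epsilon>)))
          (\<lambda>n1 n2. (image_cont k1 k2 L n1 n2, image_compl k1 k2 L n1 n2))) \<and>
     (k1 - k2 < - 1/2 \<longrightarrow>
        (\<exists>s :: nat \<Rightarrow> nat \<Rightarrow> complex. (\<forall>j m. s j m \<in> {1, -1}) \<and>
          decomposes_via (tensor_rep (pi_plus k1) (pi_minus k2))
            (direct_sum
               (direct_integral half_line (\<lambda>\<rho>. pi_principal \<rho> \<epsilon>))
               (direct_Sum {j. k2 - k1 - 1/2 - real j > 0} (\<lambda>j. ell2_rep (pi_minus (k2 - k1 - real j)))))
            (\<lambda>n1 n2. (image_cont k1 k2 L n1 n2, image_minus k1 k2 s n1 n2))))"
proof (intro conjI impI)
  note k = assms(1,2)
  have k2: "0 < k2" using k by simp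
  show "decomposes_via (tensor_rep (pi_plus k1) (pi_minus k2)) (direct_integral half_line (\<lambda>\<rho>. pi_principal \<rho> \<epsilon>))
          (\<lambda>n1 n2. image_cont k1 k2 L n1 n2)"
    if c: "k1 - k2 \<ge> - 1/2 \<and> k1 + k2 \<ge> 1/2"
  proof -
    interpret cdh_data k1 k2 "{} :: nat set" "\<lambda>_. 0" "\<lambda>_. 0"
      using cdh_data_continuous k c by blast
    \<comment> \<open>With no atoms the data of the constituents are mere placeholders.\<close>
    interpret tensor_data k1 k2 "{} :: nat set" "\<lambda>_. 0" "\<lambda>_. 0" \<epsilon> L "\<lambda>j p k :: nat. if 0 = p then 0 else 0"
      pi_minus "\<lambda>j k. 0" "\<lambda>j k. 0"
      by unfold_locales (auto simp: assms(3))
    have "decomposes_via (tensor_rep (pi_plus k1) (pi_minus k2)) (direct_sum W1 W2) (\<lambda>n1 n2. (image_cont k1 k2 L n1 n2, \<lambda>_ _. 0))"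
      by (rule decomposition_cong) (simp_all add: image_cont_eq k k2)
    thus ?thesis
      by (rule decomposes_via_transfer [where T = fst, OF _ W_semi_hilbert])
         (auto simp: direct_sum_simps direct_Sum_simps intro!: bexI [of _ "(_, \<lambda>_ _. 0)"])
  qed
  show "compl_params l \<epsilon>" if "k1 + k2 < 1/2"
    using assms that by (rule compl_paramsI)
  show "decomposes_via (tensor_rep (pi_plus k1) (pi_minus k2))
          (direct_sum (direct_integral half_line (\<lambda>\<rho>. pi_principal \<rho> \<epsilon>)) (ell2_rep (pi_compl l \<epsilon>)))
          (\<lambda>n1 n2. (image_cont k1 k2 L n1 n2, image_compl k1 k2 L n1 n2))"
    if c: "k1 + k2 < 1/2"
  proof -
    let ?y = "- ((k1 + k2 - 1/2)\<^sup>2)" and ?A = "atom0 (k1 - k2 + 1/2) (k1 + k2 - 1/2)"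
    interpret cdh_data k1 k2 "{()}" "\<lambda>_. ?y" "\<lambda>_. ?A"
      by (rule cdh_data_compl [OF k c])
    have ket: "ket (p - L) = (\<lambda>k. if k + L = p then 1 else 0)" for p
      by (auto simp: ket_def fun_eq_iff)
    interpret tensor_data k1 k2 "{()}" "\<lambda>_. ?y" "\<lambda>_. ?A" \<epsilon> L "\<lambda>_ p. ket (p - L)" "\<lambda>_. pi_compl l \<epsilon>"
      "\<lambda>_ k. k + L" "\<lambda>_ _. 1"
    proof
      show "weight_rep k1 k2 ?y (\<lambda>p. ket (p - L)) (pi_compl l \<epsilon>)"
        using k assms(3,6) by (rule weight_rep_compl)
      have "p \<in> range (\<lambda>k. k + L)" for p by (rule range_eqI [of _ _ "p - L"]) simp
      thus "poly (PiP (k1 - k2 + 1/2) p) ?y \<noteq> 0 \<longleftrightarrow> p \<in> range (\<lambda>k. k + L)" for p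
        using PiP_compl_pos [OF k c, of p] by simp
      show "0 \<le> (of_int p + (k1 - k2 + 1/2))\<^sup>2 + ?y \<or> (p \<notin> range (\<lambda>k. k + L) \<and> p + 1 \<notin> range (\<lambda>k. k + L))" for p
      proof -
        \<comment> \<open>Both \<alpha> and \<open>1 - \<alpha>\<close> exceed \<open>|B|\<close>;
          the first bounds the right-hand side for \<open>p \<ge> 0\<close>, the second for
          \<open>p \<le> - 1\<close>.\<close>
        have "\<bar>k1 + k2 - 1/2\<bar> \<le> \<bar>of_int p + (k1 - k2 + 1/2)\<bar>"
        proof (cases "p \<ge> 0")
          case False
          hence "real_of_int p \<le> -1" by simp
          thus ?thesis using k c by linarith
        qed (use k c in auto)
        hence "(k1 + k2 - 1/2)\<^sup>2 \<le> (of_int p + (k1 - k2 + 1/2))\<^sup>2" by (simp only: abs_le_square_iff)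
        thus ?thesis by simp
      qed
    qed (auto simp: assms(3) ket inj_def)
    have "decomposes_via (tensor_rep (pi_plus k1) (pi_minus k2)) (direct_sum W1 W2)
        (\<lambda>n1 n2. (image_cont k1 k2 L n1 n2, \<lambda>_. image_compl k1 k2 L n1 n2))"
    proof (rule decomposition_cong)
      fix n1 n2 and j :: unit
      show "snd (image_cont k1 k2 L n1 n2, \<lambda>_. image_compl k1 k2 L n1 n2) j
          = Tvec k1 k2 (\<lambda>p. ket (p - L)) ?y ?A (n1, n2)"
        unfolding snd_conv image_compl_def Let_def Tvec_def prod.case
        by (rule integral_atom_eq [OF k(1) k2 mu_mass_compl [OF k c]])
    qed (simp add: image_cont_eq k k2)
    thus ?thesis
    proof (rule decomposes_via_transfer [where T = "\<lambda>(f, g). (f, g ())", OF _ W_semi_hilbert])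
      fix u assume "u \<in> vecs (direct_sum W1 (ell2_rep (pi_compl l \<epsilon>)))"
      thus "\<exists>v\<in>vecs (direct_sum W1 W2). (case v of (f, g) \<Rightarrow> (f, g ())) = u"
        by (intro bexI [of _ "(fst u, \<lambda>_. snd u)"]) (auto simp: direct_sum_simps direct_Sum_simps)
    qed (auto simp: direct_sum_simps direct_Sum_simps)
  qed
  show "\<exists>s :: nat \<Rightarrow> nat \<Rightarrow> complex. (\<forall>j m. s j m \<in> {1, -1}) \<and>
          decomposes_via (tensor_rep (pi_plus k1) (pi_minus k2))
            (direct_sum
               (direct_integral half_line (\<lambda>\<rho>. pi_principal \<rho> \<epsilon>))
               (direct_Sum {j. k2 - k1 - 1/2 - real j > 0} (\<lambda>j. ell2_rep (pi_minus (k2 - k1 - real j)))))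
            (\<lambda>n1 n2. (image_cont k1 k2 L n1 n2, image_minus k1 k2 s n1 n2))"
    if c: "k1 - k2 < - 1/2"
  proof (intro exI conjI)
    define s :: "nat \<Rightarrow> nat \<Rightarrow> complex" where "s = (\<lambda>j m. (-1) ^ m)"
    define J where "J = {j. k2 - k1 - 1/2 - real j > 0}"
    define ya where "ya = (\<lambda>j. - ((k1 - k2 + 1/2 + real j)\<^sup>2))"
    define A where "A = (\<lambda>j. - 2 * (k1 - k2 + 1/2 + real j)
      * (Gamma (k1 + k2 - 1/2 + (k1 - k2 + 1/2 + real j)) * Gamma (k1 + k2 - 1/2 - (k1 - k2 + 1/2 + real j))))"
    show "\<forall>j m. s j m \<in> {1, -1}" by (auto simp: s_def minus_one_power_iff)
    interpret cdh_data k1 k2 J ya A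
      unfolding J_def ya_def A_def by (rule cdh_data_minus [OF k c])
    have rng: "p \<in> range (\<lambda>m. int j - int m) \<longleftrightarrow> p \<le> int j" for p j
      by (auto intro!: range_eqI [of _ _ "nat (int j - p)"])
    interpret tensor_data k1 k2 J ya A \<epsilon> L "\<lambda>j p m. if int j - int m = p then s j m else 0"
      "\<lambda>j. pi_minus (k2 - k1 - real j)" "\<lambda>j m. int j - int m" s
    proof
      fix j assume j: "j \<in> J"
      show "weight_rep k1 k2 (ya j) (\<lambda>p m. if int j - int m = p then s j m else 0) (pi_minus (k2 - k1 - real j))"
        using j unfolding ya_def s_def by (intro weight_rep_minus) (simp add: J_def)
      show "poly (PiP (k1 - k2 + 1/2) p) (ya j) \<noteq> 0 \<longleftrightarrow> p \<in> range (\<lambda>m. int j - int m)" for p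
        using j PiP_minus(2) [OF k c, of j p] by (simp add: rng J_def ya_def)
      show "0 \<le> (of_int p + (k1 - k2 + 1/2))\<^sup>2 + ya j \<or> (p \<notin> range (\<lambda>m. int j - int m) \<and> p + 1 \<notin> range (\<lambda>m. int j - int m))" for p
      proof (cases "p \<le> int j")
        case True
        hence "real_of_int p \<le> real j" by linarith
        hence "\<bar>k1 - k2 + 1/2 + real j\<bar> \<le> \<bar>of_int p + (k1 - k2 + 1/2)\<bar>" using j unfolding J_def mem_Collect_eq by linarith
        hence "(k1 - k2 + 1/2 + real j)\<^sup>2 \<le> (of_int p + (k1 - k2 + 1/2))\<^sup>2" by (simp only: abs_le_square_iff)
        thus ?thesis by (simp add: ya_def)
      qed (simp add: rng)
    qed (auto simp: assms(3) s_def inj_def norm_power)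
    have "decomposes_via (tensor_rep (pi_plus k1) (pi_minus k2)) (direct_sum W1 W2)
        (\<lambda>n1 n2. (image_cont k1 k2 L n1 n2, image_minus k1 k2 s n1 n2))"
    proof (rule decomposition_cong)
      fix n1 n2 j assume j: "j \<in> J"
      define p where "p = int n1 - int n2"
      have "snd (image_cont k1 k2 L n1 n2, image_minus k1 k2 s n1 n2) j
         = svec (of_real (Tc k1 k2 n1 n2 (ya j) (A j))) (svec (s j (nat (int j - p))) (ket (nat (int j - p))))"
        unfolding snd_conv image_minus_def Let_def p_def ya_def
        by (rule integral_atom_eq [OF k(1) k2]) (use j mu_mass_minus [OF k c, of j] in \<open>simp add: A_def J_def\<close>)
      also have "\<dots> = Tvec k1 k2 (\<lambda>p m. if int j - int m = p then s j m else 0) (ya j) (A j) (n1, n2)"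
      proof (cases "p \<le> int j")
        case True
        thus ?thesis by (auto simp: Tvec_def svec_def ket_def fun_eq_iff p_def)
      next
        case False
        \<comment> \<open>For \<open>p > j\<close> the truncated index still names a basis vector,
          but its coefficient is zero.\<close>
        hence "Tc k1 k2 n1 n2 (ya j) (A j) = 0"
          by (intro Tc_out_of_range j) (simp add: rng p_def)
        thus ?thesis by (simp add: Tvec_def svec_def)
      qed
      finally show "snd (image_cont k1 k2 L n1 n2, image_minus k1 k2 s n1 n2) j
         = Tvec k1 k2 (\<lambda>p m. if int j - int m = p then s j m else 0) (ya j) (A j) (n1, n2)" .
    qed (simp add: image_cont_eq k k2)
    thus "decomposes_via (tensor_rep (pi_plus k1) (pi_minus k2))
            (direct_sum
               (direct_integral half_line (\<lambda>\<rho>. pi_principal \<rho> \<epsilon>))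
               (direct_Sum {j. k2 - k1 - 1/2 - real j > 0} (\<lambda>j. ell2_rep (pi_minus (k2 - k1 - real j)))))
            (\<lambda>n1 n2. (image_cont k1 k2 L n1 n2, image_minus k1 k2 s n1 n2))"
      by (simp only: J_def)
  qed
qed

end
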